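(* Let $(X_{i,j})_{(i,j)\in\mathbb{N}^2}$ be an infinite array of independent exponential random variables with parameter $1$, all defined on one probability space, and let $\gamma\geq 1$ be fixed. For integers $M,N\geq 1$ let $\Pi_{M,N}$ be the set of all up/right paths in $\mathbb{N}^2$ joining $(1,1)$ to $(M,N)$ and let $$H(M,N)=\max\Big\{\sum_{(i,j)\in\pi}X_{i,j}\,;\ \pi\in\Pi_{M,N}\Big\}.$$ Set $a=(1+\sqrt{\gamma})^2$, $b=\gamma^{-1/6}(1+\sqrt{\gamma})^{4/3}$ and $$\widetilde H_N=\frac{H([\gamma N],N)-aN}{bN^{1/3}},\qquad N\geq 1 .$$ Then there exists a constant $\alpha_{\sup}>0$ such that, with probability one, $$\alpha_{\sup}\ \leq\ \limsup_{N\to\infty}\frac{\widetilde H_N}{(\log\log N)^{2/3}}\ \leq\ \Big(\frac34\Big)^{2/3}.$$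
   Context: Here $\mathbb{N}=\{1,2,3,\dots\}$ and $[x]$ denotes the integer part of $x$. An up/right path from $(i_0,j_0)$ to $(i_1,j_1)$ is a finite sequence of points of $\mathbb{N}^2$ starting at $(i_0,j_0)$ and ending at $(i_1,j_1)$, each step of which adds $(1,0)$ or $(0,1)$. All the variables $\widetilde H_N$, $N\geq1$, are built from the same array $(X_{i,j})$. The parameter $\gamma\ge 1$ is fixed throughout and $\alpha_{\sup}$ is a deterministic constant. *)

theory Defs
  imports "HOL-Probability.Probability"
begin

abbreviation pos_quadrant :: "(nat \<times> nat) set" where
  "pos_quadrant \<equiv> {1..} \<times> {1..}"

definition up_right_paths :: "nat \<times> nat \<Rightarrow> nat \<times> nat \<Rightarrow> (nat \<times> nat) list set" where
  "up_right_paths p q =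
     {\<pi>. \<pi> \<noteq> [] \<and> set \<pi> \<subseteq> pos_quadrant \<and> hd \<pi> = p \<and> last \<pi> = q \<and>
          (\<forall>k. Suc k < length \<pi> \<longrightarrow>
             \<pi> ! Suc k = \<pi> ! k + (1, 0) \<or> \<pi> ! Suc k = \<pi> ! k + (0, 1))}"

definition last_passage :: "(nat \<times> nat \<Rightarrow> real) \<Rightarrow> nat \<Rightarrow> nat \<Rightarrow> real" where
  "last_passage x m n = Max ((\<lambda>\<pi>. \<Sum>p\<in>set \<pi>. x p) ` up_right_paths (1, 1) (m, n))"

definition a_const :: "real \<Rightarrow> real" where
  "a_const \<gamma> = (1 + sqrt \<gamma>)\<^sup>2"

definition b_const :: "real \<Rightarrow> real" where
  "b_const \<gamma> = \<gamma> powr (- 1 / 6) * (1 + sqrt \<gamma>) powr (4 / 3)"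

definition rescaled_last_passage :: "(nat \<times> nat \<Rightarrow> real) \<Rightarrow> real \<Rightarrow> nat \<Rightarrow> real" where
  "rescaled_last_passage x \<gamma> N =
     (last_passage x (nat \<lfloor>\<gamma> * real N\<rfloor>) N - a_const \<gamma> * real N)
       / (b_const \<gamma> * real N powr (1 / 3))"

text \<open>
  The sum of the coordinates grows by one along each step, so paths have distinct points; hence summing over \<open>set \<pi>\<close> is summing
  along the path, and the maximum in \<open>last_passage\<close> ranges over a finite nonempty set.
\<close>

lemma up_right_paths_nth_sum:
  assumes "\<pi> \<in> up_right_paths p q" "k < length \<pi>"
  shows "fst (\<pi> ! k) + snd (\<pi> ! k) = fst p + snd p + k"
  using assms(2)
proof (induction k)
  case 0
  then show ?case using assms(1) by (auto simp: up_right_paths_def hd_conv_nth)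
next
  case (Suc k)
  then have "\<pi> ! Suc k = \<pi> ! k + (1, 0) \<or> \<pi> ! Suc k = \<pi> ! k + (0, 1)"
    using assms(1) by (auto simp: up_right_paths_def)
  then have "fst (\<pi> ! Suc k) + snd (\<pi> ! Suc k) = Suc (fst (\<pi> ! k) + snd (\<pi> ! k))"
    by (elim disjE) simp_all
  then show ?case using Suc by simp
qed

lemma distinct_up_right_path:
  assumes "\<pi> \<in> up_right_paths p q"
  shows "distinct \<pi>"
  unfolding distinct_conv_nth
  using up_right_paths_nth_sum[OF assms] by (metis add_left_cancel)

lemma finite_up_right_paths: "finite (up_right_paths p q)"
proof (rule finite_subset)
  let ?s = "fst q + snd q"
  show "up_right_paths p q \<subseteq> {\<pi>. set \<pi> \<subseteq> {..?s} \<times> {..?s} \<and> length \<pi> \<le> Suc ?s}"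
  proof
    fix \<pi> assume *: "\<pi> \<in> up_right_paths p q"
    then have ne: "\<pi> \<noteq> []" and q: "q = \<pi> ! (length \<pi> - 1)"
      by (auto simp: up_right_paths_def last_conv_nth)
    have s: "?s = fst p + snd p + (length \<pi> - 1)"
      using up_right_paths_nth_sum[OF *, of "length \<pi> - 1"] ne q by simp
    have "x \<in> {..?s} \<times> {..?s}" if x: "x \<in> set \<pi>" for x
    proof -
      obtain k where k: "k < length \<pi>" "x = \<pi> ! k" using x by (metis in_set_conv_nth)
      have "fst x + snd x \<le> ?s" using up_right_paths_nth_sum[OF * k(1)] k s by simp
      then show ?thesis by (cases x) simp
    qed
    moreover have "length \<pi> \<le> Suc ?s" using s by simp
    ultimately show "\<pi> \<in> {\<pi>. set \<pi> \<subseteq> {..?s} \<times> {..?s} \<and> length \<pi> \<le> Suc ?s}" by blast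
  qed
  show "finite {\<pi>. set \<pi> \<subseteq> {..?s} \<times> {..?s} \<and> length \<pi> \<le> Suc ?s}"
    by (rule finite_lists_length_le) simp
qed

lemma up_right_paths_snoc:
  assumes "\<pi> \<in> up_right_paths p q" "r = q + (1, 0) \<or> r = q + (0, 1)"
  shows "\<pi> @ [r] \<in> up_right_paths p r"
proof -
  have ne: "\<pi> \<noteq> []" and q: "last \<pi> = q" and sub: "set \<pi> \<subseteq> pos_quadrant"
    using assms(1) by (auto simp: up_right_paths_def)
  have "q \<in> pos_quadrant" using ne q sub last_in_set by blast
  then have "r \<in> pos_quadrant" using assms(2) by (cases q) auto
  moreover have "(\<pi> @ [r]) ! Suc k = (\<pi> @ [r]) ! k + (1, 0) \<or>
      (\<pi> @ [r]) ! Suc k = (\<pi> @ [r]) ! k + (0, 1)" if k: "Suc k < length (\<pi> @ [r])" for k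
  proof (cases "Suc k < length \<pi>")
    case True
    then show ?thesis using assms(1) by (simp add: up_right_paths_def nth_append)
  next
    case False
    then have "Suc k = length \<pi>" using k by simp
    then have len: "length \<pi> = Suc k" by simp
    then have "\<pi> ! k = q" using q ne by (simp add: last_conv_nth)
    then have "(\<pi> @ [r]) ! Suc k = r" "(\<pi> @ [r]) ! k = q"
      using len by (simp_all add: nth_append)
    then show ?thesis using assms(2) by simp
  qed
  ultimately show ?thesis using assms(1) unfolding up_right_paths_def by auto
qed

lemma up_right_paths_nonempty:
  assumes "1 \<le> m" "1 \<le> n"
  shows "up_right_paths (1, 1) (m, n) \<noteq> {}"
  using assms(1)
proof (induction m rule: dec_induct)
  case base
  show ?case using assms(2)
  proof (induction n rule: dec_induct)
    case base
    have "[(1, 1)] \<in> up_right_paths (1, 1) (1, 1)" by (simp add: up_right_paths_def)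
    then show ?case by blast
  next
    case (step k)
    then obtain \<pi> where "\<pi> \<in> up_right_paths (1, 1) (1, k)" by blast
    from up_right_paths_snoc[OF this, of "(1, Suc k)"] show ?case by auto
  qed
next
  case (step k)
  then obtain \<pi> where "\<pi> \<in> up_right_paths (1, 1) (k, n)" by blast
  from up_right_paths_snoc[OF this, of "(Suc k, n)"] show ?case by auto
qed

end

theory Submission imports Defs "HOL-Real_Asymp.Real_Asymp" begin

text \<open>
  The passage time $H(m,n)$ from the corner is superadditive, its deterministic size is \<open>shape m n\<close>,
  that is $(\sqrt m+\sqrt n)^2$, and its fluctuations are of order $n^{1/3}$. Both halves of the law of the iterated
  logarithm come from two facts: an upper tail bound with the right constant in the exponent, and the existence of
  independent blocks in which the passage time exceeds its typical value by a multiple of $n^{1/3}$ with a probability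
  that is bounded below. Everything is derived from one exact identity.

  The identity concerns the model with independent exponential weights on the two coordinate axes as well. If the
  rates on the axes are $\rho$ and $1-\rho$, the increments of the passage time along every horizontal line are again
  independent exponential variables of rate $\rho$ (Burke's property): the recursion of the passage time at one site
  maps the triple (horizontal increment, vertical increment, weight) to a triple with the same law
  (\<open>exponential_queue\<close>), and sweeping through the sites preserves the product measure
  (\<open>sweep_preserves\<close>). If the rates are $w$ and $1-z$ with $z<w$, a change of measure on the vertical
  axis alone turns this into \<open>lpp_exponential_moment\<close>: the passage time $G$ satisfies
  $E\exp((w-z)G)=(w/z)^m((1-z)/(1-w))^n$. Its logarithm, with $w=c+h$ and $z=c-h$, is
  \<open>cumulant m n c h\<close>; expanded at the critical density \<open>crit m n\<close> it is
  $2h\,\mathrm{shape}+\frac23h^3\,\mathrm{cubic}$ plus terms of order $h^5$. Since $G$ dominates the passage time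
  without axes, optimising Markov's inequality over $h$ gives \<open>sharp_upper_tail\<close>, with the exponent
  $-\frac43s^3$ at the level $aN+bs^2N^{1/3}$.

  Bounds from below compare $H$ with stationary models whose density differs from the critical one by $O(n^{-1/3})$.
  In such a model the optimal path leaves the axes within distance $O(n^{2/3})$ of the origin. What it gains along the
  axis and what $H$ loses because the starting point has moved are both compared with stationary random walks, and
  their slopes are almost equal. This gives \<open>typical_lower_bound\<close>: with probability one half, $H$ is at
  least its deterministic size minus $Cn^{1/3}$. For deviations upwards, the exact moment at $h=K/n^{1/3}$ is compared
  with its square by the Paley-Zygmund inequality (\<open>profile_fluctuation\<close>); together with the typical
  lower bound this shows that $H$ exceeds its deterministic size by $n^{1/3}$ with a probability that is bounded below
  (\<open>upward_fluctuation\<close>). A chain of $L$ such boxes gains $L^{2/3}n^{1/3}$ with probability at least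
  $p^L$ (\<open>blocks_fluctuation\<close>).

  For the upper half of the theorem the scales $\exp(wk)$ with small $w$ are used. An excess at some size in a block
  survives up to the end of the next block with probability one half, by \<open>typical_lower_bound\<close>; hence the
  probability of an excess in the block is at most twice a tail probability at a fixed size
  (\<open>block_maximal_inequality\<close>), and this is summable above the level $(3/4)^{2/3}$
  (\<open>lil_upper\<close>). For the lower half the scales are $2^k$, and $L$ is of order $\log k$ such that the
  chains have probabilities of order $1/k$, which is not summable; the segments between consecutive scales are
  independent and the path before the segment is again typical with probability one half
  (\<open>window_fluctuation\<close>). Disjoint windows repeat this infinitely often (\<open>lil_lower\<close>).
\<close>

section \<open>Last-passage percolation with boundary values\<close>

text \<open>
  \<open>A\<close> and \<open>B\<close> are the values on the axes, so that a path starts by collecting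
  \<open>A i\<close> or \<open>B j\<close> when it leaves an axis and the weights \<open>X\<close> afterwards;
  \<open>A 0\<close> is the value at the origin. With zero boundary values this is the passage time of the array on
  the positive quadrant.
\<close>

fun lpp :: "(nat \<Rightarrow> real) \<Rightarrow> (nat \<Rightarrow> real) \<Rightarrow> (nat \<times> nat \<Rightarrow> real) \<Rightarrow> nat \<Rightarrow> nat \<Rightarrow> real" where
  "lpp A B X i 0 = A i"
| "lpp A B X 0 (Suc j) = B (Suc j)"
| "lpp A B X (Suc i) (Suc j) = X (Suc i, Suc j) + max (lpp A B X i (Suc j)) (lpp A B X (Suc i) j)"

abbreviation bulk :: "(nat \<times> nat \<Rightarrow> real) \<Rightarrow> nat \<Rightarrow> nat \<Rightarrow> real" where
  "bulk \<equiv> lpp (\<lambda>_. 0) (\<lambda>_. 0)"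

definition shift :: "nat \<Rightarrow> nat \<Rightarrow> (nat \<times> nat \<Rightarrow> 'b) \<Rightarrow> nat \<times> nat \<Rightarrow> 'b" where
  "shift k l X = (\<lambda>(i, j). X (i + k, j + l))"

definition reflect :: "nat \<Rightarrow> nat \<Rightarrow> (nat \<times> nat \<Rightarrow> 'b) \<Rightarrow> nat \<times> nat \<Rightarrow> 'b" where
  "reflect m n X = (\<lambda>(i, j). X (Suc m - i, Suc n - j))"

lemma shift_apply [simp]: "shift k l X (i, j) = X (i + k, j + l)"
  by (simp add: shift_def)

lemma lpp_left [simp]: "lpp A B X 0 j = (if j = 0 then A 0 else B j)"
  by (cases j) auto

lemma lpp_cong:
  assumes "\<And>i'. i' \<le> i \<Longrightarrow> A i' = A' i'"
    and "\<And>j'. 1 \<le> j' \<Longrightarrow> j' \<le> j \<Longrightarrow> B j' = B' j'"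
    and "\<And>i' j'. 1 \<le> i' \<Longrightarrow> i' \<le> i \<Longrightarrow> 1 \<le> j' \<Longrightarrow> j' \<le> j \<Longrightarrow> X (i', j') = X' (i', j')"
  shows "lpp A B X i j = lpp A' B' X' i j"
  using assms by (induction A B X i j rule: lpp.induct) auto

lemma lpp_mono:
  assumes "\<And>i'. i' \<le> i \<Longrightarrow> A i' \<le> A' i'"
    and "\<And>j'. 1 \<le> j' \<Longrightarrow> j' \<le> j \<Longrightarrow> B j' \<le> B' j'"
    and "\<And>i' j'. 1 \<le> i' \<Longrightarrow> i' \<le> i \<Longrightarrow> 1 \<le> j' \<Longrightarrow> j' \<le> j \<Longrightarrow> X (i', j') \<le> X' (i', j')"
  shows "lpp A B X i j \<le> lpp A' B' X' i j"
  using assms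
proof (induction A B X i j rule: lpp.induct)
  case (3 A B X i j)
  have "lpp A B X i (Suc j) \<le> lpp A' B' X' i (Suc j)" "lpp A B X (Suc i) j \<le> lpp A' B' X' (Suc i) j"
    using 3 by auto
  moreover have "X (Suc i, Suc j) \<le> X' (Suc i, Suc j)" using 3 by auto
  ultimately show ?case by (auto simp: max_def)
qed auto

text \<open>
  The recursion uses only addition and maximum, so the passage time is linear over the max-plus semiring in its
  boundary values; this lemma and the next one are what splitting a passage time according to the exit point rests on.
\<close>

lemma lpp_max:
  "lpp (\<lambda>i. max (A i) (A' i)) (\<lambda>j. max (B j) (B' j)) X i j = max (lpp A B X i j) (lpp A' B' X i j)"
  by (induction A B X i j rule: lpp.induct) (auto simp: max_def)

lemma lpp_add: "lpp (\<lambda>i. A i + c) (\<lambda>j. B j + c) X i j = lpp A B X i j + c"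
  by (induction A B X i j rule: lpp.induct) (auto simp: max_def)

text \<open>
  The values on two lines through an interior point serve as boundary values for the rest of the quadrant.
\<close>

lemma lpp_shift:
  "lpp A B X (i + k) (j + l) =
     lpp (\<lambda>i. lpp A B X (i + k) l) (\<lambda>j. lpp A B X k (j + l)) (shift k l X) i j"
  by (induction "(\<lambda>i. lpp A B X (i + k) l)" "(\<lambda>j. lpp A B X k (j + l))" "(shift k l X)" i j rule: lpp.induct) auto

lemma lpp_nonneg:
  assumes "\<And>i. 0 \<le> A i" "\<And>j. 0 \<le> B j" "\<And>p. 0 \<le> X p"
  shows "0 \<le> lpp A B X i j"
  using assms by (induction A B X i j rule: lpp.induct) (auto simp: max_def intro!: add_nonneg_nonneg)

lemma bulk_nonneg: "(\<And>p. 0 \<le> X p) \<Longrightarrow> 0 \<le> bulk X i j"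
  by (rule lpp_nonneg) auto

lemma lpp_mono_Suc:
  assumes "\<And>p. 0 \<le> X p"
  shows "lpp A B X (Suc i) (Suc j) \<ge> lpp A B X i (Suc j)" "lpp A B X (Suc i) (Suc j) \<ge> lpp A B X (Suc i) j"
  using assms[of "(Suc i, Suc j)"] by auto

lemma bulk_mono:
  assumes "\<And>p. 0 \<le> X p" and "i \<le> i'" "j \<le> j'"
  shows "bulk X i j \<le> bulk X i' j'"
proof -
  have 1: "bulk X i j \<le> bulk X (Suc i) j" for i j
    using lpp_mono_Suc(1)[OF assms(1)] by (cases j) auto
  have 2: "bulk X i j \<le> bulk X i (Suc j)" for i j
    using lpp_mono_Suc(2)[OF assms(1)] by (cases i) auto
  have "bulk X i j \<le> bulk X i' j" using assms(2) 1 by (induction rule: dec_induct) (auto intro: order_trans)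
  also have "\<dots> \<le> bulk X i' j'" using assms(3) 2 by (induction rule: dec_induct) (auto intro: order_trans)
  finally show ?thesis .
qed

text \<open>
  Concatenation of an optimal path of the first box with an optimal path of the box that starts at its corner.
\<close>

lemma bulk_superadditive:
  assumes "\<And>p. 0 \<le> X p"
  shows "bulk X k l + bulk (shift k l X) i j \<le> bulk X (i + k) (j + l)"
proof -
  have "bulk (shift k l X) i j + bulk X k l = lpp (\<lambda>_. 0 + bulk X k l) (\<lambda>_. 0 + bulk X k l) (shift k l X) i j"
    by (rule lpp_add[symmetric])
  also have "\<dots> \<le> lpp (\<lambda>i. bulk X (i + k) l) (\<lambda>j. bulk X k (j + l)) (shift k l X) i j"
    by (rule lpp_mono) (auto intro!: bulk_mono assms)
  also have "\<dots> = bulk X (i + k) (j + l)"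
    by (rule lpp_shift[symmetric])
  finally show ?thesis by simp
qed

lemma lpp_first_column:
  assumes "0 \<le> A 1" "\<And>p. 0 \<le> X p"
  shows "lpp A (\<lambda>_. 0) X 1 j = A 1 + bulk X 1 j"
proof (induction j)
  case (Suc j)
  then show ?case using assms bulk_nonneg[of X 1 j] by auto
qed auto

text \<open>
  A path that leaves the horizontal axis at column \<open>k\<close> collects \<open>A k\<close> and then the weights
  of the columns from \<open>k\<close> on. The induction moves the origin to the right along the axis; the first
  column is split off by max-plus linearity.
\<close>

lemma lpp_exit_le:
  assumes "mono A" "0 \<le> A 0" "\<And>p. 0 \<le> X p" "1 \<le> m"
    and "\<And>k. 1 \<le> k \<Longrightarrow> k \<le> m \<Longrightarrow> A k + bulk (shift (k - 1) 0 X) (m - k + 1) n \<le> c"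
  shows "lpp A (\<lambda>_. 0) X m n \<le> c"
  using assms(4,1-3,5)
proof (induction m arbitrary: A X rule: dec_induct)
  case base
  have "0 \<le> A 1" using base(1,2) by (meson le_numeral_extra(4) monoD order_trans zero_le)
  then show ?case using lpp_first_column[of A X n] base(3) base(4)[of 1] by (simp add: shift_def)
next
  case (step m)
  have A1: "0 \<le> A 1" using step(4,5) by (meson monoD order_trans zero_le)
  let ?Y = "shift 1 0 X"
  have "lpp A (\<lambda>_. 0) X (Suc m) n
      = lpp (\<lambda>i. A (i + 1)) (\<lambda>j. lpp A (\<lambda>_. 0) X 1 j) ?Y m n"
    using lpp_shift[of A "\<lambda>_. 0" X m 1 n 0] by simp
  also have "\<dots> \<le> lpp (\<lambda>i. max (A (i + 1)) (0 + A 1)) (\<lambda>j. max 0 (bulk X 1 j + A 1)) ?Y m n"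
    by (rule lpp_mono) (use lpp_first_column[of A X, OF A1 step(6)] in auto)
  also have "\<dots> = max (lpp (\<lambda>i. A (i + 1)) (\<lambda>_. 0) ?Y m n) (lpp (\<lambda>_. 0 + A 1) (\<lambda>j. bulk X 1 j + A 1) ?Y m n)"
    by (rule lpp_max)
  also have "lpp (\<lambda>_. 0 + A 1) (\<lambda>j. bulk X 1 j + A 1) ?Y m n = lpp (\<lambda>_. 0) (\<lambda>j. bulk X 1 j) ?Y m n + A 1"
    by (rule lpp_add)
  also have "lpp (\<lambda>_. 0) (\<lambda>j. bulk X 1 j) ?Y m n = bulk X (Suc m) n"
    using lpp_shift[of "\<lambda>_. 0" "\<lambda>_. 0" X m 1 n 0] by simp
  finally have *: "lpp A (\<lambda>_. 0) X (Suc m) n \<le> max (lpp (\<lambda>i. A (i + 1)) (\<lambda>_. 0) ?Y m n) (bulk X (Suc m) n + A 1)" .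
  have "lpp (\<lambda>i. A (i + 1)) (\<lambda>_. 0) ?Y m n \<le> c"
  proof (rule step.IH)
    show "mono (\<lambda>i. A (i + 1))" using step(4) by (auto simp: mono_def)
    show "A (k + 1) + bulk (shift (k - 1) 0 ?Y) (m - k + 1) n \<le> c" if "1 \<le> k" "k \<le> m" for k
    proof -
      have "shift (k - 1) 0 ?Y = shift (k + 1 - 1) 0 X" using that by (auto simp: shift_def)
      then show ?thesis using step(7)[of "k + 1"] that by simp
    qed
  qed (use A1 step in \<open>auto simp: shift_def split: prod.split\<close>)
  moreover have "bulk X (Suc m) n + A 1 \<le> c" using step(7)[of 1] by (simp add: shift_def add.commute)
  ultimately show ?case using * by simp
qed

text \<open>
  Freezing \<open>A\<close> after column \<open>k\<close> makes later exits useless, since superadditivity lets a path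
  leave at \<open>k\<close> instead.
\<close>

lemma lpp_near_le:
  assumes "mono A" "0 \<le> A 0" "\<And>p. 0 \<le> X p" "1 \<le> k" "k \<le> m"
    and "\<And>j. 1 \<le> j \<Longrightarrow> j \<le> k \<Longrightarrow> A j + bulk (shift (j - 1) 0 X) (m - j + 1) n \<le> c"
  shows "lpp (\<lambda>i. min (A i) (A k)) (\<lambda>_. 0) X m n \<le> c"
proof (rule lpp_exit_le)
  show "mono (\<lambda>i. min (A i) (A k))" using assms(1) by (auto simp: mono_def min_def intro: order_trans)
  have "0 \<le> A k" using assms(1,2) by (meson monoD order_trans zero_le)
  then show "0 \<le> min (A 0) (A k)" using assms by simp
  fix j assume j: "1 \<le> j" "j \<le> m"
  show "min (A j) (A k) + bulk (shift (j - 1) 0 X) (m - j + 1) n \<le> c"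
  proof (cases "j \<le> k")
    case True then show ?thesis using assms(6)[of j] j by (simp add: min_def)
  next
    case False
    let ?Y = "shift (k - 1) 0 X"
    have Y: "0 \<le> ?Y p" for p using assms(3) by (auto simp: shift_def split: prod.split)
    have "shift (j - 1) 0 X = shift (j - k) 0 ?Y" using False assms(4) by (auto simp: shift_def)
    then have "bulk (shift (j - 1) 0 X) (m - j + 1) n \<le> bulk ?Y (j - k) 0 + bulk (shift (j - k) 0 ?Y) (m - j + 1) n"
      by simp
    also have "\<dots> \<le> bulk ?Y (m - k + 1) n"
      using bulk_superadditive[of ?Y "j - k" 0 "m - j + 1" n, OF Y] False j by simp
    finally show ?thesis using assms(6)[of k] assms(4) by (auto simp: min_def)
  qed
qed (use assms in auto)

text \<open>
  The two terms on the right correspond to paths that leave the axis up to column \<open>k\<close> and after it.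
\<close>

lemma lpp_near_far:
  assumes "mono A" "0 \<le> A 0" "\<And>p. 0 \<le> X p"
  shows "lpp A (\<lambda>_. 0) X (i + k) j \<le> max (lpp (\<lambda>i. min (A i) (A k)) (\<lambda>_. 0) X (i + k) j)
     (lpp (\<lambda>i. A (i + k) - A k) (\<lambda>_. 0) (shift k 0 X) i j + A k)"
proof -
  let ?N = "lpp (\<lambda>i. min (A i) (A k)) (\<lambda>_. 0) X"
  have *: "lpp A (\<lambda>_. 0) X k j = ?N k j" for j
    by (rule lpp_cong) (use assms(1) in \<open>auto simp: mono_def min_def intro: antisym\<close>)
  have Ak: "A k \<le> A (i + k)" for i using assms(1) by (auto simp: mono_def)
  have "0 \<le> A k" using assms(1,2) by (meson monoD order_trans zero_le)
  have "lpp A (\<lambda>_. 0) X (i + k) j = lpp (\<lambda>i. A (i + k)) (\<lambda>j. ?N k j) (shift k 0 X) i j"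
    using lpp_shift[of A "\<lambda>_. 0" X i k j 0] * by simp
  also have "\<dots> \<le> lpp (\<lambda>i. max (?N (i + k) 0) (A (i + k) - A k + A k)) (\<lambda>j. max (?N k j) (0 + A k)) (shift k 0 X) i j"
    by (rule lpp_mono) auto
  also have "\<dots> = max (lpp (\<lambda>i. ?N (i + k) 0) (\<lambda>j. ?N k j) (shift k 0 X) i j)
      (lpp (\<lambda>i. A (i + k) - A k + A k) (\<lambda>j. 0 + A k) (shift k 0 X) i j)"
    by (rule lpp_max)
  also have "lpp (\<lambda>i. ?N (i + k) 0) (\<lambda>j. ?N k j) (shift k 0 X) i j = ?N (i + k) j"
    using lpp_shift[of "\<lambda>i. min (A i) (A k)" "\<lambda>_. 0" X i k j 0] by simp
  also have "lpp (\<lambda>i. A (i + k) - A k + A k) (\<lambda>j. 0 + A k) (shift k 0 X) i j =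
     lpp (\<lambda>i. A (i + k) - A k) (\<lambda>_. 0) (shift k 0 X) i j + A k"
    by (rule lpp_add)
  finally show ?thesis .
qed

lemma lpp_split_boundary:
  assumes "\<And>i. 0 \<le> A i" "\<And>j. 0 \<le> B j"
  shows "lpp A B X i j = max (lpp A (\<lambda>_. 0) X i j) (lpp (\<lambda>_. 0) B X i j)"
proof -
  have "lpp A B X i j = lpp (\<lambda>i. max (A i) 0) (\<lambda>j. max 0 (B j)) X i j"
    by (rule lpp_cong) (use assms in auto)
  then show ?thesis by (simp add: lpp_max)
qed

text \<open>
  The comparison principle for increments: steeper horizontal boundary values and flatter vertical ones increase every
  horizontal increment of the passage time. Horizontal and vertical increments are compared alternately, row by row.
\<close>

lemma lpp_increments_mono:
  assumes "\<And>i. A' (Suc i) - A' i \<le> A (Suc i) - A i"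
    and "\<And>j. B (Suc j) - B j \<le> B' (Suc j) - B' j"
    and "A 0 = B 0" "A' 0 = B' 0"
  shows "lpp A' B' X (Suc i) j - lpp A' B' X i j \<le> lpp A B X (Suc i) j - lpp A B X i j"
proof -
  let ?L = "lpp A B X" and ?L' = "lpp A' B' X"
  have V: "\<forall>i. ?L i (Suc j) - ?L i j \<le> ?L' i (Suc j) - ?L' i j"
    if H: "\<forall>i. ?L' (Suc i) j - ?L' i j \<le> ?L (Suc i) j - ?L i j" for j
  proof
    fix i show "?L i (Suc j) - ?L i j \<le> ?L' i (Suc j) - ?L' i j"
    proof (induction i)
      case 0 then show ?case using assms(2)[of j] assms(3,4) by (cases j) auto
    next
      case (Suc i) then show ?case using H[rule_format, of i] by (auto simp: max_def)
    qed
  qed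
  have "\<forall>i. ?L' (Suc i) j - ?L' i j \<le> ?L (Suc i) j - ?L i j"
  proof (induction j)
    case 0 then show ?case using assms(1) by simp
  next
    case (Suc j)
    show ?case
    proof
      fix i show "?L' (Suc i) (Suc j) - ?L' i (Suc j) \<le> ?L (Suc i) (Suc j) - ?L i (Suc j)"
        using Suc[rule_format, of i] V[OF Suc, rule_format, of i] by (auto simp: max_def)
    qed
  qed
  then show ?thesis by blast
qed

text \<open>
  The recursion that defines the passage time decomposes a path at its last site; here it is decomposed at its first
  one, which the reflection of the box needs.
\<close>

lemma bulk_first_step:
  assumes "\<And>p. 0 \<le> X p"
  shows "bulk X (Suc m) (Suc n) = X (1, 1) + max (bulk (shift 1 0 X) m (Suc n)) (bulk (shift 0 1 X) (Suc m) n)"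
proof (induction "m + n" arbitrary: m n rule: less_induct)
  case less
  have nn: "0 \<le> shift k l X p" for k l p using assms by (auto simp: shift_def split: prod.split)
  have nb: "0 \<le> bulk (shift k l X) i j" for k l i j by (rule bulk_nonneg) (rule nn)
  show ?case
  proof (cases m)
    case 0
    show ?thesis
    proof (cases n)
      case 0 with \<open>m = 0\<close> show ?thesis by simp
    next
      case (Suc n')
      have "bulk X (Suc 0) (Suc n') = X (1, 1) + max (bulk (shift 1 0 X) 0 (Suc n')) (bulk (shift 0 1 X) (Suc 0) n')"
        using less[of 0 n'] Suc 0 by simp
      then show ?thesis
        using 0 Suc nb[of 0 1 "Suc 0" n'] nb[of 0 1 "Suc 0" "Suc n'"]
          bulk_nonneg[of X "Suc 0" "Suc n'"] assms by (auto simp: max_def split: if_splits)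
    qed
  next
    case (Suc m')
    show ?thesis
    proof (cases n)
      case 0
      have "bulk X (Suc m') (Suc 0) = X (1, 1) + max (bulk (shift 1 0 X) m' (Suc 0)) (bulk (shift 0 1 X) (Suc m') 0)"
        using less[of m' 0] Suc 0 by simp
      then have 1: "bulk X m (Suc 0) = X (1, 1) + bulk (shift 1 0 X) m' (Suc 0)"
        using nb[of 1 0 m' "Suc 0"] Suc by simp
      have "bulk X (Suc m) (Suc 0) = X (Suc m, Suc 0) + bulk X m (Suc 0)"
        using bulk_nonneg[of X m "Suc 0"] assms by simp
      moreover have "bulk (shift 1 0 X) m (Suc 0) = X (Suc m, Suc 0) + bulk (shift 1 0 X) m' (Suc 0)"
        using nb[of 1 0 m' "Suc 0"] Suc by simp
      ultimately show ?thesis using 0 1 nb[of 1 0 m "Suc 0"] by (simp del: lpp.simps(3))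
    next
      case (Suc n')
      have "bulk X m (Suc n) = X (1, 1) + max (bulk (shift 1 0 X) m' (Suc n)) (bulk (shift 0 1 X) m n)"
        using less[of m' n] \<open>m = Suc m'\<close> by simp
      moreover have "bulk X (Suc m) n = X (1, 1) + max (bulk (shift 1 0 X) m n) (bulk (shift 0 1 X) (Suc m) n')"
        using less[of m n'] \<open>n = Suc n'\<close> by simp
      ultimately show ?thesis using \<open>m = Suc m'\<close> \<open>n = Suc n'\<close> by (auto simp: max_def)
    qed
  qed
qed

text \<open>
  Reading paths backwards. Passage times from a moving starting point to a fixed corner become passage times from a
  fixed corner to a moving end point, to which the comparison principle for increments applies.
\<close>

lemma bulk_reflect:
  assumes "\<And>p. 0 \<le> X p"
  shows "bulk (reflect m n X) m n = bulk X m n"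
  using assms
proof (induction "m + n" arbitrary: m n X rule: less_induct)
  case less
  have nn: "0 \<le> shift k l X p" for k l p using less(2) by (auto simp: shift_def split: prod.split)
  show ?case
  proof (cases "m = 0 \<or> n = 0")
    case True then show ?thesis by (cases n) auto
  next
    case False
    then obtain m' n' where mn: "m = Suc m'" "n = Suc n'" by (metis not0_implies_Suc)
    have 1: "bulk (reflect m n X) m' n = bulk (shift 1 0 X) m' n"
    proof -
      have "bulk (reflect m n X) m' n = bulk (reflect m' n (shift 1 0 X)) m' n"
        by (rule lpp_cong) (auto simp: reflect_def mn Suc_diff_le)
      then show ?thesis using less(1)[of m' n "shift 1 0 X"] nn mn by simp
    qed
    have 2: "bulk (reflect m n X) m n' = bulk (shift 0 1 X) m n'"
    proof -
      have "bulk (reflect m n X) m n' = bulk (reflect m n' (shift 0 1 X)) m n'"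
        by (rule lpp_cong) (auto simp: reflect_def mn Suc_diff_le)
      then show ?thesis using less(1)[of m n' "shift 0 1 X"] nn mn by simp
    qed
    have "bulk (reflect m n X) m n = X (1, 1) + max (bulk (reflect m n X) m' n) (bulk (reflect m n X) m n')"
      by (simp add: mn reflect_def)
    then show ?thesis using bulk_first_step[of X m' n'] 1 2 less(2) mn by simp
  qed
qed

lemma bulk_shift_reflect:
  assumes "\<And>p. 0 \<le> X p" "1 \<le> j" "j \<le> m"
  shows "bulk (shift (j - 1) 0 X) (m - j + 1) n = bulk (reflect m n X) (m - j + 1) n"
proof -
  have "bulk (shift (j - 1) 0 X) (m - j + 1) n = bulk (reflect (m - j + 1) n (shift (j - 1) 0 X)) (m - j + 1) n"
    by (rule bulk_reflect[symmetric]) (use assms in \<open>auto simp: shift_def split: prod.split\<close>)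
  also have "\<dots> = bulk (reflect m n X) (m - j + 1) n"
  proof (rule lpp_cong)
    fix i' j' assume "1 \<le> i'" "i' \<le> m - j + 1" "1 \<le> j'" "j' \<le> n"
    then have "Suc (m - j + 1) - i' + (j - 1) = Suc m - i'" using assms by simp
    then show "reflect (m - j + 1) n (shift (j - 1) 0 X) (i', j') = reflect m n X (i', j')"
      by (simp only: reflect_def shift_def prod.case) simp
  qed auto
  finally show ?thesis .
qed

lemma last_passage_eq_bulk:
  assumes "\<And>p. 0 \<le> X p" "1 \<le> m" "1 \<le> n"
  shows "last_passage X m n = bulk X m n"
proof -
  let ?S = "\<lambda>\<pi>. \<Sum>p\<in>set \<pi>. X p"
  (* The weight of a path is split off at its last site. *)
  have ub: "?S \<pi> \<le> bulk X m n" if "\<pi> \<in> up_right_paths (1, 1) (m, n)" for \<pi> m n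
    using that
  proof (induction "length \<pi>" arbitrary: \<pi> m n)
    case 0 then show ?case by (simp add: up_right_paths_def)
  next
    case (Suc l)
    have ne: "\<pi> \<noteq> []" and q: "last \<pi> = (m, n)" and sub: "set \<pi> \<subseteq> pos_quadrant" and hd: "hd \<pi> = (1, 1)"
      and st: "\<And>k. Suc k < length \<pi> \<Longrightarrow> \<pi> ! Suc k = \<pi> ! k + (1, 0) \<or> \<pi> ! Suc k = \<pi> ! k + (0, 1)"
      using Suc(3) by (auto simp: up_right_paths_def)
    have mn: "1 \<le> m" "1 \<le> n" using q sub ne last_in_set[of \<pi>] by auto
    then obtain m' n' where mn': "m = Suc m'" "n = Suc n'" by (metis Suc_le_D One_nat_def)
    have dist: "distinct \<pi>" by (rule distinct_up_right_path[OF Suc(3)])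
    have \<pi>: "\<pi> = butlast \<pi> @ [(m, n)]" using ne q by (metis append_butlast_last_id)
    have sum: "?S \<pi> = X (m, n) + ?S (butlast \<pi>)"
    proof -
      have "(m, n) \<notin> set (butlast \<pi>)" using dist \<pi> by (metis distinct_append disjoint_iff list.set_intros(1))
      then show ?thesis by (subst \<pi>) simp
    qed
    have nn: "0 \<le> bulk X i j" for i j using bulk_nonneg assms by blast
    show ?case
    proof (cases "butlast \<pi> = []")
      case True
      then show ?thesis using sum nn[of m' n] mn' by (auto simp: max_def)
    next
      case False
      then have "0 < length (butlast \<pi>)" by blast
      then have l: "2 \<le> length \<pi>" by simp
      define q' where "q' = last (butlast \<pi>)"
      have q'nth: "q' = \<pi> ! (length \<pi> - 2)"
        using False l by (simp add: q'_def last_conv_nth nth_butlast numeral_2_eq_2)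
      have "\<pi> ! (length \<pi> - 1) = (m, n)" using q ne by (simp add: last_conv_nth)
      moreover have "Suc (length \<pi> - 2) = length \<pi> - 1" using l by simp
      ultimately have step: "(m, n) = q' + (1, 0) \<or> (m, n) = q' + (0, 1)"
        using st[of "length \<pi> - 2"] l q'nth by (auto simp: numeral_2_eq_2)
      have P: "butlast \<pi> \<in> up_right_paths (1, 1) q'"
        unfolding up_right_paths_def
      proof (safe)
        show "hd (butlast \<pi>) = (1, 1)" using hd False by (metis \<pi> hd_append2)
        fix k assume k: "Suc k < length (butlast \<pi>)"
        assume "\<not> butlast \<pi> ! Suc k = butlast \<pi> ! k + (0, 1)"
        then show "butlast \<pi> ! Suc k = butlast \<pi> ! k + (1, 0)"
          using st[of k] k by (auto simp: nth_butlast)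
      qed (use False sub q'_def in \<open>auto dest: in_set_butlastD\<close>)
      have "?S (butlast \<pi>) \<le> bulk X (fst q') (snd q')"
        using Suc(1)[of "butlast \<pi>" "fst q'" "snd q'"] Suc(2) P by simp
      moreover have "q' = (m', n) \<or> q' = (m, n')" using step mn' by (cases q') auto
      ultimately show ?thesis using sum mn' by (auto simp: max_def)
    qed
  qed
  have ex: "\<exists>\<pi>\<in>up_right_paths (1, 1) (Suc m, Suc n). ?S \<pi> = bulk X (Suc m) (Suc n)" for m n
  proof (induction "m + n" arbitrary: m n rule: less_induct)
    case less
    have nn: "0 \<le> bulk X i j" for i j using bulk_nonneg assms by blast
    have ext: "\<exists>\<pi>\<in>up_right_paths (1, 1) r. ?S \<pi> = X r + v"
      if "\<exists>\<pi>\<in>up_right_paths (1, 1) q. ?S \<pi> = v" "r = q + (1, 0) \<or> r = q + (0, 1)" for q r v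
    proof -
      from that obtain \<pi> where \<pi>: "\<pi> \<in> up_right_paths (1, 1) q" "?S \<pi> = v" by blast
      have 1: "\<pi> @ [r] \<in> up_right_paths (1, 1) r" by (rule up_right_paths_snoc[OF \<pi>(1) that(2)])
      then have "distinct (\<pi> @ [r])" by (rule distinct_up_right_path)
      then have "?S (\<pi> @ [r]) = X r + v" using \<pi> by simp
      with 1 show ?thesis by blast
    qed
    have left: ?case if "m = Suc m'" "bulk X (Suc m) n \<le> bulk X m (Suc n)" for m'
      using ext[of "(m, Suc n)" "bulk X m (Suc n)" "(Suc m, Suc n)"] less[of m' n] that by simp
    have down: ?case if "n = Suc n'" "bulk X m (Suc n) \<le> bulk X (Suc m) n" for n'
      using ext[of "(Suc m, n)" "bulk X (Suc m) n" "(Suc m, Suc n)"] less[of m n'] that by simp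
    show ?case
    proof (cases m)
      case 0
      show ?thesis
      proof (cases n)
        case 0
        have "[(1, 1)] \<in> up_right_paths (1, 1) (1, 1)" by (simp add: up_right_paths_def)
        then show ?thesis using 0 \<open>m = 0\<close> by (intro bexI[of _ "[(1,1)]"]) auto
      next
        case (Suc n') then show ?thesis using down 0 nn[of "Suc m" n] by simp
      qed
    next
      case (Suc m')
      show ?thesis
      proof (cases n)
        case 0 then show ?thesis using left Suc nn[of m "Suc n"] by simp
      next
        case (Suc n') then show ?thesis using left[OF \<open>m = Suc m'\<close>] down[OF Suc] by (cases "bulk X (Suc m) n \<le> bulk X m (Suc n)") auto
      qed
    qed
  qed
  have fin: "finite (?S ` up_right_paths (1, 1) (m, n))" using finite_up_right_paths by blast
  obtain m' n' where mn': "m = Suc m'" "n = Suc n'" using assms by (metis Suc_le_D One_nat_def)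
  show ?thesis
    unfolding last_passage_def
  proof (rule Max_eqI[OF fin])
    show "bulk X m n \<in> ?S ` up_right_paths (1, 1) (m, n)" using ex[of m' n'] mn' by (metis image_eqI)
  qed (use ub in auto)
qed

section \<open>Exponential arrays and the exponential queue\<close>

text \<open>
  Nonnegativity is demanded at every sample point, not only almost surely; this makes the path inequalities
  deterministic, and an almost everywhere modification provides it.
\<close>

definition exp_array :: "'a measure \<Rightarrow> 'i set \<Rightarrow> ('i \<Rightarrow> 'a \<Rightarrow> real) \<Rightarrow> bool" where
  "exp_array M I Y \<longleftrightarrow> prob_space.indep_vars M (\<lambda>_. borel) Y I \<and>
     (\<forall>i\<in>I. distributed M lborel (Y i) (exponential_density 1)) \<and> (\<forall>i \<omega>. 0 \<le> Y i \<omega>)"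

abbreviation expm :: "real \<Rightarrow> real measure" where
  "expm r \<equiv> density lborel (\<lambda>x. ennreal (exponential_density r x))"

lemma exp_arrayD:
  assumes "exp_array M I Y"
  shows "i \<in> I \<Longrightarrow> Y i \<in> borel_measurable M" "0 \<le> Y i \<omega>"
    "i \<in> I \<Longrightarrow> distributed M lborel (Y i) (exponential_density 1)"
  using assms by (auto simp: exp_array_def distributed_def)

context prob_space begin

lemma exp_array_reindex:
  assumes "exp_array M I Y" "inj_on f J" "f ` J \<subseteq> I"
  shows "exp_array M J (\<lambda>j. Y (f j))"
proof -
  have "indep_vars (\<lambda>j. PiM {f j} (\<lambda>_. borel)) (\<lambda>j \<omega>. restrict (\<lambda>i. Y i \<omega>) {f j}) J"
    using assms by (intro indep_vars_restrict) (auto simp: exp_array_def disjoint_family_on_def inj_on_def)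
  then have "indep_vars (\<lambda>_. borel) (\<lambda>j \<omega>. (\<lambda>x. x (f j)) (restrict (\<lambda>i. Y i \<omega>) {f j})) J"
    by (rule indep_vars_compose2) (auto intro: measurable_component_singleton)
  then have "indep_vars (\<lambda>_. borel) (\<lambda>j. Y (f j)) J" by simp
  then show ?thesis using assms(1,3) unfolding exp_array_def by blast
qed

lemma exp_array_subset: "exp_array M I Y \<Longrightarrow> J \<subseteq> I \<Longrightarrow> exp_array M J Y"
  using exp_array_reindex[of I Y "\<lambda>x. x" J] by simp

text \<open>
  The transfer of integrals over the probability space to product measures, where a change of variables can be carried
  out one coordinate at a time. Dividing a variable of rate one by \<open>r p\<close> gives it the rate
  \<open>r p\<close>.
\<close>

lemma exp_array_law:
  assumes Y: "exp_array M I Y" and I: "finite I" "I \<noteq> {}" and r: "\<And>p. 0 < r p"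
  shows "distr M (PiM I (\<lambda>_. borel)) (\<lambda>\<omega>. \<lambda>p\<in>I. Y p \<omega> / r p) = PiM I (\<lambda>p. expm (r p))"
proof -
  have m: "random_variable borel (\<lambda>\<omega>. Y p \<omega> / r p)" if "p \<in> I" for p
    using exp_arrayD(1)[OF Y that] by measurable
  have "indep_vars (\<lambda>_. borel) (\<lambda>p \<omega>. (\<lambda>x. x / r p) (Y p \<omega>)) I"
    by (rule indep_vars_compose2[where M'="\<lambda>_. borel"]) (use Y in \<open>simp_all add: exp_array_def\<close>)
  then have "distr M (PiM I (\<lambda>_. borel)) (\<lambda>\<omega>. \<lambda>p\<in>I. Y p \<omega> / r p) = PiM I (\<lambda>p. distr M borel (\<lambda>\<omega>. Y p \<omega> / r p))"
    by (subst (asm) indep_vars_iff_distr_eq_PiM') (use I m in auto)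
  also have "\<dots> = PiM I (\<lambda>p. expm (r p))"
  proof (rule PiM_cong[OF refl])
    fix p assume p: "p \<in> I"
    have "distributed M lborel (\<lambda>\<omega>. Y p \<omega> / r p) (exponential_density (r p))"
    proof (subst exponential_distributed_iff[OF r], intro conjI allI impI)
      fix a :: real assume a: "0 \<le> a"
      have "\<P>(x in M. Y p x / r p \<le> a) = \<P>(x in M. Y p x \<le> a * r p)"
        using r[of p] by (simp add: field_simps)
      also have "\<dots> = 1 - exp (- (a * r p) * 1)"
        using r[of p] a by (intro exponential_distributedD_le exp_arrayD(3)[OF Y p]) auto
      finally show "\<P>(x in M. Y p x / r p \<le> a) = 1 - exp (- a * r p)" by simp
    qed (rule m[OF p])
    then have "distr M lborel (\<lambda>\<omega>. Y p \<omega> / r p) = expm (r p)"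
      by (rule distributed_distr_eq_density)
    moreover have "distr M lborel (\<lambda>\<omega>. Y p \<omega> / r p) = distr M borel (\<lambda>\<omega>. Y p \<omega> / r p)"
      by (rule distr_cong) auto
    ultimately show "distr M borel (\<lambda>\<omega>. Y p \<omega> / r p) = expm (r p)" by simp
  qed
  finally show ?thesis .
qed

lemma exp_array_nn_integral:
  assumes Y: "exp_array M I Y" and I: "finite I" "I \<noteq> {}" and r: "\<And>p. 0 < r p"
    and F: "F \<in> borel_measurable (PiM I (\<lambda>_. borel))"
  shows "(\<integral>\<^sup>+\<omega>. F (\<lambda>p\<in>I. Y p \<omega> / r p) \<partial>M) = (\<integral>\<^sup>+x. F x \<partial>PiM I (\<lambda>p. expm (r p)))"
proof -
  have m: "(\<lambda>\<omega>. \<lambda>p\<in>I. Y p \<omega> / r p) \<in> measurable M (PiM I (\<lambda>_. borel))"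
    using exp_arrayD(1)[OF Y] by (intro measurable_restrict) auto
  show ?thesis
    using nn_integral_distr[OF m, of F] F unfolding exp_array_law[OF Y I r] by simp
qed

end

lemma measurable_curry3:
  assumes "(\<lambda>(a, b, c). g a b c) \<in> measurable (A \<Otimes>\<^sub>M B \<Otimes>\<^sub>M C) L"
    "f1 \<in> measurable N A" "f2 \<in> measurable N B" "f3 \<in> measurable N C"
  shows "(\<lambda>x. g (f1 x) (f2 x) (f3 x)) \<in> measurable N L"
  using measurable_compose[OF measurable_Pair[OF assms(2) measurable_Pair[OF assms(3,4)]] assms(1)] by simp

text \<open>
  On the event $a\ge b$ write $a=b+d$. The joint density is then $\rho\sigma e^{-\rho d}e^{-(\rho+\sigma)b}e^{-c}$,
  which is symmetric in $b$ and $c$ because $\rho+\sigma=1$, and the map $(a,b,c)\mapsto(c+d,c,b)$ just exchanges $b$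
  and $c$. The set \<open>D\<close> is open or closed at zero so that the two events $a>b$ and $b\ge a$ can be
  covered by the same lemma.
\<close>

lemma exponential_queue_half:
  fixes g :: "real \<Rightarrow> real \<Rightarrow> real \<Rightarrow> ennreal" and \<rho> \<sigma> :: real
  assumes \<rho>: "0 < \<rho>" "0 < \<sigma>" "\<rho> + \<sigma> = 1" and D: "D = {0<..} \<or> D = {0..}"
    and g: "(\<lambda>(a, b, c). g a b c) \<in> borel_measurable (borel \<Otimes>\<^sub>M borel \<Otimes>\<^sub>M borel)"
  defines "e \<equiv> (\<lambda>r x. ennreal (exponential_density r x))"
  shows "(\<integral>\<^sup>+c. \<integral>\<^sup>+b. \<integral>\<^sup>+a. e \<rho> a * e \<sigma> b * e 1 c * (indicator D (a - b) * g (c + (a - b)) c b) \<partial>lborel \<partial>lborel \<partial>lborel)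
       = (\<integral>\<^sup>+c. \<integral>\<^sup>+b. \<integral>\<^sup>+a. e \<rho> a * e \<sigma> b * e 1 c * (indicator D (a - b) * g a b c) \<partial>lborel \<partial>lborel \<partial>lborel)"
proof -
  note [measurable (raw)] = measurable_curry3[OF g]
  have [measurable]: "D \<in> sets borel" using D by auto
  have [measurable]: "e r \<in> borel_measurable borel" for r unfolding e_def by measurable
  have dens: "e \<rho> (b + d) * e \<sigma> b * e 1 c * indicator D d = e \<rho> (c + d) * e \<sigma> c * e 1 b * indicator D d" for b c d
  proof (cases "d \<in> D \<and> 0 \<le> b \<and> 0 \<le> c")
    case True
    then have d: "0 \<le> d" using D by auto
    have \<sigma>: "\<sigma> = 1 - \<rho>" using \<rho> by simp
    have "e \<rho> (b + d) * e \<sigma> b * e 1 c = ennreal (\<rho> * exp (- (b + d) * \<rho>) * (\<sigma> * exp (- b * \<sigma>)) * (1 * exp (- c * 1)))"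
      using True d \<rho> by (simp add: e_def exponential_density_def ennreal_mult')
    also have "\<rho> * exp (- (b + d) * \<rho>) * (\<sigma> * exp (- b * \<sigma>)) * (1 * exp (- c * 1)) =
               \<rho> * exp (- (c + d) * \<rho>) * (\<sigma> * exp (- c * \<sigma>)) * (1 * exp (- b * 1))"
      by (simp add: \<sigma> exp_add[symmetric] algebra_simps flip: exp_add)
    also have "ennreal \<dots> = e \<rho> (c + d) * e \<sigma> c * e 1 b"
      using True d \<rho> by (simp add: e_def exponential_density_def ennreal_mult')
    finally show ?thesis by simp
  next
    case False
    then show ?thesis by (auto simp: e_def exponential_density_def indicator_def)
  qed
  have tr: "(\<integral>\<^sup>+a. h a \<partial>lborel) = (\<integral>\<^sup>+d. h (b + d) \<partial>lborel)" if "h \<in> borel_measurable borel" for h :: "real \<Rightarrow> ennreal" and b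
    using nn_integral_real_affine[OF that, of 1 b] by simp
  have "(\<integral>\<^sup>+c. \<integral>\<^sup>+b. \<integral>\<^sup>+a. e \<rho> a * e \<sigma> b * e 1 c * (indicator D (a - b) * g (c + (a - b)) c b) \<partial>lborel \<partial>lborel \<partial>lborel)
      = (\<integral>\<^sup>+c. \<integral>\<^sup>+b. \<integral>\<^sup>+d. e \<rho> (b + d) * e \<sigma> b * e 1 c * indicator D d * g (c + d) c b \<partial>lborel \<partial>lborel \<partial>lborel)"
  proof (rule nn_integral_cong, rule nn_integral_cong)
    fix c b show "(\<integral>\<^sup>+a. e \<rho> a * e \<sigma> b * e 1 c * (indicator D (a - b) * g (c + (a - b)) c b) \<partial>lborel)
      = (\<integral>\<^sup>+d. e \<rho> (b + d) * e \<sigma> b * e 1 c * indicator D d * g (c + d) c b \<partial>lborel)"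
      by (subst tr[of _ b]) (auto simp: mult.assoc)
  qed
  also have "\<dots> = (\<integral>\<^sup>+c. \<integral>\<^sup>+b. \<integral>\<^sup>+d. e \<rho> (c + d) * e \<sigma> c * e 1 b * indicator D d * g (c + d) c b \<partial>lborel \<partial>lborel \<partial>lborel)"
    by (simp only: dens)
  also have "\<dots> = (\<integral>\<^sup>+b. \<integral>\<^sup>+c. \<integral>\<^sup>+d. e \<rho> (c + d) * e \<sigma> c * e 1 b * indicator D d * g (c + d) c b \<partial>lborel \<partial>lborel \<partial>lborel)"
    by (rule lborel_pair.Fubini') measurable
  also have "\<dots> = (\<integral>\<^sup>+c. \<integral>\<^sup>+b. \<integral>\<^sup>+a. e \<rho> a * e \<sigma> b * e 1 c * (indicator D (a - b) * g a b c) \<partial>lborel \<partial>lborel \<partial>lborel)"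
  proof (rule nn_integral_cong, rule nn_integral_cong)
    fix c b show "(\<integral>\<^sup>+d. e \<rho> (b + d) * e \<sigma> b * e 1 c * indicator D d * g (b + d) b c \<partial>lborel)
       = (\<integral>\<^sup>+a. e \<rho> a * e \<sigma> b * e 1 c * (indicator D (a - b) * g a b c) \<partial>lborel)"
      by (subst (2) tr[of _ b]) (auto simp: mult.assoc)
  qed
  finally show ?thesis .
qed

text \<open>
  Burke's property for one site: $a$ and $b$ are the horizontal and the vertical increment that enter the site, $c$ is
  its weight, and the three new values are the increments that leave it together with the minimum. The law of the
  triple does not change. The cases $a>b$ and $b\ge a$ are mirror images of each other.
\<close>

lemma exponential_queue:
  fixes g :: "real \<Rightarrow> real \<Rightarrow> real \<Rightarrow> ennreal" and \<rho> :: real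
  assumes \<rho>: "0 < \<rho>" "\<rho> < 1"
    and g: "(\<lambda>(a, b, c). g a b c) \<in> borel_measurable (borel \<Otimes>\<^sub>M borel \<Otimes>\<^sub>M borel)"
  shows "(\<integral>\<^sup>+c. \<integral>\<^sup>+b. \<integral>\<^sup>+a. g (c + max 0 (a - b)) (c + max 0 (b - a)) (min a b) \<partial>expm \<rho> \<partial>expm (1 - \<rho>) \<partial>expm 1)
       = (\<integral>\<^sup>+c. \<integral>\<^sup>+b. \<integral>\<^sup>+a. g a b c \<partial>expm \<rho> \<partial>expm (1 - \<rho>) \<partial>expm 1)"
proof -
  define e where "e = (\<lambda>r x. ennreal (exponential_density r x))"
  have [measurable]: "e r \<in> borel_measurable borel" for r unfolding e_def by measurable
  note [measurable (raw)] = measurable_curry3[OF g]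
  have dens: "(\<integral>\<^sup>+c. \<integral>\<^sup>+b. \<integral>\<^sup>+a. k a b c \<partial>expm \<rho> \<partial>expm (1 - \<rho>) \<partial>expm 1)
    = (\<integral>\<^sup>+c. \<integral>\<^sup>+b. \<integral>\<^sup>+a. e \<rho> a * e (1 - \<rho>) b * e 1 c * k a b c \<partial>lborel \<partial>lborel \<partial>lborel)"
    if k: "(\<lambda>(a, b, c). k a b c) \<in> borel_measurable (borel \<Otimes>\<^sub>M borel \<Otimes>\<^sub>M borel)" for k :: "real \<Rightarrow> real \<Rightarrow> real \<Rightarrow> ennreal"
  proof -
    note [measurable (raw)] = measurable_curry3[OF k]
    have d: "(\<integral>\<^sup>+x. f x \<partial>expm r) = (\<integral>\<^sup>+x. e r x * f x \<partial>lborel)" if "f \<in> borel_measurable borel" for f :: "real \<Rightarrow> ennreal" and r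
      using that by (simp add: nn_integral_density e_def)
    have "(\<integral>\<^sup>+c. \<integral>\<^sup>+b. \<integral>\<^sup>+a. k a b c \<partial>expm \<rho> \<partial>expm (1 - \<rho>) \<partial>expm 1) =
        (\<integral>\<^sup>+c. \<integral>\<^sup>+b. (\<integral>\<^sup>+a. e \<rho> a * k a b c \<partial>lborel) \<partial>expm (1 - \<rho>) \<partial>expm 1)"
      by (intro nn_integral_cong d) measurable
    also have "\<dots> = (\<integral>\<^sup>+c. (\<integral>\<^sup>+b. e (1 - \<rho>) b * (\<integral>\<^sup>+a. e \<rho> a * k a b c \<partial>lborel) \<partial>lborel) \<partial>expm 1)"
      by (intro nn_integral_cong d) measurable
    also have "\<dots> = (\<integral>\<^sup>+c. e 1 c * (\<integral>\<^sup>+b. e (1 - \<rho>) b * (\<integral>\<^sup>+a. e \<rho> a * k a b c \<partial>lborel) \<partial>lborel) \<partial>lborel)"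
      by (rule d) measurable
    also have "\<dots> = (\<integral>\<^sup>+c. \<integral>\<^sup>+b. \<integral>\<^sup>+a. e 1 c * (e (1 - \<rho>) b * (e \<rho> a * k a b c)) \<partial>lborel \<partial>lborel \<partial>lborel)"
      by (simp add: nn_integral_cmult)
    also have "\<dots> = (\<integral>\<^sup>+c. \<integral>\<^sup>+b. \<integral>\<^sup>+a. e \<rho> a * e (1 - \<rho>) b * e 1 c * k a b c \<partial>lborel \<partial>lborel \<partial>lborel)"
      by (intro nn_integral_cong) (simp add: ac_simps)
    finally show ?thesis .
  qed
  have split: "(\<integral>\<^sup>+c. \<integral>\<^sup>+b. \<integral>\<^sup>+a. e \<rho> a * e (1 - \<rho>) b * e 1 c * k a b c \<partial>lborel \<partial>lborel \<partial>lborel)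
     = (\<integral>\<^sup>+c. \<integral>\<^sup>+b. \<integral>\<^sup>+a. e \<rho> a * e (1 - \<rho>) b * e 1 c * (indicator {0<..} (a - b) * k a b c) \<partial>lborel \<partial>lborel \<partial>lborel)
     + (\<integral>\<^sup>+c. \<integral>\<^sup>+a. \<integral>\<^sup>+b. e (1 - \<rho>) b * e \<rho> a * e 1 c * (indicator {0..} (b - a) * k a b c) \<partial>lborel \<partial>lborel \<partial>lborel)"
    if k: "(\<lambda>(a, b, c). k a b c) \<in> borel_measurable (borel \<Otimes>\<^sub>M borel \<Otimes>\<^sub>M borel)" for k :: "real \<Rightarrow> real \<Rightarrow> real \<Rightarrow> ennreal"
  proof -
    note [measurable (raw)] = measurable_curry3[OF k]
    have "(\<integral>\<^sup>+c. \<integral>\<^sup>+b. \<integral>\<^sup>+a. e \<rho> a * e (1 - \<rho>) b * e 1 c * k a b c \<partial>lborel \<partial>lborel \<partial>lborel)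
      = (\<integral>\<^sup>+c. \<integral>\<^sup>+b. \<integral>\<^sup>+a. e \<rho> a * e (1 - \<rho>) b * e 1 c * (indicator {0<..} (a - b) * k a b c)
           + e (1 - \<rho>) b * e \<rho> a * e 1 c * (indicator {0..} (b - a) * k a b c) \<partial>lborel \<partial>lborel \<partial>lborel)"
      by (intro nn_integral_cong) (auto simp: indicator_def ac_simps)
    also have "\<dots> = (\<integral>\<^sup>+c. \<integral>\<^sup>+b. \<integral>\<^sup>+a. e \<rho> a * e (1 - \<rho>) b * e 1 c * (indicator {0<..} (a - b) * k a b c) \<partial>lborel \<partial>lborel \<partial>lborel)
       + (\<integral>\<^sup>+c. \<integral>\<^sup>+b. \<integral>\<^sup>+a. e (1 - \<rho>) b * e \<rho> a * e 1 c * (indicator {0..} (b - a) * k a b c) \<partial>lborel \<partial>lborel \<partial>lborel)"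
      by (simp add: nn_integral_add)
    also have "(\<integral>\<^sup>+c. \<integral>\<^sup>+b. \<integral>\<^sup>+a. e (1 - \<rho>) b * e \<rho> a * e 1 c * (indicator {0..} (b - a) * k a b c) \<partial>lborel \<partial>lborel \<partial>lborel)
        = (\<integral>\<^sup>+c. \<integral>\<^sup>+a. \<integral>\<^sup>+b. e (1 - \<rho>) b * e \<rho> a * e 1 c * (indicator {0..} (b - a) * k a b c) \<partial>lborel \<partial>lborel \<partial>lborel)"
      by (rule nn_integral_cong, rule lborel_pair.Fubini') measurable
    finally show ?thesis .
  qed
  let ?k = "\<lambda>a b c. g (c + max 0 (a - b)) (c + max 0 (b - a)) (min a b)"
  have k: "(\<lambda>(a, b, c). ?k a b c) \<in> borel_measurable (borel \<Otimes>\<^sub>M borel \<Otimes>\<^sub>M borel)" by measurable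
  have 1: "(\<integral>\<^sup>+c. \<integral>\<^sup>+b. \<integral>\<^sup>+a. e \<rho> a * e (1 - \<rho>) b * e 1 c * (indicator {0<..} (a - b) * ?k a b c) \<partial>lborel \<partial>lborel \<partial>lborel)
     = (\<integral>\<^sup>+c. \<integral>\<^sup>+b. \<integral>\<^sup>+a. e \<rho> a * e (1 - \<rho>) b * e 1 c * (indicator {0<..} (a - b) * g a b c) \<partial>lborel \<partial>lborel \<partial>lborel)"
  proof -
    have "(\<integral>\<^sup>+c. \<integral>\<^sup>+b. \<integral>\<^sup>+a. e \<rho> a * e (1 - \<rho>) b * e 1 c * (indicator {0<..} (a - b) * ?k a b c) \<partial>lborel \<partial>lborel \<partial>lborel)
      = (\<integral>\<^sup>+c. \<integral>\<^sup>+b. \<integral>\<^sup>+a. e \<rho> a * e (1 - \<rho>) b * e 1 c * (indicator {0<..} (a - b) * g (c + (a - b)) c b) \<partial>lborel \<partial>lborel \<partial>lborel)"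
      by (intro nn_integral_cong) (auto simp: indicator_def max_def min_def)
    also have "\<dots> = (\<integral>\<^sup>+c. \<integral>\<^sup>+b. \<integral>\<^sup>+a. e \<rho> a * e (1 - \<rho>) b * e 1 c * (indicator {0<..} (a - b) * g a b c) \<partial>lborel \<partial>lborel \<partial>lborel)"
      unfolding e_def by (rule exponential_queue_half) (use \<rho> in auto)
    finally show ?thesis .
  qed
  have 2: "(\<integral>\<^sup>+c. \<integral>\<^sup>+a. \<integral>\<^sup>+b. e (1 - \<rho>) b * e \<rho> a * e 1 c * (indicator {0..} (b - a) * ?k a b c) \<partial>lborel \<partial>lborel \<partial>lborel)
     = (\<integral>\<^sup>+c. \<integral>\<^sup>+a. \<integral>\<^sup>+b. e (1 - \<rho>) b * e \<rho> a * e 1 c * (indicator {0..} (b - a) * g a b c) \<partial>lborel \<partial>lborel \<partial>lborel)"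
  proof -
    have "(\<integral>\<^sup>+c. \<integral>\<^sup>+a. \<integral>\<^sup>+b. e (1 - \<rho>) b * e \<rho> a * e 1 c * (indicator {0..} (b - a) * ?k a b c) \<partial>lborel \<partial>lborel \<partial>lborel)
      = (\<integral>\<^sup>+c. \<integral>\<^sup>+a. \<integral>\<^sup>+b. e (1 - \<rho>) b * e \<rho> a * e 1 c * (indicator {0..} (b - a) * g c (c + (b - a)) a) \<partial>lborel \<partial>lborel \<partial>lborel)"
      by (intro nn_integral_cong) (auto simp: indicator_def max_def min_def)
    also have "\<dots> = (\<integral>\<^sup>+c. \<integral>\<^sup>+a. \<integral>\<^sup>+b. e (1 - \<rho>) b * e \<rho> a * e 1 c * (indicator {0..} (b - a) * g a b c) \<partial>lborel \<partial>lborel \<partial>lborel)"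
      unfolding e_def by (rule exponential_queue_half[where g="\<lambda>b a c. g a b c"]) (use \<rho> in auto)
    finally show ?thesis .
  qed
  show ?thesis
    unfolding dens[OF g] dens[OF k] split[OF g] split[OF k] 1 2 ..
qed

text \<open>
  One site of the recursion on a whole configuration, performed in place: the coordinates \<open>a\<close> and
  \<open>b\<close> hold the current increments, and the weight \<open>c\<close> is replaced by the minimum, which is
  what keeps the product measure invariant.
\<close>

definition queue_step :: "'i \<Rightarrow> 'i \<Rightarrow> 'i \<Rightarrow> ('i \<Rightarrow> real) \<Rightarrow> 'i \<Rightarrow> real" where
  "queue_step a b c x = x(c := min (x a) (x b), b := x c + max 0 (x b - x a), a := x c + max 0 (x a - x b))"

lemma measurable_queue_step:
  assumes "a \<in> I" "b \<in> I" "c \<in> I" "\<And>i. sets (N i) = sets borel"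
  shows "queue_step a b c \<in> measurable (PiM I N) (PiM I N)"
proof -
  have [measurable]: "(\<lambda>x. x i) \<in> borel_measurable (PiM I N)" if "i \<in> I" for i
    using measurable_component_singleton[OF that, of N] by (simp add: measurable_cong_sets[OF refl assms(4)])
  have *: "queue_step a b c x = (\<lambda>i\<in>I. queue_step a b c x i)" if "x \<in> space (PiM I N)" for x
    using that assms(1-3) by (auto simp: space_PiM queue_step_def fun_eq_iff PiE_def extensional_def)
  have "(\<lambda>x. \<lambda>i\<in>I. queue_step a b c x i) \<in> measurable (PiM I N) (PiM I N)"
  proof (rule measurable_restrict)
    fix i assume "i \<in> I"
    show "(\<lambda>x. queue_step a b c x i) \<in> measurable (PiM I N) (N i)"
      using assms(1-3) \<open>i \<in> I\<close> unfolding queue_step_def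
      by (cases "i = a"; cases "i = b"; cases "i = c") (simp_all add: measurable_cong_sets[OF refl assms(4)])
  qed
  then show ?thesis by (subst measurable_cong[OF *])
qed

lemma expm_product_sigma_finite:
  assumes "\<And>p. 0 < r p"
  shows "product_sigma_finite (\<lambda>p. expm (r p))"
proof
  fix i
  interpret prob_space "expm (r i)" by (rule prob_space_exponential_density[OF assms])
  show "\<exists>A. countable A \<and> A \<subseteq> sets (expm (r i)) \<and> \<Union> A = space (expm (r i)) \<and> (\<forall>a\<in>A. emeasure (expm (r i)) a \<noteq> \<infinity>)"
    using sigma_finite_countable by blast
qed

lemma queue_step_preserves:
  assumes I: "finite I" "a \<in> I" "b \<in> I" "c \<in> I" "a \<noteq> b" "a \<noteq> c" "b \<noteq> c"
    and r: "\<And>p. 0 < r p" "r b = 1 - r a" "r c = 1"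
    and F: "F \<in> borel_measurable (PiM I (\<lambda>_. borel))"
  shows "(\<integral>\<^sup>+x. F (queue_step a b c x) \<partial>PiM I (\<lambda>p. expm (r p))) = (\<integral>\<^sup>+x. F x \<partial>PiM I (\<lambda>p. expm (r p)))"
proof -
  interpret product_sigma_finite "\<lambda>p. expm (r p)" by (rule expm_product_sigma_finite[OF r(1)])
  define J where "J = I - {a, b, c}"
  have J: "finite J" "c \<notin> J" "b \<notin> insert c J" "a \<notin> insert b (insert c J)" "I = insert a (insert b (insert c J))"
    using I by (auto simp: J_def)
  let ?N = "\<lambda>p. expm (r p)"
  have int: "(\<integral>\<^sup>+x. G x \<partial>PiM I ?N) = (\<integral>\<^sup>+x. \<integral>\<^sup>+z. \<integral>\<^sup>+y. \<integral>\<^sup>+w. G (x(c := z, b := y, a := w)) \<partial>?N a \<partial>?N b \<partial>?N c \<partial>PiM J ?N)"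
    if G[measurable]: "G \<in> borel_measurable (PiM I ?N)" for G
  proof -
    have "G \<in> borel_measurable (PiM (insert a (insert b (insert c J))) ?N)" using G J(5) by simp
    note [measurable] = this
    have 1: "(\<integral>\<^sup>+x. G x \<partial>PiM I ?N) = (\<integral>\<^sup>+x. (\<integral>\<^sup>+w. G (x(a := w)) \<partial>?N a) \<partial>PiM (insert b (insert c J)) ?N)"
      unfolding J(5) by (rule product_nn_integral_insert) (use J in auto)
    also have "\<dots> = (\<integral>\<^sup>+x. \<integral>\<^sup>+y. (\<integral>\<^sup>+w. G (x(b := y, a := w)) \<partial>?N a) \<partial>?N b \<partial>PiM (insert c J) ?N)"
      by (rule product_nn_integral_insert) (use J in auto)
    also have "\<dots> = (\<integral>\<^sup>+x. \<integral>\<^sup>+z. \<integral>\<^sup>+y. (\<integral>\<^sup>+w. G (x(c := z, b := y, a := w)) \<partial>?N a) \<partial>?N b \<partial>?N c \<partial>PiM J ?N)"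
      by (rule product_nn_integral_insert) (use J in auto)
    finally show ?thesis .
  qed
  have sets: "sets (PiM I ?N) = sets (PiM I (\<lambda>_. borel))" by (rule sets_PiM_cong) auto
  have F1[measurable]: "F \<in> borel_measurable (PiM I ?N)" using F by (simp add: measurable_cong_sets[OF sets refl])
  have F2: "(\<lambda>x. F (queue_step a b c x)) \<in> borel_measurable (PiM I ?N)"
    by (rule measurable_compose[OF measurable_queue_step F1]) (use I in auto)
  show ?thesis
    unfolding int[OF F1] int[OF F2]
  proof (rule nn_integral_cong)
    fix x assume x: "x \<in> space (PiM J ?N)"
    let ?g = "\<lambda>w y z. F (x(c := z, b := y, a := w))"
    have *: "(\<lambda>(w, y, z). x(c := z, b := y, a := w)) \<in> measurable (borel \<Otimes>\<^sub>M borel \<Otimes>\<^sub>M borel) (PiM I ?N)"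
    proof -
      have "(\<lambda>(w, y, z). x(c := z, b := y, a := w)) = (\<lambda>p. \<lambda>i\<in>I. if i = a then fst p else if i = b then fst (snd p) else if i = c then snd (snd p) else x i)"
        using x J(5) by (auto simp: fun_eq_iff space_PiM PiE_def extensional_def)
      also have "\<dots> \<in> measurable (borel \<Otimes>\<^sub>M borel \<Otimes>\<^sub>M borel) (PiM I ?N)"
        by (rule measurable_restrict) auto
      finally show ?thesis .
    qed
    have g: "(\<lambda>(w, y, z). ?g w y z) \<in> borel_measurable (borel \<Otimes>\<^sub>M borel \<Otimes>\<^sub>M borel)"
      using measurable_compose[OF * F1] by (simp add: case_prod_beta)
    have "F (queue_step a b c (x(c := z, b := y, a := w))) = ?g (z + max 0 (w - y)) (z + max 0 (y - w)) (min w y)" for w y z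
      using I by (intro arg_cong[where f=F]) (auto simp: queue_step_def fun_eq_iff)
    then have "(\<integral>\<^sup>+z. \<integral>\<^sup>+y. \<integral>\<^sup>+w. F (queue_step a b c (x(c := z, b := y, a := w))) \<partial>?N a \<partial>?N b \<partial>?N c)
      = (\<integral>\<^sup>+z. \<integral>\<^sup>+y. \<integral>\<^sup>+w. ?g (z + max 0 (w - y)) (z + max 0 (y - w)) (min w y) \<partial>expm (r a) \<partial>expm (1 - r a) \<partial>expm 1)"
      using r by simp
    also have "\<dots> = (\<integral>\<^sup>+z. \<integral>\<^sup>+y. \<integral>\<^sup>+w. ?g w y z \<partial>expm (r a) \<partial>expm (1 - r a) \<partial>expm 1)"
      by (rule exponential_queue[OF _ _ g]) (use r(1)[of a] r(1)[of b] r(2) in auto)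
    finally show "(\<integral>\<^sup>+z. \<integral>\<^sup>+y. \<integral>\<^sup>+w. F (queue_step a b c (x(c := z, b := y, a := w))) \<partial>?N a \<partial>?N b \<partial>?N c)
      = (\<integral>\<^sup>+z. \<integral>\<^sup>+y. \<integral>\<^sup>+w. ?g w y z \<partial>?N a \<partial>?N b \<partial>?N c)" using r by simp
  qed
qed

section \<open>Stationarity and the exact exponential moment\<close>

text \<open>
  While the sites of row \<open>j\<close> are processed from left to right, the coordinate \<open>(i, 0)\<close>
  holds the horizontal increment in column \<open>i\<close> along the last completed row and \<open>(0, j)\<close>
  the vertical increment that travels through row \<open>j\<close>.
\<close>

primrec sweep_row :: "nat \<Rightarrow> nat \<Rightarrow> (nat \<times> nat \<Rightarrow> real) \<Rightarrow> nat \<times> nat \<Rightarrow> real" where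
  "sweep_row j 0 x = x"
| "sweep_row j (Suc i) x = queue_step (Suc i, 0) (0, j) (Suc i, j) (sweep_row j i x)"

primrec sweep :: "nat \<Rightarrow> nat \<Rightarrow> (nat \<times> nat \<Rightarrow> real) \<Rightarrow> nat \<times> nat \<Rightarrow> real" where
  "sweep m 0 x = x"
| "sweep m (Suc j) x = sweep_row (Suc j) m (sweep m j x)"

definition hsum :: "(nat \<times> nat \<Rightarrow> real) \<Rightarrow> real \<Rightarrow> nat \<Rightarrow> real" where
  "hsum x r i = (\<Sum>k=1..i. x (k, 0)) / r"

definition vsum :: "(nat \<times> nat \<Rightarrow> real) \<Rightarrow> real \<Rightarrow> nat \<Rightarrow> real" where
  "vsum x r j = (\<Sum>k=1..j. x (0, k)) / r"

text \<open>
  Boundary values are random walks whose steps are the weights on the axes divided by the rates, so that one array of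
  weights of rate one drives the models for all rates at the same time.
\<close>

abbreviation boundary_lpp :: "(nat \<times> nat \<Rightarrow> real) \<Rightarrow> real \<Rightarrow> real \<Rightarrow> nat \<Rightarrow> nat \<Rightarrow> real" where
  "boundary_lpp x w s \<equiv> lpp (hsum x w) (vsum x s) x"

abbreviation hor_lpp :: "(nat \<times> nat \<Rightarrow> real) \<Rightarrow> real \<Rightarrow> nat \<Rightarrow> nat \<Rightarrow> real" where
  "hor_lpp x w \<equiv> lpp (hsum x w) (\<lambda>_. 0) x"

abbreviation ver_lpp :: "(nat \<times> nat \<Rightarrow> real) \<Rightarrow> real \<Rightarrow> nat \<Rightarrow> nat \<Rightarrow> real" where
  "ver_lpp x s \<equiv> lpp (\<lambda>_. 0) (vsum x s) x"

text \<open>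
  The contribution of the paths that leave the horizontal axis up to column \<open>k\<close>; \<open>far_lpp\<close>
  collects the others.
\<close>

abbreviation near_lpp :: "(nat \<times> nat \<Rightarrow> real) \<Rightarrow> real \<Rightarrow> nat \<Rightarrow> nat \<Rightarrow> nat \<Rightarrow> real" where
  "near_lpp x w k \<equiv> lpp (\<lambda>i. min (hsum x w i) (hsum x w k)) (\<lambda>_. 0) x"

abbreviation far_lpp :: "(nat \<times> nat \<Rightarrow> real) \<Rightarrow> real \<Rightarrow> nat \<Rightarrow> nat \<Rightarrow> nat \<Rightarrow> real" where
  "far_lpp x w k m n \<equiv> lpp (\<lambda>i. hsum x w (i + k) - hsum x w k) (\<lambda>_. 0) (shift k 0 x) (m - k) n + hsum x w k"

lemma hsum_0 [simp]: "hsum x r 0 = 0" and vsum_0 [simp]: "vsum x r 0 = 0"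
  by (simp_all add: hsum_def vsum_def)

lemma hsum_Suc [simp]: "hsum x r (Suc i) = hsum x r i + x (Suc i, 0) / r"
  and vsum_Suc [simp]: "vsum x r (Suc j) = vsum x r j + x (0, Suc j) / r"
  by (simp_all add: hsum_def vsum_def add_divide_distrib)

text \<open>
  The conjuncts describe a partially swept row: columns up to \<open>i\<close> already carry increments along row
  \<open>j + 1\<close>, the columns to the right still those along row \<open>j\<close>, and the weights that are
  still needed are untouched.
\<close>

lemma sweep_row_invariant:
  fixes x :: "nat \<times> nat \<Rightarrow> real" and m j :: nat
  defines "L \<equiv> boundary_lpp x 1 1"
  assumes y: "\<And>i. 1 \<le> i \<Longrightarrow> i \<le> m \<Longrightarrow> y (i, 0) = L i j - L (i - 1) j"
    "\<And>k. j < k \<Longrightarrow> y (0, k) = x (0, k)" "\<And>i k. 1 \<le> i \<Longrightarrow> j < k \<Longrightarrow> y (i, k) = x (i, k)"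
  shows "i \<le> m \<Longrightarrow> (\<forall>i'. 1 \<le> i' \<and> i' \<le> i \<longrightarrow> sweep_row (Suc j) i y (i', 0) = L i' (Suc j) - L (i' - 1) (Suc j)) \<and>
      (\<forall>i'. i < i' \<and> i' \<le> m \<longrightarrow> sweep_row (Suc j) i y (i', 0) = L i' j - L (i' - 1) j) \<and>
      sweep_row (Suc j) i y (0, Suc j) = L i (Suc j) - L i j \<and>
      (\<forall>k>Suc j. sweep_row (Suc j) i y (0, k) = x (0, k)) \<and>
      (\<forall>i' k. i < i' \<and> j < k \<longrightarrow> sweep_row (Suc j) i y (i', k) = x (i', k)) \<and>
      (\<forall>i' k. 1 \<le> i' \<and> Suc j < k \<longrightarrow> sweep_row (Suc j) i y (i', k) = x (i', k))"
proof (induction i)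
  case 0
  have "L 0 (Suc j) - L 0 j = x (0, Suc j)" by (cases j) (simp_all add: L_def)
  then show ?case using y by (auto simp: y(2))
next
  case (Suc i)
  let ?s = "sweep_row (Suc j) i y"
  have a: "?s (Suc i, 0) = L (Suc i) j - L i j" and b: "?s (0, Suc j) = L i (Suc j) - L i j"
    and c: "?s (Suc i, Suc j) = x (Suc i, Suc j)" using Suc by auto
  have LL: "L (Suc i) (Suc j) = x (Suc i, Suc j) + max (L i (Suc j)) (L (Suc i) j)" by (simp add: L_def)
  have 1: "queue_step (Suc i, 0) (0, Suc j) (Suc i, Suc j) ?s (Suc i, 0) = L (Suc i) (Suc j) - L i (Suc j)"
    by (simp add: queue_step_def a b c LL max_def)
  have 2: "queue_step (Suc i, 0) (0, Suc j) (Suc i, Suc j) ?s (0, Suc j) = L (Suc i) (Suc j) - L (Suc i) j"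
    by (simp add: queue_step_def a b c LL max_def)
  have 3: "queue_step (Suc i, 0) (0, Suc j) (Suc i, Suc j) ?s p = ?s p" if "p \<noteq> (Suc i, 0)" "p \<noteq> (0, Suc j)" "p \<noteq> (Suc i, Suc j)" for p
    using that by (simp add: queue_step_def)
  show ?case
    unfolding sweep_row.simps
  proof (intro conjI allI impI)
    fix i' assume "1 \<le> i' \<and> i' \<le> Suc i"
    then show "queue_step (Suc i, 0) (0, Suc j) (Suc i, Suc j) ?s (i', 0) = L i' (Suc j) - L (i' - 1) (Suc j)"
      using 1 3[of "(i', 0)"] Suc by (cases "i' = Suc i") auto
  qed (use 2 3 Suc in auto)
qed

lemma sweep_invariant:
  fixes x :: "nat \<times> nat \<Rightarrow> real" and m j :: nat
  defines "L \<equiv> boundary_lpp x 1 1"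
  shows "(\<forall>i. 1 \<le> i \<and> i \<le> m \<longrightarrow> sweep m j x (i, 0) = L i j - L (i - 1) j) \<and>
    (\<forall>k>j. sweep m j x (0, k) = x (0, k)) \<and> (\<forall>i k. 1 \<le> i \<and> j < k \<longrightarrow> sweep m j x (i, k) = x (i, k))"
proof (induction j)
  case 0
  have "hsum x 1 i - hsum x 1 (i - 1) = x (i, 0)" if "1 \<le> i" for i using that by (cases i) auto
  then show ?case by (auto simp: L_def)
next
  case (Suc j)
  show ?case
    using sweep_row_invariant[of m "sweep m j x" x j m] Suc unfolding L_def by auto
qed

lemma sweep_top:
  assumes "1 \<le> i" "i \<le> m"
  shows "sweep m n x (i, 0) = boundary_lpp x 1 1 i n - boundary_lpp x 1 1 (i - 1) n"
  using sweep_invariant[of m n x] assms by auto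

text \<open>
  The rate of the weight at each site: \<open>w\<close> on the horizontal axis, \<open>s\<close> on the vertical one
  and 1 inside.
\<close>

definition rates :: "real \<Rightarrow> real \<Rightarrow> nat \<times> nat \<Rightarrow> real" where
  "rates w s = (\<lambda>(i, j). if j = 0 then w else if i = 0 then s else 1)"

lemma rates_pos: "0 < w \<Longrightarrow> 0 < s \<Longrightarrow> 0 < rates w s p"
  by (auto simp: rates_def split: prod.split)

lemma measurable_sweep_row:
  assumes "j \<in> {1..n}" "i \<le> m"
  shows "sweep_row j i \<in> measurable (PiM ({0..m} \<times> {0..n}) (\<lambda>_. borel)) (PiM ({0..m} \<times> {0..n}) (\<lambda>_. borel))"
  using assms(2)
proof (induction i)
  case 0 then show ?case by simp
next
  case (Suc i)
  have "(\<lambda>x. queue_step (Suc i, 0) (0, j) (Suc i, j) (sweep_row j i x)) \<in> measurable (PiM ({0..m} \<times> {0..n}) (\<lambda>_. borel)) (PiM ({0..m} \<times> {0..n}) (\<lambda>_. borel))"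
    by (rule measurable_compose[OF _ measurable_queue_step]) (use Suc assms in auto)
  then show ?case by (simp cong: measurable_cong)
qed

lemma measurable_sweep:
  assumes "j \<le> n"
  shows "sweep m j \<in> measurable (PiM ({0..m} \<times> {0..n}) (\<lambda>_. borel)) (PiM ({0..m} \<times> {0..n}) (\<lambda>_. borel))"
  using assms
proof (induction j)
  case 0 then show ?case by simp
next
  case (Suc j)
  have "(\<lambda>x. sweep_row (Suc j) m (sweep m j x)) \<in> measurable (PiM ({0..m} \<times> {0..n}) (\<lambda>_. borel)) (PiM ({0..m} \<times> {0..n}) (\<lambda>_. borel))"
    by (rule measurable_compose[OF _ measurable_sweep_row]) (use Suc in auto)
  then show ?case by (simp cong: measurable_cong)
qed

text \<open>
  Every step is a \<open>queue_step\<close> on three distinct coordinates with rates $\rho$, $1-\rho$ and 1, so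
  Burke's property applies to each.
\<close>

lemma sweep_preserves:
  assumes \<rho>: "0 < \<rho>" "\<rho> < 1" and F: "F \<in> borel_measurable (PiM ({0..m} \<times> {0..n}) (\<lambda>_. borel))"
  shows "(\<integral>\<^sup>+x. F (sweep m n x) \<partial>PiM ({0..m} \<times> {0..n}) (\<lambda>p. expm (rates \<rho> (1 - \<rho>) p)))
       = (\<integral>\<^sup>+x. F x \<partial>PiM ({0..m} \<times> {0..n}) (\<lambda>p. expm (rates \<rho> (1 - \<rho>) p)))"
proof -
  let ?I = "{0..m} \<times> {0..n}"
  let ?P = "PiM ?I (\<lambda>p. expm (rates \<rho> (1 - \<rho>) p))"
  have row: "(\<integral>\<^sup>+x. F (sweep_row j i x) \<partial>?P) = (\<integral>\<^sup>+x. F x \<partial>?P)"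
    if "j \<in> {1..n}" "i \<le> m" "F \<in> borel_measurable (PiM ?I (\<lambda>_. borel))" for F i j
    using that(2,3)
  proof (induction i arbitrary: F)
    case 0 then show ?case by simp
  next
    case (Suc i)
    let ?q = "queue_step (Suc i, 0) (0, j) (Suc i, j)"
    have "(\<integral>\<^sup>+x. F (sweep_row j (Suc i) x) \<partial>?P) = (\<integral>\<^sup>+x. (\<lambda>x. F (?q x)) (sweep_row j i x) \<partial>?P)"
      by simp
    also have "\<dots> = (\<integral>\<^sup>+x. F (?q x) \<partial>?P)"
      by (rule Suc.IH) (use Suc that(1) in \<open>auto intro!: measurable_compose[OF measurable_queue_step]\<close>)
    also have "\<dots> = (\<integral>\<^sup>+x. F x \<partial>?P)"
      by (rule queue_step_preserves) (use Suc that(1) \<rho> in \<open>auto intro!: rates_pos\<close>, auto simp: rates_def)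
    finally show ?case .
  qed
  have "(\<integral>\<^sup>+x. F (sweep m j x) \<partial>?P) = (\<integral>\<^sup>+x. F x \<partial>?P)" if "j \<le> n" for j
    using that F
  proof (induction j arbitrary: F)
    case 0 then show ?case by simp
  next
    case (Suc j)
    have "(\<integral>\<^sup>+x. F (sweep m (Suc j) x) \<partial>?P) = (\<integral>\<^sup>+x. (\<lambda>x. F (sweep_row (Suc j) m x)) (sweep m j x) \<partial>?P)"
      by simp
    also have "\<dots> = (\<integral>\<^sup>+x. F (sweep_row (Suc j) m x) \<partial>?P)"
      by (rule Suc.IH) (use Suc in \<open>auto intro!: measurable_compose[OF measurable_sweep_row]\<close>)
    also have "\<dots> = (\<integral>\<^sup>+x. F x \<partial>?P)" by (rule row) (use Suc in auto)
    finally show ?case .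
  qed
  then show ?thesis by simp
qed

text \<open>
  The likelihood ratio of two products of exponential laws.
\<close>

lemma expm_change_rate:
  assumes r: "\<And>p. 0 < r p" "\<And>p. 0 < r' p" and I: "finite I" and F: "F \<in> borel_measurable (PiM I (\<lambda>_. borel))"
  shows "(\<integral>\<^sup>+x. F x \<partial>PiM I (\<lambda>p. expm (r' p)))
    = (\<integral>\<^sup>+x. (\<Prod>p\<in>I. ennreal (r' p / r p * exp (- (r' p - r p) * x p))) * F x \<partial>PiM I (\<lambda>p. expm (r p)))"
  using I F
proof (induction I arbitrary: F rule: finite_induct)
  case empty
  then show ?case by (simp add: PiM_empty)
next
  case (insert i I)
  interpret A: product_sigma_finite "\<lambda>p. expm (r p)" by (rule expm_product_sigma_finite[OF r(1)])
  interpret B: product_sigma_finite "\<lambda>p. expm (r' p)" by (rule expm_product_sigma_finite[OF r(2)])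
  let ?d = "\<lambda>p y. ennreal (r' p / r p * exp (- (r' p - r p) * y))"
  have sets: "sets (PiM J (\<lambda>p. expm (q p))) = sets (PiM J (\<lambda>_. borel))" for J q by (rule sets_PiM_cong) auto
  have m: "(f \<in> borel_measurable (PiM J (\<lambda>p. expm (q p)))) = (f \<in> borel_measurable (PiM J (\<lambda>_. borel)))" for f :: "_ \<Rightarrow> ennreal" and J q
    by (simp add: measurable_cong_sets[OF sets refl])
  note F = insert.prems
  have upd: "(\<lambda>(x, y). x(i := y)) \<in> measurable (PiM I (\<lambda>_. borel) \<Otimes>\<^sub>M borel) (PiM (insert i I) (\<lambda>_. borel))"
    using measurable_add_dim[of i I "\<lambda>_. borel"] by simp
  have Fm: "(\<lambda>(x, y). F (x(i := y))) \<in> borel_measurable (PiM I (\<lambda>_. borel) \<Otimes>\<^sub>M borel)"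
    using measurable_compose[OF upd F] by (simp add: case_prod_beta' fun_upd_def)
  have Fy: "(\<lambda>y. F (x(i := y))) \<in> borel_measurable borel" if "x \<in> space (PiM I (\<lambda>p. expm (q p)))" for x q
  proof -
    have "x \<in> space (PiM I (\<lambda>_. borel))" using that by (simp add: space_PiM)
    from measurable_compose[OF measurable_Pair1'[OF this] Fm] show ?thesis by simp
  qed
  have one: "(\<integral>\<^sup>+y. G y \<partial>expm (r' i)) = (\<integral>\<^sup>+y. ?d i y * G y \<partial>expm (r i))" if "G \<in> borel_measurable borel" for G
  proof -
    have "ennreal (exponential_density (r' i) y) = ennreal (exponential_density (r i) y) * ?d i y" for y
      using r[of i] by (simp add: exponential_density_def ennreal_mult'[symmetric] algebra_simps flip: exp_add)
    then show ?thesis using that by (simp add: nn_integral_density mult.assoc)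
  qed
  have G: "(\<lambda>x. \<integral>\<^sup>+y. ?d i y * F (x(i := y)) \<partial>expm (r i)) \<in> borel_measurable (PiM I (\<lambda>_. borel))"
    by (rule sigma_finite_measure.borel_measurable_nn_integral[OF A.sigma_finite_measures])
      (use Fm in \<open>auto simp: case_prod_beta intro!: borel_measurable_times\<close>)
  have "(\<integral>\<^sup>+x. F x \<partial>PiM (insert i I) (\<lambda>p. expm (r' p))) = (\<integral>\<^sup>+x. \<integral>\<^sup>+y. F (x(i := y)) \<partial>expm (r' i) \<partial>PiM I (\<lambda>p. expm (r' p)))"
    by (rule B.product_nn_integral_insert) (use insert m in auto)
  also have "\<dots> = (\<integral>\<^sup>+x. \<integral>\<^sup>+y. ?d i y * F (x(i := y)) \<partial>expm (r i) \<partial>PiM I (\<lambda>p. expm (r' p)))"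
    by (intro nn_integral_cong one Fy)
  also have "\<dots> = (\<integral>\<^sup>+x. (\<Prod>p\<in>I. ?d p (x p)) * (\<integral>\<^sup>+y. ?d i y * F (x(i := y)) \<partial>expm (r i)) \<partial>PiM I (\<lambda>p. expm (r p)))"
    by (rule insert.IH[OF G])
  also have "\<dots> = (\<integral>\<^sup>+x. \<integral>\<^sup>+y. (\<Prod>p\<in>insert i I. ?d p ((x(i := y)) p)) * F (x(i := y)) \<partial>expm (r i) \<partial>PiM I (\<lambda>p. expm (r p)))"
  proof (intro nn_integral_cong)
    fix x assume x: "x \<in> space (PiM I (\<lambda>p. expm (r p)))"
    have "(\<Prod>p\<in>insert i I. ?d p ((x(i := y)) p)) = ?d i y * (\<Prod>p\<in>I. ?d p (x p))" for y
      using insert(1,2) by (simp, intro arg_cong2[where f="(*)"] refl prod.cong) auto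
    then show "(\<Prod>p\<in>I. ?d p (x p)) * (\<integral>\<^sup>+y. ?d i y * F (x(i := y)) \<partial>expm (r i))
        = (\<integral>\<^sup>+y. (\<Prod>p\<in>insert i I. ?d p ((x(i := y)) p)) * F (x(i := y)) \<partial>expm (r i))"
      using Fy[OF x] by (simp add: nn_integral_cmult[symmetric] ac_simps)
  qed
  also have "\<dots> = (\<integral>\<^sup>+x. (\<Prod>p\<in>insert i I. ?d p (x p)) * F x \<partial>PiM (insert i I) (\<lambda>p. expm (r p)))"
  proof (rule A.product_nn_integral_insert[symmetric])
    have [measurable]: "F \<in> borel_measurable (PiM (insert i I) (\<lambda>_. borel))" by (rule F)
    show "(\<lambda>x. (\<Prod>p\<in>insert i I. ?d p (x p)) * F x) \<in> borel_measurable (PiM (insert i I) (\<lambda>p. expm (r p)))"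
      unfolding m by measurable
  qed (use insert in auto)
  finally show ?case .
qed

lemma measurable_lpp:
  assumes "\<And>i. i \<le> m \<Longrightarrow> (\<lambda>\<omega>. A \<omega> i) \<in> borel_measurable N" "\<And>j. j \<le> n \<Longrightarrow> (\<lambda>\<omega>. B \<omega> j) \<in> borel_measurable N"
    and "\<And>i j. 1 \<le> i \<Longrightarrow> i \<le> m \<Longrightarrow> 1 \<le> j \<Longrightarrow> j \<le> n \<Longrightarrow> (\<lambda>\<omega>. X \<omega> (i, j)) \<in> borel_measurable N"
  shows "(\<lambda>\<omega>. lpp (A \<omega>) (B \<omega>) (X \<omega>) m n) \<in> borel_measurable N"
proof -
  have "i \<le> m \<Longrightarrow> j \<le> n \<Longrightarrow> (\<lambda>\<omega>. lpp (A \<omega>) (B \<omega>) (X \<omega>) i j) \<in> borel_measurable N" for i j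
  proof (induction "i + j" arbitrary: i j rule: less_induct)
    case less
    show ?case
    proof (cases "i = 0 \<or> j = 0")
      case True then show ?thesis using assms less by (cases j) auto
    next
      case False
      then obtain i' j' where ij: "i = Suc i'" "j = Suc j'" by (metis not0_implies_Suc)
      have "(\<lambda>\<omega>. lpp (A \<omega>) (B \<omega>) (X \<omega>) i' (Suc j')) \<in> borel_measurable N" "(\<lambda>\<omega>. lpp (A \<omega>) (B \<omega>) (X \<omega>) (Suc i') j') \<in> borel_measurable N"
        using less(1)[of i' "Suc j'"] less(1)[of "Suc i'" j'] less(2,3) ij by auto
      then show ?thesis using assms(3)[of i j] less(2,3) ij by auto
    qed
  qed
  then show ?thesis by auto
qed

lemma measurable_hsum: "(\<And>k. 1 \<le> k \<Longrightarrow> k \<le> i \<Longrightarrow> (\<lambda>\<omega>. x \<omega> (k, 0)) \<in> borel_measurable N) \<Longrightarrow> (\<lambda>\<omega>. hsum (x \<omega>) r i) \<in> borel_measurable N"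
  unfolding hsum_def by (intro borel_measurable_divide borel_measurable_sum) auto

lemma measurable_vsum: "(\<And>k. 1 \<le> k \<Longrightarrow> k \<le> i \<Longrightarrow> (\<lambda>\<omega>. x \<omega> (0, k)) \<in> borel_measurable N) \<Longrightarrow> (\<lambda>\<omega>. vsum (x \<omega>) r i) \<in> borel_measurable N"
  unfolding vsum_def by (intro borel_measurable_divide borel_measurable_sum) auto

text \<open>
  Rescaling the axis weights beforehand or taking the rates into the boundary walks amounts to the same.
\<close>

lemma lpp_rates:
  assumes "x = (\<lambda>p\<in>{0..m} \<times> {0..n}. y p / rates w s p)" "i \<le> m" "j \<le> n"
  shows "boundary_lpp x 1 1 i j = boundary_lpp y w s i j"
  by (rule lpp_cong) (use assms in \<open>auto simp: rates_def hsum_def vsum_def sum_divide_distrib intro!: sum.cong\<close>)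

context prob_space begin

text \<open>
  Burke's property along the top row: the horizontal increments of the stationary passage time are distributed as the
  weights on the horizontal axis, in particular independent.
\<close>

lemma lpp_top_increments_law:
  assumes Y: "exp_array M ({0..m} \<times> {0..n}) Y" and \<rho>: "0 < \<rho>" "\<rho> < 1"
    and G: "G \<in> borel_measurable (PiM {1..m} (\<lambda>_. borel))"
  defines "L \<equiv> \<lambda>\<omega>. boundary_lpp (\<lambda>p. Y p \<omega>) \<rho> (1 - \<rho>)"
  shows "(\<integral>\<^sup>+\<omega>. G (\<lambda>i\<in>{1..m}. L \<omega> i n - L \<omega> (i - 1) n) \<partial>M) = (\<integral>\<^sup>+\<omega>. G (\<lambda>i\<in>{1..m}. Y (i, 0) \<omega> / \<rho>) \<partial>M)"
proof -
  let ?I = "{0..m} \<times> {0..n}" and ?r = "rates \<rho> (1 - \<rho>)"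
  have r: "0 < ?r p" for p using \<rho> by (intro rates_pos) auto
  define F where "F = (\<lambda>x :: nat \<times> nat \<Rightarrow> real. G (\<lambda>i\<in>{1..m}. x (i, 0)))"
  have F: "F \<in> borel_measurable (PiM ?I (\<lambda>_. borel))"
    unfolding F_def by (rule measurable_compose[OF _ G]) (intro measurable_restrict measurable_component_singleton, auto)
  have FS: "(\<lambda>x. F (sweep m n x)) \<in> borel_measurable (PiM ?I (\<lambda>_. borel))"
    by (rule measurable_compose[OF measurable_sweep F]) simp
  have "(\<integral>\<^sup>+\<omega>. G (\<lambda>i\<in>{1..m}. L \<omega> i n - L \<omega> (i - 1) n) \<partial>M) = (\<integral>\<^sup>+\<omega>. F (sweep m n (\<lambda>p\<in>?I. Y p \<omega> / ?r p)) \<partial>M)"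
    unfolding F_def
    by (intro nn_integral_cong arg_cong[where f=G])
      (auto simp: sweep_top lpp_rates[OF refl] L_def fun_eq_iff)
  also have "\<dots> = (\<integral>\<^sup>+x. F (sweep m n x) \<partial>PiM ?I (\<lambda>p. expm (?r p)))"
    by (rule exp_array_nn_integral[OF Y _ _ r FS]) auto
  also have "\<dots> = (\<integral>\<^sup>+x. F x \<partial>PiM ?I (\<lambda>p. expm (?r p)))"
    by (rule sweep_preserves[OF \<rho> F])
  also have "\<dots> = (\<integral>\<^sup>+\<omega>. F (\<lambda>p\<in>?I. Y p \<omega> / ?r p) \<partial>M)"
    by (rule exp_array_nn_integral[OF Y _ _ r F, symmetric]) auto
  also have "\<dots> = (\<integral>\<^sup>+\<omega>. G (\<lambda>i\<in>{1..m}. Y (i, 0) \<omega> / \<rho>) \<partial>M)"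
    unfolding F_def by (intro nn_integral_cong arg_cong[where f=G]) (auto simp: fun_eq_iff rates_def)
  finally show ?thesis .
qed

lemma nn_integral_exp_expm:
  assumes "0 < r" "\<delta> < r"
  shows "(\<integral>\<^sup>+x. ennreal (exp (\<delta> * x)) \<partial>expm r) = ennreal (r / (r - \<delta>))"
proof -
  have "(\<integral>\<^sup>+x. ennreal (exp (\<delta> * x)) \<partial>expm r) = (\<integral>\<^sup>+x. ennreal (exponential_density r x) * ennreal (exp (\<delta> * x)) \<partial>lborel)"
    by (simp add: nn_integral_density)
  also have "\<dots> = (\<integral>\<^sup>+x. ennreal (r / (r - \<delta>)) * ennreal (exponential_density (r - \<delta>) x) \<partial>lborel)"
  proof (intro nn_integral_cong)
    fix x :: real
    have "exp (- x * r) * exp (\<delta> * x) = exp (- x * (r - \<delta>))" by (simp add: algebra_simps flip: exp_add)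
    then show "ennreal (exponential_density r x) * ennreal (exp (\<delta> * x)) = ennreal (r / (r - \<delta>)) * ennreal (exponential_density (r - \<delta>) x)"
      using assms by (simp add: exponential_density_def mult.assoc flip: ennreal_mult')
  qed
  also have "\<dots> = ennreal (r / (r - \<delta>)) * emeasure (expm (r - \<delta>)) (space (expm (r - \<delta>)))"
    by (simp add: nn_integral_cmult emeasure_density)
  also have "emeasure (expm (r - \<delta>)) (space (expm (r - \<delta>))) = 1"
    by (rule prob_space.emeasure_space_1[OF prob_space_exponential_density]) (use assms in simp)
  finally show ?thesis by simp
qed

text \<open>
  Replace the rate $1-z$ on the vertical axis by $1-w$. The likelihood ratio is a constant times $\exp(-(w-z)V)$ with
  $V$ the sum of the vertical axis weights, and multiplied with $\exp((w-z)G)$ it leaves the exponential of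
  $(w-z)(G-V)$. But $G-V$ is the sum of the increments along the top row, which in the stationary model are
  independent of rate $w$, so the expectation factorises.
\<close>

theorem lpp_exponential_moment:
  assumes Y: "exp_array M ({0..m} \<times> {0..n}) Y" and wz: "0 < z" "z < w" "w < 1"
  shows "(\<integral>\<^sup>+\<omega>. ennreal (exp ((w - z) * boundary_lpp (\<lambda>p. Y p \<omega>) w (1 - z) m n)) \<partial>M)
     = ennreal ((w / z) ^ m * ((1 - z) / (1 - w)) ^ n)"
proof -
  let ?I = "{0..m} \<times> {0..n}" and ?r = "rates w (1 - w)" and ?r' = "rates w (1 - z)"
  have r: "0 < ?r p" "0 < ?r' p" for p using wz by (auto intro!: rates_pos)
  interpret A: product_sigma_finite "\<lambda>p. expm (?r p)" by (rule expm_product_sigma_finite[OF r(1)])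
  define L where "L = (\<lambda>x. boundary_lpp x 1 1 m n)"
  define E where "E = (\<lambda>x. ennreal (exp ((w - z) * L x)))"
  have [measurable]: "L \<in> borel_measurable (PiM ?I (\<lambda>_. borel))"
    unfolding L_def by (intro measurable_lpp measurable_hsum measurable_vsum measurable_component_singleton) auto
  have E: "E \<in> borel_measurable (PiM ?I (\<lambda>_. borel))" unfolding E_def by measurable
  define F where "F = (\<lambda>x :: nat \<times> nat \<Rightarrow> real. ennreal (((1 - z) / (1 - w)) ^ n * exp ((w - z) * (\<Sum>i=1..m. x (i, 0)))))"
  have F: "F \<in> borel_measurable (PiM ?I (\<lambda>_. borel))"
    unfolding F_def by (intro measurable_compose[OF _ measurable_ennreal] borel_measurable_times borel_measurable_exp[THEN measurable_compose[rotated]]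
        borel_measurable_sum measurable_component_singleton borel_measurable_const) auto
  have "(\<integral>\<^sup>+\<omega>. ennreal (exp ((w - z) * boundary_lpp (\<lambda>p. Y p \<omega>) w (1 - z) m n)) \<partial>M)
     = (\<integral>\<^sup>+\<omega>. E (\<lambda>p\<in>?I. Y p \<omega> / ?r' p) \<partial>M)"
    unfolding E_def L_def by (intro nn_integral_cong) (simp add: lpp_rates[OF refl])
  also have "\<dots> = (\<integral>\<^sup>+x. E x \<partial>PiM ?I (\<lambda>p. expm (?r' p)))"
    by (rule exp_array_nn_integral[OF Y _ _ r(2) E]) auto
  also have "\<dots> = (\<integral>\<^sup>+x. (\<Prod>p\<in>?I. ennreal (?r' p / ?r p * exp (- (?r' p - ?r p) * x p))) * E x \<partial>PiM ?I (\<lambda>p. expm (?r p)))"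
    by (rule expm_change_rate[OF r(1) r(2) _ E]) auto
  also have "\<dots> = (\<integral>\<^sup>+x. F (sweep m n x) \<partial>PiM ?I (\<lambda>p. expm (?r p)))"
  proof (intro nn_integral_cong)
    fix x :: "nat \<times> nat \<Rightarrow> real"
    let ?d = "\<lambda>p. ?r' p / ?r p * exp (- (?r' p - ?r p) * x p)"
    (* The two families of rates differ only on the vertical axis. *)
    have sub: "(\<Prod>p\<in>?I. ?d p) = (\<Prod>p\<in>{0} \<times> {1..n}. ?d p)"
    proof (rule prod.mono_neutral_right)
      show "\<forall>p\<in>?I - {0} \<times> {1..n}. ?d p = 1"
      proof
        fix p assume p: "p \<in> ?I - {0} \<times> {1..n}"
        obtain i j where ij: "p = (i, j)" by (cases p)
        then have "j = 0 \<or> i \<noteq> 0" using p by auto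
        then show "?d p = 1" unfolding ij using wz by (cases "j = 0") (simp_all add: rates_def)
      qed
    qed auto
    also have "\<dots> = (\<Prod>k\<in>{1..n}. (1 - z) / (1 - w) * exp (- (w - z) * x (0, k)))"
      by (rule prod.reindex_bij_witness[of _ "\<lambda>k. (0, k)" snd]) (auto simp: rates_def algebra_simps)
    also have "\<dots> = ((1 - z) / (1 - w)) ^ n * exp (- (w - z) * vsum x 1 n)"
      by (simp only: prod.distrib) (simp add: vsum_def exp_sum sum_distrib_left flip: sum_negf)
    finally have 1: "(\<Prod>p\<in>?I. ?d p) = ((1 - z) / (1 - w)) ^ n * exp (- (w - z) * vsum x 1 n)" .
    (* After the sweep, the axis coordinates hold the increments along the top row; they telescope. *)
    have "(\<Sum>i=1..m. sweep m n x (i, 0)) = (\<Sum>i=1..m. boundary_lpp x 1 1 i n - boundary_lpp x 1 1 (i - 1) n)"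
      by (intro sum.cong) (auto simp: sweep_top)
    also have "\<dots> = L x - boundary_lpp x 1 1 0 n"
      unfolding L_def by (induction m) auto
    also have "boundary_lpp x 1 1 0 n = vsum x 1 n" by simp
    finally have 2: "(\<Sum>i=1..m. sweep m n x (i, 0)) = L x - vsum x 1 n" .
    have "(\<Prod>p\<in>?I. ennreal (?d p)) = ennreal (\<Prod>p\<in>?I. ?d p)"
      by (rule prod_ennreal) (use r in \<open>auto intro!: divide_nonneg_pos mult_nonneg_nonneg simp: less_imp_le\<close>)
    then have "(\<Prod>p\<in>?I. ennreal (?d p)) * E x = ennreal (((1 - z) / (1 - w)) ^ n * exp (- (w - z) * vsum x 1 n) * exp ((w - z) * L x))"
      unfolding 1 E_def using wz by (simp add: ennreal_mult')
    also have "\<dots> = F (sweep m n x)"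
      unfolding F_def 2 by (simp add: mult.assoc algebra_simps flip: exp_add)
    finally show "(\<Prod>p\<in>?I. ennreal (?d p)) * E x = F (sweep m n x)" .
  qed
  also have "\<dots> = (\<integral>\<^sup>+x. F x \<partial>PiM ?I (\<lambda>p. expm (?r p)))"
    by (rule sweep_preserves[OF _ _ F]) (use wz in auto)
  also have "\<dots> = (\<integral>\<^sup>+x. ennreal (((1 - z) / (1 - w)) ^ n) * (\<Prod>p\<in>?I. (if p \<in> {1..m} \<times> {0} then ennreal (exp ((w - z) * x p)) else 1)) \<partial>PiM ?I (\<lambda>p. expm (?r p)))"
  proof (intro nn_integral_cong)
    fix x :: "nat \<times> nat \<Rightarrow> real"
    have "(\<Prod>p\<in>?I. (if p \<in> {1..m} \<times> {0} then ennreal (exp ((w - z) * x p)) else 1)) = (\<Prod>p\<in>{1..m} \<times> {0}. ennreal (exp ((w - z) * x p)))"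
      by (rule prod.mono_neutral_cong_right) auto
    also have "\<dots> = (\<Prod>i\<in>{1..m}. ennreal (exp ((w - z) * x (i, 0))))"
      by (rule prod.reindex_bij_witness[of _ "\<lambda>k. (k, 0)" fst]) auto
    also have "\<dots> = ennreal (exp ((w - z) * (\<Sum>i=1..m. x (i, 0))))"
      by (subst prod_ennreal) (auto simp: exp_sum sum_distrib_left)
    finally show "F x = ennreal (((1 - z) / (1 - w)) ^ n) * (\<Prod>p\<in>?I. (if p \<in> {1..m} \<times> {0} then ennreal (exp ((w - z) * x p)) else 1))"
      unfolding F_def using wz by (simp add: ennreal_mult')
  qed
  also have "\<dots> = ennreal (((1 - z) / (1 - w)) ^ n) * (\<integral>\<^sup>+x. (\<Prod>p\<in>?I. (\<lambda>y. if p \<in> {1..m} \<times> {0} then ennreal (exp ((w - z) * y)) else 1) (x p)) \<partial>PiM ?I (\<lambda>p. expm (?r p)))"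
    by (subst nn_integral_cmult) (auto intro!: borel_measurable_prod simp: if_distrib)
  also have "(\<integral>\<^sup>+x. (\<Prod>p\<in>?I. (\<lambda>y. if p \<in> {1..m} \<times> {0} then ennreal (exp ((w - z) * y)) else 1) (x p)) \<partial>PiM ?I (\<lambda>p. expm (?r p)))
     = (\<Prod>p\<in>?I. \<integral>\<^sup>+y. (if p \<in> {1..m} \<times> {0} then ennreal (exp ((w - z) * y)) else 1) \<partial>expm (?r p))"
    by (rule A.product_nn_integral_prod) auto
  also have "\<dots> = (\<Prod>p\<in>?I. if p \<in> {1..m} \<times> {0} then ennreal (w / z) else 1)"
  proof (rule prod.cong[OF refl])
    fix p assume "p \<in> ?I"
    interpret p: prob_space "expm (?r p)" by (rule prob_space_exponential_density[OF r(1)])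
    have "emeasure (expm (?r p)) UNIV = 1" using p.emeasure_space_1 by simp
    then show "(\<integral>\<^sup>+y. (if p \<in> {1..m} \<times> {0} then ennreal (exp ((w - z) * y)) else 1) \<partial>expm (?r p)) = (if p \<in> {1..m} \<times> {0} then ennreal (w / z) else 1)"
      using nn_integral_exp_expm[of w "w - z"] wz by (auto simp: rates_def)
  qed
  also have "\<dots> = (\<Prod>p\<in>{1..m} \<times> {0::nat}. ennreal (w / z))"
    by (rule prod.mono_neutral_cong_right) auto
  also have "\<dots> = ennreal ((w / z) ^ m)"
    using wz by (simp add: ennreal_power card_cartesian_product)
  finally show ?thesis using wz by (simp add: ennreal_mult' mult.commute)
qed

end

section \<open>The cumulant near the critical density\<close>

lemma ln_ratio_lower:
  fixes u :: real
  assumes "0 \<le> u" "u \<le> 1/2"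
  shows "2 * u + 2 * u ^ 3 / 3 \<le> ln ((1 + u) / (1 - u))"
proof -
  define f where "f = (\<lambda>u::real. ln (1 + u) - ln (1 - u) - 2 * u - 2 * u ^ 3 / 3)"
  have "f 0 \<le> f u"
  proof (rule DERIV_nonneg_imp_nondecreasing[OF assms(1)])
    fix x assume x: "0 \<le> x" "x \<le> u"
    then have x1: "x < 1" using assms by simp
    have "(f has_real_derivative (1 / (1 + x) + 1 / (1 - x) - 2 - 2 * x\<^sup>2)) (at x)"
      unfolding f_def using x x1
      by (auto intro!: derivative_eq_intros simp: power2_eq_square)
    moreover have "1 / (1 + x) + 1 / (1 - x) - 2 - 2 * x\<^sup>2 = 2 * x ^ 4 / ((1 + x) * (1 - x))"
    proof -
      have "1 + x \<noteq> 0" "1 - x \<noteq> 0" using x x1 by auto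
      then show ?thesis by (simp add: divide_simps) (simp add: algebra_simps power2_eq_square power4_eq_xxxx)
    qed
    moreover have "0 \<le> 2 * x ^ 4 / ((1 + x) * (1 - x))" using x x1 by simp
    ultimately show "\<exists>y. (f has_real_derivative y) (at x) \<and> 0 \<le> y" by metis
  qed
  then show ?thesis using assms by (simp add: f_def ln_div)
qed

lemma ln_ratio_upper:
  fixes u :: real
  assumes "0 \<le> u" "u \<le> 1/2"
  shows "ln ((1 + u) / (1 - u)) \<le> 2 * u + 2 * u ^ 3 / 3 + u ^ 5"
proof -
  define f where "f = (\<lambda>u::real. 2 * u + 2 * u ^ 3 / 3 + u ^ 5 - ln (1 + u) + ln (1 - u))"
  have "f 0 \<le> f u"
  proof (rule DERIV_nonneg_imp_nondecreasing[OF assms(1)])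
    fix x assume x: "0 \<le> x" "x \<le> u"
    then have x1: "x \<le> 1/2" using assms by simp
    have "(f has_real_derivative (2 + 2 * x\<^sup>2 + 5 * x ^ 4 - 1 / (1 + x) - 1 / (1 - x))) (at x)"
      unfolding f_def using x x1
      by (auto intro!: derivative_eq_intros simp: power2_eq_square)
    moreover have "2 + 2 * x\<^sup>2 + 5 * x ^ 4 - 1 / (1 + x) - 1 / (1 - x) = x ^ 4 * (3 - 5 * x\<^sup>2) / ((1 + x) * (1 - x))"
    proof -
      have "1 + x \<noteq> 0" "1 - x \<noteq> 0" using x x1 by auto
      then show ?thesis by (simp add: divide_simps) (simp add: algebra_simps power2_eq_square power4_eq_xxxx)
    qed
    moreover have "x\<^sup>2 \<le> (1/2)\<^sup>2" using x x1 by (intro power_mono) auto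
    then have "0 \<le> x ^ 4 * (3 - 5 * x\<^sup>2) / ((1 + x) * (1 - x))" using x x1
      by (intro divide_nonneg_nonneg mult_nonneg_nonneg) (auto simp: power2_eq_square)
    ultimately show "\<exists>y. (f has_real_derivative y) (at x) \<and> 0 \<le> y" by metis
  qed
  then show ?thesis using assms by (simp add: f_def ln_div)
qed

text \<open>
  The function $c\mapsto\ln((c+h)/(c-h))$ has derivative $-2h/(c^2-h^2)$, which is at most $-2h$ for $c\le1$.
\<close>

lemma ln_ratio_shift:
  fixes h c c' :: real
  assumes "0 < h" "h < c'" "c' \<le> c" "c \<le> 1"
  shows "ln ((c + h) / (c - h)) + 2 * h * (c - c') \<le> ln ((c' + h) / (c' - h))"
proof -
  define f where "f = (\<lambda>x::real. ln (x + h) - ln (x - h) + 2 * h * x)"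
  have "f c \<le> f c'"
  proof (rule DERIV_nonpos_imp_nonincreasing[OF assms(3)])
    fix x assume x: "c' \<le> x" "x \<le> c"
    have "(f has_real_derivative (1 / (x + h) - 1 / (x - h) + 2 * h)) (at x)"
      unfolding f_def using x assms
      by (auto intro!: derivative_eq_intros)
    moreover have "1 / (x + h) - 1 / (x - h) + 2 * h = 2 * h * ((x\<^sup>2 - h\<^sup>2) - 1) / ((x + h) * (x - h))"
    proof -
      have "x + h \<noteq> 0" "x - h \<noteq> 0" using x assms by auto
      then show ?thesis by (simp add: divide_simps) (simp add: algebra_simps power2_eq_square)
    qed
    moreover have "x\<^sup>2 \<le> 1\<^sup>2" using x assms by (intro power_mono) auto
    then have "2 * h * ((x\<^sup>2 - h\<^sup>2) - 1) / ((x + h) * (x - h)) \<le> 0" using x assms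
      by (intro divide_nonpos_nonneg mult_nonneg_nonpos) (auto intro: order_trans[of _ "x\<^sup>2"])
    ultimately show "\<exists>y. (f has_real_derivative y) (at x) \<and> y \<le> 0" by metis
  qed
  then show ?thesis using assms by (simp add: f_def ln_div algebra_simps)
qed

definition shape :: "real \<Rightarrow> real \<Rightarrow> real" where
  "shape m n = (sqrt m + sqrt n)\<^sup>2"

text \<open>
  The density at which \<open>drift\<close>, the mean of the stationary passage time, is smallest; the minimum is
  \<open>shape\<close>.
\<close>

definition crit :: "real \<Rightarrow> real \<Rightarrow> real" where
  "crit m n = sqrt m / (sqrt m + sqrt n)"

definition drift :: "real \<Rightarrow> real \<Rightarrow> real \<Rightarrow> real" where
  "drift m n c = m / c + n / (1 - c)"

text \<open>
  The logarithm of the exact exponential moment for the rates $w=c+h$ and $1-z=1-c+h$.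
\<close>

definition cumulant :: "real \<Rightarrow> real \<Rightarrow> real \<Rightarrow> real \<Rightarrow> real" where
  "cumulant m n c h = m * ln ((c + h) / (c - h)) + n * ln ((1 - c + h) / (1 - c - h))"

text \<open>
  The third derivative of \<open>cumulant\<close> in \<open>h\<close> at zero is four times this sum, which therefore
  governs the constant in the tail.
\<close>

definition cubic :: "real \<Rightarrow> real \<Rightarrow> real \<Rightarrow> real" where
  "cubic m n c = m / c ^ 3 + n / (1 - c) ^ 3"

lemma exp_cumulant:
  fixes m n :: nat
  assumes "0 < h" "0 < c - h" "c + h < 1"
  shows "exp (cumulant m n c h) = ((c + h) / (c - h)) ^ m * ((1 - c + h) / (1 - c - h)) ^ n"
  using assms by (simp add: cumulant_def exp_add exp_of_nat_mult)

lemma ln_ratio_scale: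
  fixes c h :: real
  assumes "0 < c"
  shows "ln ((c + h) / (c - h)) = ln ((1 + h / c) / (1 - h / c))"
proof -
  have "(c + h) / (c - h) = (1 + h / c) / (1 - h / c)" using assms by (simp add: divide_simps)
  then show ?thesis by simp
qed

lemma cumulant_lower:
  assumes "0 \<le> m" "0 \<le> n" "0 < c" "c < 1" "0 \<le> h" "2 * h \<le> c" "2 * h \<le> 1 - c"
  shows "2 * h * drift m n c + 2 / 3 * h ^ 3 * cubic m n c \<le> cumulant m n c h"
proof -
  have 1: "2 * (h / c) + 2 * (h / c) ^ 3 / 3 \<le> ln ((c + h) / (c - h))"
    using assms unfolding ln_ratio_scale[OF assms(3)] by (intro ln_ratio_lower) (auto simp: divide_simps)
  have "0 < 1 - c" using assms by simp
  then have 2: "2 * (h / (1 - c)) + 2 * (h / (1 - c)) ^ 3 / 3 \<le> ln ((1 - c + h) / (1 - c - h))"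
    using assms unfolding ln_ratio_scale[OF \<open>0 < 1 - c\<close>] by (intro ln_ratio_lower) (auto simp: divide_simps)
  show ?thesis
    using mult_left_mono[OF 1 assms(1)] mult_left_mono[OF 2 assms(2)]
    by (simp add: cumulant_def drift_def cubic_def algebra_simps power_divide)
qed

lemma cumulant_upper:
  assumes "0 \<le> m" "0 \<le> n" "0 < c" "c < 1" "0 \<le> h" "2 * h \<le> c" "2 * h \<le> 1 - c"
  shows "cumulant m n c h \<le> 2 * h * drift m n c + 2 / 3 * h ^ 3 * cubic m n c + h ^ 5 * (m / c ^ 5 + n / (1 - c) ^ 5)"
proof -
  have 1: "ln ((c + h) / (c - h)) \<le> 2 * (h / c) + 2 * (h / c) ^ 3 / 3 + (h / c) ^ 5"
    using assms unfolding ln_ratio_scale[OF assms(3)] by (intro ln_ratio_upper) (auto simp: divide_simps)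
  have "0 < 1 - c" using assms by simp
  then have 2: "ln ((1 - c + h) / (1 - c - h)) \<le> 2 * (h / (1 - c)) + 2 * (h / (1 - c)) ^ 3 / 3 + (h / (1 - c)) ^ 5"
    using assms unfolding ln_ratio_scale[OF \<open>0 < 1 - c\<close>] by (intro ln_ratio_upper) (auto simp: divide_simps)
  show ?thesis
    using mult_left_mono[OF 1 assms(1)] mult_left_mono[OF 2 assms(2)]
    by (simp add: cumulant_def drift_def cubic_def algebra_simps power_divide)
qed

lemma crit_bounds:
  assumes "0 < m" "0 < n"
  shows "0 < crit m n" "crit m n < 1" "1 - crit m n = sqrt n / (sqrt m + sqrt n)"
proof -
  have s: "0 < sqrt m" "0 < sqrt n" using assms by auto
  then have sp: "0 < sqrt m + sqrt n" by (rule add_pos_pos)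
  show "0 < crit m n" unfolding crit_def by (rule divide_pos_pos[OF s(1) sp])
  show "crit m n < 1" unfolding crit_def by (subst pos_divide_less_eq[OF sp]) (use s in simp)
  have "sqrt m / (sqrt m + sqrt n) + sqrt n / (sqrt m + sqrt n) = 1"
    by (subst add_divide_distrib[symmetric]) (rule divide_self, use sp in simp)
  then show "1 - crit m n = sqrt n / (sqrt m + sqrt n)" by (simp add: crit_def)
qed

lemma crit_square:
  assumes "0 < m" "0 < n"
  shows "m = shape m n * (crit m n)\<^sup>2" "n = shape m n * (1 - crit m n)\<^sup>2"
proof -
  have s: "0 < sqrt m + sqrt n" using assms by (simp add: add_pos_pos)
  show "m = shape m n * (crit m n)\<^sup>2" using s assms by (simp add: shape_def crit_def power_divide)
  show "n = shape m n * (1 - crit m n)\<^sup>2" using s assms by (simp add: shape_def crit_bounds power_divide)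
qed

text \<open>
  The drift is a convex function of the density with an explicit quadratic excess over its minimum; a deviation $r/t$
  from the critical density costs about $r^2t$ when $m$ and $n$ are of order $t^3$.
\<close>

lemma drift_eq:
  assumes "0 < m" "0 < n" "0 < c" "c < 1"
  shows "drift m n c = shape m n + shape m n * (c - crit m n)\<^sup>2 / (c * (1 - c))"
proof -
  let ?z = "crit m n" and ?S = "shape m n"
  have "drift m n c = ?S * (?z\<^sup>2 / c + (1 - ?z)\<^sup>2 / (1 - c))"
    using crit_square[OF assms(1,2)] by (simp add: drift_def distrib_left)
  also have "?z\<^sup>2 / c + (1 - ?z)\<^sup>2 / (1 - c) = 1 + (c - ?z)\<^sup>2 / (c * (1 - c))"
    using assms by (simp add: divide_simps) (simp add: power2_eq_square algebra_simps)
  finally show ?thesis by (simp add: distrib_left)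
qed

lemma drift_crit: "0 < m \<Longrightarrow> 0 < n \<Longrightarrow> drift m n (crit m n) = shape m n"
  using drift_eq[of m n "crit m n"] crit_bounds[of m n] by simp

lemma cubic_crit:
  assumes "0 < m" "0 < n"
  shows "cubic m n (crit m n) = (sqrt m + sqrt n) ^ 4 / (sqrt m * sqrt n)"
proof -
  have s: "0 < sqrt m" "0 < sqrt n" using assms by auto
  define a b where "a = sqrt m" and "b = sqrt n"
  have ab: "0 < a" "0 < b" "m = a\<^sup>2" "n = b\<^sup>2" using assms by (auto simp: a_def b_def)
  have "cubic m n (crit m n) = a\<^sup>2 / (a / (a + b)) ^ 3 + b\<^sup>2 / (b / (a + b)) ^ 3"
    using crit_bounds(3)[OF assms] by (simp add: cubic_def crit_def ab a_def[symmetric] b_def[symmetric])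
      (use assms in \<open>simp add: a_def b_def\<close>)
  also have "\<dots> = (a + b) ^ 3 * (a\<^sup>2 / a ^ 3 + b\<^sup>2 / b ^ 3)"
    by (simp only: power_divide distrib_left) (simp add: ac_simps)
  also have "a\<^sup>2 / a ^ 3 + b\<^sup>2 / b ^ 3 = (a + b) / (a * b)"
    using ab(1,2) by (simp add: field_simps power2_eq_square power3_eq_cube)
  also have "(a + b) ^ 3 * ((a + b) / (a * b)) = (a + b) ^ 4 / (a * b)"
    by (simp add: power4_eq_xxxx power3_eq_cube)
  finally show ?thesis by (simp add: a_def b_def)
qed

text \<open>
  Boxes of bounded aspect ratio on the fluctuation scale: \<open>t\<close> is of the order of the cube root of both
  sides, and \<open>\<eta>\<close> bounds all ratios, including the distance of the critical density from 0 and 1.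
  Later estimates depend on the box through \<open>\<eta>\<close> only.
\<close>

locale aspect =
  fixes m n \<eta> t :: real
  assumes eta: "0 < \<eta>" and mn: "0 < m" "0 < n"
    and sum_le: "2 * \<eta> * (m + n) \<le> t ^ 3" and n_t: "t ^ 3 \<le> n" and t: "0 < t"
    and crit_ge: "2 * \<eta> \<le> crit m n" "2 * \<eta> \<le> 1 - crit m n"
begin

lemma eta_le: "4 * \<eta> \<le> 1" using crit_ge by simp

lemma shape_le: "shape m n \<le> t ^ 3 / \<eta>"
proof -
  have "0 \<le> (sqrt m - sqrt n)\<^sup>2" by simp
  then have "shape m n \<le> 2 * (m + n)" using mn by (simp add: shape_def power2_sum power2_diff)
  also have "\<dots> \<le> t ^ 3 / \<eta>" using sum_le eta by (simp add: field_simps)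
  finally show ?thesis .
qed

lemma shape_ge: "n \<le> shape m n"
  using mn by (simp add: shape_def power2_sum)

text \<open>
  The distance from the origin at which optimal paths leave the axes is of order $t^2$; for large \<open>t\<close> it
  is smaller than the side of the box.
\<close>

lemma exit_scale:
  assumes "0 < y" "y \<le> \<eta>\<^sup>2 * t" "1 \<le> y * t\<^sup>2"
  shows "y * t\<^sup>2 \<le> real (nat \<lceil>y * t\<^sup>2\<rceil>)" "real (nat \<lceil>y * t\<^sup>2\<rceil>) \<le> 2 * y * t\<^sup>2" "real (nat \<lceil>y * t\<^sup>2\<rceil>) \<le> m"
    "1 \<le> nat \<lceil>y * t\<^sup>2\<rceil>"
proof -
  let ?k = "nat \<lceil>y * t\<^sup>2\<rceil>"
  show 1: "y * t\<^sup>2 \<le> real ?k" by (simp add: real_nat_ceiling_ge)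
  show 2: "real ?k \<le> 2 * y * t\<^sup>2" using assms(3) ceiling_correct[of "y * t\<^sup>2"] by (simp add: of_nat_nat)
  show "1 \<le> ?k" using 1 assms(3) by linarith
  have "real ?k \<le> 2 * (\<eta>\<^sup>2 * t) * t\<^sup>2" using 2 mult_right_mono[OF assms(2), of "t\<^sup>2"] by simp
  also have "\<dots> = t ^ 3 * (2 * \<eta>\<^sup>2)" by (simp add: power2_eq_square power3_eq_cube)
  also have "\<dots> \<le> shape m n * (crit m n)\<^sup>2"
  proof (intro mult_mono)
    have "(2 * \<eta>)\<^sup>2 \<le> (crit m n)\<^sup>2" using crit_ge eta by (intro power_mono) auto
    then have "4 * \<eta>\<^sup>2 \<le> (crit m n)\<^sup>2" by (simp add: power_mult_distrib)
    with zero_le_power2[of \<eta>] show "2 * \<eta>\<^sup>2 \<le> (crit m n)\<^sup>2" by linarith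
  qed (use shape_ge n_t t mn in auto)
  also have "\<dots> = m" using crit_square(1)[OF mn] by simp
  finally show "real ?k \<le> m" .
qed

lemma drift_lower:
  assumes "0 < c" "c < 1"
  shows "shape m n + 4 * t ^ 3 * (c - crit m n)\<^sup>2 \<le> drift m n c"
proof -
  have "0 \<le> (c - 1/2)\<^sup>2" by simp
  then have "c * (1 - c) \<le> 1 / 4" by (simp add: power2_eq_square algebra_simps)
  moreover have c0: "0 < c * (1 - c)" using assms by simp
  ultimately have 4: "4 \<le> 1 / (c * (1 - c))" by (simp add: field_simps)
  have "4 * t ^ 3 * (c - crit m n)\<^sup>2 \<le> 1 / (c * (1 - c)) * shape m n * (c - crit m n)\<^sup>2"
    using 4 shape_ge n_t t by (intro mult_right_mono mult_mono) (use c0 in \<open>auto simp: less_imp_le\<close>)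
  then show ?thesis using drift_eq[OF mn assms] by simp
qed

lemma drift_diff:
  assumes c: "\<eta> \<le> c" "\<eta> \<le> 1 - c" and c': "\<eta> \<le> c'" "\<eta> \<le> 1 - c'"
  shows "\<bar>drift m n c' - drift m n c\<bar> \<le> \<bar>c' - c\<bar> * (2 * t ^ 3 / \<eta> ^ 3) * (\<bar>c - crit m n\<bar> + \<bar>c' - crit m n\<bar>)"
proof -
  let ?z = "crit m n" and ?S = "shape m n"
  let ?e = "\<bar>c - ?z\<bar> + \<bar>c' - ?z\<bar>"
  have pos: "0 < c" "0 < c'" "0 < 1 - c" "0 < 1 - c'" using c c' eta by auto
  have z: "0 < ?z" "?z < 1" using crit_bounds mn by auto
  have q: "\<bar>1 - y\<^sup>2 / (x * x')\<bar> \<le> (\<bar>x - y\<bar> + \<bar>x' - y\<bar>) / \<eta>\<^sup>2"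
    if "\<eta> \<le> x" "\<eta> \<le> x'" "x \<le> 1" "0 \<le> y" "y \<le> 1" for x x' y
  proof -
    have xx: "\<eta>\<^sup>2 \<le> x * x'" using that eta unfolding power2_eq_square by (intro mult_mono) auto
    have x0: "0 < x" "0 < x'" using that eta by auto
    have "1 - y\<^sup>2 / (x * x') = (x * (x' - y) + y * (x - y)) / (x * x')"
      using x0 by (simp add: field_simps power2_eq_square)
    also have "\<bar>\<dots>\<bar> \<le> \<bar>x * (x' - y) + y * (x - y)\<bar> / \<eta>\<^sup>2"
      using x0 xx eta by (simp add: abs_mult) (intro divide_left_mono, auto)
    also have "\<bar>x * (x' - y) + y * (x - y)\<bar> \<le> x * \<bar>x' - y\<bar> + y * \<bar>x - y\<bar>"
      using x0 that by (intro order_trans[OF abs_triangle_ineq]) (auto simp: abs_mult)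
    also have "\<dots> \<le> 1 * \<bar>x' - y\<bar> + 1 * \<bar>x - y\<bar>" using x0 that by (intro add_mono mult_right_mono) auto
    finally show ?thesis using eta by (simp add: divide_right_mono add.commute)
  qed
  have "drift m n c' - drift m n c = (c' - c) * (n / ((1 - c) * (1 - c')) - m / (c * c'))"
    using pos by (simp add: drift_def divide_simps) (simp add: algebra_simps)
  also have "\<dots> = (c' - c) * ?S * ((1 - ?z\<^sup>2 / (c * c')) - (1 - (1 - ?z)\<^sup>2 / ((1 - c) * (1 - c'))))"
    using crit_square[OF mn] pos by (simp add: algebra_simps)
  finally have "\<bar>drift m n c' - drift m n c\<bar> = \<bar>c' - c\<bar> * ?S * \<bar>(1 - ?z\<^sup>2 / (c * c')) - (1 - (1 - ?z)\<^sup>2 / ((1 - c) * (1 - c')))\<bar>"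
    by (simp only: abs_mult) (simp add: shape_def)
  also have "\<dots> \<le> \<bar>c' - c\<bar> * (t ^ 3 / \<eta>) * (?e / \<eta>\<^sup>2 + ?e / \<eta>\<^sup>2)"
  proof (intro mult_mono shape_le order_refl)
    have "\<bar>1 - ?z\<^sup>2 / (c * c')\<bar> \<le> ?e / \<eta>\<^sup>2" using q[of c c' ?z] c c' eta z by simp
    moreover have "\<bar>1 - (1 - ?z)\<^sup>2 / ((1 - c) * (1 - c'))\<bar> \<le> ?e / \<eta>\<^sup>2" using q[of "1 - c" "1 - c'" "1 - ?z"] c c' eta z by (simp add: abs_minus_commute)
    ultimately show "\<bar>(1 - ?z\<^sup>2 / (c * c')) - (1 - (1 - ?z)\<^sup>2 / ((1 - c) * (1 - c')))\<bar> \<le> ?e / \<eta>\<^sup>2 + ?e / \<eta>\<^sup>2"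
      by linarith
  qed (use t eta in \<open>auto simp: shape_def\<close>)
  also have "\<dots> = \<bar>c' - c\<bar> * (2 * t ^ 3 / \<eta> ^ 3) * ?e"
    using eta by (simp add: field_simps power2_eq_square power3_eq_cube)
  finally show ?thesis .
qed

lemma cumulant_le:
  assumes c: "\<eta> \<le> c" "\<eta> \<le> 1 - c" and h: "0 \<le> h" "2 * h \<le> \<eta>"
  shows "cumulant m n c h \<le> 2 * h * drift m n c + (h * t) ^ 3 / \<eta> ^ 4"
proof -
  have inv: "m / c ^ k + n / (1 - c) ^ k \<le> t ^ 3 / (2 * \<eta> ^ Suc k)" for k
  proof -
    have "m / c ^ k + n / (1 - c) ^ k \<le> m / \<eta> ^ k + n / \<eta> ^ k"
      using c eta mn by (intro add_mono divide_left_mono power_mono mult_pos_pos) auto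
    also have "\<dots> = (m + n) / \<eta> ^ k" by (simp add: add_divide_distrib)
    also have "\<dots> \<le> (t ^ 3 / (2 * \<eta>)) / \<eta> ^ k" using sum_le eta by (intro divide_right_mono) (auto simp: field_simps)
    finally show ?thesis by simp
  qed
  have "cumulant m n c h \<le> 2 * h * drift m n c + 2 / 3 * h ^ 3 * cubic m n c + h ^ 5 * (m / c ^ 5 + n / (1 - c) ^ 5)"
    by (rule cumulant_upper) (use c h mn eta in auto)
  also have "\<dots> \<le> 2 * h * drift m n c + 2 / 3 * h ^ 3 * (t ^ 3 / (2 * \<eta> ^ Suc 3)) + h ^ 5 * (t ^ 3 / (2 * \<eta> ^ Suc 5))"
    unfolding cubic_def using inv[of 3] inv[of 5] h by (intro add_mono mult_left_mono) auto
  also have "h ^ 5 * (t ^ 3 / (2 * \<eta> ^ Suc 5)) \<le> h ^ 3 * (t ^ 3 / (8 * \<eta> ^ 4))"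
  proof -
    have "h\<^sup>2 \<le> (\<eta> / 2)\<^sup>2" using h by (intro power_mono) auto
    then have "h\<^sup>2 * (h ^ 3 * t ^ 3 / (2 * \<eta> ^ 6)) \<le> (\<eta> / 2)\<^sup>2 * (h ^ 3 * t ^ 3 / (2 * \<eta> ^ 6))"
      using h t eta by (intro mult_right_mono) auto
    moreover have "(\<eta> / 2)\<^sup>2 * (h ^ 3 * t ^ 3 / (2 * \<eta> ^ 6)) = h ^ 3 * (t ^ 3 / (8 * \<eta> ^ 4))"
      using eta by (simp add: field_simps power_def numeral_eq_Suc)
    moreover have "h\<^sup>2 * (h ^ 3 * t ^ 3 / (2 * \<eta> ^ 6)) = h ^ 5 * (t ^ 3 / (2 * \<eta> ^ Suc 5))"
      by (simp add: power_def numeral_eq_Suc)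
    ultimately show ?thesis by simp
  qed
  also have "2 * h * drift m n c + 2 / 3 * h ^ 3 * (t ^ 3 / (2 * \<eta> ^ Suc 3)) + h ^ 3 * (t ^ 3 / (8 * \<eta> ^ 4))
     = 2 * h * drift m n c + 11 / 24 * ((h * t) ^ 3 / \<eta> ^ 4)"
    using eta by (simp add: field_simps)
  also have "\<dots> \<le> 2 * h * drift m n c + (h * t) ^ 3 / \<eta> ^ 4"
  proof -
    have "0 \<le> (h * t) ^ 3 / \<eta> ^ 4" using eta h t by simp
    then show ?thesis by linarith
  qed
  finally show ?thesis by simp
qed

text \<open>
  The leading term of the cumulant in \<open>h\<close> is linear in the drift; the difference of the cubic terms is
  small because the densities are close, and the remainder is of fifth order.
\<close>

lemma cumulant_diff:
  assumes c: "\<eta> \<le> c" "\<eta> \<le> 1 - c" and c': "\<eta> \<le> c'" "\<eta> \<le> 1 - c'" and h: "0 \<le> h" "2 * h \<le> \<eta>"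
  shows "cumulant m n c' h - cumulant m n c h \<le> 2 * h * (drift m n c' - drift m n c)
     + (h * t) ^ 3 * \<bar>c' - c\<bar> / \<eta> ^ 5 + h\<^sup>2 * (h * t) ^ 3 / \<eta> ^ 6"
proof -
  have inv: "m / c' ^ 5 + n / (1 - c') ^ 5 \<le> t ^ 3 / \<eta> ^ 6"
  proof -
    have "m / c' ^ 5 + n / (1 - c') ^ 5 \<le> m / \<eta> ^ 5 + n / \<eta> ^ 5"
      using c' eta mn by (intro add_mono divide_left_mono power_mono mult_pos_pos) auto
    also have "\<dots> = (m + n) / \<eta> ^ 5" by (simp add: add_divide_distrib)
    also have "\<dots> \<le> (t ^ 3 / (2 * \<eta>)) / \<eta> ^ 5" using sum_le eta by (intro divide_right_mono) (auto simp: field_simps)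
    also have "\<dots> \<le> t ^ 3 / \<eta> ^ 6" using eta t by (simp add: field_simps power_def numeral_eq_Suc)
    finally show ?thesis .
  qed
  have cube: "1 / x ^ 3 - 1 / y ^ 3 \<le> 3 * \<bar>x - y\<bar> / \<eta> ^ 4" if "\<eta> \<le> x" "\<eta> \<le> y" for x y
  proof -
    have x0: "0 < x" "0 < y" using that eta by auto
    have "1 / x ^ 3 - 1 / y ^ 3 = (y - x) * (1 / (x * y ^ 3) + 1 / (x\<^sup>2 * y\<^sup>2) + 1 / (x ^ 3 * y))"
      using x0 by (simp add: field_simps power2_eq_square power3_eq_cube)
    also have "\<dots> \<le> \<bar>x - y\<bar> * (1 / (\<eta> * \<eta> ^ 3) + 1 / (\<eta>\<^sup>2 * \<eta>\<^sup>2) + 1 / (\<eta> ^ 3 * \<eta>))"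
      using x0 that eta
      by (intro mult_mono add_mono divide_left_mono power_mono mult_pos_pos add_nonneg_nonneg) auto
    also have "\<dots> = 3 * \<bar>x - y\<bar> / \<eta> ^ 4" using eta by (simp add: field_simps power_def numeral_eq_Suc)
    finally show ?thesis .
  qed
  have cub: "cubic m n c' - cubic m n c \<le> 3 / 2 * \<bar>c' - c\<bar> * t ^ 3 / \<eta> ^ 5"
  proof -
    have "cubic m n c' - cubic m n c = m * (1 / c' ^ 3 - 1 / c ^ 3) + n * (1 / (1 - c') ^ 3 - 1 / (1 - c) ^ 3)"
      by (simp add: cubic_def algebra_simps)
    also have "\<dots> \<le> m * (3 * \<bar>c' - c\<bar> / \<eta> ^ 4) + n * (3 * \<bar>c' - c\<bar> / \<eta> ^ 4)"
      using cube[of c' c] cube[of "1 - c'" "1 - c"] c c' mn by (intro add_mono mult_left_mono) (auto simp: abs_minus_commute)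
    also have "\<dots> = (m + n) * (3 * \<bar>c' - c\<bar> / \<eta> ^ 4)" by (simp only: distrib_right)
    also have "\<dots> \<le> (t ^ 3 / (2 * \<eta>)) * (3 * \<bar>c' - c\<bar> / \<eta> ^ 4)"
      using sum_le eta by (intro mult_right_mono) (auto simp: field_simps)
    also have "\<dots> = 3 / 2 * \<bar>c' - c\<bar> * t ^ 3 / \<eta> ^ 5" using eta by (simp add: field_simps power_def numeral_eq_Suc)
    finally show ?thesis .
  qed
  have "cumulant m n c' h \<le> 2 * h * drift m n c' + 2 / 3 * h ^ 3 * cubic m n c' + h ^ 5 * (t ^ 3 / \<eta> ^ 6)"
    using cumulant_upper[of m n c' h] mult_left_mono[OF inv, of "h ^ 5"] c' h mn eta by auto
  moreover have "2 * h * drift m n c + 2 / 3 * h ^ 3 * cubic m n c \<le> cumulant m n c h"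
    by (rule cumulant_lower) (use c h mn eta in auto)
  moreover have "2 / 3 * h ^ 3 * (cubic m n c' - cubic m n c) \<le> 2 / 3 * h ^ 3 * (3 / 2 * \<bar>c' - c\<bar> * t ^ 3 / \<eta> ^ 5)"
    using cub h by (intro mult_left_mono) auto
  moreover have "2 / 3 * h ^ 3 * (3 / 2 * \<bar>c' - c\<bar> * t ^ 3 / \<eta> ^ 5) = (h * t) ^ 3 * \<bar>c' - c\<bar> / \<eta> ^ 5"
    by (simp add: power_mult_distrib)
  moreover have "h ^ 5 * (t ^ 3 / \<eta> ^ 6) = h\<^sup>2 * (h * t) ^ 3 / \<eta> ^ 6"
    by (simp add: power_mult_distrib power_def numeral_eq_Suc)
  ultimately show ?thesis by (simp add: algebra_simps)
qed

end

section \<open>Moments of the model with boundary weights\<close>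

text \<open>
  The Lindley recursion in multiplicative form: the maximum over $j\le k$ of the product of the last \<open>j\<close>
  factors. Read backwards, it dominates the exponential of every partial sum of a random walk.
\<close>

primrec running_max :: "(real \<Rightarrow> real) \<Rightarrow> (nat \<Rightarrow> real) \<Rightarrow> nat \<Rightarrow> real" where
  "running_max g u 0 = 1"
| "running_max g u (Suc k) = max 1 (g (u (Suc k)) * running_max g u k)"

lemma running_max_ge_1: "1 \<le> running_max g u k"
  by (cases k) auto

lemma running_max_ge:
  assumes "\<And>x. 0 \<le> g x" "j \<le> k"
  shows "(\<Prod>i\<in>{k - j + 1..k}. g (u i)) \<le> running_max g u k"
  using assms(2)
proof (induction k arbitrary: j)
  case 0 then show ?case by simp
next
  case (Suc k)
  show ?case
  proof (cases j)
    case 0 then show ?thesis by simp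
  next
    case (Suc j')
    have "{Suc k - j + 1..Suc k} = insert (Suc k) {k - j' + 1..k}" using Suc \<open>j \<le> Suc k\<close> by auto
    then have "(\<Prod>i\<in>{Suc k - j + 1..Suc k}. g (u i)) = g (u (Suc k)) * (\<Prod>i\<in>{k - j' + 1..k}. g (u i))"
      by simp
    also have "\<dots> \<le> g (u (Suc k)) * running_max g u k"
      using Suc.IH[of j'] Suc Suc.prems assms by (intro mult_left_mono) auto
    finally show ?thesis by simp
  qed
qed

lemma running_max_measurable:
  assumes "g \<in> borel_measurable borel" "\<And>i. 1 \<le> i \<Longrightarrow> i \<le> k \<Longrightarrow> (\<lambda>\<omega>. u \<omega> i) \<in> borel_measurable N"
  shows "(\<lambda>\<omega>. running_max g (u \<omega>) k) \<in> borel_measurable N"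
  using assms(2)
proof (induction k)
  case (Suc k)
  have "(\<lambda>\<omega>. g (u \<omega> (Suc k))) \<in> borel_measurable N"
    using measurable_compose[OF Suc.prems[of "Suc k"] assms(1)] by simp
  with Suc show ?case by simp
qed simp

text \<open>
  If $E g^2\le1$ the running maximum $R$ satisfies $E\max(a,R)\le a+1/a$ for all $a>0$, an invariant that reproduces
  itself: for $a\ge1$ one has $\max(a,gR)=g\max(a/g,R)$, with conditional expectation at most $g(a/g+g/a)=a+g^2/a$.
\<close>

lemma running_max_moment_PiM:
  assumes g[measurable]: "g \<in> borel_measurable borel" and g0: "\<And>x. 0 < g x"
    and le1: "(\<integral>\<^sup>+x. ennreal ((g x)\<^sup>2) \<partial>expm 1) \<le> 1" and "0 < a"
  shows "(\<integral>\<^sup>+u. ennreal (max a (running_max g u k)) \<partial>PiM {1..k} (\<lambda>_. expm 1)) \<le> ennreal (a + 1 / a)"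
  using \<open>0 < a\<close>
proof (induction k arbitrary: a)
  interpret product_sigma_finite "\<lambda>_::nat. expm 1" by (rule expm_product_sigma_finite) simp
  interpret E: prob_space "expm 1" by (rule prob_space_exponential_density) simp
  have comp: "(\<lambda>x. x i) \<in> borel_measurable (PiM A (\<lambda>_. expm 1))" if "i \<in> A" for A and i :: nat
  proof -
    have "measurable (PiM A (\<lambda>_. expm 1)) (expm 1) = borel_measurable (PiM A (\<lambda>_. expm 1))"
      by (rule measurable_cong_sets) auto
    then show ?thesis using measurable_component_singleton[OF that, of "\<lambda>_. expm 1"] by simp
  qed
  have one: "max a 1 + 1 / max a 1 \<le> a + 1 / a" if "0 < a" for a :: real
  proof (cases "1 \<le> a")
    case False
    have "0 \<le> (a - 1)\<^sup>2 / a" using that by simp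
    also have "(a - 1)\<^sup>2 / a = a + 1 / a - 2" using that by (simp add: field_simps power2_eq_square)
    finally show ?thesis using False by (simp add: max_def)
  qed (simp add: max_def)
  {
    case 0
    have "max a 1 \<le> a + 1 / a" using one[OF 0] by (auto simp: max_def split: if_splits)
    moreover have "(\<integral>\<^sup>+u. ennreal (max a (running_max g u 0)) \<partial>PiM {1..0} (\<lambda>_. expm 1)) = ennreal (max a 1)"
      by (simp add: PiM_empty nn_integral_count_space_finite)
    ultimately show ?case by (simp only: ennreal_leI)
  next
    case (Suc k)
    define b where "b = max a 1"
    have b: "0 < b" using Suc.prems by (simp add: b_def)
    have ins: "{1..Suc k} = insert (Suc k) {1..k}" by auto
    have run: "running_max g (x(Suc k := y)) k = running_max g x k" for x y
    proof -
      have "l < Suc k \<Longrightarrow> running_max g (x(Suc k := y)) l = running_max g x l" for l by (induction l) auto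
      then show ?thesis by simp
    qed
    have "(\<integral>\<^sup>+u. ennreal (max a (running_max g u (Suc k))) \<partial>PiM {1..Suc k} (\<lambda>_. expm 1)) =
       (\<integral>\<^sup>+y. \<integral>\<^sup>+x. ennreal (max a (running_max g (x(Suc k := y)) (Suc k))) \<partial>PiM {1..k} (\<lambda>_. expm 1) \<partial>expm 1)"
      unfolding ins
    proof (rule product_nn_integral_insert_rev)
      show "(\<lambda>u. ennreal (max a (running_max g u (Suc k)))) \<in> borel_measurable (PiM (insert (Suc k) {1..k}) (\<lambda>_. expm 1))"
        by (intro measurable_compose[OF _ measurable_ennreal] borel_measurable_max running_max_measurable g borel_measurable_const)
          (auto intro: comp)
    qed auto
    also have "\<dots> = (\<integral>\<^sup>+y. \<integral>\<^sup>+x. ennreal (g y) * ennreal (max (b / g y) (running_max g x k)) \<partial>PiM {1..k} (\<lambda>_. expm 1) \<partial>expm 1)"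
    proof (rule nn_integral_cong, rule nn_integral_cong)
      fix x y
      have "g y * max (b / g y) (running_max g x k) = max b (g y * running_max g x k)"
        using g0[of y] by (auto simp: max_def field_simps)
      then show "ennreal (max a (running_max g (x(Suc k := y)) (Suc k))) = ennreal (g y) * ennreal (max (b / g y) (running_max g x k))"
        using g0[of y] by (simp add: run b_def max.assoc flip: ennreal_mult')
    qed
    also have "\<dots> \<le> (\<integral>\<^sup>+y. ennreal (g y) * ennreal (b / g y + g y / b) \<partial>expm 1)"
    proof (rule nn_integral_mono)
      fix y
      have m: "(\<lambda>x. running_max g x k) \<in> borel_measurable (PiM {1..k} (\<lambda>_. expm 1))"
        by (rule running_max_measurable[OF g]) (auto intro: comp)
      have "(\<integral>\<^sup>+x. ennreal (g y) * ennreal (max (b / g y) (running_max g x k)) \<partial>PiM {1..k} (\<lambda>_. expm 1))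
         = ennreal (g y) * (\<integral>\<^sup>+x. ennreal (max (b / g y) (running_max g x k)) \<partial>PiM {1..k} (\<lambda>_. expm 1))"
        using m by (intro nn_integral_cmult) auto
      also have "\<dots> \<le> ennreal (g y) * ennreal (b / g y + 1 / (b / g y))"
        using b g0[of y] by (intro mult_left_mono Suc.IH) auto
      finally show "(\<integral>\<^sup>+x. ennreal (g y) * ennreal (max (b / g y) (running_max g x k)) \<partial>PiM {1..k} (\<lambda>_. expm 1))
        \<le> ennreal (g y) * ennreal (b / g y + g y / b)" by simp
    qed
    also have "\<dots> = (\<integral>\<^sup>+y. ennreal b + ennreal (1 / b) * ennreal ((g y)\<^sup>2) \<partial>expm 1)"
    proof (rule nn_integral_cong)
      fix y
      have "g y * (b / g y + g y / b) = b + 1 / b * (g y)\<^sup>2" using g0[of y] b by (simp add: field_simps power2_eq_square)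
      then show "ennreal (g y) * ennreal (b / g y + g y / b) = ennreal b + ennreal (1 / b) * ennreal ((g y)\<^sup>2)"
        using g0[of y] b by (simp flip: ennreal_mult' ennreal_plus)
    qed
    also have "\<dots> = ennreal b + ennreal (1 / b) * (\<integral>\<^sup>+y. ennreal ((g y)\<^sup>2) \<partial>expm 1)"
      using E.emeasure_space_1 by (simp add: nn_integral_add nn_integral_cmult)
    also have "\<dots> \<le> ennreal b + ennreal (1 / b) * 1"
      by (intro add_left_mono mult_left_mono le1) simp
    also have "\<dots> = ennreal (b + 1 / b)" using b by simp
    also have "\<dots> \<le> ennreal (a + 1 / a)" using one[OF Suc.prems] by (intro ennreal_leI) (simp add: b_def)
    finally show ?case .
  }
qed

context prob_space begin

text \<open>
  The case $a=1$ of the preceding invariant.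
\<close>

lemma running_max_moment:
  assumes U: "exp_array M {1..k} U" and g[measurable]: "g \<in> borel_measurable borel" and g0: "\<And>x. 0 < g x"
    and le1: "(\<integral>\<^sup>+x. ennreal ((g x)\<^sup>2) \<partial>expm 1) \<le> 1"
  shows "(\<integral>\<^sup>+\<omega>. ennreal (running_max g (\<lambda>i. U i \<omega>) k) \<partial>M) \<le> 2"
proof (cases "k = 0")
  case True then show ?thesis by (simp add: emeasure_space_1)
next
  case False
  have cong: "running_max g (\<lambda>i\<in>{1..k}. U i \<omega> / 1) l = running_max g (\<lambda>i. U i \<omega>) l" if "l \<le> k" for l \<omega>
    using that by (induction l) auto
  have "(\<integral>\<^sup>+\<omega>. ennreal (running_max g (\<lambda>i. U i \<omega>) k) \<partial>M) = (\<integral>\<^sup>+\<omega>. (\<lambda>u. ennreal (max 1 (running_max g u k))) (\<lambda>i\<in>{1..k}. U i \<omega> / 1) \<partial>M)"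
    unfolding cong[OF order_refl] using running_max_ge_1 by (simp add: max_absorb2)
  also have "\<dots> = (\<integral>\<^sup>+u. ennreal (max 1 (running_max g u k)) \<partial>PiM {1..k} (\<lambda>_. expm 1))"
  proof (rule exp_array_nn_integral[OF U, of "\<lambda>_. 1"])
    show "(\<lambda>u. ennreal (max 1 (running_max g u k))) \<in> borel_measurable (PiM {1..k} (\<lambda>_. borel))"
      by (intro measurable_compose[OF _ measurable_ennreal] borel_measurable_max running_max_measurable g borel_measurable_const) auto
  qed (use False in auto)
  also have "\<dots> \<le> ennreal (1 + 1 / 1)" by (rule running_max_moment_PiM[OF g g0 le1]) simp
  finally show ?thesis by simp
qed

lemma exp_array_indep_nn_integral:
  assumes Y: "exp_array M I Y" and AB: "A \<inter> B = {}" "A \<subseteq> I" "B \<subseteq> I"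
    and f: "f \<in> borel_measurable (PiM A (\<lambda>_. borel))" and g: "g \<in> borel_measurable (PiM B (\<lambda>_. borel))"
  shows "(\<integral>\<^sup>+\<omega>. f (\<lambda>p\<in>A. Y p \<omega>) * g (\<lambda>p\<in>B. Y p \<omega>) \<partial>M)
       = (\<integral>\<^sup>+\<omega>. f (\<lambda>p\<in>A. Y p \<omega>) \<partial>M) * (\<integral>\<^sup>+\<omega>. g (\<lambda>p\<in>B. Y p \<omega>) \<partial>M)"
proof -
  let ?S = "PiM A (\<lambda>_. borel :: real measure)" and ?T = "PiM B (\<lambda>_. borel :: real measure)"
  let ?X = "\<lambda>\<omega>. \<lambda>p\<in>A. Y p \<omega>" and ?Z = "\<lambda>\<omega>. \<lambda>p\<in>B. Y p \<omega>"
  have "indep_vars (\<lambda>_. borel) Y I" using Y by (simp add: exp_array_def)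
  then have "indep_var ?S ?X ?T ?Z" by (rule indep_var_restrict[OF _ AB])
  then have X: "random_variable ?S ?X" and Z: "random_variable ?T ?Z"
    and eq: "distr M ?S ?X \<Otimes>\<^sub>M distr M ?T ?Z = distr M (?S \<Otimes>\<^sub>M ?T) (\<lambda>x. (?X x, ?Z x))"
    unfolding indep_var_distribution_eq by auto
  interpret DX: prob_space "distr M ?S ?X" by (rule prob_space_distr[OF X])
  interpret DZ: prob_space "distr M ?T ?Z" by (rule prob_space_distr[OF Z])
  have fg: "(\<lambda>p. f (fst p) * g (snd p)) \<in> borel_measurable (?S \<Otimes>\<^sub>M ?T)"
    using f g by measurable
  have "(\<integral>\<^sup>+\<omega>. f (?X \<omega>) * g (?Z \<omega>) \<partial>M) = (\<integral>\<^sup>+p. f (fst p) * g (snd p) \<partial>distr M (?S \<Otimes>\<^sub>M ?T) (\<lambda>x. (?X x, ?Z x)))"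
    by (subst nn_integral_distr) (use X Z fg in auto)
  also have "\<dots> = (\<integral>\<^sup>+p. f (fst p) * g (snd p) \<partial>(distr M ?S ?X \<Otimes>\<^sub>M distr M ?T ?Z))"
    by (simp only: eq)
  also have "\<dots> = (\<integral>\<^sup>+x. \<integral>\<^sup>+z. f x * g z \<partial>distr M ?T ?Z \<partial>distr M ?S ?X)"
    by (subst DZ.nn_integral_fst[symmetric]) (use f g in auto)
  also have "\<dots> = (\<integral>\<^sup>+x. f x * (\<integral>\<^sup>+z. g z \<partial>distr M ?T ?Z) \<partial>distr M ?S ?X)"
    using g by (simp add: nn_integral_cmult)
  also have "\<dots> = (\<integral>\<^sup>+x. f x \<partial>distr M ?S ?X) * (\<integral>\<^sup>+z. g z \<partial>distr M ?T ?Z)"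
    using f by (simp add: nn_integral_multc)
  finally show ?thesis using f g X Z by (simp add: nn_integral_distr)
qed

lemma exp_array_indep_prob:
  assumes Y: "exp_array M I Y" and AB: "A \<inter> B = {}" "A \<subseteq> I" "B \<subseteq> I"
    and P: "Measurable.pred (PiM A (\<lambda>_. borel)) P" and Q: "Measurable.pred (PiM B (\<lambda>_. borel)) Q"
  shows "\<P>(\<omega> in M. P (\<lambda>p\<in>A. Y p \<omega>) \<and> Q (\<lambda>p\<in>B. Y p \<omega>))
       = \<P>(\<omega> in M. P (\<lambda>p\<in>A. Y p \<omega>)) * \<P>(\<omega> in M. Q (\<lambda>p\<in>B. Y p \<omega>))"
proof -
  let ?X = "\<lambda>\<omega>. \<lambda>p\<in>A. Y p \<omega>" and ?Z = "\<lambda>\<omega>. \<lambda>p\<in>B. Y p \<omega>"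
  have X[measurable]: "?X \<in> measurable M (PiM A (\<lambda>_. borel))" and Z[measurable]: "?Z \<in> measurable M (PiM B (\<lambda>_. borel))"
    using exp_arrayD(1)[OF Y] AB by (auto intro!: measurable_restrict)
  note [measurable] = P Q
  have e: "ennreal (\<P>(\<omega> in M. R \<omega>)) = (\<integral>\<^sup>+\<omega>. indicator {\<omega>\<in>space M. R \<omega>} \<omega> \<partial>M)" if "{\<omega>\<in>space M. R \<omega>} \<in> events" for R
    using that by (simp add: emeasure_eq_measure)
  have i: "(\<integral>\<^sup>+\<omega>. indicator {\<omega>\<in>space M. R \<omega>} \<omega> \<partial>M) = (\<integral>\<^sup>+\<omega>. (if R \<omega> then 1 else 0) \<partial>M)" for R
    by (intro nn_integral_cong) (auto simp: indicator_def)
  let ?f = "\<lambda>x. if P x then 1 else 0 :: ennreal" and ?g = "\<lambda>x. if Q x then 1 else 0 :: ennreal"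
  have "ennreal (\<P>(\<omega> in M. P (?X \<omega>) \<and> Q (?Z \<omega>))) = (\<integral>\<^sup>+\<omega>. (if P (?X \<omega>) \<and> Q (?Z \<omega>) then 1 else 0) \<partial>M)"
    by (subst e, measurable) (rule i)
  also have "\<dots> = (\<integral>\<^sup>+\<omega>. ?f (?X \<omega>) * ?g (?Z \<omega>) \<partial>M)" by (intro nn_integral_cong) auto
  also have "\<dots> = (\<integral>\<^sup>+\<omega>. ?f (?X \<omega>) \<partial>M) * (\<integral>\<^sup>+\<omega>. ?g (?Z \<omega>) \<partial>M)"
    by (rule exp_array_indep_nn_integral[OF Y AB, of ?f ?g]) measurable
  also have "\<dots> = ennreal (\<P>(\<omega> in M. P (?X \<omega>))) * ennreal (\<P>(\<omega> in M. Q (?Z \<omega>)))"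
    by (subst e, measurable, subst e, measurable) (simp add: i)
  finally show ?thesis by (simp flip: ennreal_mult')
qed

lemma markov_exp:
  assumes f[measurable]: "f \<in> borel_measurable M" and h: "0 < h"
    and le: "(\<integral>\<^sup>+\<omega>. ennreal (exp (h * f \<omega>)) \<partial>M) \<le> ennreal (exp E)"
  shows "\<P>(\<omega> in M. s \<le> f \<omega>) \<le> exp (E - h * s)"
proof -
  have "ennreal (\<P>(\<omega> in M. s \<le> f \<omega>)) = (\<integral>\<^sup>+\<omega>. indicator {\<omega>\<in>space M. s \<le> f \<omega>} \<omega> \<partial>M)"
    by (simp add: emeasure_eq_measure)
  also have "\<dots> \<le> (\<integral>\<^sup>+\<omega>. ennreal (exp (- h * s)) * ennreal (exp (h * f \<omega>)) \<partial>M)"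
  proof (rule nn_integral_mono)
    fix \<omega>
    have "1 \<le> exp (- h * s) * exp (h * f \<omega>)" if "s \<le> f \<omega>"
      using that h by (simp flip: exp_add)
    then show "indicator {\<omega>\<in>space M. s \<le> f \<omega>} \<omega> \<le> ennreal (exp (- h * s)) * ennreal (exp (h * f \<omega>))"
      by (auto simp: indicator_def simp flip: ennreal_mult')
  qed
  also have "\<dots> = ennreal (exp (- h * s)) * (\<integral>\<^sup>+\<omega>. ennreal (exp (h * f \<omega>)) \<partial>M)"
    by (rule nn_integral_cmult) measurable
  also have "\<dots> \<le> ennreal (exp (- h * s)) * ennreal (exp E)" by (intro mult_left_mono le) simp
  also have "\<dots> = ennreal (exp (E - h * s))" by (simp add: exp_diff exp_minus field_simps flip: ennreal_mult')
  finally show ?thesis by simp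
qed

end

lemma hsum_mono_rate: "0 < w \<Longrightarrow> w \<le> w' \<Longrightarrow> (\<And>p. 0 \<le> x p) \<Longrightarrow> hsum x w' i \<le> hsum x w i"
  unfolding hsum_def by (intro divide_left_mono sum_nonneg) (auto intro: mult_pos_pos)

lemma vsum_mono_rate: "0 < w \<Longrightarrow> w \<le> w' \<Longrightarrow> (\<And>p. 0 \<le> x p) \<Longrightarrow> vsum x w' i \<le> vsum x w i"
  unfolding vsum_def by (intro divide_left_mono sum_nonneg) (auto intro: mult_pos_pos)

lemma hsum_nonneg: "0 < w \<Longrightarrow> (\<And>p. 0 \<le> x p) \<Longrightarrow> 0 \<le> hsum x w i"
  unfolding hsum_def by (intro divide_nonneg_pos sum_nonneg) auto

lemma vsum_nonneg: "0 < w \<Longrightarrow> (\<And>p. 0 \<le> x p) \<Longrightarrow> 0 \<le> vsum x w i"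
  unfolding vsum_def by (intro divide_nonneg_pos sum_nonneg) auto

lemma mono_hsum: "0 < w \<Longrightarrow> (\<And>p. 0 \<le> x p) \<Longrightarrow> mono (hsum x w)"
  by (rule mono_iff_le_Suc[THEN iffD2]) auto

context prob_space begin

lemma exp_array_lpp_measurable:
  assumes Y: "exp_array M ({0..m} \<times> {0..n}) Y"
  shows "(\<lambda>\<omega>. boundary_lpp (\<lambda>p. Y p \<omega>) w s m n) \<in> borel_measurable M"
    "(\<lambda>\<omega>. hor_lpp (\<lambda>p. Y p \<omega>) w m n) \<in> borel_measurable M"
    "(\<lambda>\<omega>. ver_lpp (\<lambda>p. Y p \<omega>) s m n) \<in> borel_measurable M"
  using exp_arrayD(1)[OF Y] by (auto intro!: measurable_lpp measurable_hsum measurable_vsum)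

text \<open>
  Dropping the vertical boundary and raising the horizontal rate only decreases the passage time, so the exact moment
  is an upper bound; the density \<open>c\<close> remains free and is chosen according to the application.
\<close>

lemma horizontal_moment:
  assumes Y: "exp_array M ({0..m} \<times> {0..n}) Y" and h: "0 < h" "0 < c - h" "c + h < 1" "c + h \<le> w"
  shows "(\<integral>\<^sup>+\<omega>. ennreal (exp (2 * h * hor_lpp (\<lambda>p. Y p \<omega>) w m n)) \<partial>M)
     \<le> ennreal (exp (cumulant m n c h))"
proof -
  have "(\<integral>\<^sup>+\<omega>. ennreal (exp (2 * h * hor_lpp (\<lambda>p. Y p \<omega>) w m n)) \<partial>M)
     \<le> (\<integral>\<^sup>+\<omega>. ennreal (exp (((c + h) - (c - h)) * boundary_lpp (\<lambda>p. Y p \<omega>) (c + h) (1 - (c - h)) m n)) \<partial>M)"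
  proof (intro nn_integral_mono ennreal_leI)
    fix \<omega>
    have "hor_lpp (\<lambda>p. Y p \<omega>) w m n \<le> boundary_lpp (\<lambda>p. Y p \<omega>) (c + h) (1 - (c - h)) m n"
      by (rule lpp_mono) (use h exp_arrayD(2)[OF Y] in \<open>auto intro!: hsum_mono_rate vsum_nonneg\<close>)
    then show "exp (2 * h * hor_lpp (\<lambda>p. Y p \<omega>) w m n)
      \<le> exp (((c + h) - (c - h)) * boundary_lpp (\<lambda>p. Y p \<omega>) (c + h) (1 - (c - h)) m n)"
      using h by simp
  qed
  also have "\<dots> = ennreal (((c + h) / (c - h)) ^ m * ((1 - (c - h)) / (1 - (c + h))) ^ n)"
    by (rule lpp_exponential_moment[OF Y]) (use h in auto)
  also have "\<dots> = ennreal (exp (cumulant m n c h))"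
    using exp_cumulant[of h c m n] h by (simp add: algebra_simps)
  finally show ?thesis .
qed

lemma vertical_moment:
  assumes Y: "exp_array M ({0..m} \<times> {0..n}) Y" and h: "0 < h" "0 < c - h" "c + h < 1" "z \<le> c - h"
  shows "(\<integral>\<^sup>+\<omega>. ennreal (exp (2 * h * ver_lpp (\<lambda>p. Y p \<omega>) (1 - z) m n)) \<partial>M)
     \<le> ennreal (exp (cumulant m n c h))"
proof -
  have "(\<integral>\<^sup>+\<omega>. ennreal (exp (2 * h * ver_lpp (\<lambda>p. Y p \<omega>) (1 - z) m n)) \<partial>M)
     \<le> (\<integral>\<^sup>+\<omega>. ennreal (exp (((c + h) - (c - h)) * boundary_lpp (\<lambda>p. Y p \<omega>) (c + h) (1 - (c - h)) m n)) \<partial>M)"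
  proof (intro nn_integral_mono ennreal_leI)
    fix \<omega>
    have "ver_lpp (\<lambda>p. Y p \<omega>) (1 - z) m n \<le> boundary_lpp (\<lambda>p. Y p \<omega>) (c + h) (1 - (c - h)) m n"
      by (rule lpp_mono) (use h exp_arrayD(2)[OF Y] in \<open>auto intro!: vsum_mono_rate hsum_nonneg\<close>)
    then show "exp (2 * h * ver_lpp (\<lambda>p. Y p \<omega>) (1 - z) m n)
      \<le> exp (((c + h) - (c - h)) * boundary_lpp (\<lambda>p. Y p \<omega>) (c + h) (1 - (c - h)) m n)"
      using h by simp
  qed
  also have "\<dots> = ennreal (((c + h) / (c - h)) ^ m * ((1 - (c - h)) / (1 - (c + h))) ^ n)"
    by (rule lpp_exponential_moment[OF Y]) (use h in auto)
  also have "\<dots> = ennreal (exp (cumulant m n c h))"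
    using exp_cumulant[of h c m n] h by (simp add: algebra_simps)
  finally show ?thesis .
qed

text \<open>
  The first \<open>k\<close> axis weights are independent of what the path collects after its exit, and the two
  moments are evaluated at different densities: \<open>c\<close> for the prefix, as forced by the rate
  \<open>w\<close>, and \<open>c'\<close> for the rest. The mismatch is the factor $\exp(-2hk(c-c'))$, which makes
  late exits improbable.
\<close>

lemma far_moment:
  assumes Y: "exp_array M ({0..m} \<times> {0..n}) Y" and h: "0 < h" "h < c'" "c' \<le> c" "c + h < 1" and k: "k \<le> m"
  defines "w \<equiv> c + h"
  shows "(\<integral>\<^sup>+\<omega>. ennreal (exp (2 * h * (far_lpp (\<lambda>p. Y p \<omega>) w k m n))) \<partial>M)
     \<le> ennreal (exp (cumulant m n c' h - 2 * h * k * (c - c')))"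
proof -
  let ?A = "{0..k} \<times> {0..0::nat}" and ?B = "{k + 1..m} \<times> {0..n}"
  define f where "f = (\<lambda>x. ennreal (exp (2 * h * hsum x w k)))"
  define g where "g = (\<lambda>x. ennreal (exp (2 * h * lpp (\<lambda>i. hsum (shift k 0 x) w i) (\<lambda>_. 0) (shift k 0 x) (m - k) n)))"
  have f: "f \<in> borel_measurable (PiM ?A (\<lambda>_. borel))" unfolding f_def
    by (intro measurable_compose[OF _ measurable_ennreal] borel_measurable_exp[THEN measurable_compose[rotated]]
       borel_measurable_times borel_measurable_const measurable_hsum measurable_component_singleton) auto
  have g: "g \<in> borel_measurable (PiM ?B (\<lambda>_. borel))" unfolding g_def
    by (intro measurable_compose[OF _ measurable_ennreal] borel_measurable_exp[THEN measurable_compose[rotated]]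
       borel_measurable_times borel_measurable_const measurable_hsum measurable_lpp)
       (use k in \<open>auto intro!: measurable_component_singleton\<close>)
  have hs: "hsum x w (i + k) - hsum x w k = hsum (shift k 0 x) w i" for x i
    by (induction i) auto
  have "(\<integral>\<^sup>+\<omega>. ennreal (exp (2 * h * (far_lpp (\<lambda>p. Y p \<omega>) w k m n))) \<partial>M)
      = (\<integral>\<^sup>+\<omega>. f (\<lambda>p\<in>?A. Y p \<omega>) * g (\<lambda>p\<in>?B. Y p \<omega>) \<partial>M)"
  proof (rule nn_integral_cong)
    fix \<omega>
    have 1: "hsum (\<lambda>p\<in>?A. Y p \<omega>) w k = hsum (\<lambda>p. Y p \<omega>) w k" by (simp add: hsum_def)
    have 2: "lpp (\<lambda>i. hsum (shift k 0 (\<lambda>p\<in>?B. Y p \<omega>)) w i) (\<lambda>_. 0) (shift k 0 (\<lambda>p\<in>?B. Y p \<omega>)) (m - k) n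
      = lpp (\<lambda>i. hsum (shift k 0 (\<lambda>p. Y p \<omega>)) w i) (\<lambda>_. 0) (shift k 0 (\<lambda>p. Y p \<omega>)) (m - k) n"
      using k by (intro lpp_cong) (auto simp: hsum_def intro!: sum.cong arg_cong2[where f="(/)"])
    show "ennreal (exp (2 * h * (far_lpp (\<lambda>p. Y p \<omega>) w k m n))) = f (\<lambda>p\<in>?A. Y p \<omega>) * g (\<lambda>p\<in>?B. Y p \<omega>)"
      unfolding f_def g_def 1 2 hs by (simp add: distrib_left exp_add ennreal_mult' mult.commute)
  qed
  also have "\<dots> = (\<integral>\<^sup>+\<omega>. f (\<lambda>p\<in>?A. Y p \<omega>) \<partial>M) * (\<integral>\<^sup>+\<omega>. g (\<lambda>p\<in>?B. Y p \<omega>) \<partial>M)"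
    by (rule exp_array_indep_nn_integral[OF Y _ _ _ f g]) (use k in auto)
  also have "(\<integral>\<^sup>+\<omega>. f (\<lambda>p\<in>?A. Y p \<omega>) \<partial>M) = ennreal (((c + h) / (c - h)) ^ k)"
  proof -
    have Yk: "exp_array M ({0..k} \<times> {0..0}) Y" by (rule exp_array_subset[OF Y]) (use k in auto)
    have "(\<integral>\<^sup>+\<omega>. f (\<lambda>p\<in>?A. Y p \<omega>) \<partial>M) = (\<integral>\<^sup>+\<omega>. ennreal (exp (((c + h) - (c - h)) * boundary_lpp (\<lambda>p. Y p \<omega>) (c + h) (1 - (c - h)) k 0)) \<partial>M)"
      by (intro nn_integral_cong) (simp add: f_def hsum_def w_def)
    also have "\<dots> = ennreal (((c + h) / (c - h)) ^ k * ((1 - (c - h)) / (1 - (c + h))) ^ 0)"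
      by (rule lpp_exponential_moment[OF Yk]) (use h in auto)
    finally show ?thesis by simp
  qed
  also have "(\<integral>\<^sup>+\<omega>. g (\<lambda>p\<in>?B. Y p \<omega>) \<partial>M) \<le> ennreal (exp (cumulant (real (m - k)) n c' h))"
  proof -
    have Y': "exp_array M ({0..m - k} \<times> {0..n}) (\<lambda>p. Y ((\<lambda>(i, j). (i + k, j)) p))"
      by (rule exp_array_reindex[OF Y]) (use k in \<open>auto simp: inj_on_def\<close>)
    have s: "(\<lambda>p. Y ((\<lambda>(i, j). (i + k, j)) p) \<omega>) = shift k 0 (\<lambda>p. Y p \<omega>)" for \<omega>
      by (auto simp: shift_def)
    have "(\<integral>\<^sup>+\<omega>. g (\<lambda>p\<in>?B. Y p \<omega>) \<partial>M) = (\<integral>\<^sup>+\<omega>. ennreal (exp (2 * h * hor_lpp (\<lambda>p. Y ((\<lambda>(i, j). (i + k, j)) p) \<omega>) w (m - k) n)) \<partial>M)"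
      unfolding s g_def
      by (rule nn_integral_cong, intro arg_cong[where f=ennreal] arg_cong[where f=exp] arg_cong2[where f="(*)"] refl lpp_cong)
         (use k in \<open>auto simp: hsum_def intro!: sum.cong arg_cong2[where f="(/)"]\<close>)
    also have "\<dots> \<le> ennreal (exp (cumulant (real (m - k)) n c' h))"
      by (rule horizontal_moment[OF Y']) (use h in \<open>auto simp: w_def\<close>)
    finally show ?thesis .
  qed
  also have "ennreal (((c + h) / (c - h)) ^ k) * ennreal (exp (cumulant (real (m - k)) n c' h))
      = ennreal (exp (k * ln ((c + h) / (c - h)) + cumulant (real (m - k)) n c' h))"
    using h by (simp add: exp_add exp_of_nat_mult ennreal_mult')
  also have "\<dots> \<le> ennreal (exp (cumulant m n c' h - 2 * h * k * (c - c')))"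
  proof (intro ennreal_leI)
    have "real k * (ln ((c + h) / (c - h)) + 2 * h * (c - c')) \<le> real k * ln ((c' + h) / (c' - h))"
      by (intro mult_left_mono ln_ratio_shift) (use h in auto)
    then have "k * ln ((c + h) / (c - h)) + cumulant (real (m - k)) n c' h \<le> cumulant m n c' h - 2 * h * k * (c - c')"
      using k by (simp add: cumulant_def of_nat_diff algebra_simps)
    then show "exp (k * ln ((c + h) / (c - h)) + cumulant (real (m - k)) n c' h) \<le> exp (cumulant m n c' h - 2 * h * k * (c - c'))"
      by simp
  qed
  finally show ?thesis by (simp add: mult_left_mono)
qed

lemma exp_array_expectation:
  assumes "exp_array M I Y" "i \<in> I"
  shows "(\<integral>\<^sup>+\<omega>. ennreal (Y i \<omega>) \<partial>M) = 1"
proof -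
  have "integrable M (Y i)"
    using erlang_ith_moment_integrable[of 1 "Y i" 0 1] exp_arrayD(3)[OF assms] by simp
  moreover have "expectation (Y i) = 1"
    using exponential_distributed_expectation[of 1 "Y i"] exp_arrayD(3)[OF assms] by simp
  ultimately show ?thesis
    using nn_integral_eq_integral[of M "Y i"] exp_arrayD(2)[OF assms(1)] by simp
qed

text \<open>
  The passage time is the vertical axis sum plus the increments along the top row, whose law is known.
\<close>

lemma stationary_mean:
  assumes Y: "exp_array M ({0..m} \<times> {0..n}) Y" and \<rho>: "0 < \<rho>" "\<rho> < 1"
  shows "(\<integral>\<^sup>+\<omega>. ennreal (boundary_lpp (\<lambda>p. Y p \<omega>) \<rho> (1 - \<rho>) m n) \<partial>M) = ennreal (drift m n \<rho>)"
proof -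
  define L where "L = (\<lambda>\<omega>. boundary_lpp (\<lambda>p. Y p \<omega>) \<rho> (1 - \<rho>))"
  have nn: "0 \<le> Y p \<omega>" for p \<omega> using exp_arrayD(2)[OF Y] .
  define G where "G = (\<lambda>v :: nat \<Rightarrow> real. ennreal (\<Sum>i\<in>{1..m}. v i))"
  have G: "G \<in> borel_measurable (PiM {1..m} (\<lambda>_. borel))" unfolding G_def by measurable
  have [measurable]: "Y p \<in> borel_measurable M" if "p \<in> {0..m} \<times> {0..n}" for p using exp_arrayD(1)[OF Y that] .
  have [measurable]: "(\<lambda>\<omega>. L \<omega> i j) \<in> borel_measurable M" if "i \<le> m" "j \<le> n" for i j
    unfolding L_def using that by (intro measurable_lpp measurable_hsum measurable_vsum) auto
  have [measurable]: "(\<lambda>\<omega>. vsum (\<lambda>p. Y p \<omega>) (1 - \<rho>) n) \<in> borel_measurable M"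
    by (intro measurable_vsum) auto
  have inc: "0 \<le> L \<omega> i n - L \<omega> (i - 1) n" if i: "i \<in> {1..m}" for \<omega> i
  proof -
    obtain i' where i': "i = Suc i'" using i by (cases i) auto
    show ?thesis
    proof (cases n)
      case 0 then show ?thesis using nn \<rho> i' by (simp add: L_def)
    next
      case (Suc n') then show ?thesis unfolding i' L_def using lpp_mono_Suc(1)[of "\<lambda>p. Y p \<omega>"] nn by simp
    qed
  qed
  have tel: "L \<omega> m n = vsum (\<lambda>p. Y p \<omega>) (1 - \<rho>) n + (\<Sum>i\<in>{1..m}. L \<omega> i n - L \<omega> (i - 1) n)" for \<omega>
  proof -
    have "(\<Sum>i\<in>{1..m}. L \<omega> i n - L \<omega> (i - 1) n) = L \<omega> m n - L \<omega> 0 n" for m by (induction m) auto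
    then show ?thesis by (simp add: L_def)
  qed
  have "(\<integral>\<^sup>+\<omega>. ennreal (L \<omega> m n) \<partial>M) = (\<integral>\<^sup>+\<omega>. ennreal (vsum (\<lambda>p. Y p \<omega>) (1 - \<rho>) n) + G (\<lambda>i\<in>{1..m}. L \<omega> i n - L \<omega> (i - 1) n) \<partial>M)"
    unfolding G_def tel using \<rho> nn inc
    by (intro nn_integral_cong, subst ennreal_plus[symmetric]) (auto intro!: sum_nonneg vsum_nonneg arg_cong[where f=ennreal])
  also have "\<dots> = (\<integral>\<^sup>+\<omega>. ennreal (vsum (\<lambda>p. Y p \<omega>) (1 - \<rho>) n) \<partial>M) + (\<integral>\<^sup>+\<omega>. G (\<lambda>i\<in>{1..m}. L \<omega> i n - L \<omega> (i - 1) n) \<partial>M)"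
  proof (rule nn_integral_add)
    have "(\<lambda>\<omega>. \<lambda>i\<in>{1..m}. L \<omega> i n - L \<omega> (i - 1) n) \<in> measurable M (PiM {1..m} (\<lambda>_. borel))"
      by (rule measurable_restrict) auto
    from measurable_compose[OF this G] show "(\<lambda>\<omega>. G (\<lambda>i\<in>{1..m}. L \<omega> i n - L \<omega> (i - 1) n)) \<in> borel_measurable M" .
  qed measurable
  also have "(\<integral>\<^sup>+\<omega>. G (\<lambda>i\<in>{1..m}. L \<omega> i n - L \<omega> (i - 1) n) \<partial>M) = (\<integral>\<^sup>+\<omega>. G (\<lambda>i\<in>{1..m}. Y (i, 0) \<omega> / \<rho>) \<partial>M)"
    unfolding L_def by (rule lpp_top_increments_law[OF Y \<rho> G])
  also have "\<dots> = (\<integral>\<^sup>+\<omega>. (\<Sum>i\<in>{1..m}. ennreal (1 / \<rho>) * ennreal (Y (i, 0) \<omega>)) \<partial>M)"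
  proof (rule nn_integral_cong)
    fix \<omega>
    have "G (\<lambda>i\<in>{1..m}. Y (i, 0) \<omega> / \<rho>) = ennreal (\<Sum>i\<in>{1..m}. 1 / \<rho> * Y (i, 0) \<omega>)" by (simp add: G_def)
    also have "\<dots> = (\<Sum>i\<in>{1..m}. ennreal (1 / \<rho> * Y (i, 0) \<omega>))" using nn \<rho> by (intro sum_ennreal[symmetric]) auto
    finally show "G (\<lambda>i\<in>{1..m}. Y (i, 0) \<omega> / \<rho>) = (\<Sum>i\<in>{1..m}. ennreal (1 / \<rho>) * ennreal (Y (i, 0) \<omega>))"
      using nn \<rho> by (simp add: ennreal_mult'[symmetric])
  qed
  also have "\<dots> = (\<Sum>i\<in>{1..m}. ennreal (1 / \<rho>))"
    by (subst nn_integral_sum) (auto simp: nn_integral_cmult exp_array_expectation[OF Y])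
  also have "\<dots> = ennreal (m / \<rho>)" using \<rho> by (simp add: ennreal_of_nat_eq_real_of_nat flip: ennreal_mult')
  also have "(\<integral>\<^sup>+\<omega>. ennreal (vsum (\<lambda>p. Y p \<omega>) (1 - \<rho>) n) \<partial>M) = (\<integral>\<^sup>+\<omega>. (\<Sum>k\<in>{1..n}. ennreal (1 / (1 - \<rho>)) * ennreal (Y (0, k) \<omega>)) \<partial>M)"
  proof (rule nn_integral_cong)
    fix \<omega>
    have "ennreal (vsum (\<lambda>p. Y p \<omega>) (1 - \<rho>) n) = ennreal (\<Sum>i\<in>{1..n}. 1 / (1 - \<rho>) * Y (0, i) \<omega>)" by (simp add: vsum_def sum_divide_distrib)
    also have "\<dots> = (\<Sum>i\<in>{1..n}. ennreal (1 / (1 - \<rho>) * Y (0, i) \<omega>))" using nn \<rho> by (intro sum_ennreal[symmetric]) auto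
    finally show "ennreal (vsum (\<lambda>p. Y p \<omega>) (1 - \<rho>) n) = (\<Sum>k\<in>{1..n}. ennreal (1 / (1 - \<rho>)) * ennreal (Y (0, k) \<omega>))"
      using nn \<rho> by (simp add: ennreal_mult'[symmetric])
  qed
  also have "\<dots> = (\<Sum>i\<in>{1..n}. ennreal (1 / (1 - \<rho>)))"
    by (subst nn_integral_sum) (auto simp: nn_integral_cmult exp_array_expectation[OF Y])
  also have "\<dots> = ennreal (n / (1 - \<rho>))" using \<rho> by (simp add: ennreal_of_nat_eq_real_of_nat flip: ennreal_mult')
  also have "ennreal (n / (1 - \<rho>)) + ennreal (m / \<rho>) = ennreal (drift m n \<rho>)"
    using \<rho> by (simp add: drift_def add.commute flip: ennreal_plus)
  finally show ?thesis by (simp add: L_def)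
qed

text \<open>
  An upper exponential moment controls the lower tail if the mean is known: the positive and the negative part of
  $f-L$ have the same expectation.
\<close>

lemma lower_tail_from_mean:
  assumes [measurable]: "f \<in> borel_measurable M" and nn: "\<And>\<omega>. 0 \<le> f \<omega>"
    and mean: "(\<integral>\<^sup>+\<omega>. ennreal (f \<omega>) \<partial>M) = ennreal L" and L: "0 \<le> L"
    and h: "0 < h" and D: "0 \<le> D" "(\<integral>\<^sup>+\<omega>. ennreal (exp (h * (f \<omega> - L))) \<partial>M) \<le> ennreal D" and s: "0 < s"
  shows "\<P>(\<omega> in M. f \<omega> \<le> L - s) \<le> D / (h * s)"
proof -
  have int: "integrable M f" and E: "expectation f = L"
    using nn_integral_eq_integrable[of f M L] mean nn L by auto
  have plus: "(\<integral>\<^sup>+\<omega>. ennreal (max 0 (f \<omega> - L)) \<partial>M) \<le> ennreal (D / h)"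
  proof -
    have "(\<integral>\<^sup>+\<omega>. ennreal (max 0 (f \<omega> - L)) \<partial>M) \<le> (\<integral>\<^sup>+\<omega>. ennreal (1 / h) * ennreal (exp (h * (f \<omega> - L))) \<partial>M)"
    proof (rule nn_integral_mono)
      fix \<omega>
      have "h * (f \<omega> - L) \<le> exp (h * (f \<omega> - L))" using exp_ge_add_one_self[of "h * (f \<omega> - L)"] by linarith
      then have "max 0 (f \<omega> - L) \<le> 1 / h * exp (h * (f \<omega> - L))" using h by (auto simp: field_simps)
      then show "ennreal (max 0 (f \<omega> - L)) \<le> ennreal (1 / h) * ennreal (exp (h * (f \<omega> - L)))"
        using h by (simp add: ennreal_leI flip: ennreal_mult')
    qed
    also have "\<dots> = ennreal (1 / h) * (\<integral>\<^sup>+\<omega>. ennreal (exp (h * (f \<omega> - L))) \<partial>M)" by (rule nn_integral_cmult) measurable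
    also have "\<dots> \<le> ennreal (1 / h) * ennreal D" by (intro mult_left_mono D) simp
    finally show ?thesis using h by (simp flip: ennreal_mult')
  qed
  have intp: "integrable M (\<lambda>\<omega>. max 0 (f \<omega> - L))" using int by (intro integrable_max) auto
  have "expectation (\<lambda>\<omega>. max 0 (L - f \<omega>)) = expectation (\<lambda>\<omega>. (L - f \<omega>) + max 0 (f \<omega> - L))"
    by (intro Bochner_Integration.integral_cong) auto
  also have "\<dots> = (L - L) + expectation (\<lambda>\<omega>. max 0 (f \<omega> - L))"
    using int intp E by (simp add: prob_space)
  also have "\<dots> \<le> D / h"
    using plus nn_integral_eq_integral[OF intp] D h by (simp add: ennreal_le_iff)
  finally have m: "expectation (\<lambda>\<omega>. max 0 (L - f \<omega>)) \<le> D / h" .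
  have intm: "integrable M (\<lambda>\<omega>. max 0 (L - f \<omega>))" using int by (intro integrable_max) auto
  have "\<P>(\<omega> in M. f \<omega> \<le> L - s) = \<P>(\<omega> in M. s \<le> max 0 (L - f \<omega>))"
    using s by (intro arg_cong[where f=prob]) auto
  also have "\<dots> \<le> expectation (\<lambda>\<omega>. max 0 (L - f \<omega>)) / s"
    by (rule integral_Markov_inequality_measure[OF intm, of "{}"]) (use s in auto)
  also have "\<dots> \<le> (D / h) / s" using m s by (intro divide_right_mono) auto
  finally show ?thesis by simp
qed

end

section \<open>Tails of the model with boundary weights\<close>

text \<open>
  A box that uses the array \<open>U\<close> inside and weights of \<open>X\<close> from outside the box on the axes.
  This provides the axis weights without enlarging the probability space.
\<close>

definition border :: "nat \<Rightarrow> nat \<Rightarrow> (nat \<times> nat \<Rightarrow> 'b) \<Rightarrow> (nat \<times> nat \<Rightarrow> 'b) \<Rightarrow> nat \<times> nat \<Rightarrow> 'b" where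
  "border m n U X = (\<lambda>(i, j). if 1 \<le> i \<and> 1 \<le> j then U (i, j) else X (m + 1 + i, n + 1 + j))"

lemma border_interior: "1 \<le> i \<Longrightarrow> 1 \<le> j \<Longrightarrow> border m n U X (i, j) = U (i, j)"
  by (simp add: border_def)

context prob_space begin

lemma exp_array_border:
  assumes X: "exp_array M pos_quadrant X"
  shows "exp_array M ({0..m} \<times> {0..n}) (border m n X X)"
    and "exp_array M ({0..m} \<times> {0..n}) (border m n (reflect m n X) X)"
proof -
  define f where "f = (\<lambda>(i, j). if 1 \<le> i \<and> 1 \<le> j then (i, j) else (m + 1 + i, n + 1 + j))"
  define g where "g = (\<lambda>(i, j). if 1 \<le> i \<and> 1 \<le> j then (Suc m - i, Suc n - j) else (m + 1 + i, n + 1 + j))"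
  have "exp_array M ({0..m} \<times> {0..n}) (\<lambda>p. X (f p))"
    by (rule exp_array_reindex[OF X]) (auto simp: inj_on_def f_def split: if_splits)
  moreover have "(\<lambda>p. X (f p)) = border m n X X" by (auto simp: f_def border_def)
  ultimately show "exp_array M ({0..m} \<times> {0..n}) (border m n X X)" by simp
  have "exp_array M ({0..m} \<times> {0..n}) (\<lambda>p. X (g p))"
    by (rule exp_array_reindex[OF X]) (auto simp: inj_on_def g_def split: if_splits)
  moreover have "(\<lambda>p. X (g p)) = border m n (reflect m n X) X" by (auto simp: g_def border_def reflect_def)
  ultimately show "exp_array M ({0..m} \<times> {0..n}) (border m n (reflect m n X) X)" by simp
qed

text \<open>
  With $x=2\theta/w\le\frac12$, the expectation of $\exp(2\theta u/w)$ is $1/(1-x)\le\exp(x+2x^2)$; the correction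
  $4\theta/w^2$ of the slope is chosen to absorb $2x^2$, which makes the square of each factor have expectation at
  most one.
\<close>

lemma walk_upper_moment:
  assumes U: "exp_array M {1..k} U" and \<theta>: "0 < \<theta>" "4 * \<theta> \<le> w"
  defines "g \<equiv> (\<lambda>u. exp (\<theta> * (u / w - (1 / w + 4 * \<theta> / w\<^sup>2))))"
  shows "(\<integral>\<^sup>+\<omega>. ennreal (running_max g (\<lambda>i. U i \<omega>) k) \<partial>M) \<le> 2"
proof (rule running_max_moment[OF U])
  have w: "0 < w" using \<theta> by simp
  define v where "v = 2 * \<theta> / w"
  have v: "0 \<le> v" "v \<le> 1 / 2" "v < 1" using \<theta> w by (auto simp: v_def field_simps)
  have "(\<integral>\<^sup>+x. ennreal ((g x)\<^sup>2) \<partial>expm 1) = (\<integral>\<^sup>+x. ennreal (exp (- (v + 2 * v\<^sup>2))) * ennreal (exp (v * x)) \<partial>expm 1)"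
  proof (rule nn_integral_cong)
    fix x
    have "(g x)\<^sup>2 = exp (2 * (\<theta> * (x / w - (1 / w + 4 * \<theta> / w\<^sup>2))))"
      by (simp add: g_def exp_double)
    also have "2 * (\<theta> * (x / w - (1 / w + 4 * \<theta> / w\<^sup>2))) = - (v + 2 * v\<^sup>2) + v * x"
      using w by (simp add: v_def field_simps power2_eq_square)
    finally show "ennreal ((g x)\<^sup>2) = ennreal (exp (- (v + 2 * v\<^sup>2))) * ennreal (exp (v * x))"
      by (simp add: exp_add flip: ennreal_mult')
  qed
  also have "\<dots> = ennreal (exp (- (v + 2 * v\<^sup>2))) * (\<integral>\<^sup>+x. ennreal (exp (v * x)) \<partial>expm 1)"
    by (rule nn_integral_cmult) measurable
  also have "(\<integral>\<^sup>+x. ennreal (exp (v * x)) \<partial>expm 1) = ennreal (1 / (1 - v))"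
    by (rule nn_integral_exp_expm) (use v in auto)
  also have "ennreal (exp (- (v + 2 * v\<^sup>2))) * ennreal (1 / (1 - v)) = ennreal (exp (- (v + 2 * v\<^sup>2)) / (1 - v))"
    by (simp flip: ennreal_mult')
  also have "\<dots> \<le> ennreal 1"
  proof (rule ennreal_leI)
    have "- v - 2 * v\<^sup>2 \<le> ln (1 - v)" by (rule ln_one_minus_pos_lower_bound) (use v in auto)
    then have "exp (- v - 2 * v\<^sup>2) \<le> exp (ln (1 - v))" by (subst exp_le_cancel_iff)
    then have "exp (- v - 2 * v\<^sup>2) \<le> 1 - v" using v by simp
    then show "exp (- (v + 2 * v\<^sup>2)) / (1 - v) \<le> 1" using v by simp
  qed
  finally show "(\<integral>\<^sup>+x. ennreal ((g x)\<^sup>2) \<partial>expm 1) \<le> 1" by simp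
  show "g \<in> borel_measurable borel" unfolding g_def by measurable
qed (simp add: g_def)

lemma walk_lower_moment:
  assumes U: "exp_array M {1..k} U" and \<theta>: "0 < \<theta>" "4 * \<theta> \<le> w"
  defines "g \<equiv> (\<lambda>u. exp (\<theta> * ((1 / w - 4 * \<theta> / w\<^sup>2) - u / w)))"
  shows "(\<integral>\<^sup>+\<omega>. ennreal (running_max g (\<lambda>i. U i \<omega>) k) \<partial>M) \<le> 2"
proof (rule running_max_moment[OF U])
  have w: "0 < w" using \<theta> by simp
  define v where "v = 2 * \<theta> / w"
  have v: "0 \<le> v" "v \<le> 1 / 2" "v < 1" using \<theta> w by (auto simp: v_def field_simps)
  have "(\<integral>\<^sup>+x. ennreal ((g x)\<^sup>2) \<partial>expm 1) = (\<integral>\<^sup>+x. ennreal (exp (v - 2 * v\<^sup>2)) * ennreal (exp ((- v) * x)) \<partial>expm 1)"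
  proof (rule nn_integral_cong)
    fix x
    have "(g x)\<^sup>2 = exp (2 * (\<theta> * ((1 / w - 4 * \<theta> / w\<^sup>2) - x / w)))"
      by (simp add: g_def exp_double)
    also have "2 * (\<theta> * ((1 / w - 4 * \<theta> / w\<^sup>2) - x / w)) = (v - 2 * v\<^sup>2) + (- v) * x"
      using w by (simp add: v_def field_simps power2_eq_square)
    finally show "ennreal ((g x)\<^sup>2) = ennreal (exp (v - 2 * v\<^sup>2)) * ennreal (exp ((- v) * x))"
      by (simp only: exp_add ennreal_mult' exp_ge_zero)
  qed
  also have "\<dots> = ennreal (exp (v - 2 * v\<^sup>2)) * (\<integral>\<^sup>+x. ennreal (exp ((- v) * x)) \<partial>expm 1)"
    by (rule nn_integral_cmult) measurable
  also have "(\<integral>\<^sup>+x. ennreal (exp ((- v) * x)) \<partial>expm 1) = ennreal (1 / (1 - (- v)))"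
    by (rule nn_integral_exp_expm) (use v in auto)
  also have "ennreal (exp (v - 2 * v\<^sup>2)) * ennreal (1 / (1 - (- v))) = ennreal (exp (v - 2 * v\<^sup>2) / (1 + v))"
    by (simp flip: ennreal_mult')
  also have "\<dots> \<le> ennreal 1"
  proof (rule ennreal_leI)
    have "v - v\<^sup>2 \<le> ln (1 + v)" by (rule ln_one_plus_pos_lower_bound) (use v in auto)
    then have "v - 2 * v\<^sup>2 \<le> ln (1 + v)" using zero_le_power2[of v] by linarith
    then have "exp (v - 2 * v\<^sup>2) \<le> exp (ln (1 + v))" by (subst exp_le_cancel_iff)
    then have "exp (v - 2 * v\<^sup>2) \<le> 1 + v" using v by simp
    then show "exp (v - 2 * v\<^sup>2) / (1 + v) \<le> 1" using v by simp
  qed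
  finally show "(\<integral>\<^sup>+x. ennreal ((g x)\<^sup>2) \<partial>expm 1) \<le> 1" by simp
  show "g \<in> borel_measurable borel" unfolding g_def by measurable
qed (simp add: g_def)

lemma markov_ge_1:
  assumes [measurable]: "f \<in> borel_measurable M" and f: "\<And>\<omega>. 1 \<le> f \<omega>" and le: "(\<integral>\<^sup>+\<omega>. ennreal (f \<omega>) \<partial>M) \<le> 2"
  shows "\<P>(\<omega> in M. exp s \<le> f \<omega>) \<le> 2 * exp (- s)"
proof -
  have f0: "0 < f \<omega>" for \<omega> using f[of \<omega>] by simp
  have "\<P>(\<omega> in M. s \<le> ln (f \<omega>)) \<le> exp (ln 2 - 1 * s)"
  proof (rule markov_exp)
    show "(\<integral>\<^sup>+\<omega>. ennreal (exp (1 * ln (f \<omega>))) \<partial>M) \<le> ennreal (exp (ln 2))"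
      using le f0 by simp
  qed auto
  also have "{\<omega>\<in>space M. s \<le> ln (f \<omega>)} = {\<omega>\<in>space M. exp s \<le> f \<omega>}"
    using f0 by (auto simp: ln_ge_iff)
  finally show ?thesis by (simp add: exp_diff exp_minus field_simps)
qed

text \<open>
  At distance $r/t$ from the critical density the mean exceeds \<open>shape m n\<close> by at least $4r^2t$, whereas
  the fluctuations are of order $\sqrt r\,t$. Staying below half of this excess therefore has a probability of order
  $1/r$. The exact moment formula requires $z<w$, so the horizontal and the vertical part are bounded separately, at
  the densities $\rho\mp h$.
\<close>

lemma stationary_lower_tail:
  assumes Y: "exp_array M ({0..m} \<times> {0..n}) Y" and asp: "aspect (real m) (real n) \<eta> t"
    and r: "1 \<le> r" "2 * r \<le> \<eta> * t" "\<bar>\<rho> - crit m n\<bar> = r / t"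
  shows "\<P>(\<omega> in M. boundary_lpp (\<lambda>p. Y p \<omega>) \<rho> (1 - \<rho>) m n \<le> shape m n + 2 * r\<^sup>2 * t)
     \<le> exp (13 / \<eta> ^ 4) / r"
proof -
  interpret aspect "real m" "real n" \<eta> t by fact
  (* The inverse of the fluctuation scale of the stationary model at this density. *)
  define h where "h = 1 / (sqrt r * t)"
  have sr: "1 \<le> sqrt r" "sqrt r \<le> r" using r real_le_lsqrt[of 1 r] by (auto simp: real_le_lsqrt power2_eq_square)
  have ht: "h * t = 1 / sqrt r" "h * t \<le> 1" "0 < h" using t sr by (auto simp: h_def)
  have h_le: "h \<le> 1 / t" using ht t by (simp add: field_simps)
  have rt: "r / t \<le> \<eta> / 2" "1 / t \<le> \<eta> / 2" using r t by (auto simp: field_simps)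
  let ?z = "crit m n"
  have \<rho>: "\<eta> \<le> \<rho>" "\<eta> \<le> 1 - \<rho>" "0 < \<rho>" "\<rho> < 1" using r(3) rt crit_ge eta by linarith+
  define G where "G = (\<lambda>\<omega>. boundary_lpp (\<lambda>p. Y p \<omega>) \<rho> (1 - \<rho>) m n)"
  define Hh where "Hh = (\<lambda>\<omega>. hor_lpp (\<lambda>p. Y p \<omega>) \<rho> m n)"
  define Hv where "Hv = (\<lambda>\<omega>. ver_lpp (\<lambda>p. Y p \<omega>) (1 - \<rho>) m n)"
  note nn = exp_arrayD(2)[OF Y]
  have [measurable]: "G \<in> borel_measurable M" "Hh \<in> borel_measurable M" "Hv \<in> borel_measurable M"
    unfolding G_def Hh_def Hv_def using exp_array_lpp_measurable[OF Y] by auto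
  have split: "G \<omega> = max (Hh \<omega>) (Hv \<omega>)" for \<omega>
    unfolding G_def Hh_def Hv_def by (rule lpp_split_boundary) (use nn \<rho> in \<open>auto intro!: hsum_nonneg vsum_nonneg\<close>)
  define L where "L = drift m n \<rho>"
  have h01: "0 < h" "2 * h < \<rho>" "\<rho> + 2 * h < 1"
    using ht h_le rt r(1,3) crit_ge eta eta_le by linarith+
  have bound: "cumulant m n c h \<le> 13 / \<eta> ^ 4 + 2 * h * L" if c: "c = \<rho> - h \<or> c = \<rho> + h" for c
  proof -
    have cz: "\<bar>c - ?z\<bar> \<le> 2 * (r / t)"
    proof -
      have "\<bar>c - ?z\<bar> \<le> r / t + 1 / t" using c r(3) h_le ht by auto
      also have "\<dots> \<le> 2 * (r / t)" using r t by (simp add: field_simps)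
      finally show ?thesis .
    qed
    have cc: "\<eta> \<le> c" "\<eta> \<le> 1 - c" using cz crit_ge rt by linarith+
    have "\<bar>drift m n c - drift m n \<rho>\<bar> \<le> \<bar>c - \<rho>\<bar> * (2 * t ^ 3 / \<eta> ^ 3) * (\<bar>\<rho> - ?z\<bar> + \<bar>c - ?z\<bar>)"
      by (rule drift_diff) (use cc \<rho> in auto)
    also have "\<dots> \<le> h * (2 * t ^ 3 / \<eta> ^ 3) * (r / t + 2 * (r / t))"
      using c ht r(3) cz eta t by (intro mult_mono add_mono) auto
    also have "\<dots> = h * 6 * r * t\<^sup>2 / \<eta> ^ 3" using t eta by (simp add: field_simps power2_eq_square power3_eq_cube)
    finally have d: "drift m n c \<le> L + h * 6 * r * t\<^sup>2 / \<eta> ^ 3" unfolding L_def by linarith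
    have "2 * h * (h * 6 * r * t\<^sup>2 / \<eta> ^ 3) = 12 * (h * t)\<^sup>2 * r / \<eta> ^ 3" by (simp add: power2_eq_square)
    also have "\<dots> = 12 / \<eta> ^ 3" using ht r by (simp add: power_divide)
    also have "\<dots> \<le> 12 / \<eta> ^ 4" using eta eta_le by (simp add: field_simps power_def numeral_eq_Suc)
    finally have d2: "2 * h * (h * 6 * r * t\<^sup>2 / \<eta> ^ 3) \<le> 12 / \<eta> ^ 4" .
    have "cumulant m n c h \<le> 2 * h * drift m n c + (h * t) ^ 3 / \<eta> ^ 4"
      by (rule cumulant_le) (use cc ht h_le rt in auto)
    also have "\<dots> \<le> 2 * h * (L + h * 6 * r * t\<^sup>2 / \<eta> ^ 3) + 1 / \<eta> ^ 4"
      using d ht eta t r by (intro add_mono mult_left_mono divide_right_mono power_le_one) auto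
    also have "\<dots> \<le> 12 / \<eta> ^ 4 + 1 / \<eta> ^ 4 + 2 * h * L" using d2 by (simp add: distrib_left)
    also have "\<dots> = 13 / \<eta> ^ 4 + 2 * h * L" by simp
    finally show ?thesis .
  qed
  have hor: "(\<integral>\<^sup>+\<omega>. ennreal (exp (2 * h * Hh \<omega>)) \<partial>M) \<le> ennreal (exp (13 / \<eta> ^ 4 + 2 * h * L))"
  proof -
    have "(\<integral>\<^sup>+\<omega>. ennreal (exp (2 * h * Hh \<omega>)) \<partial>M) \<le> ennreal (exp (cumulant m n (\<rho> - h) h))"
      unfolding Hh_def by (rule horizontal_moment[OF Y]) (use h01 in linarith)+
    also have "\<dots> \<le> ennreal (exp (13 / \<eta> ^ 4 + 2 * h * L))" using bound by (intro ennreal_leI) auto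
    finally show ?thesis .
  qed
  have ver: "(\<integral>\<^sup>+\<omega>. ennreal (exp (2 * h * Hv \<omega>)) \<partial>M) \<le> ennreal (exp (13 / \<eta> ^ 4 + 2 * h * L))"
  proof -
    have "(\<integral>\<^sup>+\<omega>. ennreal (exp (2 * h * Hv \<omega>)) \<partial>M) \<le> ennreal (exp (cumulant m n (\<rho> + h) h))"
      unfolding Hv_def by (rule vertical_moment[OF Y]) (use h01 in linarith)+
    also have "\<dots> \<le> ennreal (exp (13 / \<eta> ^ 4 + 2 * h * L))" using bound by (intro ennreal_leI) auto
    finally show ?thesis .
  qed
  have "(\<integral>\<^sup>+\<omega>. ennreal (exp (2 * h * (G \<omega> - L))) \<partial>M)
     \<le> (\<integral>\<^sup>+\<omega>. ennreal (exp (- 2 * h * L)) * (ennreal (exp (2 * h * Hh \<omega>)) + ennreal (exp (2 * h * Hv \<omega>))) \<partial>M)"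
  proof (rule nn_integral_mono)
    fix \<omega>
    have "exp (2 * h * G \<omega>) \<le> exp (2 * h * Hh \<omega>) + exp (2 * h * Hv \<omega>)" unfolding split by (simp add: max_def)
    then have "exp (- 2 * h * L) * exp (2 * h * G \<omega>) \<le> exp (- 2 * h * L) * (exp (2 * h * Hh \<omega>) + exp (2 * h * Hv \<omega>))"
      by (intro mult_left_mono) auto
    then show "ennreal (exp (2 * h * (G \<omega> - L))) \<le> ennreal (exp (- 2 * h * L)) * (ennreal (exp (2 * h * Hh \<omega>)) + ennreal (exp (2 * h * Hv \<omega>)))"
      by (simp add: algebra_simps ennreal_leI flip: exp_add ennreal_plus ennreal_mult')
  qed
  also have "\<dots> = ennreal (exp (- 2 * h * L)) * ((\<integral>\<^sup>+\<omega>. ennreal (exp (2 * h * Hh \<omega>)) \<partial>M) + (\<integral>\<^sup>+\<omega>. ennreal (exp (2 * h * Hv \<omega>)) \<partial>M))"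
    by (simp add: nn_integral_cmult nn_integral_add)
  also have "\<dots> \<le> ennreal (exp (- 2 * h * L)) * (ennreal (exp (13 / \<eta> ^ 4 + 2 * h * L)) + ennreal (exp (13 / \<eta> ^ 4 + 2 * h * L)))"
    by (intro mult_left_mono add_mono hor ver) auto
  also have "\<dots> = ennreal (2 * exp (13 / \<eta> ^ 4))"
    by (simp add: exp_add exp_minus field_simps flip: ennreal_plus ennreal_mult')
  finally have D: "(\<integral>\<^sup>+\<omega>. ennreal (exp (2 * h * (G \<omega> - L))) \<partial>M) \<le> ennreal (2 * exp (13 / \<eta> ^ 4))" .
  have "\<P>(\<omega> in M. G \<omega> \<le> L - 2 * r\<^sup>2 * t) \<le> 2 * exp (13 / \<eta> ^ 4) / (2 * h * (2 * r\<^sup>2 * t))"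
  proof (rule lower_tail_from_mean[OF _ _ _ _ _ _ D])
    show "(\<integral>\<^sup>+\<omega>. ennreal (G \<omega>) \<partial>M) = ennreal L" unfolding G_def L_def by (rule stationary_mean[OF Y]) (use \<rho> in auto)
    show "0 \<le> G \<omega>" for \<omega> unfolding G_def
      by (rule lpp_nonneg) (use nn \<rho> in \<open>auto intro!: hsum_nonneg vsum_nonneg\<close>)
    show "0 \<le> L" using \<rho> by (simp add: L_def drift_def)
  qed (use ht r t in auto)
  also have "\<dots> = exp (13 / \<eta> ^ 4) / (2 * (h * t) * r\<^sup>2)" by (simp add: field_simps)
  also have "\<dots> \<le> exp (13 / \<eta> ^ 4) / r"
  proof (intro divide_left_mono)
    have "r \<le> r\<^sup>2 / sqrt r" using sr r by (simp add: field_simps power2_eq_square)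
    also have "\<dots> \<le> 2 * (h * t) * r\<^sup>2" using ht sr by (simp add: divide_simps)
    finally show "r \<le> 2 * (h * t) * r\<^sup>2" .
  qed (use ht t r in auto)
  finally have P: "\<P>(\<omega> in M. G \<omega> \<le> L - 2 * r\<^sup>2 * t) \<le> exp (13 / \<eta> ^ 4) / r" .
  have "shape m n + 4 * t ^ 3 * (\<rho> - ?z)\<^sup>2 \<le> L" unfolding L_def by (rule drift_lower) (use \<rho> in auto)
  also have "(\<rho> - ?z)\<^sup>2 = (r / t)\<^sup>2" using r(3) by (metis power2_abs)
  also have "4 * t ^ 3 * (r / t)\<^sup>2 = 4 * r\<^sup>2 * t" using t by (simp add: field_simps power2_eq_square power3_eq_cube)
  finally have sL: "shape m n + 2 * r\<^sup>2 * t \<le> L - 2 * r\<^sup>2 * t" by (simp add: algebra_simps)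
  have "\<P>(\<omega> in M. G \<omega> \<le> shape m n + 2 * r\<^sup>2 * t) \<le> \<P>(\<omega> in M. G \<omega> \<le> L - 2 * r\<^sup>2 * t)"
    by (intro finite_measure_mono) (auto intro: order_trans[OF _ sL])
  with P show ?thesis unfolding G_def by linarith
qed

text \<open>
  At the critical density the linear term is the shape exactly, and the cubic term is bounded when \<open>h\<close> is
  $1/t$.
\<close>

lemma crit_cumulant:
  assumes asp: "aspect (real m) (real n) \<eta> t" and t2: "2 \<le> \<eta> * t"
  shows "cumulant m n (crit m n) (1 / t) \<le> 2 * (1 / t) * shape m n + 1 / \<eta> ^ 4"
proof -
  interpret aspect "real m" "real n" \<eta> t by fact
  have "cumulant m n (crit m n) (1 / t) \<le> 2 * (1 / t) * drift m n (crit m n) + (1 / t * t) ^ 3 / \<eta> ^ 4"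
    by (rule cumulant_le) (use crit_ge eta t t2 in \<open>auto simp: field_simps\<close>)
  then show ?thesis using drift_crit[of m n] mn t by simp
qed

lemma horizontal_upper_tail:
  assumes Y: "exp_array M ({0..m} \<times> {0..n}) Y" and asp: "aspect (real m) (real n) \<eta> t"
    and t2: "2 \<le> \<eta> * t" and \<rho>: "crit m n + 1 / t \<le> \<rho>"
  shows "\<P>(\<omega> in M. shape m n + s * t \<le> hor_lpp (\<lambda>p. Y p \<omega>) \<rho> m n) \<le> exp (1 / \<eta> ^ 4 - 2 * s)"
proof -
  interpret aspect "real m" "real n" \<eta> t by fact
  have t1: "1 / t \<le> \<eta> / 2" using t t2 by (simp add: field_simps)
  have "\<P>(\<omega> in M. shape m n + s * t \<le> hor_lpp (\<lambda>p. Y p \<omega>) \<rho> m n)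
     \<le> exp (cumulant m n (crit m n) (1 / t) - 2 * (1 / t) * (shape m n + s * t))"
    by (rule markov_exp[OF exp_array_lpp_measurable(2)[OF Y]], use t in simp, rule horizontal_moment[OF Y])
      (use t t1 crit_ge \<rho> eta in auto)
  also have "\<dots> \<le> exp (1 / \<eta> ^ 4 - 2 * s)"
    using crit_cumulant[OF asp t2] t by (simp add: field_simps)
  finally show ?thesis .
qed

lemma vertical_upper_tail:
  assumes Y: "exp_array M ({0..m} \<times> {0..n}) Y" and asp: "aspect (real m) (real n) \<eta> t"
    and t2: "2 \<le> \<eta> * t" and \<rho>: "\<rho> \<le> crit m n - 1 / t"
  shows "\<P>(\<omega> in M. shape m n + s * t \<le> ver_lpp (\<lambda>p. Y p \<omega>) (1 - \<rho>) m n) \<le> exp (1 / \<eta> ^ 4 - 2 * s)"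
proof -
  interpret aspect "real m" "real n" \<eta> t by fact
  have t1: "1 / t \<le> \<eta> / 2" using t t2 by (simp add: field_simps)
  have "\<P>(\<omega> in M. shape m n + s * t \<le> ver_lpp (\<lambda>p. Y p \<omega>) (1 - \<rho>) m n)
     \<le> exp (cumulant m n (crit m n) (1 / t) - 2 * (1 / t) * (shape m n + s * t))"
    by (rule markov_exp[OF exp_array_lpp_measurable(3)[OF Y]], use t in simp, rule vertical_moment[OF Y])
      (use t t1 crit_ge \<rho> eta in auto)
  also have "\<dots> \<le> exp (1 / \<eta> ^ 4 - 2 * s)"
    using crit_cumulant[OF asp t2] t by (simp add: field_simps)
  finally show ?thesis .
qed

lemma far_measurable:
  assumes Y: "exp_array M ({0..m} \<times> {0..n}) Y" and k: "k \<le> m"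
  shows "(\<lambda>\<omega>. far_lpp (\<lambda>p. Y p \<omega>) w k m n) \<in> borel_measurable M"
  using exp_arrayD(1)[OF Y] k by (intro borel_measurable_add measurable_lpp borel_measurable_diff measurable_hsum) auto

text \<open>
  The rate is below the critical density by $r/t$, so that long runs along the axis are rewarded with slope $1/w$;
  leaving the axis beyond $k$ of order $rt^2$ is nevertheless too expensive, by the gain in \<open>far_moment\<close>.
\<close>

lemma far_upper_tail:
  assumes Y: "exp_array M ({0..m} \<times> {0..n}) Y" and asp: "aspect (real m) (real n) \<eta> t"
    and r: "1 \<le> r" "6 * r \<le> \<eta> * t" and k: "k \<le> m" "19 * r / \<eta> ^ 4 * t\<^sup>2 \<le> real k"
  defines "w \<equiv> crit m n - r / t"
  shows "\<P>(\<omega> in M. shape m n + 2 * r\<^sup>2 * t \<le> far_lpp (\<lambda>p. Y p \<omega>) w k m n) \<le> exp (- 4 * r\<^sup>2)"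
proof -
  interpret aspect "real m" "real n" \<eta> t by fact
  let ?z = "crit m n"
  define h where "h = 1 / t"
  define c where "c = w - h"
  define c' where "c' = c - r / t"
  have h0: "0 < h" "h * t = 1" using t by (auto simp: h_def)
  have rt: "r / t \<le> \<eta> / 6" "h \<le> r / t" "0 \<le> r / t" using r t by (auto simp: h_def field_simps)
  have c'z: "\<bar>c' - ?z\<bar> \<le> 3 * r / t" using rt h0 by (simp add: c'_def c_def w_def)
  have cc: "\<eta> \<le> c'" "\<eta> \<le> 1 - c'" "c' \<le> c" "c + h < 1" "h < c'" using rt h0 crit_ge eta by (auto simp: c'_def c_def w_def)
  have "\<P>(\<omega> in M. shape m n + 2 * r\<^sup>2 * t \<le> far_lpp (\<lambda>p. Y p \<omega>) w k m n)
      \<le> exp ((cumulant m n c' h - 2 * h * k * (c - c')) - 2 * h * (shape m n + 2 * r\<^sup>2 * t))"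
  proof (rule markov_exp[OF far_measurable[OF Y k(1)]])
    have w: "w = c + h" by (simp add: c_def)
    show "(\<integral>\<^sup>+\<omega>. ennreal (exp (2 * h * (far_lpp (\<lambda>p. Y p \<omega>) w k m n))) \<partial>M) \<le> ennreal (exp (cumulant m n c' h - 2 * h * k * (c - c')))"
      unfolding w by (rule far_moment[OF Y]) (use cc h0 k in auto)
  qed (use h0 in simp)
  also have "\<dots> \<le> exp (- 4 * r\<^sup>2)"
  proof -
    have z: "\<eta> \<le> ?z" "\<eta> \<le> 1 - ?z" using crit_ge eta by auto
    have "\<bar>drift m n c' - drift m n ?z\<bar> \<le> \<bar>c' - ?z\<bar> * (2 * t ^ 3 / \<eta> ^ 3) * (\<bar>?z - ?z\<bar> + \<bar>c' - ?z\<bar>)"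
      by (rule drift_diff) (use cc z in auto)
    also have "\<dots> \<le> (3 * r / t) * (2 * t ^ 3 / \<eta> ^ 3) * (3 * r / t)"
      using c'z eta t r by (intro mult_mono) auto
    also have "\<dots> = 18 * r\<^sup>2 * t / \<eta> ^ 3" using t eta by (simp add: field_simps power2_eq_square power3_eq_cube)
    finally have d: "drift m n c' \<le> shape m n + 18 * r\<^sup>2 * t / \<eta> ^ 3" using drift_crit[of m n] mn by simp
    have "cumulant m n c' h \<le> 2 * h * drift m n c' + (h * t) ^ 3 / \<eta> ^ 4"
      by (rule cumulant_le) (use cc h0 rt eta in linarith)+
    also have "\<dots> \<le> 2 * h * (shape m n + 18 * r\<^sup>2 * t / \<eta> ^ 3) + 1 / \<eta> ^ 4"
      using d h0 by (intro add_mono mult_left_mono) auto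
    also have "\<dots> = 2 * h * shape m n + 36 * r\<^sup>2 / \<eta> ^ 3 + 1 / \<eta> ^ 4" using h0(2) t by (simp add: h_def field_simps)
    finally have F: "cumulant m n c' h \<le> 2 * h * shape m n + 36 * r\<^sup>2 / \<eta> ^ 3 + 1 / \<eta> ^ 4" .
    have "36 * r\<^sup>2 / \<eta> ^ 3 \<le> 36 * r\<^sup>2 / \<eta> ^ 4"
      using eta eta_le by (intro divide_left_mono power_decreasing) auto
    moreover have "1 / \<eta> ^ 4 \<le> r\<^sup>2 / \<eta> ^ 4" using r eta by (intro divide_right_mono) auto
    moreover have "2 * h * k * (c - c') \<ge> 38 * r\<^sup>2 / \<eta> ^ 4"
    proof -
      have "38 * r\<^sup>2 / \<eta> ^ 4 = 2 * h * (19 * r / \<eta> ^ 4 * t\<^sup>2) * (r / t)" using t eta by (simp add: h_def field_simps power2_eq_square)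
      also have "\<dots> \<le> 2 * h * k * (r / t)" using k h0 r t by (intro mult_right_mono mult_left_mono) auto
      finally show ?thesis by (simp add: c'_def)
    qed
    moreover have "36 * r\<^sup>2 / \<eta> ^ 4 + r\<^sup>2 / \<eta> ^ 4 \<le> 38 * r\<^sup>2 / \<eta> ^ 4" using eta by (simp add: field_simps)
    moreover have "2 * h * (shape m n + 2 * r\<^sup>2 * t) = 2 * h * shape m n + 4 * r\<^sup>2" using t by (simp add: h_def field_simps)
    ultimately have "(cumulant m n c' h - 2 * h * k * (c - c')) - 2 * h * (shape m n + 2 * r\<^sup>2 * t) \<le> - 4 * r\<^sup>2"
      using F by linarith
    then show ?thesis by simp
  qed
  finally show ?thesis .
qed

end

section \<open>The typical lower bound\<close>

lemma increments_le_imp_diff_le: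
  fixes f g :: "nat \<Rightarrow> real"
  assumes "\<And>i. f (Suc i) - f i \<le> g (Suc i) - g i" "a \<le> b"
  shows "f b - f a \<le> g b - g a"
  using assms(2)
proof (induction rule: dec_induct)
  case (step i) then show ?case using assms(1)[of i] by linarith
qed simp

text \<open>
  If the optimal stationary path leaves through the vertical axis, the stationary increment between two columns is an
  increment of the model with vertical boundary values only, and the comparison principle bounds it by an increment of
  the model without boundary.
\<close>

lemma bulk_increment_ge:
  assumes nn: "\<And>p. 0 \<le> X p" and \<rho>: "0 < \<rho>" "\<rho> < 1" and ab: "a \<le> b"
    and U: "\<And>i j. 1 \<le> i \<Longrightarrow> 1 \<le> j \<Longrightarrow> Y (i, j) = X (i, j)" and nY: "\<And>p. 0 \<le> Y p"
    and exit: "hor_lpp Y \<rho> b n < boundary_lpp Y \<rho> (1 - \<rho>) b n"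
  shows "boundary_lpp Y \<rho> (1 - \<rho>) b n - boundary_lpp Y \<rho> (1 - \<rho>) a n \<le> bulk X b n - bulk X a n"
proof -
  let ?G = "boundary_lpp Y \<rho> (1 - \<rho>)" and ?V = "ver_lpp Y (1 - \<rho>)"
  have split: "?G i j = max (hor_lpp Y \<rho> i j) (?V i j)" for i j
    by (rule lpp_split_boundary) (use nY \<rho> in \<open>auto intro!: hsum_nonneg vsum_nonneg\<close>)
  have "?V b n = ?G b n" using split[of b n] exit by (simp add: max_def split: if_splits)
  moreover have "?V a n \<le> ?G a n" using split[of a n] by simp
  ultimately have "?G b n - ?G a n \<le> ?V b n - ?V a n" by simp
  also have "\<dots> \<le> bulk Y b n - bulk Y a n"
  proof (rule increments_le_imp_diff_le[OF _ ab])
    fix i show "?V (Suc i) n - ?V i n \<le> bulk Y (Suc i) n - bulk Y i n"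
      by (rule lpp_increments_mono) (use nY \<rho> in auto)
  qed
  finally have "?G b n - ?G a n \<le> bulk Y b n - bulk Y a n" .
  moreover have "bulk Y i n = bulk X i n" for i by (rule lpp_cong) (use U in auto)
  ultimately show ?thesis by simp
qed

context prob_space begin

text \<open>
  The boundary walk stays below a line of slightly larger slope, uniformly in its length. Reversing the order of the
  weights turns the running maximum into a maximum over prefixes.
\<close>

lemma prefix_walk_tail:
  assumes Y: "exp_array M ({0..m} \<times> {0..n}) Y" and k: "k \<le> m" and \<theta>: "0 < \<theta>" "4 * \<theta> \<le> w"
  shows "\<P>(\<omega> in M. \<exists>j\<in>{1..k}. s \<le> \<theta> * (hsum (\<lambda>p. Y p \<omega>) w j - j * (1 / w + 4 * \<theta> / w\<^sup>2))) \<le> 2 * exp (- s)"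
    and "(\<integral>\<^sup>+\<omega>. ennreal (running_max (\<lambda>u. exp (\<theta> * (u / w - (1 / w + 4 * \<theta> / w\<^sup>2)))) (\<lambda>i. Y (k + 1 - i, 0) \<omega>) k) \<partial>M) \<le> 2"
    and "\<And>j \<omega>. 1 \<le> j \<Longrightarrow> j \<le> k \<Longrightarrow> exp (\<theta> * (hsum (\<lambda>p. Y p \<omega>) w j - j * (1 / w + 4 * \<theta> / w\<^sup>2)))
      \<le> running_max (\<lambda>u. exp (\<theta> * (u / w - (1 / w + 4 * \<theta> / w\<^sup>2)))) (\<lambda>i. Y (k + 1 - i, 0) \<omega>) k"
proof -
  define g where "g = (\<lambda>u. exp (\<theta> * (u / w - (1 / w + 4 * \<theta> / w\<^sup>2))))"
  define f where "f = (\<lambda>\<omega>. running_max g (\<lambda>i. Y (k + 1 - i, 0) \<omega>) k)"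
  have U: "exp_array M {1..k} (\<lambda>i. Y ((\<lambda>i. (k + 1 - i, 0)) i))"
    by (rule exp_array_reindex[OF Y]) (use k in \<open>auto simp: inj_on_def\<close>)
  have gm: "g \<in> borel_measurable borel" unfolding g_def by measurable
  have fm[measurable]: "f \<in> borel_measurable M" unfolding f_def
    by (rule running_max_measurable[OF gm]) (use exp_arrayD(1)[OF U] in auto)
  have int: "(\<integral>\<^sup>+\<omega>. ennreal (f \<omega>) \<partial>M) \<le> 2"
    unfolding f_def g_def using walk_upper_moment[OF U \<theta>] by simp
  have ge: "exp (\<theta> * (hsum (\<lambda>p. Y p \<omega>) w j - j * (1 / w + 4 * \<theta> / w\<^sup>2))) \<le> f \<omega>" if j: "1 \<le> j" "j \<le> k" for j \<omega>
  proof -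
    have "exp (\<theta> * (hsum (\<lambda>p. Y p \<omega>) w j - j * (1 / w + 4 * \<theta> / w\<^sup>2))) = (\<Prod>l\<in>{1..j}. g (Y (l, 0) \<omega>))"
      unfolding g_def hsum_def
      by (subst exp_sum[symmetric]) (auto simp: sum_distrib_left[symmetric] sum_subtractf sum_divide_distrib[symmetric])
    also have "\<dots> = (\<Prod>i\<in>{k - j + 1..k}. g (Y (k + 1 - i, 0) \<omega>))"
      by (rule prod.reindex_bij_witness[of _ "\<lambda>i. k + 1 - i" "\<lambda>i. k + 1 - i"]) (use j in auto)
    also have "\<dots> \<le> f \<omega>" unfolding f_def by (rule running_max_ge) (use j in \<open>auto simp: g_def\<close>)
    finally show ?thesis .
  qed
  have "\<P>(\<omega> in M. \<exists>j\<in>{1..k}. s \<le> \<theta> * (hsum (\<lambda>p. Y p \<omega>) w j - j * (1 / w + 4 * \<theta> / w\<^sup>2))) \<le> \<P>(\<omega> in M. exp s \<le> f \<omega>)"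
  proof (intro finite_measure_mono subsetI CollectI conjI)
    fix \<omega> assume "\<omega> \<in> {\<omega> \<in> space M. \<exists>j\<in>{1..k}. s \<le> \<theta> * (hsum (\<lambda>p. Y p \<omega>) w j - j * (1 / w + 4 * \<theta> / w\<^sup>2))}"
    then obtain j where j: "j \<in> {1..k}" "s \<le> \<theta> * (hsum (\<lambda>p. Y p \<omega>) w j - j * (1 / w + 4 * \<theta> / w\<^sup>2))" by blast
    then have "exp s \<le> exp (\<theta> * (hsum (\<lambda>p. Y p \<omega>) w j - j * (1 / w + 4 * \<theta> / w\<^sup>2)))" by (subst exp_le_cancel_iff)
    also have "\<dots> \<le> f \<omega>" using ge[of j \<omega>] j by simp
    finally show "exp s \<le> f \<omega>" .
  qed auto
  also have "\<dots> \<le> 2 * exp (- s)" by (rule markov_ge_1[OF fm _ int]) (simp add: f_def running_max_ge_1)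
  finally show "\<P>(\<omega> in M. \<exists>j\<in>{1..k}. s \<le> \<theta> * (hsum (\<lambda>p. Y p \<omega>) w j - j * (1 / w + 4 * \<theta> / w\<^sup>2))) \<le> 2 * exp (- s)" .
  show "(\<integral>\<^sup>+\<omega>. ennreal (running_max (\<lambda>u. exp (\<theta> * (u / w - (1 / w + 4 * \<theta> / w\<^sup>2)))) (\<lambda>i. Y (k + 1 - i, 0) \<omega>) k) \<partial>M) \<le> 2"
    using int unfolding f_def g_def .
  show "\<And>j \<omega>. 1 \<le> j \<Longrightarrow> j \<le> k \<Longrightarrow> exp (\<theta> * (hsum (\<lambda>p. Y p \<omega>) w j - j * (1 / w + 4 * \<theta> / w\<^sup>2)))
      \<le> running_max (\<lambda>u. exp (\<theta> * (u / w - (1 / w + 4 * \<theta> / w\<^sup>2)))) (\<lambda>i. Y (k + 1 - i, 0) \<omega>) k"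
    using ge unfolding f_def g_def .
qed

text \<open>
  The counterpart for the top row of the stationary model, where the increments are summed backwards from the corner
  and stay above a line of slightly smaller slope.
\<close>

lemma top_increments_tail:
  assumes Y: "exp_array M ({0..m} \<times> {0..n}) Y" and k: "k \<le> m" and \<rho>: "0 < \<rho>" "\<rho> < 1" and \<theta>: "0 < \<theta>" "4 * \<theta> \<le> \<rho>"
  defines "L \<equiv> \<lambda>\<omega>. boundary_lpp (\<lambda>p. Y p \<omega>) \<rho> (1 - \<rho>)"
  shows "\<P>(\<omega> in M. \<exists>j\<in>{0..k}. s \<le> \<theta> * (j * (1 / \<rho> - 4 * \<theta> / \<rho>\<^sup>2) - (L \<omega> m n - L \<omega> (m - j) n))) \<le> 2 * exp (- s)"
proof -
  define g where "g = (\<lambda>u. exp (\<theta> * ((1 / \<rho> - 4 * \<theta> / \<rho>\<^sup>2) - u / \<rho>)))"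
  define g' where "g' = (\<lambda>u. exp (\<theta> * ((1 / \<rho> - 4 * \<theta> / \<rho>\<^sup>2) - u)))"
  define f where "f = (\<lambda>\<omega>. running_max g' (\<lambda>i. L \<omega> (m - k + i) n - L \<omega> (m - k + i - 1) n) k)"
  have gm: "g' \<in> borel_measurable borel" unfolding g'_def by measurable
  have [measurable]: "Y p \<in> borel_measurable M" if "p \<in> {0..m} \<times> {0..n}" for p using exp_arrayD(1)[OF Y that] .
  have Lm[measurable]: "(\<lambda>\<omega>. L \<omega> i j) \<in> borel_measurable M" if "i \<le> m" "j \<le> n" for i j
    unfolding L_def using that by (intro measurable_lpp measurable_hsum measurable_vsum) auto
  have fm[measurable]: "f \<in> borel_measurable M" unfolding f_def
    by (rule running_max_measurable[OF gm]) (use k in \<open>auto intro!: borel_measurable_diff Lm\<close>)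
  have run_cong: "running_max p u l = running_max q v l" if "\<And>i. 1 \<le> i \<Longrightarrow> i \<le> l \<Longrightarrow> p (u i) = q (v i)" for p q u v l
    using that by (induction l) auto
  define F where "F = (\<lambda>v :: nat \<Rightarrow> real. ennreal (running_max g' (\<lambda>i. v (m - k + i)) k))"
  have F: "F \<in> borel_measurable (PiM {1..m} (\<lambda>_. borel))"
    unfolding F_def by (intro measurable_compose[OF _ measurable_ennreal] running_max_measurable[OF gm] measurable_component_singleton) (use k in auto)
  have "(\<integral>\<^sup>+\<omega>. ennreal (f \<omega>) \<partial>M) = (\<integral>\<^sup>+\<omega>. F (\<lambda>i\<in>{1..m}. L \<omega> i n - L \<omega> (i - 1) n) \<partial>M)"
    unfolding f_def F_def by (intro nn_integral_cong arg_cong[where f=ennreal] run_cong) (use k in auto)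
  also have "\<dots> = (\<integral>\<^sup>+\<omega>. F (\<lambda>i\<in>{1..m}. Y (i, 0) \<omega> / \<rho>) \<partial>M)"
    unfolding L_def by (rule lpp_top_increments_law[OF Y \<rho> F])
  also have "\<dots> = (\<integral>\<^sup>+\<omega>. ennreal (running_max g (\<lambda>i. Y ((\<lambda>i. (m - k + i, 0)) i) \<omega>) k) \<partial>M)"
    unfolding F_def by (intro nn_integral_cong arg_cong[where f=ennreal] run_cong) (use k in \<open>auto simp: g_def g'_def\<close>)
  also have "\<dots> \<le> 2"
    unfolding g_def
  proof (rule walk_lower_moment[OF _ \<theta>])
    show "exp_array M {1..k} (\<lambda>i. Y ((\<lambda>i. (m - k + i, 0)) i))"
      by (rule exp_array_reindex[OF Y]) (use k in \<open>auto simp: inj_on_def\<close>)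
  qed
  finally have int: "(\<integral>\<^sup>+\<omega>. ennreal (f \<omega>) \<partial>M) \<le> 2" .
  have ge: "exp (\<theta> * (j * (1 / \<rho> - 4 * \<theta> / \<rho>\<^sup>2) - (L \<omega> m n - L \<omega> (m - j) n))) \<le> f \<omega>" if j: "j \<le> k" for j \<omega>
  proof -
    have tel: "L \<omega> m n - L \<omega> (m - j) n = (\<Sum>i\<in>{k - j + 1..k}. L \<omega> (m - k + i) n - L \<omega> (m - k + i - 1) n)" if "j \<le> k" for j
      using that
    proof (induction j)
      case (Suc j)
      have "{k - Suc j + 1..k} = insert (k - j) {k - j + 1..k}" using Suc.prems by auto
      moreover have "m - k + (k - j) = m - j" "m - k + (k - j) - 1 = m - Suc j" using k Suc.prems by auto
      ultimately show ?case using Suc by simp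
    qed simp
    have "exp (\<theta> * (j * (1 / \<rho> - 4 * \<theta> / \<rho>\<^sup>2) - (L \<omega> m n - L \<omega> (m - j) n)))
      = (\<Prod>i\<in>{k - j + 1..k}. g' (L \<omega> (m - k + i) n - L \<omega> (m - k + i - 1) n))"
      unfolding g'_def tel[OF j]
      by (subst exp_sum[symmetric]) (use j in \<open>auto simp: sum_distrib_left[symmetric] sum_subtractf\<close>)
    also have "\<dots> \<le> f \<omega>" unfolding f_def by (rule running_max_ge) (use j in \<open>auto simp: g'_def\<close>)
    finally show ?thesis .
  qed
  have "\<P>(\<omega> in M. \<exists>j\<in>{0..k}. s \<le> \<theta> * (j * (1 / \<rho> - 4 * \<theta> / \<rho>\<^sup>2) - (L \<omega> m n - L \<omega> (m - j) n))) \<le> \<P>(\<omega> in M. exp s \<le> f \<omega>)"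
  proof (intro finite_measure_mono subsetI CollectI conjI)
    fix \<omega> assume "\<omega> \<in> {\<omega> \<in> space M. \<exists>j\<in>{0..k}. s \<le> \<theta> * (j * (1 / \<rho> - 4 * \<theta> / \<rho>\<^sup>2) - (L \<omega> m n - L \<omega> (m - j) n))}"
    then obtain j where j: "j \<in> {0..k}" "s \<le> \<theta> * (j * (1 / \<rho> - 4 * \<theta> / \<rho>\<^sup>2) - (L \<omega> m n - L \<omega> (m - j) n))" by blast
    then have "exp s \<le> exp (\<theta> * (j * (1 / \<rho> - 4 * \<theta> / \<rho>\<^sup>2) - (L \<omega> m n - L \<omega> (m - j) n)))" by (subst exp_le_cancel_iff)
    also have "\<dots> \<le> f \<omega>" using ge[of j \<omega>] j by simp
    finally show "exp s \<le> f \<omega>" .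
  qed auto
  also have "\<dots> \<le> 2 * exp (- s)" by (rule markov_ge_1[OF fm _ int]) (simp add: f_def running_max_ge_1)
  finally show ?thesis .
qed

lemma prob_compl_le_imp_ge:
  assumes [measurable]: "Measurable.pred M P" and "\<P>(\<omega> in M. \<not> P \<omega>) \<le> 1 - q"
  shows "q \<le> \<P>(\<omega> in M. P \<omega>)"
  using prob_neg[of P] assms by simp

lemma prob_le_sum_bad:
  assumes "finite I" "\<And>i. i \<in> I \<Longrightarrow> Measurable.pred M (B i)" "\<And>\<omega>. \<omega> \<in> space M \<Longrightarrow> P \<omega> \<Longrightarrow> \<exists>i\<in>I. B i \<omega>"
  shows "\<P>(\<omega> in M. P \<omega>) \<le> (\<Sum>i\<in>I. \<P>(\<omega> in M. B i \<omega>))"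
proof -
  have "\<P>(\<omega> in M. P \<omega>) \<le> prob (\<Union>i\<in>I. {\<omega>\<in>space M. B i \<omega>})"
    by (rule finite_measure_mono) (use assms in auto)
  also have "\<dots> \<le> (\<Sum>i\<in>I. \<P>(\<omega> in M. B i \<omega>))"
    by (rule finite_measure_subadditive_finite) (use assms in auto)
  finally show ?thesis .
qed

lemma bulk_measurable:
  assumes "exp_array M pos_quadrant X"
  shows "(\<lambda>\<omega>. bulk (\<lambda>p. X p \<omega>) m n) \<in> borel_measurable M"
  using exp_arrayD(1)[OF assms] by (intro measurable_lpp) auto

text \<open>
  Take the stationary model of density $z$ slightly below the critical one. It exceeds the shape by $2r^2t$, and
  neither a path that starts along the vertical axis nor one that leaves the horizontal axis after column $k$ of order
  $t^2$ does. So for some $j\le k$ the axis weights up to $j$ together with the passage time from column $j$ to the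
  corner exceed the shape. Reflected, this passage time is the one from the origin to column $m-j+1$, and it differs
  from that to column $m$ by at least the corresponding stationary increments of density $\rho$ slightly above the
  critical one. The boundary walk has slope $1/z$, the increments have slope $1/\rho$, and the slopes differ by
  $O(1/t)$, so over $k$ columns the loss is $O(t)$. The bad events are seven, with total probability at most one half.
\<close>

proposition typical_lower_bound:
  assumes \<eta>: "0 < \<eta>"
  shows "\<exists>C>0. \<exists>T>0. \<forall>X m n t. exp_array M pos_quadrant X \<longrightarrow> aspect (real m) (real n) \<eta> t \<longrightarrow> T \<le> t \<longrightarrow>
     1 / 2 \<le> \<P>(\<omega> in M. shape m n - C * t \<le> bulk (\<lambda>p. X p \<omega>) m n)"
proof -
  (* The value of r makes the bound of stationary_lower_tail equal to 1/8, y is the exit scale required by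
     far_upper_tail, and C collects the losses of the final comparison. *)
  define r where "r = 8 * exp (13 / \<eta> ^ 4)"
  define y where "y = 19 * r / \<eta> ^ 4"
  define C where "C = 14 + 20 * r * y / \<eta>\<^sup>2"
  define T where "T = 6 * r / \<eta> + y / \<eta>\<^sup>2 + 1 / \<eta> + 1 / y + 1"
  have r8: "8 \<le> r" using \<eta> by (simp add: r_def)
  have y0: "0 < y" using \<eta> r8 by (simp add: y_def)
  have "0 < C" using \<eta> r8 y0 by (auto simp: C_def intro!: add_pos_nonneg)
  moreover have "0 < T" using \<eta> r8 y0 by (auto simp: T_def intro!: add_nonneg_pos add_nonneg_nonneg)
  moreover have "1 / 2 \<le> \<P>(\<omega> in M. shape m n - C * t \<le> bulk (\<lambda>p. X p \<omega>) m n)"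
    if X: "exp_array M pos_quadrant X" and asp: "aspect (real m) (real n) \<eta> t" and T: "T \<le> t" for X m n t
  proof -
    interpret aspect "real m" "real n" \<eta> t by fact
    note nn = exp_arrayD(2)[OF X]
    have T': "6 * r / \<eta> \<le> t" "y / \<eta>\<^sup>2 \<le> t" "1 / \<eta> \<le> t" "1 / y \<le> t" "1 \<le> t"
    proof -
      have "0 \<le> 6 * r / \<eta>" "0 \<le> y / \<eta>\<^sup>2" "0 \<le> 1 / \<eta>" "0 \<le> 1 / y" using \<eta> r8 y0 by auto
      then show "6 * r / \<eta> \<le> t" "y / \<eta>\<^sup>2 \<le> t" "1 / \<eta> \<le> t" "1 / y \<le> t" "1 \<le> t" using T unfolding T_def by linarith+
    qed
    have rt: "6 * r \<le> \<eta> * t" "y \<le> \<eta>\<^sup>2 * t" "1 \<le> y * t" using T' \<eta> y0 by (auto simp: field_simps)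
    define k where "k = nat \<lceil>y * t\<^sup>2\<rceil>"
    have yt: "1 \<le> y * t\<^sup>2"
    proof -
      have "1 \<le> y * t * 1" using rt by simp
      also have "\<dots> \<le> y * t * t" using T' y0 by (intro mult_left_mono) auto
      finally show ?thesis by (simp add: power2_eq_square mult.assoc)
    qed
    have k: "y * t\<^sup>2 \<le> real k" "real k \<le> 2 * (y * t\<^sup>2)" "1 \<le> k" and km: "k \<le> m"
      using exit_scale[OF y0 rt(2) yt] unfolding k_def[symmetric] by simp_all
    define Y where "Y = border m n X X"
    define Y' where "Y' = border m n (reflect m n X) X"
    have Y: "exp_array M ({0..m} \<times> {0..n}) Y" and Y': "exp_array M ({0..m} \<times> {0..n}) Y'"
      unfolding Y_def Y'_def using exp_array_border[OF X] by auto
    note nY = exp_arrayD(2)[OF Y] and nY' = exp_arrayD(2)[OF Y']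
    define R where "R = r / t"
    define z where "z = crit m n - R"
    define \<rho> where "\<rho> = crit m n + R"
    define \<theta> where "\<theta> = 1 / t"
    have R: "R \<le> \<eta> / 6" "\<theta> \<le> R / 8" "0 < R" "0 < \<theta>" using rt(1) t r8 by (auto simp: R_def \<theta>_def field_simps)
    have zr: "\<eta> \<le> z" "z < 1" "\<eta> \<le> \<rho>" "\<rho> < 1" "0 < z" "0 < \<rho>" using R crit_ge eta unfolding z_def \<rho>_def by linarith+
    define s where "s = shape m n + 2 * r\<^sup>2 * t"
    define GZ where "GZ = (\<lambda>\<omega>. boundary_lpp (\<lambda>p. Y p \<omega>) z (1 - z) m n)"
    define VZ where "VZ = (\<lambda>\<omega>. ver_lpp (\<lambda>p. Y p \<omega>) (1 - z) m n)"
    define FZ where "FZ = (\<lambda>\<omega>. far_lpp (\<lambda>p. Y p \<omega>) z k m n)"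
    define L where "L = (\<lambda>\<omega>. boundary_lpp (\<lambda>p. Y' p \<omega>) \<rho> (1 - \<rho>))"
    define HR where "HR = (\<lambda>\<omega>. hor_lpp (\<lambda>p. Y' p \<omega>) \<rho> m n)"
    define \<beta> where "\<beta> = 1 / z + 4 * \<theta> / z\<^sup>2"
    define \<beta>' where "\<beta>' = 1 / \<rho> - 4 * \<theta> / \<rho>\<^sup>2"
    (* Outside the events 0 to 2 the optimal path of the model of density z exits early, outside 3 and 4 that of
       the reflected model of density \<rho> leaves through the vertical axis, and outside 5 and 6 the two walks stay
       close to their lines. *)
    define B where "B = (\<lambda>i::nat. \<lambda>\<omega>. if i = 0 then GZ \<omega> \<le> s else if i = 1 then s \<le> VZ \<omega> else if i = 2 then s \<le> FZ \<omega>
       else if i = 3 then L \<omega> m n \<le> s else if i = 4 then s \<le> HR \<omega>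
       else if i = 5 then \<exists>j\<in>{1..k}. 6 \<le> \<theta> * (hsum (\<lambda>p. Y p \<omega>) z j - j * \<beta>)
       else \<exists>j\<in>{0..k}. 6 \<le> \<theta> * (j * \<beta>' - (L \<omega> m n - L \<omega> (m - j) n)))"
    have meas: "GZ \<in> borel_measurable M" "VZ \<in> borel_measurable M" "FZ \<in> borel_measurable M" "HR \<in> borel_measurable M"
      unfolding GZ_def VZ_def FZ_def HR_def using exp_array_lpp_measurable[OF Y] exp_array_lpp_measurable[OF Y'] far_measurable[OF Y km] by auto
    have Lm: "(\<lambda>\<omega>. L \<omega> i n) \<in> borel_measurable M" if "i \<le> m" for i
      unfolding L_def using that exp_arrayD(1)[OF Y'] by (intro measurable_lpp measurable_hsum measurable_vsum) auto
    have hm: "(\<lambda>\<omega>. hsum (\<lambda>p. Y p \<omega>) z j) \<in> borel_measurable M" if "j \<le> m" for j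
      using that exp_arrayD(1)[OF Y] by (intro measurable_hsum) auto
    note [measurable] = meas
    have B: "B 0 = (\<lambda>\<omega>. GZ \<omega> \<le> s)" "B 1 = (\<lambda>\<omega>. s \<le> VZ \<omega>)" "B 2 = (\<lambda>\<omega>. s \<le> FZ \<omega>)"
      "B 3 = (\<lambda>\<omega>. L \<omega> m n \<le> s)" "B 4 = (\<lambda>\<omega>. s \<le> HR \<omega>)"
      "B 5 = (\<lambda>\<omega>. \<exists>j\<in>{1..k}. 6 \<le> \<theta> * (hsum (\<lambda>p. Y p \<omega>) z j - j * \<beta>))"
      by (simp_all add: B_def)
    have B6: "B i = (\<lambda>\<omega>. \<exists>j\<in>{0..k}. 6 \<le> \<theta> * (j * \<beta>' - (L \<omega> m n - L \<omega> (m - j) n)))" if "5 < i" for i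
      using that by (simp add: B_def)
    have Bm: "Measurable.pred M (B i)" for i
    proof -
      have [measurable]: "(\<lambda>\<omega>. L \<omega> m n) \<in> borel_measurable M" by (rule Lm) simp
      have m5: "Measurable.pred M (\<lambda>\<omega>. \<exists>j\<in>{1..k}. 6 \<le> \<theta> * (hsum (\<lambda>p. Y p \<omega>) z j - j * \<beta>))"
      proof (rule pred_intros_finite)
        fix j assume "j \<in> {1..k}"
        then have [measurable]: "(\<lambda>\<omega>. hsum (\<lambda>p. Y p \<omega>) z j) \<in> borel_measurable M" using km by (intro hm) auto
        show "Measurable.pred M (\<lambda>\<omega>. 6 \<le> \<theta> * (hsum (\<lambda>p. Y p \<omega>) z j - j * \<beta>))" by measurable
      qed simp
      have m6: "Measurable.pred M (\<lambda>\<omega>. \<exists>j\<in>{0..k}. 6 \<le> \<theta> * (j * \<beta>' - (L \<omega> m n - L \<omega> (m - j) n)))"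
      proof (rule pred_intros_finite)
        fix j assume "j \<in> {0..k}"
        have [measurable]: "(\<lambda>\<omega>. L \<omega> (m - j) n) \<in> borel_measurable M" by (intro Lm) auto
        show "Measurable.pred M (\<lambda>\<omega>. 6 \<le> \<theta> * (j * \<beta>' - (L \<omega> m n - L \<omega> (m - j) n)))" by measurable
      qed simp
      have m0: "Measurable.pred M (\<lambda>\<omega>. GZ \<omega> \<le> s)" "Measurable.pred M (\<lambda>\<omega>. s \<le> VZ \<omega>)" "Measurable.pred M (\<lambda>\<omega>. s \<le> FZ \<omega>)"
        "Measurable.pred M (\<lambda>\<omega>. L \<omega> m n \<le> s)" "Measurable.pred M (\<lambda>\<omega>. s \<le> HR \<omega>)" by measurable
      consider "i = 0" | "i = 1" | "i = 2" | "i = 3" | "i = 4" | "i = 5" | "5 < i" by linarith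
      then show ?thesis
      proof cases
        case 7 show ?thesis unfolding B6[OF 7] by (rule m6)
      qed (simp_all only: B m0 m5)
    qed
    have e6: "exp (- 6 :: real) \<le> 1 / 64"
    proof -
      have "(2 :: real) ^ 6 \<le> exp 1 ^ 6" using exp_ge_add_one_self[of "1::real"] by (intro power_mono) auto
      also have "exp 1 ^ 6 = exp (6 :: real)" by (simp flip: exp_of_nat_mult)
      finally show ?thesis by (simp add: exp_minus field_simps)
    qed
    have er: "exp (13 / \<eta> ^ 4) / r = 1 / 8" by (simp add: r_def)
    have small: "exp (1 / \<eta> ^ 4 - 2 * (2 * r\<^sup>2)) \<le> 1 / 32" "exp (- 4 * r\<^sup>2) \<le> 1 / 32"
    proof -
      have r2': "8 * r \<le> r\<^sup>2" using r8 unfolding power2_eq_square by (intro mult_right_mono) auto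
      with r8 have r2: "8 * 8 \<le> r\<^sup>2" "8 * r \<le> r\<^sup>2" by linarith+
      have "4 * r\<^sup>2 \<le> exp (4 * r\<^sup>2)" using exp_ge_add_one_self[of "4 * r\<^sup>2"] by linarith
      then have i: "exp (- (4 * r\<^sup>2)) \<le> 1 / (4 * r\<^sup>2)"
        unfolding exp_minus inverse_eq_divide using r2(1) by (intro divide_left_mono mult_pos_pos) linarith+
      also have "\<dots> \<le> 1 / 32" using r2(1) by (intro divide_left_mono mult_pos_pos) linarith+
      finally show "exp (- 4 * r\<^sup>2) \<le> 1 / 32" by simp
      have "exp (1 / \<eta> ^ 4) \<le> exp (13 / \<eta> ^ 4)" using \<eta> by (simp add: divide_right_mono)
      also have "\<dots> = r / 8" by (simp add: r_def)
      finally have "exp (1 / \<eta> ^ 4) * exp (- (4 * r\<^sup>2)) \<le> (r / 8) * (1 / (4 * r\<^sup>2))" using i r8 by (intro mult_mono) auto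
      also have "\<dots> \<le> 1 / 32" using r8 by (simp add: field_simps power2_eq_square)
      finally show "exp (1 / \<eta> ^ 4 - 2 * (2 * r\<^sup>2)) \<le> 1 / 32" by (simp add: exp_diff exp_minus field_simps)
    qed
    have t2: "2 \<le> \<eta> * t" using rt(1) r8 by linarith
    have R1: "1 / t \<le> R" using r8 t by (simp add: R_def divide_right_mono)
    have b: "\<P>(\<omega> in M. B i \<omega>) \<le> (if i = 0 \<or> i = 3 then 1 / 8 else 1 / 32)" for i
    proof -
      consider "i = 0" | "i = 1" | "i = 2" | "i = 3" | "i = 4" | "i = 5" | "5 < i" by linarith
      then show ?thesis
      proof cases
        case 1
        have "\<P>(\<omega> in M. GZ \<omega> \<le> s) \<le> exp (13 / \<eta> ^ 4) / r"
          unfolding GZ_def s_def by (rule stationary_lower_tail[OF Y asp]) (use r8 rt R t in \<open>auto simp: z_def R_def\<close>)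
        then show ?thesis using 1 er by (simp add: B_def)
      next
        case 2
        have "\<P>(\<omega> in M. s \<le> VZ \<omega>) \<le> exp (1 / \<eta> ^ 4 - 2 * (2 * r\<^sup>2))"
          unfolding VZ_def s_def by (rule vertical_upper_tail[OF Y asp t2]) (use R1 in \<open>auto simp: z_def\<close>)
        then show ?thesis using 2 small by (simp add: B_def)
      next
        case 3
        have "\<P>(\<omega> in M. s \<le> FZ \<omega>) \<le> exp (- 4 * r\<^sup>2)"
          unfolding FZ_def s_def z_def R_def by (rule far_upper_tail[OF Y asp]) (use r8 rt km k in \<open>auto simp: y_def\<close>)
        then show ?thesis using 3 small by (simp add: B_def)
      next
        case 4
        have "\<P>(\<omega> in M. L \<omega> m n \<le> s) \<le> exp (13 / \<eta> ^ 4) / r"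
          unfolding L_def s_def by (rule stationary_lower_tail[OF Y' asp]) (use r8 rt R t in \<open>auto simp: \<rho>_def R_def\<close>)
        then show ?thesis using 4 er by (simp add: B_def)
      next
        case 5
        have "\<P>(\<omega> in M. s \<le> HR \<omega>) \<le> exp (1 / \<eta> ^ 4 - 2 * (2 * r\<^sup>2))"
          unfolding HR_def s_def by (rule horizontal_upper_tail[OF Y' asp t2]) (use R1 in \<open>auto simp: \<rho>_def\<close>)
        then show ?thesis using 5 small by (simp add: B_def)
      next
        case 6
        have "\<P>(\<omega> in M. \<exists>j\<in>{1..k}. 6 \<le> \<theta> * (hsum (\<lambda>p. Y p \<omega>) z j - j * \<beta>)) \<le> 2 * exp (- 6)"
          unfolding \<beta>_def by (rule prefix_walk_tail(1)[OF Y km]) (use R zr in auto)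
        then show ?thesis using 6 e6 by (simp add: B_def)
      next
        case 7
        have "\<P>(\<omega> in M. \<exists>j\<in>{0..k}. 6 \<le> \<theta> * (j * \<beta>' - (L \<omega> m n - L \<omega> (m - j) n))) \<le> 2 * exp (- 6)"
          unfolding \<beta>'_def L_def by (rule top_increments_tail[OF Y' km]) (use R zr in auto)
        then show ?thesis using 7 e6 by (simp add: B_def)
      qed
    qed
    have det: "shape m n - C * t \<le> bulk (\<lambda>p. X p \<omega>) m n" if good: "\<And>i. i \<in> {..6} \<Longrightarrow> \<not> B i \<omega>" for \<omega>
    proof -
      have g0: "s < GZ \<omega>" using good[of 0] by (simp add: B_def)
      have g1: "VZ \<omega> < s" using good[of 1] by (simp add: B_def)
      have g2: "FZ \<omega> < s" using good[of 2] by (simp add: B_def)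
      have g3: "s < L \<omega> m n" using good[of 3] by (simp add: B_def)
      have g4: "HR \<omega> < s" using good[of 4] by (simp add: B_def)
      have g5: "hsum (\<lambda>p. Y p \<omega>) z j < j * \<beta> + 6 * t" if "j \<in> {1..k}" for j
      proof -
        have "\<theta> * (hsum (\<lambda>p. Y p \<omega>) z j - j * \<beta>) < 6" using good[of 5] that by (auto simp: B_def not_le)
        then show ?thesis using t by (simp add: \<theta>_def field_simps)
      qed
      have g6: "j * \<beta>' - (L \<omega> m n - L \<omega> (m - j) n) < 6 * t" if "j \<in> {0..k}" for j
      proof -
        have "\<theta> * (j * \<beta>' - (L \<omega> m n - L \<omega> (m - j) n)) < 6" using good[of 6] that by (auto simp: B_def not_le)
        then show ?thesis using t by (simp add: \<theta>_def field_simps)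
      qed
      let ?Y = "\<lambda>p. Y p \<omega>" and ?Y' = "\<lambda>p. Y' p \<omega>" and ?X = "\<lambda>p. X p \<omega>"
      let ?A = "hsum ?Y z"
      have "GZ \<omega> = max (lpp ?A (\<lambda>_. 0) ?Y m n) (VZ \<omega>)" unfolding GZ_def VZ_def
        by (rule lpp_split_boundary) (use nY zr in \<open>auto intro!: hsum_nonneg vsum_nonneg\<close>)
      then have "s < lpp ?A (\<lambda>_. 0) ?Y m n" using g0 g1 by (auto simp: max_def split: if_splits)
      moreover have "lpp ?A (\<lambda>_. 0) ?Y m n \<le> max (lpp (\<lambda>i. min (?A i) (?A k)) (\<lambda>_. 0) ?Y m n) (FZ \<omega>)"
        using lpp_near_far[of ?A ?Y "m - k" k n] km mono_hsum[of z ?Y] nY zr unfolding FZ_def by simp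
      ultimately have near: "s < lpp (\<lambda>i. min (?A i) (?A k)) (\<lambda>_. 0) ?Y m n" using g2 by linarith
      let ?H = "bulk ?X m n"
      (* Over k steps the two lines separate by O(t) only. *)
      have \<beta>: "k * (\<beta> - \<beta>') + \<beta>' \<le> (C - 12) * t"
      proof -
        have "1 / z - 1 / \<rho> = 2 * R / (z * \<rho>)" using zr by (simp add: field_simps z_def \<rho>_def)
        also have "\<dots> \<le> 2 * R / (\<eta> * \<eta>)" using zr R eta by (intro divide_left_mono mult_mono mult_pos_pos) auto
        finally have 1: "1 / z - 1 / \<rho> \<le> 2 * R / \<eta>\<^sup>2" by (simp add: power2_eq_square)
        have 2: "4 * \<theta> / x\<^sup>2 \<le> R / \<eta>\<^sup>2" if "\<eta> \<le> x" for x
          using that eta R by (intro frac_le power_mono) auto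
        have "\<beta> - \<beta>' \<le> 4 * R / \<eta>\<^sup>2" using 1 2[of z] 2[of \<rho>] zr unfolding \<beta>_def \<beta>'_def by (simp add: diff_divide_distrib)
        then have "k * (\<beta> - \<beta>') \<le> k * (4 * R / \<eta>\<^sup>2)" by (intro mult_left_mono) auto
        also have "\<dots> \<le> 2 * (y * t\<^sup>2) * (4 * R / \<eta>\<^sup>2)" using k R by (intro mult_right_mono) auto
        also have "\<dots> = 8 * r * y / \<eta>\<^sup>2 * t" using t by (simp add: R_def power2_eq_square)
        finally have 3: "k * (\<beta> - \<beta>') \<le> 8 * r * y / \<eta>\<^sup>2 * t" .
        have "\<beta>' \<le> 1 / \<rho>" using R by (simp add: \<beta>'_def)
        also have "\<dots> \<le> 1 / \<eta>" using zr eta by (intro divide_left_mono) auto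
        also have "\<dots> \<le> t" by (rule T')
        finally have 4: "\<beta>' \<le> t" .
        have "8 * r * y / \<eta>\<^sup>2 * t \<le> 20 * r * y / \<eta>\<^sup>2 * t" using r8 y0 eta t by (intro mult_right_mono divide_right_mono) auto
        then show ?thesis using 3 4 t by (simp add: C_def distrib_right)
      qed
      have \<beta>\<beta>': "0 \<le> \<beta> - \<beta>'"
      proof -
        have "1 / \<rho> \<le> 1 / z" using zr R by (intro divide_left_mono) (auto simp: z_def \<rho>_def)
        moreover have "0 \<le> 4 * \<theta> / z\<^sup>2" "0 \<le> 4 * \<theta> / \<rho>\<^sup>2" using R by auto
        ultimately show ?thesis unfolding \<beta>_def \<beta>'_def by linarith
      qed
      have "lpp (\<lambda>i. min (?A i) (?A k)) (\<lambda>_. 0) ?Y m n \<le> ?H + C * t"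
      proof (rule lpp_near_le)
        fix j assume j: "1 \<le> j" "j \<le> k"
        have jm: "j \<le> m" using j km by simp
        have "bulk (shift (j - 1) 0 ?Y) (m - j + 1) n = bulk (shift (j - 1) 0 ?X) (m - j + 1) n"
          by (rule lpp_cong) (auto simp: Y_def border_interior)
        also have "\<dots> = bulk (reflect m n ?X) (m - j + 1) n"
          by (rule bulk_shift_reflect) (use nn j jm in auto)
        finally have hj: "bulk (shift (j - 1) 0 ?Y) (m - j + 1) n = bulk (reflect m n ?X) (m - j + 1) n" .
        have "L \<omega> m n - L \<omega> (m - j + 1) n \<le> bulk (reflect m n ?X) m n - bulk (reflect m n ?X) (m - j + 1) n"
          unfolding L_def
        proof (rule bulk_increment_ge)
          show "0 \<le> reflect m n ?X p" for p using nn by (auto simp: reflect_def split: prod.split)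
          show "hor_lpp ?Y' \<rho> m n < boundary_lpp ?Y' \<rho> (1 - \<rho>) m n"
            using g3 g4 unfolding L_def HR_def by simp
        qed (use zr j jm nY' in \<open>auto simp: Y'_def border_interior reflect_def\<close>)
        moreover have "bulk (reflect m n ?X) m n = ?H" by (rule bulk_reflect) (rule nn)
        moreover have "m - (j - 1) = m - j + 1" using j jm by simp
        moreover have "real (j - 1) * \<beta>' - (L \<omega> m n - L \<omega> (m - (j - 1)) n) < 6 * t" by (rule g6) (use j in auto)
        ultimately have "bulk (shift (j - 1) 0 ?Y) (m - j + 1) n \<le> ?H + 6 * t - real (j - 1) * \<beta>'"
          unfolding hj by simp
        moreover have "?A j < j * \<beta> + 6 * t" by (rule g5) (use j in auto)
        moreover have "real (j - 1) * \<beta>' = j * \<beta>' - \<beta>'" using j by (simp add: of_nat_diff algebra_simps)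
        moreover have "j * \<beta> - j * \<beta>' \<le> k * (\<beta> - \<beta>')"
          using j \<beta>\<beta>' mult_right_mono[of "real j" "real k" "\<beta> - \<beta>'"] by (simp add: right_diff_distrib)
        ultimately show "?A j + bulk (shift (j - 1) 0 ?Y) (m - j + 1) n \<le> ?H + C * t"
          using \<beta> by (simp add: left_diff_distrib)
      qed (use mono_hsum[of z ?Y] nY zr k km in auto)
      moreover have "shape m n \<le> s" using t by (simp add: s_def)
      ultimately show ?thesis using near by linarith
    qed
    show ?thesis
    proof (rule prob_compl_le_imp_ge)
      show "Measurable.pred M (\<lambda>\<omega>. shape m n - C * t \<le> bulk (\<lambda>p. X p \<omega>) m n)"
        using bulk_measurable[OF X] by measurable
      have "\<P>(\<omega> in M. \<not> shape m n - C * t \<le> bulk (\<lambda>p. X p \<omega>) m n) \<le> (\<Sum>i\<in>{..6::nat}. \<P>(\<omega> in M. B i \<omega>))"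
        by (rule prob_le_sum_bad) (use Bm det in auto)
      also have "\<dots> \<le> (\<Sum>i\<in>{..6::nat}. if i = 0 \<or> i = 3 then 1 / 8 else 1 / 32)" by (rule sum_mono) (rule b)
      also have "\<dots> \<le> 1 - 1 / 2" by (simp add: eval_nat_numeral)
      finally show "\<P>(\<omega> in M. \<not> shape m n - C * t \<le> bulk (\<lambda>p. X p \<omega>) m n) \<le> 1 - 1 / 2" .
    qed
  qed
  ultimately show ?thesis by blast
qed

end

section \<open>Replacing the boundary walk by its mean profile\<close>

lemma prefix_running_max:
  assumes "\<And>x. 0 \<le> g x" "j \<le> k"
  shows "(\<Prod>l\<in>{1..j}. g (y l)) \<le> running_max g (\<lambda>i. y (k + 1 - i)) k"
proof -
  have "(\<Prod>l\<in>{1..j}. g (y l)) = (\<Prod>i\<in>{k - j + 1..k}. g (y (k + 1 - i)))"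
    by (rule prod.reindex_bij_witness[of _ "\<lambda>i. k + 1 - i" "\<lambda>i. k + 1 - i"]) (use assms(2) in auto)
  also have "\<dots> \<le> running_max g (\<lambda>i. y (k + 1 - i)) k" by (rule running_max_ge) (use assms in auto)
  finally show ?thesis .
qed

text \<open>
  The mean of a boundary walk of rate $1/\beta$, frozen after column \<open>k\<close>.
\<close>

abbreviation ramp :: "real \<Rightarrow> nat \<Rightarrow> nat \<Rightarrow> real" where
  "ramp \<beta> k i \<equiv> \<beta> * real (min i k)"

text \<open>
  The shape is concave in the number of columns with derivative \<open>1 / crit m n\<close>, and over $x$ of order
  $t^2$ columns the second order term is of order $t$.
\<close>

lemma shape_shift_lower:
  assumes "aspect m n \<eta> t" "0 \<le> x" "x \<le> m" "x \<le> 2 * y * t\<^sup>2" "0 < y"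
  shows "shape m n + x / crit m n - y\<^sup>2 / (2 * \<eta> ^ 3) * t \<le> shape (m + x) n"
proof -
  interpret aspect m n \<eta> t by fact
  define u where "u = x / m"
  have u: "0 \<le> u" "u \<le> 1" "x = u * m" using assms mn by (auto simp: u_def)
  have sq: "1 + u / 2 - u\<^sup>2 / 2 \<le> sqrt (1 + u)"
  proof (rule real_le_rsqrt)
    have "u * (u * (u * u)) \<le> 1 * (u * (u * u))" using u by (intro mult_right_mono) auto
    moreover have "0 \<le> u * (u * u)" "0 \<le> u * u" using u by auto
    moreover have "(1 + u / 2 - u\<^sup>2 / 2)\<^sup>2 = 1 + u - 3 / 4 * (u * u) - u * (u * u) / 2 + u * (u * (u * u)) / 4"
      by (simp add: power2_eq_square algebra_simps)
    ultimately show "(1 + u / 2 - u\<^sup>2 / 2)\<^sup>2 \<le> 1 + u" by linarith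
  qed
  have s0: "0 < sqrt m" "0 < sqrt n" using mn by auto
  have "sqrt (m + x) = sqrt m * sqrt (1 + u)"
    using u mn by (simp add: real_sqrt_mult[symmetric] algebra_simps)
  moreover have "shape (m + x) n = m + x + n + 2 * sqrt (m + x) * sqrt n"
    using mn assms(2) by (simp add: shape_def power2_sum)
  ultimately have "shape (m + x) n = m + x + n + 2 * sqrt m * sqrt n * sqrt (1 + u)"
    by simp
  also have "\<dots> \<ge> m + x + n + 2 * sqrt m * sqrt n * (1 + u / 2 - u\<^sup>2 / 2)"
    using sq mn by (intro add_left_mono mult_left_mono) auto
  moreover have "m + x + n + 2 * sqrt m * sqrt n * (1 + u / 2 - u\<^sup>2 / 2) = shape m n + (x + sqrt m * sqrt n * u) - sqrt m * sqrt n * u\<^sup>2"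
    using mn by (simp add: shape_def power2_sum algebra_simps)
  moreover have "x + sqrt m * sqrt n * u = x / crit m n"
  proof -
    have "x / crit m n = x * ((sqrt m + sqrt n) / sqrt m)" by (simp add: crit_def)
    also have "\<dots> = x + x * sqrt n / sqrt m" using s0 by (simp add: add_divide_distrib distrib_left)
    also have "x * sqrt n / sqrt m = sqrt m * sqrt n * u"
    proof -
      have "x * sqrt n / a = a * sqrt n * u" if "x = u * (a * a)" "0 < a" for a using that by simp
      from this[of "sqrt m"] show ?thesis using u(3) mn by simp
    qed
    finally show ?thesis by simp
  qed
  moreover have "sqrt m * sqrt n * u\<^sup>2 \<le> y\<^sup>2 / (2 * \<eta> ^ 3) * t"
  proof -
    let ?z = "crit m n" and ?S = "shape m n"
    have S0: "0 < ?S" using shape_ge mn by linarith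
    have z0: "0 < ?z" "2 * \<eta> \<le> ?z" "?z < 1" using crit_ge eta crit_bounds mn by auto
    have sm: "sqrt m = sqrt ?S * ?z" "sqrt n = sqrt ?S * (1 - ?z)"
      using crit_square[OF mn] z0 by (metis real_sqrt_mult real_sqrt_abs abs_of_pos, metis real_sqrt_mult real_sqrt_abs abs_of_pos diff_gt_0_iff_gt)
    have "sqrt m * sqrt n * u\<^sup>2 = ?S * ?z * (1 - ?z) * (x / m)\<^sup>2"
      using S0 unfolding sm u_def by simp
    also have "\<dots> = ?S * ?z * (1 - ?z) * (x / (?S * ?z\<^sup>2))\<^sup>2" using crit_square(1)[OF mn] by simp
    also have "\<dots> = (1 - ?z) * x\<^sup>2 / (?S * ?z ^ 3)"
      using S0 z0 by (simp add: power2_eq_square power3_eq_cube divide_simps)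
    also have "\<dots> \<le> 1 * (2 * y * t\<^sup>2)\<^sup>2 / (t ^ 3 * (2 * \<eta>) ^ 3)"
      using z0 S0 shape_ge n_t t eta assms by (intro frac_le mult_mono power_mono mult_pos_pos) auto
    also have "\<dots> = y\<^sup>2 / (2 * \<eta> ^ 3) * t"
      using t eta by (simp add: field_simps power2_eq_square power3_eq_cube)
    finally show ?thesis .
  qed
  ultimately show ?thesis by linarith
qed

context prob_space begin

lemma paley_zygmund:
  assumes [measurable]: "U \<in> borel_measurable M" and U: "\<And>\<omega>. 0 \<le> U \<omega>" and Q: "0 < Q" "0 < Q2"
    and m1: "ennreal Q \<le> (\<integral>\<^sup>+\<omega>. ennreal (U \<omega>) \<partial>M)" and m2: "(\<integral>\<^sup>+\<omega>. ennreal ((U \<omega>)\<^sup>2) \<partial>M) \<le> ennreal Q2"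
  shows "Q\<^sup>2 / (4 * Q2) \<le> \<P>(\<omega> in M. Q / 2 \<le> U \<omega>)"
proof -
  let ?P = "\<P>(\<omega> in M. Q / 2 \<le> U \<omega>)"
  have pt: "u \<le> Q / 2 + Q / (4 * Q2) * u\<^sup>2 + Q2 / Q * (if Q / 2 \<le> u then 1 else 0)" if "0 \<le> u" for u
  proof (cases "Q / 2 \<le> u")
    case True
    have "0 \<le> (Q * u - 2 * Q2)\<^sup>2 / (4 * Q2 * Q)" using Q by simp
    also have "\<dots> = Q / (4 * Q2) * u\<^sup>2 + Q2 / Q - u" using Q by (simp add: field_simps power2_eq_square)
    finally show ?thesis using True Q by simp
  next
    case False then show ?thesis using Q by (simp add: add_increasing2)
  qed
  have "ennreal Q \<le> (\<integral>\<^sup>+\<omega>. ennreal (U \<omega>) \<partial>M)" by (rule m1)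
  also have "\<dots> \<le> (\<integral>\<^sup>+\<omega>. ennreal (Q / 2) + ennreal (Q / (4 * Q2)) * ennreal ((U \<omega>)\<^sup>2) + ennreal (Q2 / Q) * indicator {\<omega>\<in>space M. Q / 2 \<le> U \<omega>} \<omega> \<partial>M)"
  proof (rule nn_integral_mono)
    fix \<omega> assume \<omega>: "\<omega> \<in> space M"
    have i: "indicator {\<omega>\<in>space M. Q / 2 \<le> U \<omega>} \<omega> = ennreal (if Q / 2 \<le> U \<omega> then 1 else 0)" using \<omega> by (simp add: indicator_def)
    show "ennreal (U \<omega>) \<le> ennreal (Q / 2) + ennreal (Q / (4 * Q2)) * ennreal ((U \<omega>)\<^sup>2) + ennreal (Q2 / Q) * indicator {\<omega>\<in>space M. Q / 2 \<le> U \<omega>} \<omega>"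
      unfolding i using Q pt[OF U] by (simp add: ennreal_leI flip: ennreal_mult' ennreal_plus)
  qed
  also have "\<dots> = ennreal (Q / 2) + ennreal (Q / (4 * Q2)) * (\<integral>\<^sup>+\<omega>. ennreal ((U \<omega>)\<^sup>2) \<partial>M) + ennreal (Q2 / Q) * ennreal ?P"
    by (simp add: nn_integral_add nn_integral_cmult emeasure_eq_measure prob_space)
  also have "\<dots> \<le> ennreal (Q / 2) + ennreal (Q / (4 * Q2)) * ennreal Q2 + ennreal (Q2 / Q) * ennreal ?P"
    by (intro add_mono mult_left_mono m2) auto
  also have "\<dots> = ennreal (Q / 2 + Q / (4 * Q2) * Q2 + Q2 / Q * ?P)"
    using Q by (simp flip: ennreal_mult' ennreal_plus)
  finally have "Q \<le> Q / 2 + Q / (4 * Q2) * Q2 + Q2 / Q * ?P"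
    using Q by (subst (asm) ennreal_le_iff) auto
  then show ?thesis using Q by (simp add: field_simps power2_eq_square)
qed

lemma ramp_measurable:
  assumes Y: "exp_array M ({0..m} \<times> {0..n}) Y"
  shows "(\<lambda>\<omega>. lpp (ramp \<beta> k) (\<lambda>_. 0) (\<lambda>p. Y p \<omega>) m n) \<in> borel_measurable M"
  using exp_arrayD(1)[OF Y] by (intro measurable_lpp) auto

text \<open>
  The running maximum involves axis weights only and the sloped passage time only inner weights.
\<close>

lemma ramp_indep:
  assumes Y: "exp_array M ({0..m} \<times> {0..n}) Y" and k: "k \<le> m" and g: "g \<in> borel_measurable borel"
    and e: "e \<in> borel_measurable borel"
  shows "(\<integral>\<^sup>+\<omega>. ennreal (e (running_max g (\<lambda>i. Y (k + 1 - i, 0) \<omega>) k)) * ennreal (exp (a * lpp (ramp \<beta> k) (\<lambda>_. 0) (\<lambda>p. Y p \<omega>) m n)) \<partial>M)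
    = (\<integral>\<^sup>+\<omega>. ennreal (e (running_max g (\<lambda>i. Y (k + 1 - i, 0) \<omega>) k)) \<partial>M) * (\<integral>\<^sup>+\<omega>. ennreal (exp (a * lpp (ramp \<beta> k) (\<lambda>_. 0) (\<lambda>p. Y p \<omega>) m n)) \<partial>M)"
proof -
  let ?A = "{1..k} \<times> {0::nat}" and ?B = "{1..m} \<times> {1..n}"
  define f where "f = (\<lambda>x :: nat \<times> nat \<Rightarrow> real. ennreal (e (running_max g (\<lambda>i. x (k + 1 - i, 0)) k)))"
  define G where "G = (\<lambda>x. ennreal (exp (a * lpp (ramp \<beta> k) (\<lambda>_. 0) x m n)))"
  have f: "f \<in> borel_measurable (PiM ?A (\<lambda>_. borel))" unfolding f_def
    by (intro measurable_compose[OF _ measurable_ennreal] measurable_compose[OF _ e] running_max_measurable[OF g] measurable_component_singleton) auto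
  have G: "G \<in> borel_measurable (PiM ?B (\<lambda>_. borel))" unfolding G_def
    by (intro measurable_compose[OF _ measurable_ennreal] borel_measurable_exp[THEN measurable_compose[rotated]]
       borel_measurable_times borel_measurable_const measurable_lpp measurable_component_singleton) auto
  have run: "running_max g (\<lambda>i. (\<lambda>p\<in>?A. Y p \<omega>) (k + 1 - i, 0)) l = running_max g (\<lambda>i. Y (k + 1 - i, 0) \<omega>) l" if "l \<le> k" for l \<omega>
    using that by (induction l) auto
  have 1: "f (\<lambda>p\<in>?A. Y p \<omega>) = ennreal (e (running_max g (\<lambda>i. Y (k + 1 - i, 0) \<omega>) k))" for \<omega>
    unfolding f_def run[OF order_refl] ..
  have 2: "G (\<lambda>p\<in>?B. Y p \<omega>) = ennreal (exp (a * lpp (ramp \<beta> k) (\<lambda>_. 0) (\<lambda>p. Y p \<omega>) m n))" for \<omega>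
    unfolding G_def by (intro arg_cong[where f=ennreal] arg_cong[where f=exp] arg_cong2[where f="(*)"] refl lpp_cong) auto
  have "(\<integral>\<^sup>+\<omega>. f (\<lambda>p\<in>?A. Y p \<omega>) * G (\<lambda>p\<in>?B. Y p \<omega>) \<partial>M)
       = (\<integral>\<^sup>+\<omega>. f (\<lambda>p\<in>?A. Y p \<omega>) \<partial>M) * (\<integral>\<^sup>+\<omega>. G (\<lambda>p\<in>?B. Y p \<omega>) \<partial>M)"
    by (rule exp_array_indep_nn_integral[OF Y _ _ _ f G]) (use k in auto)
  then show ?thesis unfolding 1 2 .
qed

text \<open>
  The boundary walk exceeds a line of slightly larger slope by at most the logarithm of the running maximum divided by
  $2h$. This excess is independent of the inner weights and costs a factor 2 in the moment.
\<close>

lemma near_le_ramp: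
  assumes Y: "exp_array M ({0..m} \<times> {0..n}) Y" and k: "k \<le> m" and h: "0 < h" "8 * h \<le> w"
  defines "\<beta> \<equiv> 1 / w + 8 * h / w\<^sup>2"
  shows "(\<integral>\<^sup>+\<omega>. ennreal (exp (2 * h * near_lpp (\<lambda>p. Y p \<omega>) w k m n)) \<partial>M)
    \<le> 2 * (\<integral>\<^sup>+\<omega>. ennreal (exp (2 * h * lpp (ramp \<beta> k) (\<lambda>_. 0) (\<lambda>p. Y p \<omega>) m n)) \<partial>M)"
proof -
  note nn = exp_arrayD(2)[OF Y]
  define g where "g = (\<lambda>u. exp (2 * h * (u / w - (1 / w + 4 * (2 * h) / w\<^sup>2))))"
  define R where "R = (\<lambda>\<omega>. running_max g (\<lambda>i. Y (k + 1 - i, 0) \<omega>) k)"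
  have \<beta>: "\<beta> = 1 / w + 4 * (2 * h) / w\<^sup>2" by (simp add: \<beta>_def)
  have w: "0 < w" using h by simp
  have pt: "exp (2 * h * near_lpp (\<lambda>p. Y p \<omega>) w k m n)
      \<le> R \<omega> * exp (2 * h * lpp (ramp \<beta> k) (\<lambda>_. 0) (\<lambda>p. Y p \<omega>) m n)" for \<omega>
  proof -
    let ?A = "hsum (\<lambda>p. Y p \<omega>) w"
    define W where "W = ln (R \<omega>) / (2 * h)"
    have R1: "1 \<le> R \<omega>" unfolding R_def by (rule running_max_ge_1)
    have W: "0 \<le> W" "exp (2 * h * W) = R \<omega>" using R1 h by (auto simp: W_def)
    have le: "?A j \<le> \<beta> * real j + W" if "j \<le> k" for j
    proof (cases "j = 0")
      case False
      then have "exp (2 * h * (?A j - j * \<beta>)) \<le> exp (2 * h * W)"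
        using prefix_walk_tail(3)[OF Y k, of "2 * h" w j \<omega>] h that unfolding W(2) R_def g_def \<beta> by simp
      then have "2 * h * (?A j - j * \<beta>) \<le> 2 * h * W" by (subst (asm) exp_le_cancel_iff)
      then have "?A j - j * \<beta> \<le> W" by (rule mult_left_le_imp_le) (use h in simp)
      then show ?thesis by (simp add: mult.commute)
    qed (use W in simp)
    have "lpp (\<lambda>i. min (?A i) (?A k)) (\<lambda>_. 0) (\<lambda>p. Y p \<omega>) m n \<le> lpp (\<lambda>i. ramp \<beta> k i + W) (\<lambda>_. 0 + W) (\<lambda>p. Y p \<omega>) m n"
    proof (rule lpp_mono)
      fix i have "min (?A i) (?A k) = ?A (min i k)"
        using mono_hsum[of w "\<lambda>p. Y p \<omega>"] w nn by (auto simp: min_def mono_def intro: antisym)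
      then show "min (?A i) (?A k) \<le> ramp \<beta> k i + W" using le[of "min i k"] by simp
    qed (use W in auto)
    also have "\<dots> = lpp (ramp \<beta> k) (\<lambda>_. 0) (\<lambda>p. Y p \<omega>) m n + W" by (rule lpp_add)
    finally have "exp (2 * h * lpp (\<lambda>i. min (?A i) (?A k)) (\<lambda>_. 0) (\<lambda>p. Y p \<omega>) m n) \<le> exp (2 * h * (lpp (ramp \<beta> k) (\<lambda>_. 0) (\<lambda>p. Y p \<omega>) m n + W))"
      using h by simp
    then show ?thesis by (simp only: distrib_left exp_add W(2) mult.commute[of "R \<omega>"])
  qed
  have gm: "g \<in> borel_measurable borel" unfolding g_def by measurable
  have "(\<integral>\<^sup>+\<omega>. ennreal (exp (2 * h * near_lpp (\<lambda>p. Y p \<omega>) w k m n)) \<partial>M)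
    \<le> (\<integral>\<^sup>+\<omega>. ennreal (R \<omega>) * ennreal (exp (2 * h * lpp (ramp \<beta> k) (\<lambda>_. 0) (\<lambda>p. Y p \<omega>) m n)) \<partial>M)"
    using pt running_max_ge_1 by (intro nn_integral_mono) (simp add: ennreal_leI flip: ennreal_mult'')
  also have "\<dots> = (\<integral>\<^sup>+\<omega>. ennreal (R \<omega>) \<partial>M) * (\<integral>\<^sup>+\<omega>. ennreal (exp (2 * h * lpp (ramp \<beta> k) (\<lambda>_. 0) (\<lambda>p. Y p \<omega>) m n)) \<partial>M)"
    unfolding R_def by (rule ramp_indep[OF Y k gm, of "\<lambda>x. x"]) simp
  also have "\<dots> \<le> 2 * (\<integral>\<^sup>+\<omega>. ennreal (exp (2 * h * lpp (ramp \<beta> k) (\<lambda>_. 0) (\<lambda>p. Y p \<omega>) m n)) \<partial>M)"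
    using prefix_walk_tail(2)[OF Y k, of "2 * h" w] h unfolding R_def g_def by (intro mult_right_mono) auto
  finally show ?thesis .
qed

text \<open>
  The converse of \<open>near_le_ramp\<close>: the walk falls below a line of slightly smaller slope by at most the
  logarithm of a running maximum $R$ divided by $\theta$, and $E(1/R)\ge\frac12$ because $ER\le2$.
\<close>

lemma ramp_le_horizontal:
  assumes Y: "exp_array M ({0..m} \<times> {0..n}) Y" and k: "k \<le> m" and \<theta>: "0 < \<theta>" "4 * \<theta> \<le> w"
  defines "\<beta> \<equiv> 1 / w - 4 * \<theta> / w\<^sup>2"
  shows "(\<integral>\<^sup>+\<omega>. ennreal (exp (\<theta> * lpp (ramp \<beta> k) (\<lambda>_. 0) (\<lambda>p. Y p \<omega>) m n)) \<partial>M)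
    \<le> 2 * (\<integral>\<^sup>+\<omega>. ennreal (exp (\<theta> * hor_lpp (\<lambda>p. Y p \<omega>) w m n)) \<partial>M)"
proof -
  note nn = exp_arrayD(2)[OF Y]
  define g where "g = (\<lambda>u. exp (\<theta> * ((1 / w - 4 * \<theta> / w\<^sup>2) - u / w)))"
  define R where "R = (\<lambda>\<omega>. running_max g (\<lambda>i. Y (k + 1 - i, 0) \<omega>) k)"
  have w: "0 < w" using \<theta> by simp
  have R1: "1 \<le> R \<omega>" for \<omega> unfolding R_def by (rule running_max_ge_1)
  have gm: "g \<in> borel_measurable borel" unfolding g_def by measurable
  have U: "exp_array M {1..k} (\<lambda>i. Y ((\<lambda>i. (k + 1 - i, 0)) i))"
    by (rule exp_array_reindex[OF Y]) (use k in \<open>auto simp: inj_on_def\<close>)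
  have Rm[measurable]: "R \<in> borel_measurable M" unfolding R_def
    by (rule running_max_measurable[OF gm]) (use exp_arrayD(1)[OF U] in auto)
  have Rint: "(\<integral>\<^sup>+\<omega>. ennreal (R \<omega>) \<partial>M) \<le> 2"
    using walk_lower_moment[OF U \<theta>] unfolding R_def g_def by simp
  have inv: "1 \<le> 2 * (\<integral>\<^sup>+\<omega>. ennreal (1 / R \<omega>) \<partial>M)"
  proof -
    have "(\<integral>\<^sup>+\<omega>. ennreal (1 / 4) * ennreal (R \<omega>) \<partial>M) + (\<integral>\<^sup>+\<omega>. ennreal (1 / R \<omega>) \<partial>M) = (\<integral>\<^sup>+\<omega>. ennreal (1 / 4) * ennreal (R \<omega>) + ennreal (1 / R \<omega>) \<partial>M)"
      by (rule nn_integral_add[symmetric]) measurable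
    also have "\<dots> \<ge> (\<integral>\<^sup>+\<omega>. 1 \<partial>M)"
    proof (rule nn_integral_mono)
      fix \<omega>
      have "0 \<le> (R \<omega> - 2)\<^sup>2 / (4 * R \<omega>)" using R1[of \<omega>] by simp
      also have "\<dots> = 1 / 4 * R \<omega> + 1 / R \<omega> - 1" using R1[of \<omega>] by (simp add: field_simps power2_eq_square)
      finally have "1 \<le> 1 / 4 * R \<omega> + 1 / R \<omega>" by simp
      then have "ennreal 1 \<le> ennreal (1 / 4 * R \<omega> + 1 / R \<omega>)" by (rule ennreal_leI)
      also have "\<dots> = ennreal (1 / 4) * ennreal (R \<omega>) + ennreal (1 / R \<omega>)"
        using R1[of \<omega>] by (subst ennreal_plus) (auto simp flip: ennreal_mult')
      finally show "1 \<le> ennreal (1 / 4) * ennreal (R \<omega>) + ennreal (1 / R \<omega>)" by simp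
    qed
    finally have 1: "1 \<le> (\<integral>\<^sup>+\<omega>. ennreal (1 / 4) * ennreal (R \<omega>) \<partial>M) + (\<integral>\<^sup>+\<omega>. ennreal (1 / R \<omega>) \<partial>M)"
      by (simp add: emeasure_space_1)
    have "(\<integral>\<^sup>+\<omega>. ennreal (1 / 4) * ennreal (R \<omega>) \<partial>M) = ennreal (1 / 4) * (\<integral>\<^sup>+\<omega>. ennreal (R \<omega>) \<partial>M)"
      by (rule nn_integral_cmult) measurable
    also have "\<dots> \<le> ennreal (1 / 4) * ennreal 2" using Rint by (intro mult_left_mono) auto
    also have "\<dots> = ennreal (1 / 2)" using ennreal_mult'[of "1 / 4" 2] by simp
    finally have 2: "(\<integral>\<^sup>+\<omega>. ennreal (1 / 4) * ennreal (R \<omega>) \<partial>M) \<le> ennreal (1 / 2)" .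
    have le1: "(\<integral>\<^sup>+\<omega>. ennreal (1 / R \<omega>) \<partial>M) \<le> (\<integral>\<^sup>+\<omega>. 1 \<partial>M)" using R1 by (intro nn_integral_mono) (simp add: divide_le_eq)
    then obtain v where v: "(\<integral>\<^sup>+\<omega>. ennreal (1 / R \<omega>) \<partial>M) = ennreal v" "0 \<le> v"
      by (cases "(\<integral>\<^sup>+\<omega>. ennreal (1 / R \<omega>) \<partial>M)") (auto simp: emeasure_space_1 top_unique)
    have "ennreal 1 \<le> ennreal (1 / 2) + ennreal v" using order_trans[OF 1 add_right_mono[OF 2]] v by simp
    also have "\<dots> = ennreal (1 / 2 + v)" using v(2) by (intro ennreal_plus[symmetric]) auto
    finally have "1 \<le> 1 / 2 + v" using v(2) by (subst (asm) ennreal_le_iff) auto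
    then have "ennreal 1 \<le> ennreal (2 * v)" by (intro ennreal_leI) simp
    then show ?thesis using v by (simp add: ennreal_mult')
  qed
  have pt: "1 / R \<omega> * exp (\<theta> * lpp (ramp \<beta> k) (\<lambda>_. 0) (\<lambda>p. Y p \<omega>) m n)
     \<le> exp (\<theta> * hor_lpp (\<lambda>p. Y p \<omega>) w m n)" for \<omega>
  proof -
    let ?A = "hsum (\<lambda>p. Y p \<omega>) w"
    define W where "W = ln (R \<omega>) / \<theta>"
    have W: "0 \<le> W" "exp (\<theta> * W) = R \<omega>" using R1[of \<omega>] \<theta> by (auto simp: W_def)
    have le: "\<beta> * real j \<le> ?A j + W" if "j \<le> k" for j
    proof -
      have "exp (\<theta> * (j * \<beta> - ?A j)) = (\<Prod>l\<in>{1..j}. g (Y (l, 0) \<omega>))"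
        unfolding g_def hsum_def \<beta>_def
        by (subst exp_sum[symmetric]) (auto simp: sum_distrib_left[symmetric] sum_subtractf sum_divide_distrib[symmetric])
      also have "\<dots> \<le> exp (\<theta> * W)" unfolding W R_def by (rule prefix_running_max) (use that in \<open>auto simp: g_def\<close>)
      finally have "\<theta> * (j * \<beta> - ?A j) \<le> \<theta> * W" by (subst (asm) exp_le_cancel_iff)
      then have "j * \<beta> - ?A j \<le> W" by (rule mult_left_le_imp_le) (use \<theta> in simp)
      then show ?thesis by (simp add: mult.commute)
    qed
    have "lpp (ramp \<beta> k) (\<lambda>_. 0) (\<lambda>p. Y p \<omega>) m n \<le> lpp (\<lambda>i. ?A i + W) (\<lambda>_. 0 + W) (\<lambda>p. Y p \<omega>) m n"
    proof (rule lpp_mono)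
      fix i have "?A (min i k) \<le> ?A i" using mono_hsum[of w "\<lambda>p. Y p \<omega>"] w nn by (auto simp: mono_def)
      then show "ramp \<beta> k i \<le> ?A i + W" using le[of "min i k"] by simp
    qed (use W in auto)
    also have "\<dots> = lpp ?A (\<lambda>_. 0) (\<lambda>p. Y p \<omega>) m n + W" by (rule lpp_add)
    finally have "exp (\<theta> * lpp (ramp \<beta> k) (\<lambda>_. 0) (\<lambda>p. Y p \<omega>) m n) \<le> exp (\<theta> * (lpp ?A (\<lambda>_. 0) (\<lambda>p. Y p \<omega>) m n + W))"
      using \<theta> by simp
    then have "exp (\<theta> * lpp (ramp \<beta> k) (\<lambda>_. 0) (\<lambda>p. Y p \<omega>) m n) \<le> R \<omega> * exp (\<theta> * lpp ?A (\<lambda>_. 0) (\<lambda>p. Y p \<omega>) m n)"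
      by (simp only: distrib_left exp_add W(2) mult.commute[of "R \<omega>"])
    then show ?thesis using R1[of \<omega>] by (simp add: divide_le_eq mult.commute)
  qed
  let ?I = "\<integral>\<^sup>+\<omega>. ennreal (exp (\<theta> * lpp (ramp \<beta> k) (\<lambda>_. 0) (\<lambda>p. Y p \<omega>) m n)) \<partial>M"
  have "?I \<le> (2 * (\<integral>\<^sup>+\<omega>. ennreal (1 / R \<omega>) \<partial>M)) * ?I" using mult_right_mono[OF inv, of ?I] by simp
  also have "\<dots> = 2 * ((\<integral>\<^sup>+\<omega>. ennreal (1 / R \<omega>) \<partial>M) * ?I)" by (simp add: mult.assoc)
  also have "(\<integral>\<^sup>+\<omega>. ennreal (1 / R \<omega>) \<partial>M) * ?I = (\<integral>\<^sup>+\<omega>. ennreal (1 / R \<omega>) * ennreal (exp (\<theta> * lpp (ramp \<beta> k) (\<lambda>_. 0) (\<lambda>p. Y p \<omega>) m n)) \<partial>M)"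
    unfolding R_def by (rule ramp_indep[OF Y k gm, of "\<lambda>x. 1 / x", symmetric]) measurable
  also have "\<dots> \<le> (\<integral>\<^sup>+\<omega>. ennreal (exp (\<theta> * hor_lpp (\<lambda>p. Y p \<omega>) w m n)) \<partial>M)"
    using pt by (intro nn_integral_mono) (simp add: ennreal_leI flip: ennreal_mult'')
  finally show ?thesis by (simp add: mult_left_mono)
qed

end

section \<open>Fluctuations of the passage time to a sloped profile\<close>

text \<open>
  Changing the slope by $\Delta$ changes the profile by at most $k\Delta$, hence also the passage time.
\<close>

lemma lpp_ramp_mono:
  assumes "\<beta> \<le> \<beta>' + \<Delta>" "0 \<le> \<Delta>"
  shows "lpp (ramp \<beta> k) (\<lambda>_. 0) X m n \<le> lpp (ramp \<beta>' k) (\<lambda>_. 0) X m n + k * \<Delta>"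
proof -
  have "lpp (ramp \<beta> k) (\<lambda>_. 0) X m n \<le> lpp (\<lambda>i. ramp \<beta>' k i + k * \<Delta>) (\<lambda>_. 0 + k * \<Delta>) X m n"
  proof (rule lpp_mono)
    fix i
    have "\<beta> * real (min i k) \<le> (\<beta>' + \<Delta>) * real (min i k)" using assms by (intro mult_right_mono) auto
    also have "\<dots> \<le> \<beta>' * real (min i k) + real k * \<Delta>"
      using mult_right_mono[of "real (min i k)" "real k" \<Delta>] assms by (simp only: distrib_right mult.commute[of \<Delta>]) auto
    finally show "ramp \<beta> k i \<le> ramp \<beta>' k i + k * \<Delta>" .
  qed (use assms in auto)
  also have "\<dots> = lpp (ramp \<beta>' k) (\<lambda>_. 0) X m n + k * \<Delta>" by (rule lpp_add)
  finally show ?thesis .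
qed

lemma ennreal_double_mult: "0 \<le> v \<Longrightarrow> 0 \<le> E \<Longrightarrow> 2 * (ennreal E * ennreal v) = ennreal (v * (2 * E))"
  by (simp add: ennreal_mult mult.commute mult.left_commute)

lemma ennreal_half_le:
  assumes "0 \<le> e" "ennreal e \<le> I + ennreal (e / 4) + ennreal (e / 4)"
  shows "ennreal (e / 2) \<le> I"
proof (cases I)
  case (real v)
  have "ennreal (v + e / 4 + e / 4) = ennreal (v + e / 4) + ennreal (e / 4)" by (rule ennreal_plus) (use assms real in auto)
  also have "ennreal (v + e / 4) = ennreal v + ennreal (e / 4)" by (rule ennreal_plus) (use assms real in auto)
  finally have "ennreal e \<le> ennreal (v + e / 4 + e / 4)" using assms(2) real by simp
  then have "e \<le> v + e / 4 + e / 4" using real assms by (subst (asm) ennreal_le_iff) auto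
  then show ?thesis using real by (simp add: ennreal_leI)
qed simp

context prob_space begin

text \<open>
  The exact moment at $h=K/t$ contains the factor $\exp(\frac23K^3)$, and the paths that leave the axis late or
  through the other axis account for at most half of it. Replacing the walk by the ramp costs only $\exp(O(K^2))$, so
  the moment of the sloped passage time beats its typical size once $K$ is large. The second moment is bounded in the
  same way from above, and the Paley-Zygmund inequality gives a positive probability that depends on $K$ and $\eta$
  only.
\<close>

lemma profile_fluctuation_by_moments:
  assumes X: "exp_array M pos_quadrant X" and asp: "aspect (real m) (real n) \<eta> t"
    and K: "1 \<le> K" and T: "64 * K ^ 5 / \<eta> ^ 6 \<le> t"
    and y: "y = 6 / \<eta> ^ 3 + 4" and k: "y * t\<^sup>2 \<le> real k" "real k \<le> 2 * y * t\<^sup>2" "k \<le> m"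
  defines "Q \<equiv> exp (2 / 3 * K ^ 3 - 8 * y * K\<^sup>2 / \<eta>\<^sup>2 - 2)"
    and "Q2 \<equiv> 2 * exp (32 * y * K\<^sup>2 / \<eta>\<^sup>2 + 40 * K ^ 3 / \<eta> ^ 4)"
  shows "Q\<^sup>2 / (4 * Q2) \<le> \<P>(\<omega> in M. Q / 2 \<le> exp (2 * (K / t) * (lpp (ramp (1 / crit m n) k) (\<lambda>_. 0) (\<lambda>p. X p \<omega>) m n - shape m n)))"
proof -
  interpret aspect "real m" "real n" \<eta> t by fact
  define Y where "Y = border m n X X"
  have Y: "exp_array M ({0..m} \<times> {0..n}) Y" unfolding Y_def using exp_array_border[OF X] by auto
  note nn = exp_arrayD(2)[OF Y]
  have YX: "lpp (ramp \<beta> k) (\<lambda>_. 0) (\<lambda>p. X p \<omega>) m n = lpp (ramp \<beta> k) (\<lambda>_. 0) (\<lambda>p. Y p \<omega>) m n" for \<beta> \<omega>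
    by (rule lpp_cong) (auto simp: Y_def border_interior)
  have eta1: "\<eta> \<le> 1" "4 * \<eta> \<le> 1" using eta_le eta by auto
  have y0: "0 < y" using eta by (simp add: y add_pos_pos)
  have pw: "\<eta> ^ j \<le> 1" for j using eta eta1 by (simp add: power_le_one)
  have big: "64 * (K / \<eta>) \<le> t" "64 * (K ^ 3 / \<eta> ^ 5) \<le> t" "64 * (K ^ 5 / \<eta> ^ 6) \<le> t" "64 \<le> t" "64 \<le> \<eta> * t"
  proof -
    have "K ^ 1 / \<eta> ^ 1 \<le> K ^ 5 / \<eta> ^ 6" using K eta eta1 by (intro frac_le power_increasing power_decreasing) auto
    then show 1: "64 * (K / \<eta>) \<le> t" using T by simp
    have "K ^ 3 / \<eta> ^ 5 \<le> K ^ 5 / \<eta> ^ 6" using K eta eta1 by (intro frac_le power_increasing power_decreasing) auto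
    then show "64 * (K ^ 3 / \<eta> ^ 5) \<le> t" using T by simp
    show "64 * (K ^ 5 / \<eta> ^ 6) \<le> t" using T by simp
    have "1 \<le> K / \<eta>" using K eta eta1 by simp
    then show "64 \<le> t" using 1 by linarith
    have "64 * K \<le> \<eta> * t" using 1 eta by (simp add: field_simps)
    then show "64 \<le> \<eta> * t" using K by linarith
  qed
  let ?z = "crit m n" and ?S = "shape m n"
  (* The density c lies 1 / t below the critical one, so that w = c + h is at least critical because 1 \<le> K; the
     density c' for late exits lies 1 / t below c. *)
  define h where "h = K / t"
  define c where "c = ?z - 1 / t"
  define c' where "c' = ?z - 2 / t"
  define w where "w = c + h"
  define F where "F = cumulant m n c h"
  have ht: "h * t = K" using t by (simp add: h_def)
  have h: "0 < h" "h \<le> \<eta> / 64" using K t eta big(1) by (auto simp: h_def field_simps)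
  have it: "1 / t \<le> \<eta> / 64" "0 < 1 / t" "2 / t = 2 * (1 / t)" "1 / t \<le> h" using big(5) t K by (auto simp: field_simps h_def)
  have cb: "\<eta> \<le> c" "\<eta> \<le> 1 - c" "\<eta> \<le> c'" "\<eta> \<le> 1 - c'" "\<eta> \<le> ?z" "\<eta> \<le> 1 - ?z" "c' \<le> c" "c - c' = 1 / t" "?z - c = 1 / t"
    using it crit_ge eta unfolding c_def c'_def by linarith+
  have w: "?z \<le> w" "w < 1" "8 * h \<le> w" "2 * \<eta> \<le> w"
    using it crit_ge eta h unfolding w_def c_def by linarith+
  have eps: "(h * t) ^ 3 * (1 / t) / \<eta> ^ 5 + h\<^sup>2 * (h * t) ^ 3 / \<eta> ^ 6 \<le> 1"
  proof -
    have "0 \<le> K ^ 3" using K by simp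
    moreover have "64 * K ^ 3 \<le> t * \<eta> ^ 5" using big(2) t eta by (simp add: field_simps)
    ultimately have "2 * K ^ 3 \<le> t * \<eta> ^ 5" by linarith
    then have "(h * t) ^ 3 * (1 / t) / \<eta> ^ 5 \<le> 1 / 2" using t eta unfolding ht by (simp add: field_simps)
    moreover have "h\<^sup>2 * (h * t) ^ 3 / \<eta> ^ 6 \<le> 1 / 2"
    proof -
      have K5: "K ^ 5 = K\<^sup>2 * K ^ 3" by (simp flip: power_add)
      have "h\<^sup>2 * (h * t) ^ 3 / \<eta> ^ 6 = (K ^ 5 / \<eta> ^ 6) / t\<^sup>2" unfolding ht h_def K5 by (simp add: power_divide)
      also have "\<dots> \<le> (t / 64) / t\<^sup>2" by (intro divide_right_mono) (use big(3) in linarith, simp)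
      also have "\<dots> \<le> 1 / 2" using big(4) by (simp add: power2_eq_square)
      finally show ?thesis .
    qed
    ultimately show ?thesis by linarith
  qed
  have dc: "?S + 4 * t \<le> drift m n c"
  proof -
    have "?S + 4 * t ^ 3 * (c - ?z)\<^sup>2 \<le> drift m n c" by (rule drift_lower) (use cb eta in linarith)+
    moreover have "4 * t ^ 3 * (c - ?z)\<^sup>2 = 4 * t" using t by (simp add: c_def power2_eq_square power3_eq_cube)
    ultimately show ?thesis by simp
  qed
  have Fz: "cumulant m n ?z h \<le> F - 7"
  proof -
    have "cumulant m n ?z h - F \<le> 2 * h * (drift m n ?z - drift m n c) + (h * t) ^ 3 * \<bar>?z - c\<bar> / \<eta> ^ 5 + h\<^sup>2 * (h * t) ^ 3 / \<eta> ^ 6"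
      unfolding F_def by (rule cumulant_diff) (use cb h eta in linarith)+
    also have "\<bar>?z - c\<bar> = 1 / t" using cb(9) it by linarith
    finally have "cumulant m n ?z h - F \<le> 2 * h * (drift m n ?z - drift m n c) + 1" using eps by linarith
    moreover have "2 * h * (drift m n ?z - drift m n c) \<le> 2 * h * (- 4 * t)"
      using dc drift_crit[of m n] mn h by (intro mult_left_mono) auto
    moreover have "2 * h * (- 4 * t) = - 8 * K" using ht by (simp add: mult.commute mult.left_commute)
    ultimately show ?thesis using K by linarith
  qed
  have Ff: "cumulant m n c' h - 2 * h * k * (c - c') \<le> F - 7"
  proof -
    have "cumulant m n c' h - F \<le> 2 * h * (drift m n c' - drift m n c) + (h * t) ^ 3 * \<bar>c' - c\<bar> / \<eta> ^ 5 + h\<^sup>2 * (h * t) ^ 3 / \<eta> ^ 6"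
      unfolding F_def by (rule cumulant_diff) (use cb h eta in linarith)+
    also have "\<bar>c' - c\<bar> = 1 / t" using cb it by linarith
    finally have 1: "cumulant m n c' h - F \<le> 2 * h * (drift m n c' - drift m n c) + 1" using eps by linarith
    have "\<bar>drift m n c' - drift m n c\<bar> \<le> \<bar>c' - c\<bar> * (2 * t ^ 3 / \<eta> ^ 3) * (\<bar>c - ?z\<bar> + \<bar>c' - ?z\<bar>)"
      by (rule drift_diff) (use cb in linarith)+
    also have "\<bar>c' - c\<bar> = 1 / t" using cb it by linarith
    also have "\<bar>c - ?z\<bar> + \<bar>c' - ?z\<bar> = 3 * (1 / t)" using it unfolding c_def c'_def by linarith
    also have "1 / t * (2 * t ^ 3 / \<eta> ^ 3) * (3 * (1 / t)) = 6 / \<eta> ^ 3 * t" using t by (simp add: power3_eq_cube)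
    finally have "2 * h * (drift m n c' - drift m n c) \<le> 2 * h * (6 / \<eta> ^ 3 * t)" using h by (intro mult_left_mono) auto
    also have "\<dots> = 12 / \<eta> ^ 3 * (h * t)" by simp
    finally have 2: "2 * h * (drift m n c' - drift m n c) \<le> 12 / \<eta> ^ 3 * K" unfolding ht .
    have "2 * y * K = 2 * h * (y * t\<^sup>2) * (1 / t)" using t ht by (simp add: h_def power2_eq_square)
    also have "\<dots> \<le> 2 * h * k * (c - c')" unfolding cb(8) by (intro mult_right_mono mult_left_mono) (use k(1) h(1) it(2) in linarith)+
    finally have "12 / \<eta> ^ 3 * K + 8 * K \<le> 2 * h * k * (c - c')" by (simp add: y algebra_simps)
    then show ?thesis using 1 2 K by linarith
  qed
  define N where "N = (\<lambda>\<omega>. near_lpp (\<lambda>p. Y p \<omega>) w k m n)"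
  define Fa where "Fa = (\<lambda>\<omega>. far_lpp (\<lambda>p. Y p \<omega>) w k m n)"
  define V where "V = (\<lambda>\<omega>. ver_lpp (\<lambda>p. Y p \<omega>) (1 - (c - h)) m n)"
  define G where "G = (\<lambda>\<omega>. boundary_lpp (\<lambda>p. Y p \<omega>) (c + h) (1 - (c - h)) m n)"
  have [measurable]: "N \<in> borel_measurable M" "Fa \<in> borel_measurable M" "V \<in> borel_measurable M"
  proof -
    show "N \<in> borel_measurable M" unfolding N_def
      using exp_arrayD(1)[OF Y] k by (intro measurable_lpp borel_measurable_min measurable_hsum) auto
    show "Fa \<in> borel_measurable M" unfolding Fa_def by (rule far_measurable[OF Y k(3)])
    show "V \<in> borel_measurable M" unfolding V_def by (rule exp_array_lpp_measurable[OF Y])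
  qed
  have ch: "0 < c - h" "c + h < 1" "h < c'" "\<eta> \<le> c - h" using cb h eta w unfolding w_def c'_def c_def using it crit_ge by linarith+
  have chx: "0 < c + h" "0 < 1 - (c - h)" "c - h < 1" "0 < w" using ch h(1) unfolding w_def by linarith+
  have G_le: "G \<omega> \<le> max (max (N \<omega>) (Fa \<omega>)) (V \<omega>)" for \<omega>
  proof -
    have "G \<omega> = max (hor_lpp (\<lambda>p. Y p \<omega>) w m n) (V \<omega>)" unfolding G_def V_def w_def
      by (rule lpp_split_boundary) (use nn chx in \<open>auto intro!: hsum_nonneg vsum_nonneg\<close>)
    also have "hor_lpp (\<lambda>p. Y p \<omega>) w m n \<le> max (N \<omega>) (Fa \<omega>)"
      using lpp_near_far[of "hsum (\<lambda>p. Y p \<omega>) w" "\<lambda>p. Y p \<omega>" "m - k" k n] k mono_hsum[of w "\<lambda>p. Y p \<omega>"] nn chx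
      unfolding N_def Fa_def by simp
    finally show ?thesis by simp
  qed
  have e7: "exp (F - 7) \<le> exp F / 4"
  proof -
    have "4 \<le> exp (7::real)" using exp_ge_add_one_self[of "7::real"] by linarith
    then show ?thesis by (simp add: exp_diff field_simps)
  qed
  (* Of the three parts of the exact moment exp F, the late exits and the vertical ones contribute at most a
     quarter each. *)
  have N_ge: "ennreal (exp F / 2) \<le> (\<integral>\<^sup>+\<omega>. ennreal (exp (2 * h * N \<omega>)) \<partial>M)"
  proof (rule ennreal_half_le)
    have "ennreal (exp F) = (\<integral>\<^sup>+\<omega>. ennreal (exp (((c + h) - (c - h)) * G \<omega>)) \<partial>M)"
    proof -
      have "(\<integral>\<^sup>+\<omega>. ennreal (exp (((c + h) - (c - h)) * G \<omega>)) \<partial>M) = ennreal (((c + h) / (c - h)) ^ m * ((1 - (c - h)) / (1 - (c + h))) ^ n)"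
        unfolding G_def by (rule lpp_exponential_moment[OF Y]) (use ch h in auto)
      also have "\<dots> = ennreal (exp F)"
        unfolding F_def using exp_cumulant[of h c m n] h ch by (simp add: algebra_simps)
      finally show ?thesis by simp
    qed
    also have "\<dots> \<le> (\<integral>\<^sup>+\<omega>. ennreal (exp (2 * h * N \<omega>)) + ennreal (exp (2 * h * Fa \<omega>)) + ennreal (exp (2 * h * V \<omega>)) \<partial>M)"
    proof (rule nn_integral_mono)
      fix \<omega>
      have "exp (((c + h) - (c - h)) * G \<omega>) \<le> exp (2 * h * max (max (N \<omega>) (Fa \<omega>)) (V \<omega>))" using G_le[of \<omega>] h by simp
      also have "\<dots> \<le> exp (2 * h * N \<omega>) + exp (2 * h * Fa \<omega>) + exp (2 * h * V \<omega>)" by (auto simp: max_def)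
      finally show "ennreal (exp (((c + h) - (c - h)) * G \<omega>)) \<le> ennreal (exp (2 * h * N \<omega>)) + ennreal (exp (2 * h * Fa \<omega>)) + ennreal (exp (2 * h * V \<omega>))"
        by (simp add: ennreal_leI flip: ennreal_plus)
    qed
    also have "\<dots> = (\<integral>\<^sup>+\<omega>. ennreal (exp (2 * h * N \<omega>)) \<partial>M) + (\<integral>\<^sup>+\<omega>. ennreal (exp (2 * h * Fa \<omega>)) \<partial>M) + (\<integral>\<^sup>+\<omega>. ennreal (exp (2 * h * V \<omega>)) \<partial>M)"
      by (simp add: nn_integral_add)
    also have "\<dots> \<le> (\<integral>\<^sup>+\<omega>. ennreal (exp (2 * h * N \<omega>)) \<partial>M) + ennreal (exp F / 4) + ennreal (exp F / 4)"
    proof (intro add_mono order_refl)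
      have "(\<integral>\<^sup>+\<omega>. ennreal (exp (2 * h * Fa \<omega>)) \<partial>M) \<le> ennreal (exp (cumulant m n c' h - 2 * h * k * (c - c')))"
        unfolding Fa_def w_def by (rule far_moment[OF Y]) (use ch h(1) cb(7) k(3) in simp_all)
      also have "\<dots> \<le> ennreal (exp F / 4)"
      proof (rule ennreal_leI)
        have "exp (cumulant m n c' h - 2 * h * k * (c - c')) \<le> exp (F - 7)" using Ff by (subst exp_le_cancel_iff)
        then show "exp (cumulant m n c' h - 2 * h * k * (c - c')) \<le> exp F / 4" using e7 by linarith
      qed
      finally show "(\<integral>\<^sup>+\<omega>. ennreal (exp (2 * h * Fa \<omega>)) \<partial>M) \<le> ennreal (exp F / 4)" .
      have "(\<integral>\<^sup>+\<omega>. ennreal (exp (2 * h * V \<omega>)) \<partial>M) \<le> ennreal (exp (cumulant m n ?z h))"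
        unfolding V_def by (rule vertical_moment[OF Y]) (use ch h cb crit_ge eta it in linarith)+
      also have "\<dots> \<le> ennreal (exp F / 4)"
      proof (rule ennreal_leI)
        have "exp (cumulant m n ?z h) \<le> exp (F - 7)" using Fz by (subst exp_le_cancel_iff)
        then show "exp (cumulant m n ?z h) \<le> exp F / 4" using e7 by linarith
      qed
      finally show "(\<integral>\<^sup>+\<omega>. ennreal (exp (2 * h * V \<omega>)) \<partial>M) \<le> ennreal (exp F / 4)" .
    qed
    finally show "ennreal (exp F) \<le> (\<integral>\<^sup>+\<omega>. ennreal (exp (2 * h * N \<omega>)) \<partial>M) + ennreal (exp F / 4) + ennreal (exp F / 4)" .
  qed simp
  define M' where "M' = (\<lambda>\<omega>. lpp (ramp (1 / ?z) k) (\<lambda>_. 0) (\<lambda>p. Y p \<omega>) m n)"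
  define U where "U = (\<lambda>\<omega>. exp (2 * h * (M' \<omega> - ?S)))"
  have M'm[measurable]: "M' \<in> borel_measurable M" unfolding M'_def by (rule ramp_measurable[OF Y])
  have z2: "1 / ?z\<^sup>2 \<le> 1 / (4 * \<eta>\<^sup>2)"
  proof -
    have "(2 * \<eta>)\<^sup>2 \<le> ?z\<^sup>2" using crit_ge eta by (intro power_mono) auto
    then show ?thesis using eta by (intro divide_left_mono) (auto simp: power_mult_distrib intro!: mult_pos_pos)
  qed
  have kh: "h * real k \<le> 2 * y * K * t"
  proof -
    have "h * real k \<le> h * (2 * y * t\<^sup>2)" using k h by (intro mult_left_mono) auto
    also have "\<dots> = 2 * y * (h * t) * t" by (simp add: power2_eq_square)
    finally show ?thesis unfolding ht .
  qed
  have m1: "ennreal Q \<le> (\<integral>\<^sup>+\<omega>. ennreal (U \<omega>) \<partial>M)"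
  proof -
    define \<beta> where "\<beta> = 1 / w + 8 * h / w\<^sup>2"
    have \<beta>: "\<beta> \<le> 1 / ?z + 2 * h / \<eta>\<^sup>2"
    proof -
      have "1 / w \<le> 1 / ?z" using w crit_ge eta by (intro divide_left_mono) auto
      moreover have "8 * h / w\<^sup>2 \<le> 8 * h / (2 * \<eta>)\<^sup>2" using w eta h by (intro divide_left_mono power_mono) auto
      moreover have "8 * h / (2 * \<eta>)\<^sup>2 = 2 * h / \<eta>\<^sup>2" by (simp add: power_mult_distrib)
      ultimately show ?thesis unfolding \<beta>_def by linarith
    qed
    have R: "lpp (ramp \<beta> k) (\<lambda>_. 0) (\<lambda>p. Y p \<omega>) m n \<le> M' \<omega> + 4 * y * K * t / \<eta>\<^sup>2" for \<omega>
    proof -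
      have "lpp (ramp \<beta> k) (\<lambda>_. 0) (\<lambda>p. Y p \<omega>) m n \<le> M' \<omega> + k * (2 * h / \<eta>\<^sup>2)"
        unfolding M'_def by (rule lpp_ramp_mono[OF \<beta>]) (use h in simp)
      also have "k * (2 * h / \<eta>\<^sup>2) = 2 * (h * k) / \<eta>\<^sup>2" by simp
      also have "\<dots> \<le> 2 * (2 * y * K * t) / \<eta>\<^sup>2" by (intro divide_right_mono mult_left_mono kh) auto
      finally show ?thesis by simp
    qed
    have "ennreal (exp F / 2) \<le> 2 * (\<integral>\<^sup>+\<omega>. ennreal (exp (2 * h * lpp (ramp \<beta> k) (\<lambda>_. 0) (\<lambda>p. Y p \<omega>) m n)) \<partial>M)"
      using N_ge near_le_ramp[OF Y k(3) h(1) w(3)] unfolding N_def \<beta>_def by (rule order_trans)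
    also have "\<dots> \<le> 2 * (\<integral>\<^sup>+\<omega>. ennreal (exp (8 * y * K\<^sup>2 / \<eta>\<^sup>2 + 2 * h * ?S)) * ennreal (U \<omega>) \<partial>M)"
    proof (intro mult_left_mono nn_integral_mono)
      fix \<omega>
      have "2 * h * lpp (ramp \<beta> k) (\<lambda>_. 0) (\<lambda>p. Y p \<omega>) m n \<le> 2 * h * (M' \<omega> + 4 * y * K * t / \<eta>\<^sup>2)"
        using R[of \<omega>] h by (intro mult_left_mono) auto
      also have "\<dots> = 8 * y * K * (h * t) / \<eta>\<^sup>2 + 2 * h * M' \<omega>" by (simp add: algebra_simps)
      also have "\<dots> = (8 * y * K\<^sup>2 / \<eta>\<^sup>2 + 2 * h * ?S) + 2 * h * (M' \<omega> - ?S)" unfolding ht by (simp add: algebra_simps power2_eq_square)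
      finally show "ennreal (exp (2 * h * lpp (ramp \<beta> k) (\<lambda>_. 0) (\<lambda>p. Y p \<omega>) m n)) \<le> ennreal (exp (8 * y * K\<^sup>2 / \<eta>\<^sup>2 + 2 * h * ?S)) * ennreal (U \<omega>)"
        unfolding U_def by (simp add: ennreal_leI flip: ennreal_mult' exp_add)
    qed simp
    also have "\<dots> = 2 * (ennreal (exp (8 * y * K\<^sup>2 / \<eta>\<^sup>2 + 2 * h * ?S)) * (\<integral>\<^sup>+\<omega>. ennreal (U \<omega>) \<partial>M))"
      by (subst nn_integral_cmult) (auto simp: U_def)
    finally have le: "ennreal (exp F / 2) \<le> 2 * (ennreal (exp (8 * y * K\<^sup>2 / \<eta>\<^sup>2 + 2 * h * ?S)) * (\<integral>\<^sup>+\<omega>. ennreal (U \<omega>) \<partial>M))" .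
    have FQ: "Q * (2 * exp (8 * y * K\<^sup>2 / \<eta>\<^sup>2 + 2 * h * ?S)) \<le> exp F / 2"
    proof -
      have cub: "t ^ 3 \<le> cubic m n c"
      proof -
        have "t ^ 3 \<le> n" by (rule n_t)
        also have "\<dots> \<le> n / (1 - c) ^ 3" using cb eta mn by (simp add: pos_le_divide_eq mult_left_le power_le_one)
        also have "\<dots> \<le> cubic m n c" using cb eta mn by (simp add: cubic_def)
        finally show ?thesis .
      qed
      have "2 * h * drift m n c + 2 / 3 * h ^ 3 * cubic m n c \<le> F"
        unfolding F_def by (rule cumulant_lower) (use cb h eta mn in linarith)+
      moreover have "2 * h * ?S \<le> 2 * h * drift m n c" using dc h t by (intro mult_left_mono) auto
      moreover have "2 / 3 * h ^ 3 * t ^ 3 \<le> 2 / 3 * h ^ 3 * cubic m n c" using cub h by (intro mult_left_mono) auto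
      moreover have "2 / 3 * h ^ 3 * t ^ 3 = 2 / 3 * K ^ 3" using ht by (metis mult.assoc power_mult_distrib)
      ultimately have F: "2 * h * ?S + 2 / 3 * K ^ 3 \<le> F" by linarith
      have e2: "4 \<le> exp (2::real)"
      proof -
        have "(2::real)\<^sup>2 \<le> exp 1 ^ 2" using exp_ge_add_one_self[of "1::real"] by (intro power_mono) auto
        also have "exp 1 ^ 2 = exp (2::real)" by (simp flip: exp_of_nat_mult)
        finally show ?thesis by simp
      qed
      have "Q * exp (8 * y * K\<^sup>2 / \<eta>\<^sup>2 + 2 * h * ?S) * 4 \<le> Q * exp (8 * y * K\<^sup>2 / \<eta>\<^sup>2 + 2 * h * ?S) * exp 2"
        using e2 by (intro mult_left_mono) (auto simp: Q_def)
      also have "\<dots> = exp (2 / 3 * K ^ 3 + 2 * h * ?S)" unfolding Q_def by (simp flip: exp_add)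
      also have "\<dots> \<le> exp F" using F by (subst exp_le_cancel_iff) linarith
      finally show ?thesis by linarith
    qed
    show ?thesis
    proof (cases "\<integral>\<^sup>+\<omega>. ennreal (U \<omega>) \<partial>M")
      case (real v)
      have "ennreal (Q * (2 * exp (8 * y * K\<^sup>2 / \<eta>\<^sup>2 + 2 * h * ?S))) \<le> ennreal (exp F / 2)" by (rule ennreal_leI[OF FQ])
      also note le
      also have "2 * (ennreal (exp (8 * y * K\<^sup>2 / \<eta>\<^sup>2 + 2 * h * ?S)) * (\<integral>\<^sup>+\<omega>. ennreal (U \<omega>) \<partial>M)) = ennreal (v * (2 * exp (8 * y * K\<^sup>2 / \<eta>\<^sup>2 + 2 * h * ?S)))"
        unfolding real(2) by (rule ennreal_double_mult[OF real(1)]) simp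
      finally have "Q * (2 * exp (8 * y * K\<^sup>2 / \<eta>\<^sup>2 + 2 * h * ?S)) \<le> v * (2 * exp (8 * y * K\<^sup>2 / \<eta>\<^sup>2 + 2 * h * ?S))"
        using real(1) by (subst (asm) ennreal_le_iff) auto
      then have "Q \<le> v" by (rule mult_right_le_imp_le) simp
      then show ?thesis unfolding real(2) by (rule ennreal_leI)
    qed simp
  qed
  (* The second moment is a moment at 2h, bounded by that of the horizontal model at the critical rate. *)
  have m2: "(\<integral>\<^sup>+\<omega>. ennreal ((U \<omega>)\<^sup>2) \<partial>M) \<le> ennreal Q2"
  proof -
    define \<beta> where "\<beta> = 1 / ?z - 4 * (4 * h) / ?z\<^sup>2"
    have \<beta>: "1 / ?z \<le> \<beta> + 4 * h / \<eta>\<^sup>2"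
    proof -
      have "16 * h * (1 / ?z\<^sup>2) \<le> 16 * h * (1 / (4 * \<eta>\<^sup>2))" using z2 h by (intro mult_left_mono) auto
      then show ?thesis unfolding \<beta>_def by simp
    qed
    have R: "M' \<omega> \<le> lpp (ramp \<beta> k) (\<lambda>_. 0) (\<lambda>p. Y p \<omega>) m n + 8 * y * K * t / \<eta>\<^sup>2" for \<omega>
    proof -
      have "M' \<omega> \<le> lpp (ramp \<beta> k) (\<lambda>_. 0) (\<lambda>p. Y p \<omega>) m n + k * (4 * h / \<eta>\<^sup>2)"
        unfolding M'_def by (rule lpp_ramp_mono[OF \<beta>]) (use h in simp)
      also have "k * (4 * h / \<eta>\<^sup>2) = 4 * (h * k) / \<eta>\<^sup>2" by simp
      also have "\<dots> \<le> 4 * (2 * y * K * t) / \<eta>\<^sup>2" by (intro divide_right_mono mult_left_mono kh) auto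
      finally show ?thesis by simp
    qed
    let ?E = "32 * y * K\<^sup>2 / \<eta>\<^sup>2 - 4 * h * ?S"
    have "(\<integral>\<^sup>+\<omega>. ennreal ((U \<omega>)\<^sup>2) \<partial>M) \<le> (\<integral>\<^sup>+\<omega>. ennreal (exp ?E) * ennreal (exp (4 * h * lpp (ramp \<beta> k) (\<lambda>_. 0) (\<lambda>p. Y p \<omega>) m n)) \<partial>M)"
    proof (intro nn_integral_mono)
      fix \<omega>
      have "4 * h * (M' \<omega> - ?S) \<le> 4 * h * (lpp (ramp \<beta> k) (\<lambda>_. 0) (\<lambda>p. Y p \<omega>) m n + 8 * y * K * t / \<eta>\<^sup>2 - ?S)"
        using R[of \<omega>] h by (intro mult_left_mono) auto
      also have "\<dots> = (32 * y * K * (h * t) / \<eta>\<^sup>2 - 4 * h * ?S) + 4 * h * lpp (ramp \<beta> k) (\<lambda>_. 0) (\<lambda>p. Y p \<omega>) m n"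
        by (simp add: algebra_simps)
      finally have "4 * h * (M' \<omega> - ?S) \<le> ?E + 4 * h * lpp (ramp \<beta> k) (\<lambda>_. 0) (\<lambda>p. Y p \<omega>) m n"
        unfolding ht by (simp add: power2_eq_square)
      moreover have "(U \<omega>)\<^sup>2 = exp (4 * h * (M' \<omega> - ?S))" unfolding U_def by (simp flip: exp_double)
      ultimately show "ennreal ((U \<omega>)\<^sup>2) \<le> ennreal (exp ?E) * ennreal (exp (4 * h * lpp (ramp \<beta> k) (\<lambda>_. 0) (\<lambda>p. Y p \<omega>) m n))"
        by (simp add: ennreal_leI flip: ennreal_mult' exp_add)
    qed
    also have "\<dots> = ennreal (exp ?E) * (\<integral>\<^sup>+\<omega>. ennreal (exp (4 * h * lpp (ramp \<beta> k) (\<lambda>_. 0) (\<lambda>p. Y p \<omega>) m n)) \<partial>M)"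
      using ramp_measurable[OF Y, of \<beta> k] by (intro nn_integral_cmult) auto
    also have "\<dots> \<le> ennreal (exp ?E) * (2 * (\<integral>\<^sup>+\<omega>. ennreal (exp (4 * h * lpp (hsum (\<lambda>p. Y p \<omega>) ?z) (\<lambda>_. 0) (\<lambda>p. Y p \<omega>) m n)) \<partial>M))"
      unfolding \<beta>_def by (intro mult_left_mono ramp_le_horizontal[OF Y k(3)]) (use h crit_ge eta in auto)
    also have "\<dots> \<le> ennreal (exp ?E) * (2 * ennreal (exp (4 * h * ?S + 40 * K ^ 3 / \<eta> ^ 4)))"
    proof (intro mult_left_mono)
      have b: "\<eta> \<le> ?z - 2 * h" "\<eta> \<le> 1 - (?z - 2 * h)" using crit_ge eta h by linarith+
      have "(\<integral>\<^sup>+\<omega>. ennreal (exp (2 * (2 * h) * lpp (hsum (\<lambda>p. Y p \<omega>) ?z) (\<lambda>_. 0) (\<lambda>p. Y p \<omega>) m n)) \<partial>M)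
         \<le> ennreal (exp (cumulant m n (?z - 2 * h) (2 * h)))"
        by (rule horizontal_moment[OF Y]) (use h crit_ge eta in linarith)+
      also have "\<dots> \<le> ennreal (exp (4 * h * ?S + 40 * K ^ 3 / \<eta> ^ 4))"
      proof -
        have "\<bar>drift m n (?z - 2 * h) - drift m n ?z\<bar> \<le> \<bar>(?z - 2 * h) - ?z\<bar> * (2 * t ^ 3 / \<eta> ^ 3) * (\<bar>?z - ?z\<bar> + \<bar>(?z - 2 * h) - ?z\<bar>)"
          by (rule drift_diff) (use b cb in auto)
        also have "\<dots> = 8 * h\<^sup>2 * t ^ 3 / \<eta> ^ 3" using h by (simp add: power2_eq_square)
        also have "\<dots> = 8 * (h * t)\<^sup>2 * t / \<eta> ^ 3" by (simp add: power2_eq_square power3_eq_cube)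
        finally have "drift m n (?z - 2 * h) \<le> ?S + 8 * K\<^sup>2 * t / \<eta> ^ 3" unfolding ht using drift_crit[of m n] mn by simp
        then have "4 * h * drift m n (?z - 2 * h) \<le> 4 * h * (?S + 8 * K\<^sup>2 * t / \<eta> ^ 3)" using h by (intro mult_left_mono) auto
        also have "\<dots> = 4 * h * ?S + 32 * K\<^sup>2 * (h * t) / \<eta> ^ 3" by (simp add: algebra_simps)
        finally have 1: "4 * h * drift m n (?z - 2 * h) \<le> 4 * h * ?S + 32 * K ^ 3 / \<eta> ^ 3" unfolding ht by (simp add: power2_eq_square power3_eq_cube)
        have "cumulant m n (?z - 2 * h) (2 * h) \<le> 2 * (2 * h) * drift m n (?z - 2 * h) + (2 * h * t) ^ 3 / \<eta> ^ 4"
          by (rule cumulant_le) (use b h eta in linarith)+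
        moreover have "(2 * h * t) ^ 3 / \<eta> ^ 4 = 8 * K ^ 3 / \<eta> ^ 4" using ht by (simp add: mult.assoc power_mult_distrib)
        moreover have "32 * K ^ 3 / \<eta> ^ 3 \<le> 32 * K ^ 3 / \<eta> ^ 4" using K eta eta1 by (intro divide_left_mono power_decreasing) auto
        ultimately have "cumulant m n (?z - 2 * h) (2 * h) \<le> 4 * h * ?S + 32 * K ^ 3 / \<eta> ^ 4 + 8 * K ^ 3 / \<eta> ^ 4" using 1 by linarith
        then have "cumulant m n (?z - 2 * h) (2 * h) \<le> 4 * h * ?S + 40 * K ^ 3 / \<eta> ^ 4" by (simp add: add_divide_distrib[symmetric])
        then show ?thesis by (intro ennreal_leI) (subst exp_le_cancel_iff)
      qed
      finally show "(\<integral>\<^sup>+\<omega>. ennreal (exp (4 * h * lpp (hsum (\<lambda>p. Y p \<omega>) ?z) (\<lambda>_. 0) (\<lambda>p. Y p \<omega>) m n)) \<partial>M) \<le> ennreal (exp (4 * h * ?S + 40 * K ^ 3 / \<eta> ^ 4))"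
        by simp
    qed auto
    also have "\<dots> = ennreal (exp ?E * (2 * exp (4 * h * ?S + 40 * K ^ 3 / \<eta> ^ 4)))"
      by (simp add: ennreal_mult')
    also have "exp ?E * (2 * exp (4 * h * ?S + 40 * K ^ 3 / \<eta> ^ 4)) = Q2"
      unfolding Q2_def by (simp flip: exp_add)
    finally show ?thesis .
  qed
  have "Q\<^sup>2 / (4 * Q2) \<le> \<P>(\<omega> in M. Q / 2 \<le> U \<omega>)"
    by (rule paley_zygmund[OF _ _ _ _ m1 m2]) (auto simp: U_def Q_def Q2_def)
  then show ?thesis unfolding U_def M'_def h_def YX .
qed

text \<open>
  The moment bound grows like $\exp(\frac23K^3)$ with errors of order $K^2$, so that $K$ can be chosen such that the
  excess is any prescribed multiple \<open>g\<close> of the fluctuation scale.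
\<close>

proposition profile_fluctuation:
  assumes "0 < \<eta>" "0 < g" and y: "y = 6 / \<eta> ^ 3 + 4"
  shows "\<exists>p>0. \<exists>T>0. \<forall>X m n t. exp_array M pos_quadrant X \<longrightarrow> aspect (real m) (real n) \<eta> t \<longrightarrow> T \<le> t \<longrightarrow>
    (\<exists>k. 1 \<le> k \<and> k \<le> m \<and> real k \<le> 2 * y * t\<^sup>2 \<and>
     p \<le> \<P>(\<omega> in M. shape m n + g * t \<le> lpp (ramp (1 / crit m n) k) (\<lambda>_. 0) (\<lambda>p. X p \<omega>) m n))"
proof -
  have y0: "0 < y" using assms by (simp add: y add_pos_pos)
  define K where "K = 24 * y / \<eta>\<^sup>2 + 6 * (g + 2)"
  define T where "T = 64 * K ^ 5 / \<eta> ^ 6 + y / \<eta>\<^sup>2 + 1 / y + 1"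
  define Q where "Q = exp (2 / 3 * K ^ 3 - 8 * y * K\<^sup>2 / \<eta>\<^sup>2 - 2)"
  define Q2 where "Q2 = 2 * exp (32 * y * K\<^sup>2 / \<eta>\<^sup>2 + 40 * K ^ 3 / \<eta> ^ 4)"
  have K: "1 \<le> K" "6 * (g + 2) \<le> K" "24 * y / \<eta>\<^sup>2 \<le> K"
  proof -
    define a where "a = 24 * y / \<eta>\<^sup>2"
    have "0 \<le> a" using y0 by (simp add: a_def)
    moreover have "K = a + 6 * (g + 2)" by (simp add: a_def K_def)
    moreover have "0 < g" by (rule assms(2))
    ultimately show "1 \<le> K" "6 * (g + 2) \<le> K" "24 * y / \<eta>\<^sup>2 \<le> K" by (simp_all add: a_def)
  qed
  have nonneg: "0 \<le> 64 * K ^ 5 / \<eta> ^ 6" "0 \<le> y / \<eta>\<^sup>2" "0 \<le> 1 / y" using K y0 assms by auto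
  have "0 < T" using nonneg unfolding T_def by linarith
  moreover have "0 < Q\<^sup>2 / (4 * Q2)" by (simp add: Q_def Q2_def)
  moreover have "\<exists>k. 1 \<le> k \<and> k \<le> m \<and> real k \<le> 2 * y * t\<^sup>2 \<and>
     Q\<^sup>2 / (4 * Q2) \<le> \<P>(\<omega> in M. shape m n + g * t \<le> lpp (ramp (1 / crit m n) k) (\<lambda>_. 0) (\<lambda>p. X p \<omega>) m n)"
    if X: "exp_array M pos_quadrant X" and asp: "aspect (real m) (real n) \<eta> t" and Tt: "T \<le> t" for X m n t
  proof -
    interpret aspect "real m" "real n" \<eta> t by fact
    have big: "64 * K ^ 5 / \<eta> ^ 6 \<le> t" "y / \<eta>\<^sup>2 \<le> t" "1 / y \<le> t" "1 \<le> t"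
      using nonneg Tt unfolding T_def by linarith+
    have yt: "y \<le> \<eta>\<^sup>2 * t" "1 \<le> y * t" using big assms(1) y0 by (auto simp: field_simps)
    have "y * t * 1 \<le> y * t * t" using big y0 t by (intro mult_left_mono) auto
    then have yt2: "1 \<le> y * t\<^sup>2" using yt(2) by (simp add: power2_eq_square mult.assoc)
    define k where "k = nat \<lceil>y * t\<^sup>2\<rceil>"
    have k: "y * t\<^sup>2 \<le> real k" "real k \<le> 2 * y * t\<^sup>2" "k \<le> m" "1 \<le> k"
      using exit_scale[OF y0 yt(1) yt2] unfolding k_def[symmetric] by simp_all
    have "Q\<^sup>2 / (4 * Q2) \<le> \<P>(\<omega> in M. Q / 2 \<le> exp (2 * (K / t) * (lpp (ramp (1 / crit m n) k) (\<lambda>_. 0) (\<lambda>p. X p \<omega>) m n - shape m n)))"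
      unfolding Q_def Q2_def by (rule profile_fluctuation_by_moments[OF X asp K(1) big(1) y k(1,2,3)])
    also have "\<dots> \<le> \<P>(\<omega> in M. shape m n + g * t \<le> lpp (ramp (1 / crit m n) k) (\<lambda>_. 0) (\<lambda>p. X p \<omega>) m n)"
    proof (rule finite_measure_mono)
      show "{\<omega> \<in> space M. Q / 2 \<le> exp (2 * (K / t) * (lpp (ramp (1 / crit m n) k) (\<lambda>_. 0) (\<lambda>p. X p \<omega>) m n - shape m n))}
         \<subseteq> {\<omega> \<in> space M. shape m n + g * t \<le> lpp (ramp (1 / crit m n) k) (\<lambda>_. 0) (\<lambda>p. X p \<omega>) m n}"
      proof safe
        fix \<omega>
        let ?D = "lpp (ramp (1 / crit m n) k) (\<lambda>_. 0) (\<lambda>p. X p \<omega>) m n - shape m n"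
        assume "Q / 2 \<le> exp (2 * (K / t) * ?D)"
        moreover have "exp (- 1) \<le> (1 / 2 :: real)" using exp_ge_add_one_self[of "1::real"] by (simp add: exp_minus field_simps)
        then have "Q * exp (- 1) \<le> Q * (1 / 2)" by (intro mult_left_mono) (auto simp: Q_def)
        ultimately have "exp ((2 / 3 * K ^ 3 - 8 * y * K\<^sup>2 / \<eta>\<^sup>2 - 2) + - 1) \<le> exp (2 * (K / t) * ?D)"
          unfolding Q_def exp_add by linarith
        then have 1: "2 / 3 * K ^ 3 - 8 * y * K\<^sup>2 / \<eta>\<^sup>2 - 3 \<le> 2 * (K / t) * ?D" by (subst (asm) exp_le_cancel_iff) linarith
        have "K\<^sup>2 * (8 * y / \<eta>\<^sup>2) \<le> K\<^sup>2 * (K / 3)" using K(3) by (intro mult_left_mono) auto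
        then have 2: "8 * y * K\<^sup>2 / \<eta>\<^sup>2 \<le> K ^ 3 / 3" by (simp add: power2_eq_square power3_eq_cube mult.commute mult.left_commute)
        have "K * K * (6 * (g + 2)) \<le> K * K * K" using K by (intro mult_left_mono) auto
        moreover have "K * 1 * (6 * (g + 2)) \<le> K * K * (6 * (g + 2))" using K assms(2) by (intro mult_right_mono mult_left_mono) auto
        ultimately have 3: "6 * (K * g) + 12 * K \<le> K ^ 3" by (simp add: power3_eq_cube algebra_simps)
        have "2 * K * g \<le> 2 * (K / t) * ?D" using 1 2 3 K(1) by linarith
        then have "2 * K * (g * t) \<le> 2 * K * ?D" using t by (simp add: field_simps)
        then have "g * t \<le> ?D" by (rule mult_left_le_imp_le) (use K in simp)
        then show "shape m n + g * t \<le> lpp (ramp (1 / crit m n) k) (\<lambda>_. 0) (\<lambda>p. X p \<omega>) m n" by simp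
      qed
      have [measurable]: "(\<lambda>\<omega>. lpp (ramp (1 / crit m n) k) (\<lambda>_. 0) (\<lambda>p. X p \<omega>) m n) \<in> borel_measurable M"
        using exp_arrayD(1)[OF X] by (intro measurable_lpp) auto
      show "{\<omega> \<in> space M. shape m n + g * t \<le> lpp (ramp (1 / crit m n) k) (\<lambda>_. 0) (\<lambda>p. X p \<omega>) m n} \<in> events" by measurable
    qed
    finally show ?thesis using k by blast
  qed
  ultimately show ?thesis by blast
qed

end

section \<open>Upward fluctuations in independent boxes\<close>

context prob_space begin

lemma exp_array_restrict_measurable:
  assumes "exp_array M I Y" "A \<subseteq> I"
  shows "(\<lambda>\<omega>. \<lambda>p\<in>A. Y p \<omega>) \<in> measurable M (PiM A (\<lambda>_. borel))"
  using exp_arrayD(1)[OF assms(1)] assms(2) by (intro measurable_restrict) auto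

lemma exp_array_pred:
  assumes "exp_array M I Y" "A \<subseteq> I" "Measurable.pred (PiM A (\<lambda>_. borel)) P"
  shows "Measurable.pred M (\<lambda>\<omega>. P (\<lambda>p\<in>A. Y p \<omega>))"
  using measurable_compose[OF exp_array_restrict_measurable[OF assms(1,2)] assms(3)] .

text \<open>
  Decompose according to the first \<open>j\<close> with \<open>P j\<close>. Up to this \<open>j\<close> only weights
  in \<open>A j\<close> have been inspected, and \<open>Q j\<close> depends on a disjoint region, so the conditional
  probability of \<open>Q j\<close> is at least \<open>q\<close>.
\<close>

lemma first_success_indep:
  fixes A B :: "nat \<Rightarrow> 'i set"
  assumes Y: "exp_array M I Y"
    and AB: "\<And>j. j < J \<Longrightarrow> A j \<inter> B j = {}" "\<And>j. j < J \<Longrightarrow> A j \<subseteq> I" "\<And>j. j < J \<Longrightarrow> B j \<subseteq> I"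
    and inc: "\<And>i j. i \<le> j \<Longrightarrow> j < J \<Longrightarrow> A i \<subseteq> A j"
    and P: "\<And>j. j < J \<Longrightarrow> Measurable.pred (PiM (A j) (\<lambda>_. borel)) (P j)"
    and Q: "\<And>j. j < J \<Longrightarrow> Measurable.pred (PiM (B j) (\<lambda>_. borel)) (Q j)"
    and q: "\<And>j. j < J \<Longrightarrow> q \<le> \<P>(\<omega> in M. Q j (\<lambda>p\<in>B j. Y p \<omega>))"
  shows "q * \<P>(\<omega> in M. \<exists>j<J. P j (\<lambda>p\<in>A j. Y p \<omega>)) \<le> \<P>(\<omega> in M. \<exists>j<J. P j (\<lambda>p\<in>A j. Y p \<omega>) \<and> Q j (\<lambda>p\<in>B j. Y p \<omega>))"
proof -
  define P' where "P' = (\<lambda>j x. P j x \<and> (\<forall>i<j. \<not> P i (restrict x (A i))))"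
  have P': "Measurable.pred (PiM (A j) (\<lambda>_. borel)) (P' j)" if j: "j < J" for j
  proof -
    have "Measurable.pred (PiM (A j) (\<lambda>_. borel)) (\<lambda>x. \<forall>i\<in>{..<j}. \<not> P i (restrict x (A i)))"
    proof (rule pred_intros_finite)
      fix i assume i: "i \<in> {..<j}"
      have "(\<lambda>x. restrict x (A i)) \<in> measurable (PiM (A j) (\<lambda>_. borel)) (PiM (A i) (\<lambda>_. borel))"
        by (rule measurable_restrict_subset) (use i j inc in auto)
      from measurable_compose[OF this P[of i]] i j
      have "Measurable.pred (PiM (A j) (\<lambda>_. borel)) (\<lambda>x. P i (restrict x (A i)))" by simp
      then show "Measurable.pred (PiM (A j) (\<lambda>_. borel)) (\<lambda>x. \<not> P i (restrict x (A i)))" by measurable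
    qed simp
    then have "Measurable.pred (PiM (A j) (\<lambda>_. borel)) (\<lambda>x. P j x \<and> (\<forall>i\<in>{..<j}. \<not> P i (restrict x (A i))))"
      using P[OF j] by (intro pred_intros_logic)
    then show ?thesis by (simp add: P'_def lessThan_def)
  qed
  let ?R = "\<lambda>j \<omega>. \<lambda>p\<in>A j. Y p \<omega>" and ?S = "\<lambda>j \<omega>. \<lambda>p\<in>B j. Y p \<omega>"
  have P'_eq: "P' j (?R j \<omega>) \<longleftrightarrow> P j (?R j \<omega>) \<and> (\<forall>i<j. \<not> P i (?R i \<omega>))" if "j < J" for j \<omega>
  proof -
    have "restrict (?R j \<omega>) (A i) = ?R i \<omega>" if "i < j" for i
      using inc[of i j] that \<open>j < J\<close> by (auto simp: fun_eq_iff restrict_def)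
    then show ?thesis by (auto simp: P'_def)
  qed
  define E where "E = (\<lambda>j. {\<omega>\<in>space M. P' j (?R j \<omega>)})"
  define F where "F = (\<lambda>j. {\<omega>\<in>space M. P' j (?R j \<omega>) \<and> Q j (?S j \<omega>)})"
  have mE: "Measurable.pred M (\<lambda>\<omega>. P' j (?R j \<omega>))" if "j < J" for j using exp_array_pred[OF Y AB(2)[OF that] P'[OF that]] .
  have mQ: "Measurable.pred M (\<lambda>\<omega>. Q j (?S j \<omega>))" if "j < J" for j using exp_array_pred[OF Y AB(3)[OF that] Q[OF that]] .
  have Ee: "E j \<in> events" "F j \<in> events" if "j < J" for j
    using mE[OF that] mQ[OF that] unfolding E_def F_def by measurable
  have dis: "disjoint_family_on E {..<J}" "disjoint_family_on F {..<J}"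
  proof -
    have *: "\<not> (P' i (?R i \<omega>) \<and> P' j (?R j \<omega>))" if "i < J" "j < J" "i \<noteq> j" for i j \<omega>
      using that P'_eq[of i \<omega>] P'_eq[of j \<omega>] by (cases "i < j") auto
    show "disjoint_family_on E {..<J}" "disjoint_family_on F {..<J}"
      unfolding disjoint_family_on_def E_def F_def using * by blast+
  qed
  have first: "\<exists>j<J. P' j (?R j \<omega>) \<and> j \<le> j0" if "j0 < J" "P j0 (?R j0 \<omega>)" for j0 \<omega>
  proof -
    define j where "j = (LEAST j. P j (?R j \<omega>))"
    have "P j (?R j \<omega>)" unfolding j_def by (rule LeastI) (rule that(2))
    moreover have "j \<le> j0" unfolding j_def by (rule Least_le) (rule that(2))
    moreover have "\<not> P i (?R i \<omega>)" if "i < j" for i using not_less_Least that unfolding j_def by blast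
    ultimately show ?thesis using P'_eq[of j \<omega>] that(1) by (intro exI[of _ j]) auto
  qed
  have "{\<omega>\<in>space M. \<exists>j<J. P j (?R j \<omega>)} = (\<Union>j\<in>{..<J}. E j)"
    unfolding E_def using first P'_eq by blast
  then have "\<P>(\<omega> in M. \<exists>j<J. P j (?R j \<omega>)) = (\<Sum>j\<in>{..<J}. prob (E j))"
    using finite_measure_finite_Union[of "{..<J}" E] Ee dis by auto
  also have "q * \<dots> = (\<Sum>j\<in>{..<J}. q * prob (E j))" by (rule sum_distrib_left)
  also have "\<dots> \<le> (\<Sum>j\<in>{..<J}. prob (F j))"
  proof (rule sum_mono)
    fix j assume "j \<in> {..<J}"
    then have j: "j < J" by simp
    have "prob (F j) = prob (E j) * \<P>(\<omega> in M. Q j (?S j \<omega>))"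
      unfolding F_def E_def by (rule exp_array_indep_prob[OF Y AB(1)[OF j] AB(2)[OF j] AB(3)[OF j] P'[OF j] Q[OF j]])
    then show "q * prob (E j) \<le> prob (F j)" using mult_right_mono[OF q[OF j], of "prob (E j)"] by (simp add: mult.commute)
  qed
  also have "\<dots> = prob (\<Union>j\<in>{..<J}. F j)"
    by (rule finite_measure_finite_Union[symmetric]) (use Ee dis in auto)
  also have "\<dots> \<le> \<P>(\<omega> in M. \<exists>j<J. P j (?R j \<omega>) \<and> Q j (?S j \<omega>))"
  proof (rule finite_measure_mono)
    show "(\<Union>j\<in>{..<J}. F j) \<subseteq> {\<omega>\<in>space M. \<exists>j<J. P j (?R j \<omega>) \<and> Q j (?S j \<omega>)}"
      unfolding F_def using P'_eq by blast
    have "Measurable.pred M (\<lambda>\<omega>. \<exists>j\<in>{..<J}. P j (?R j \<omega>) \<and> Q j (?S j \<omega>))"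
    proof (rule pred_intros_finite)
      fix j assume "j \<in> {..<J}"
      then have j: "j < J" by simp
      show "Measurable.pred M (\<lambda>\<omega>. P j (?R j \<omega>) \<and> Q j (?S j \<omega>))"
        using exp_array_pred[OF Y AB(2)[OF j] P[OF j]] mQ[OF j] by (rule pred_intros_logic)
    qed simp
    then show "{\<omega>\<in>space M. \<exists>j<J. P j (?R j \<omega>) \<and> Q j (?S j \<omega>)} \<in> events" by (simp only: pred_def Bex_def lessThan_iff)
  qed
  finally show ?thesis .
qed

text \<open>
  Disjoint regions carry independent events; this is the finite form of the second Borel-Cantelli lemma.
\<close>

lemma all_fail_le_prod:
  fixes R :: "nat \<Rightarrow> 'i set"
  assumes Y: "exp_array M I Y" and dis: "\<And>i j. i < j \<Longrightarrow> j < J \<Longrightarrow> R i \<inter> R j = {}" and R: "\<And>j. j < J \<Longrightarrow> R j \<subseteq> I"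
    and P: "\<And>j. j < J \<Longrightarrow> Measurable.pred (PiM (R j) (\<lambda>_. borel)) (P j)"
    and p: "\<And>j. j < J \<Longrightarrow> p j \<le> \<P>(\<omega> in M. P j (\<lambda>k\<in>R j. Y k \<omega>))"
  shows "\<P>(\<omega> in M. \<forall>j<J. \<not> P j (\<lambda>k\<in>R j. Y k \<omega>)) \<le> (\<Prod>j<J. 1 - p j)"
  using dis R P p
proof (induction J)
  case 0 then show ?case by simp
next
  case (Suc J)
  let ?A = "\<Union>j<J. R j"
  define P' where "P' = (\<lambda>x. \<forall>j\<in>{..<J}. \<not> P j (restrict x (R j)))"
  have P': "Measurable.pred (PiM ?A (\<lambda>_. borel)) P'"
    unfolding P'_def
  proof (rule pred_intros_finite)
    fix i assume i: "i \<in> {..<J}"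
    have "(\<lambda>x. restrict x (R i)) \<in> measurable (PiM ?A (\<lambda>_. borel)) (PiM (R i) (\<lambda>_. borel))"
      by (rule measurable_restrict_subset) (use i in auto)
    from measurable_compose[OF this Suc.prems(3)[of i]] i
    have "Measurable.pred (PiM ?A (\<lambda>_. borel)) (\<lambda>x. P i (restrict x (R i)))" by (simp only: lessThan_iff)
    then show "Measurable.pred (PiM ?A (\<lambda>_. borel)) (\<lambda>x. \<not> P i (restrict x (R i)))" by measurable
  qed simp
  have res: "restrict (\<lambda>k\<in>?A. Y k \<omega>) (R j) = (\<lambda>k\<in>R j. Y k \<omega>)" if "j < J" for j \<omega>
    using that by (auto simp: fun_eq_iff restrict_def)
  have P'_eq: "P' (\<lambda>k\<in>?A. Y k \<omega>) \<longleftrightarrow> (\<forall>j<J. \<not> P j (\<lambda>k\<in>R j. Y k \<omega>))" for \<omega>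
    unfolding P'_def using res by auto
  have nP: "Measurable.pred (PiM (R J) (\<lambda>_. borel)) (\<lambda>x. \<not> P J x)" using Suc.prems(3)[of J] by measurable
  have sub: "?A \<subseteq> I" "R J \<subseteq> I" using Suc.prems(2) by (auto dest: less_SucI)
  have mJ: "Measurable.pred M (\<lambda>\<omega>. P J (\<lambda>k\<in>R J. Y k \<omega>))" by (rule exp_array_pred[OF Y sub(2)]) (use Suc.prems in simp)
  have "\<P>(\<omega> in M. \<forall>j<Suc J. \<not> P j (\<lambda>k\<in>R j. Y k \<omega>)) = \<P>(\<omega> in M. P' (\<lambda>k\<in>?A. Y k \<omega>) \<and> \<not> P J (\<lambda>k\<in>R J. Y k \<omega>))"
    unfolding P'_eq by (simp add: less_Suc_eq all_conj_distrib imp_conjR disj_imp conj_commute) (intro arg_cong[where f=prob], auto)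
  also have "\<dots> = \<P>(\<omega> in M. P' (\<lambda>k\<in>?A. Y k \<omega>)) * \<P>(\<omega> in M. \<not> P J (\<lambda>k\<in>R J. Y k \<omega>))"
    by (rule exp_array_indep_prob[OF Y _ sub P' nP]) (use Suc.prems(1)[of _ J] in auto)
  also have "\<dots> \<le> (\<Prod>j<J. 1 - p j) * (1 - p J)"
  proof (intro mult_mono)
    show 1: "\<P>(\<omega> in M. P' (\<lambda>k\<in>?A. Y k \<omega>)) \<le> (\<Prod>j<J. 1 - p j)"
      unfolding P'_eq by (rule Suc.IH) (use Suc.prems in auto)
    show "\<P>(\<omega> in M. \<not> P J (\<lambda>k\<in>R J. Y k \<omega>)) \<le> 1 - p J"
    proof -
      have "\<P>(\<omega> in M. \<not> P J (\<lambda>k\<in>R J. Y k \<omega>)) = 1 - \<P>(\<omega> in M. P J (\<lambda>k\<in>R J. Y k \<omega>))"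
        by (rule prob_neg) (use mJ in \<open>simp add: pred_def\<close>)
      with Suc.prems(4)[OF lessI] show ?thesis by linarith
    qed
    show "0 \<le> (\<Prod>j<J. 1 - p j)" using order_trans[OF measure_nonneg 1] .
  qed simp
  finally show ?case by (simp only: prod.lessThan_Suc)
qed

lemma exp_array_shift:
  assumes "exp_array M pos_quadrant X"
  shows "exp_array M pos_quadrant (shift k l X)"
proof -
  have "exp_array M pos_quadrant (\<lambda>p. X ((\<lambda>(i, j). (i + k, j + l)) p))"
    by (rule exp_array_reindex[OF assms]) (auto simp: inj_on_def)
  moreover have "(\<lambda>p. X ((\<lambda>(i, j). (i + k, j + l)) p)) = shift k l X" by (auto simp: shift_def)
  ultimately show ?thesis by simp
qed

lemma shift_apply_fun: "(\<lambda>p. shift k l X p \<omega>) = shift k l (\<lambda>p. X p \<omega>)"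
  by (auto simp: shift_def)

lemma bulk_shift_pred:
  assumes "{k + 1..k + i} \<times> {l + 1..l + j} \<subseteq> A"
  shows "Measurable.pred (PiM A (\<lambda>_. borel)) (\<lambda>x. v \<le> bulk (shift k l x) i j)"
proof -
  have [measurable]: "(\<lambda>x. bulk (shift k l x) i j) \<in> borel_measurable (PiM A (\<lambda>_. borel))"
    using assms by (intro measurable_lpp) (auto intro!: measurable_component_singleton)
  show ?thesis by measurable
qed

lemma bulk_shift_restrict:
  assumes "{k + 1..k + i} \<times> {l + 1..l + j} \<subseteq> A"
  shows "bulk (shift k l (\<lambda>p\<in>A. Y p)) i j = bulk (shift k l Y) i j"
proof (rule lpp_cong)
  fix i' j' assume "1 \<le> i'" "i' \<le> i" "1 \<le> j'" "j' \<le> j"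
  then have "(i' + k, j' + l) \<in> A" using assms by auto
  then show "shift k l (\<lambda>p\<in>A. Y p) (i', j') = shift k l Y (i', j')" by simp
qed auto

text \<open>
  Widening the box by at most a factor two preserves the aspect condition up to a factor two in \<open>\<eta>\<close>.
\<close>

lemma aspect_extend:
  assumes "aspect m n \<eta> t" "0 \<le> x" "x \<le> m"
  shows "aspect (m + x) n (\<eta> / 2) t"
proof -
  interpret aspect m n \<eta> t by fact
  have s: "0 < sqrt m" "0 < sqrt n" "0 < sqrt m + sqrt n" using mn by (auto simp: add_pos_pos)
  show ?thesis
  proof
    have "\<eta> * (m + x + n) \<le> \<eta> * (2 * (m + n))" using eta assms mn by (intro mult_left_mono) auto
    then show "2 * (\<eta> / 2) * (m + x + n) \<le> t ^ 3" using sum_le by (simp add: algebra_simps)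
    have s2: "sqrt m \<le> sqrt (m + x)" using assms by simp
    have sp: "0 < sqrt (m + x) + sqrt n" using s s2 by linarith
    have "crit m n \<le> crit (m + x) n"
      using s s2 sp unfolding crit_def by (simp add: divide_simps) (simp add: algebra_simps)
    then show "2 * (\<eta> / 2) \<le> crit (m + x) n" using crit_ge eta by linarith
    have "sqrt (m + x) \<le> 2 * sqrt m"
    proof -
      have "sqrt (m + x) \<le> sqrt (2\<^sup>2 * m)" using assms by (intro real_sqrt_le_mono) auto
      then show ?thesis by (simp add: real_sqrt_mult)
    qed
    moreover have "sqrt n \<le> 2 * sqrt n" using mn by simp
    ultimately have "sqrt (m + x) + sqrt n \<le> 2 * sqrt m + 2 * sqrt n" by (rule add_mono)
    then have "sqrt (m + x) + sqrt n \<le> 2 * (sqrt m + sqrt n)" by (simp only: distrib_left)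
    then have "sqrt n / (2 * (sqrt m + sqrt n)) \<le> sqrt n / (sqrt (m + x) + sqrt n)"
      using s sp by (intro divide_left_mono mult_pos_pos) auto
    moreover have "sqrt n / (2 * (sqrt m + sqrt n)) = (1 - crit m n) / 2" using crit_bounds(3)[OF mn] by simp
    moreover have "1 - crit (m + x) n = sqrt n / (sqrt (m + x) + sqrt n)" using crit_bounds(3)[of "m + x" n] mn assms by simp
    ultimately have "(1 - crit m n) / 2 \<le> 1 - crit (m + x) n" by (simp only:)
    moreover have "2 * (\<eta> / 2) \<le> (1 - crit m n) / 2" using crit_ge by simp
    ultimately show "2 * (\<eta> / 2) \<le> 1 - crit (m + x) n" by (rule order_trans[rotated])
  qed (use eta mn assms n_t t in auto)
qed

text \<open>
  In the upper right one of two boxes placed corner to corner, the sloped passage time exceeds the shape by $gt$ with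
  a positive probability. The optimal exit column \<open>i\<close> gives an excess over the line of slope
  \<open>1 / crit m n\<close>, and the passage time of the lower left box, widened by \<open>i\<close> columns, is
  typically at least its shape, which follows the same line up to $O(t)$. The exit column is determined by the upper
  right box, the widened lower left boxes are independent of it, and \<open>first_success_indep\<close> combines the
  two. The constant $g$ is taken large enough to leave an excess $t$.
\<close>

proposition upward_fluctuation:
  assumes \<eta>: "0 < \<eta>"
  shows "\<exists>p>0. \<exists>T>0. \<forall>X m n t. exp_array M pos_quadrant X \<longrightarrow> aspect (real m) (real n) \<eta> t \<longrightarrow> T \<le> t \<longrightarrow>
    p \<le> \<P>(\<omega> in M. 2 * shape m n + t \<le> bulk (\<lambda>p. X p \<omega>) (2 * m) (2 * n))"
proof -
  define y where "y = 6 / \<eta> ^ 3 + 4"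
  have y0: "0 < y" using \<eta> by (simp add: y_def add_pos_pos)
  have "0 < \<eta> / 2" using \<eta> by simp
  from typical_lower_bound[OF this] obtain C T1 where C: "0 < C" "0 < T1"
    and low: "\<And>X m n t. exp_array M pos_quadrant X \<Longrightarrow> aspect (real m) (real n) (\<eta> / 2) t \<Longrightarrow> T1 \<le> t \<Longrightarrow>
     1 / 2 \<le> \<P>(\<omega> in M. shape m n - C * t \<le> bulk (\<lambda>p. X p \<omega>) m n)"
    by blast
  define g where "g = C + y\<^sup>2 / (2 * \<eta> ^ 3) + 2"
  have "0 \<le> y\<^sup>2 / (2 * \<eta> ^ 3)" using \<eta> by simp
  then have g: "0 < g" using C unfolding g_def by linarith
  from profile_fluctuation[OF \<eta> g y_def] obtain p T2 where p: "0 < p" "0 < T2"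
    and prof: "\<And>X m n t. exp_array M pos_quadrant X \<Longrightarrow> aspect (real m) (real n) \<eta> t \<Longrightarrow> T2 \<le> t \<Longrightarrow>
    (\<exists>k. 1 \<le> k \<and> k \<le> m \<and> real k \<le> 2 * y * t\<^sup>2 \<and>
     p \<le> \<P>(\<omega> in M. shape m n + g * t \<le> lpp (ramp (1 / crit m n) k) (\<lambda>_. 0) (\<lambda>p. X p \<omega>) m n))"
    by blast
  define T where "T = T1 + T2 + 1 / (2 * \<eta>)"
  have "0 < T" using C p \<eta> by (simp add: T_def add_pos_pos)
  moreover have "0 < p / 2" using p by simp
  moreover have "p / 2 \<le> \<P>(\<omega> in M. 2 * shape m n + t \<le> bulk (\<lambda>p. X p \<omega>) (2 * m) (2 * n))"
    if X: "exp_array M pos_quadrant X" and asp: "aspect (real m) (real n) \<eta> t" and Tt: "T \<le> t" for X m n t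
  proof -
    interpret aspect "real m" "real n" \<eta> t by fact
    have "0 < 1 / (2 * \<eta>)" using \<eta> by simp
    then have TT: "T1 \<le> t" "T2 \<le> t" "1 / (2 * \<eta>) \<le> t" using Tt C p unfolding T_def by linarith+
    let ?X1 = "shift m n X"
    from prof[OF exp_array_shift[OF X, of m n] asp TT(2)] obtain k where k: "1 \<le> k" "k \<le> m" "real k \<le> 2 * y * t\<^sup>2"
      and pk: "p \<le> \<P>(\<omega> in M. shape m n + g * t \<le> lpp (ramp (1 / crit m n) k) (\<lambda>_. 0) (\<lambda>p. ?X1 p \<omega>) m n)"
      by blast
    note nn = exp_arrayD(2)[OF X]
    let ?z = "crit m n"
    have z0: "0 < ?z" using crit_ge eta by linarith
    (* A is the upper right box, which determines the exit column, and B i the lower left box widened by i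
       columns. *)
    define A where "A = {m + 1..2 * m} \<times> {n + 1..2 * n}"
    define B where "B = (\<lambda>i. {1..m + i} \<times> {1..n})"
    define P where "P = (\<lambda>i x. shape m n + g * t - real (i + 1) / ?z \<le> bulk (shift (m + i) n x) (m - i) n)"
    define Q where "Q = (\<lambda>i x. shape m n + real i / ?z - (y\<^sup>2 / (2 * \<eta> ^ 3) + C) * t \<le> bulk (shift 0 0 x) (m + i) n)"
    have s00: "shift 0 0 x = x" for x :: "nat \<times> nat \<Rightarrow> real" by (auto simp: shift_def)
    have mA: "A \<subseteq> pos_quadrant" by (auto simp: A_def)
    have mP: "Measurable.pred (PiM A (\<lambda>_. borel)) (P i)" if "i < k" for i unfolding P_def
      by (rule bulk_shift_pred) (use that k in \<open>auto simp: A_def\<close>)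
    have "1 / 2 * \<P>(\<omega> in M. \<exists>i<k. P i (\<lambda>p\<in>A. X p \<omega>)) \<le> \<P>(\<omega> in M. \<exists>i<k. P i (\<lambda>p\<in>A. X p \<omega>) \<and> Q i (\<lambda>p\<in>B i. X p \<omega>))"
    proof (rule first_success_indep[OF X, where A = "\<lambda>_. A"])
      fix i assume i: "i < k"
      show "A \<inter> B i = {}" "A \<subseteq> pos_quadrant" "B i \<subseteq> pos_quadrant" by (auto simp: A_def B_def)
      show "Measurable.pred (PiM A (\<lambda>_. borel)) (P i)" by (rule mP[OF i])
      show "Measurable.pred (PiM (B i) (\<lambda>_. borel)) (Q i)" unfolding Q_def
        by (rule bulk_shift_pred) (auto simp: B_def)
      have im: "i \<le> m" using i k by simp
      have Qeq: "Q i (\<lambda>p\<in>B i. X p \<omega>) \<longleftrightarrow> shape m n + real i / ?z - (y\<^sup>2 / (2 * \<eta> ^ 3) + C) * t \<le> bulk (\<lambda>p. X p \<omega>) (m + i) n" for \<omega>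
        unfolding Q_def by (subst bulk_shift_restrict) (auto simp: B_def s00)
      have "aspect (real (m + i)) (real n) (\<eta> / 2) t"
        using aspect_extend[OF asp, of "real i"] im by simp
      from low[OF X this TT(1)]
      have "1 / 2 \<le> \<P>(\<omega> in M. shape (real (m + i)) n - C * t \<le> bulk (\<lambda>p. X p \<omega>) (m + i) n)" .
      also have "\<dots> \<le> \<P>(\<omega> in M. Q i (\<lambda>p\<in>B i. X p \<omega>))"
      proof (rule finite_measure_mono)
        have "shape m n + real i / ?z - y\<^sup>2 / (2 * \<eta> ^ 3) * t \<le> shape (real m + real i) n"
          by (rule shape_shift_lower[OF asp]) (use im i k y0 in auto)
        then have "shape m n + real i / ?z - (y\<^sup>2 / (2 * \<eta> ^ 3) + C) * t \<le> shape (real (m + i)) n - C * t"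
          by (simp add: distrib_right)
        then show "{\<omega> \<in> space M. shape (real (m + i)) n - C * t \<le> bulk (\<lambda>p. X p \<omega>) (m + i) n} \<subseteq> {\<omega> \<in> space M. Q i (\<lambda>p\<in>B i. X p \<omega>)}"
          unfolding Qeq by auto
        have [measurable]: "(\<lambda>\<omega>. bulk (\<lambda>p. X p \<omega>) (m + i) n) \<in> borel_measurable M" by (rule bulk_measurable[OF X])
        show "{\<omega> \<in> space M. Q i (\<lambda>p\<in>B i. X p \<omega>)} \<in> events" unfolding Qeq by measurable
      qed
      finally show "1 / 2 \<le> \<P>(\<omega> in M. Q i (\<lambda>p\<in>B i. X p \<omega>))" .
    qed simp
    moreover have Peq: "P i (\<lambda>p\<in>A. X p \<omega>) \<longleftrightarrow> shape m n + g * t - real (i + 1) / ?z \<le> bulk (shift (m + i) n (\<lambda>p. X p \<omega>)) (m - i) n" if "i < k" for i \<omega>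
      unfolding P_def by (subst bulk_shift_restrict) (use that k in \<open>auto simp: A_def\<close>)
    moreover have "p \<le> \<P>(\<omega> in M. \<exists>i<k. P i (\<lambda>p\<in>A. X p \<omega>))"
    proof (rule order_trans[OF pk], rule finite_measure_mono)
      show "{\<omega> \<in> space M. shape m n + g * t \<le> lpp (ramp (1 / ?z) k) (\<lambda>_. 0) (\<lambda>p. ?X1 p \<omega>) m n} \<subseteq> {\<omega> \<in> space M. \<exists>i<k. P i (\<lambda>p\<in>A. X p \<omega>)}"
      proof (safe, rule ccontr)
        fix \<omega> assume big: "shape m n + g * t \<le> lpp (ramp (1 / ?z) k) (\<lambda>_. 0) (\<lambda>p. ?X1 p \<omega>) m n"
          and none: "\<not> (\<exists>i<k. P i (\<lambda>p\<in>A. X p \<omega>))"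
        let ?x = "shift m n (\<lambda>p. X p \<omega>)"
        define v where "v = (\<lambda>j. real j * (1 / ?z) + bulk (shift (j - 1) 0 ?x) (m - j + 1) n)"
        define c where "c = Max (v ` {1..k})"
        have vc: "v j \<le> c" if "1 \<le> j" "j \<le> k" for j unfolding c_def using that by (intro Max_ge) auto
        have "c \<in> v ` {1..k}" unfolding c_def using k by (intro Max_in) auto
        then obtain j where j: "1 \<le> j" "j \<le> k" "c = v j" by auto
        have "shift (j - 1) 0 ?x = shift (m + (j - 1)) n (\<lambda>p. X p \<omega>)" by (auto simp: shift_def ac_simps)
        moreover have "m - j + 1 = m - (j - 1)" using j k by simp
        moreover have j1k: "j - 1 < k" using j by linarith
        moreover have "\<not> P (j - 1) (\<lambda>p\<in>A. X p \<omega>)" using none j1k by auto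
        ultimately have "c < shape m n + g * t"
          using Peq[OF j1k, of \<omega>] j unfolding v_def by (simp add: of_nat_diff)
        moreover have "lpp (\<lambda>i. min (real i * (1 / ?z)) (real k * (1 / ?z))) (\<lambda>_. 0) ?x m n \<le> c"
        proof (rule lpp_near_le)
          show "mono (\<lambda>i. real i * (1 / ?z))" using z0 by (auto simp: mono_def divide_right_mono)
          show "0 \<le> ?x p" for p using nn by (auto simp: shift_def split: prod.split)
          show "real j * (1 / ?z) + bulk (shift (j - 1) 0 ?x) (m - j + 1) n \<le> c" if "1 \<le> j" "j \<le> k" for j
            using vc[OF that] by (simp add: v_def)
        qed (use k z0 in auto)
        moreover have "(\<lambda>i. min (real i * (1 / ?z)) (real k * (1 / ?z))) = ramp (1 / ?z) k"
          using z0 by (auto simp: fun_eq_iff min_def divide_right_mono field_simps)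
        ultimately show False using big by (simp add: shift_apply_fun)
      qed
      have "Measurable.pred M (\<lambda>\<omega>. \<exists>i\<in>{..<k}. P i (\<lambda>p\<in>A. X p \<omega>))"
      proof (rule pred_intros_finite)
        fix i assume i: "i \<in> {..<k}"
        show "Measurable.pred M (\<lambda>\<omega>. P i (\<lambda>p\<in>A. X p \<omega>))"
          using i by (intro exp_array_pred[OF X mA mP]) simp
      qed simp
      then show "{\<omega> \<in> space M. \<exists>i<k. P i (\<lambda>p\<in>A. X p \<omega>)} \<in> events" by (simp only: pred_def Bex_def lessThan_iff)
    qed
    moreover have "\<P>(\<omega> in M. \<exists>i<k. P i (\<lambda>p\<in>A. X p \<omega>) \<and> Q i (\<lambda>p\<in>B i. X p \<omega>)) \<le> \<P>(\<omega> in M. 2 * shape m n + t \<le> bulk (\<lambda>p. X p \<omega>) (2 * m) (2 * n))"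
    proof (rule finite_measure_mono)
      show "{\<omega> \<in> space M. \<exists>i<k. P i (\<lambda>p\<in>A. X p \<omega>) \<and> Q i (\<lambda>p\<in>B i. X p \<omega>)} \<subseteq> {\<omega> \<in> space M. 2 * shape m n + t \<le> bulk (\<lambda>p. X p \<omega>) (2 * m) (2 * n)}"
      proof safe
        fix \<omega> i assume i: "i < k" and Pi: "P i (\<lambda>p\<in>A. X p \<omega>)" and Qi: "Q i (\<lambda>p\<in>B i. X p \<omega>)"
        have 1: "shape m n + g * t - real (i + 1) / ?z \<le> bulk (shift (m + i) n (\<lambda>p. X p \<omega>)) (m - i) n" using Pi Peq[OF i] by simp
        have 2: "shape m n + real i / ?z - (y\<^sup>2 / (2 * \<eta> ^ 3) + C) * t \<le> bulk (\<lambda>p. X p \<omega>) (m + i) n"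
          using Qi unfolding Q_def by (subst (asm) bulk_shift_restrict) (auto simp: B_def s00)
        have "bulk (\<lambda>p. X p \<omega>) (m + i) n + bulk (shift (m + i) n (\<lambda>p. X p \<omega>)) (m - i) n \<le> bulk (\<lambda>p. X p \<omega>) ((m - i) + (m + i)) (n + n)"
          by (rule bulk_superadditive) (rule nn)
        also have "(m - i) + (m + i) = 2 * m" using i k by simp
        finally have 3: "bulk (\<lambda>p. X p \<omega>) (m + i) n + bulk (shift (m + i) n (\<lambda>p. X p \<omega>)) (m - i) n \<le> bulk (\<lambda>p. X p \<omega>) (2 * m) (2 * n)"
          by (simp add: mult_2)
        have "1 / ?z \<le> 1 / (2 * \<eta>)" using crit_ge eta by (intro divide_left_mono) auto
        then have "1 / ?z \<le> t" using TT by linarith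
        moreover have "real (i + 1) / ?z = real i / ?z + 1 / ?z" by (simp add: add_divide_distrib)
        moreover have "g * t = (y\<^sup>2 / (2 * \<eta> ^ 3) + C) * t + 2 * t" by (simp add: g_def algebra_simps)
        ultimately show "2 * shape m n + t \<le> bulk (\<lambda>p. X p \<omega>) (2 * m) (2 * n)" using 1 2 3 by linarith
      qed
      have [measurable]: "(\<lambda>\<omega>. bulk (\<lambda>p. X p \<omega>) (2 * m) (2 * n)) \<in> borel_measurable M" by (rule bulk_measurable[OF X])
      show "{\<omega> \<in> space M. 2 * shape m n + t \<le> bulk (\<lambda>p. X p \<omega>) (2 * m) (2 * n)} \<in> events" by measurable
    qed
    ultimately show ?thesis by linarith
  qed
  ultimately show ?thesis by blast
qed

text \<open>
  Boxes placed corner to corner are independent, and their passage times add up by superadditivity.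
\<close>

lemma block_chain:
  assumes X: "exp_array M pos_quadrant X" and p: "0 \<le> p"
    and one: "\<And>X. exp_array M pos_quadrant X \<Longrightarrow> p \<le> \<P>(\<omega> in M. v \<le> bulk (\<lambda>p. X p \<omega>) m n)"
  shows "p ^ L \<le> \<P>(\<omega> in M. real L * v \<le> bulk (\<lambda>p. X p \<omega>) (L * m) (L * n))"
proof (induction L)
  case 0
  have "{\<omega> \<in> space M. True} = space M" by simp
  then show ?case using prob_space by simp
next
  case (Suc L)
  let ?A = "{1..L * m} \<times> {1..L * n}" and ?B = "{L * m + 1..L * m + m} \<times> {L * n + 1..L * n + n}"
  let ?P = "\<lambda>x. real L * v \<le> bulk (shift 0 0 x) (L * m) (L * n)" and ?Q = "\<lambda>x. v \<le> bulk (shift (L * m) (L * n) x) m n"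
  have s00: "shift 0 0 x = x" for x :: "nat \<times> nat \<Rightarrow> real" by (auto simp: shift_def)
  have P: "?P (\<lambda>p\<in>?A. X p \<omega>) \<longleftrightarrow> real L * v \<le> bulk (\<lambda>p. X p \<omega>) (L * m) (L * n)" for \<omega>
    by (subst bulk_shift_restrict) (auto simp: s00)
  have Q: "?Q (\<lambda>p\<in>?B. X p \<omega>) \<longleftrightarrow> v \<le> bulk (\<lambda>p. shift (L * m) (L * n) X p \<omega>) m n" for \<omega>
    by (subst bulk_shift_restrict) (auto simp: shift_apply_fun)
  have "p ^ Suc L \<le> \<P>(\<omega> in M. real L * v \<le> bulk (\<lambda>p. X p \<omega>) (L * m) (L * n)) * \<P>(\<omega> in M. v \<le> bulk (\<lambda>p. shift (L * m) (L * n) X p \<omega>) m n)"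
    unfolding power_Suc2 by (intro mult_mono Suc.IH one exp_array_shift X p) auto
  also have "\<dots> = \<P>(\<omega> in M. ?P (\<lambda>p\<in>?A. X p \<omega>) \<and> ?Q (\<lambda>p\<in>?B. X p \<omega>))"
    unfolding P[symmetric] Q[symmetric]
    by (rule exp_array_indep_prob[OF X, symmetric]) (auto intro!: bulk_shift_pred)
  also have "\<dots> \<le> \<P>(\<omega> in M. real (Suc L) * v \<le> bulk (\<lambda>p. X p \<omega>) (Suc L * m) (Suc L * n))"
    unfolding P Q
  proof (rule finite_measure_mono)
    show "{\<omega> \<in> space M. real L * v \<le> bulk (\<lambda>p. X p \<omega>) (L * m) (L * n) \<and> v \<le> bulk (\<lambda>p. shift (L * m) (L * n) X p \<omega>) m n}
      \<subseteq> {\<omega> \<in> space M. real (Suc L) * v \<le> bulk (\<lambda>p. X p \<omega>) (Suc L * m) (Suc L * n)}"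
    proof safe
      fix \<omega> assume 1: "real L * v \<le> bulk (\<lambda>p. X p \<omega>) (L * m) (L * n)" and 2: "v \<le> bulk (\<lambda>p. shift (L * m) (L * n) X p \<omega>) m n"
      have "bulk (\<lambda>p. X p \<omega>) (L * m) (L * n) + bulk (shift (L * m) (L * n) (\<lambda>p. X p \<omega>)) m n \<le> bulk (\<lambda>p. X p \<omega>) (m + L * m) (n + L * n)"
        by (rule bulk_superadditive) (rule exp_arrayD(2)[OF X])
      then show "real (Suc L) * v \<le> bulk (\<lambda>p. X p \<omega>) (Suc L * m) (Suc L * n)"
        using 1 2 by (simp add: shift_apply_fun distrib_right)
    qed
    have [measurable]: "(\<lambda>\<omega>. bulk (\<lambda>p. X p \<omega>) (Suc L * m) (Suc L * n)) \<in> borel_measurable M" by (rule bulk_measurable[OF X])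
    show "{\<omega> \<in> space M. real (Suc L) * v \<le> bulk (\<lambda>p. X p \<omega>) (Suc L * m) (Suc L * n)} \<in> events" by measurable
  qed
  finally show ?case .
qed

text \<open>
  Markov's inequality with the exact moment, which is available after adding weights on the horizontal axis.
\<close>

lemma bulk_upper_tail:
  assumes X: "exp_array M pos_quadrant X" and h: "0 < h" "0 < c - h" "c + h < 1"
  shows "\<P>(\<omega> in M. s \<le> bulk (\<lambda>p. X p \<omega>) m n) \<le> exp (cumulant m n c h - 2 * h * s)"
proof (rule markov_exp[OF bulk_measurable[OF X]])
  define Y where "Y = border m n X X"
  have Y: "exp_array M ({0..m} \<times> {0..n}) Y" unfolding Y_def using exp_array_border[OF X] by auto
  have "bulk (\<lambda>p. X p \<omega>) m n \<le> hor_lpp (\<lambda>p. Y p \<omega>) (c + h) m n" for \<omega>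
    by (rule lpp_mono) (use exp_arrayD(2)[OF Y] h in \<open>auto simp: Y_def border_interior intro!: hsum_nonneg\<close>)
  then have "(\<integral>\<^sup>+\<omega>. ennreal (exp (2 * h * bulk (\<lambda>p. X p \<omega>) m n)) \<partial>M)
      \<le> (\<integral>\<^sup>+\<omega>. ennreal (exp (2 * h * hor_lpp (\<lambda>p. Y p \<omega>) (c + h) m n)) \<partial>M)"
    using h by (intro nn_integral_mono ennreal_leI) simp
  also have "\<dots> \<le> ennreal (exp (cumulant m n c h))" by (rule horizontal_moment[OF Y]) (use h in auto)
  finally show "(\<integral>\<^sup>+\<omega>. ennreal (exp (2 * h * bulk (\<lambda>p. X p \<omega>) m n)) \<partial>M) \<le> ennreal (exp (cumulant m n c h))" .
qed (use h in simp)

end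

section \<open>The aspect ratio and the sharp upper tail\<close>

definition cols :: "real \<Rightarrow> nat \<Rightarrow> nat" where
  "cols \<gamma> n = nat \<lfloor>\<gamma> * real n\<rfloor>"

lemma cols_bounds:
  assumes "1 \<le> \<gamma>"
  shows "real (cols \<gamma> n) \<le> \<gamma> * real n" "\<gamma> * real n - 1 < real (cols \<gamma> n)" "n \<le> cols \<gamma> n"
proof -
  have "real n \<le> \<gamma> * real n" using assms mult_right_mono[of 1 \<gamma> "real n"] by simp
  then show "real (cols \<gamma> n) \<le> \<gamma> * real n" "\<gamma> * real n - 1 < real (cols \<gamma> n)"
    using assms unfolding cols_def by (auto simp: of_nat_nat)
  show "n \<le> cols \<gamma> n" using \<open>real n \<le> \<gamma> * real n\<close> unfolding cols_def by (simp add: le_nat_iff le_floor_iff)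
qed

lemma cols_mono: "1 \<le> \<gamma> \<Longrightarrow> i \<le> j \<Longrightarrow> cols \<gamma> i \<le> cols \<gamma> j"
  unfolding cols_def by (intro nat_mono floor_mono mult_left_mono) auto

text \<open>
  Between two sizes the box has the aspect ratio $\gamma$ up to rounding, and rounding is in favour of the wider box.
\<close>

lemma cols_diff:
  assumes "1 \<le> \<gamma>" "i < j"
  shows "cols \<gamma> (j - i) \<le> cols \<gamma> j - cols \<gamma> i" "real (cols \<gamma> j - cols \<gamma> i) \<le> (\<gamma> + 1) * real (j - i)"
    "cols \<gamma> i + (cols \<gamma> j - cols \<gamma> i) = cols \<gamma> j"
proof -
  note m = cols_mono[OF assms(1), of i j]
  show eq: "cols \<gamma> i + (cols \<gamma> j - cols \<gamma> i) = cols \<gamma> j" using m assms(2) by simp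
  have "\<lfloor>\<gamma> * real (j - i)\<rfloor> + \<lfloor>\<gamma> * real i\<rfloor> \<le> \<lfloor>\<gamma> * real (j - i) + \<gamma> * real i\<rfloor>" by (rule le_floor_add)
  also have "\<gamma> * real (j - i) + \<gamma> * real i = \<gamma> * real j" using assms(2) by (simp add: of_nat_diff algebra_simps)
  finally have "int (cols \<gamma> (j - i)) + int (cols \<gamma> i) \<le> int (cols \<gamma> j)"
    using assms(1) unfolding cols_def by simp
  then show "cols \<gamma> (j - i) \<le> cols \<gamma> j - cols \<gamma> i" using eq by linarith
  have "real (cols \<gamma> j - cols \<gamma> i) = real (cols \<gamma> j) - real (cols \<gamma> i)" using eq by linarith
  also have "\<dots> \<le> \<gamma> * real j - (\<gamma> * real i - 1)" using cols_bounds[OF assms(1)] by (intro diff_mono) (auto intro: less_imp_le)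
  also have "\<dots> = \<gamma> * real (j - i) + 1" using assms(2) by (simp add: of_nat_diff algebra_simps)
  also have "\<dots> \<le> (\<gamma> + 1) * real (j - i)" using assms(2) by (simp add: distrib_right)
  finally show "real (cols \<gamma> j - cols \<gamma> i) \<le> (\<gamma> + 1) * real (j - i)" .
qed

lemma shape_ge_linear:
  assumes "1 \<le> \<gamma>" "1 \<le> n" "\<gamma> * n - 1 \<le> m"
  shows "a_const \<gamma> * n - 3 \<le> shape m n"
proof -
  let ?x = "\<gamma> * n"
  have x: "1 \<le> ?x" using assms mult_mono[of 1 \<gamma> 1 n] by simp
  have "sqrt ?x - 1 / sqrt ?x \<le> sqrt (?x - 1)"
  proof (rule real_le_rsqrt)
    have "(sqrt x - 1 / sqrt x)\<^sup>2 = x - 2 + 1 / x" if "1 \<le> x" for x :: real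
      using that by (simp add: power2_diff power_divide)
    from this[OF x] have "(sqrt ?x - 1 / sqrt ?x)\<^sup>2 = ?x - 2 + 1 / ?x" .
    also have "\<dots> \<le> ?x - 1" using x by simp
    finally show "(sqrt ?x - 1 / sqrt ?x)\<^sup>2 \<le> ?x - 1" .
  qed
  also have "sqrt (?x - 1) \<le> sqrt m" using assms by simp
  finally have s: "sqrt ?x - 1 / sqrt ?x \<le> sqrt m" .
  have n0: "0 < sqrt n" using assms by simp
  have m0: "0 \<le> m" using assms x by linarith
  have "1 / sqrt ?x * sqrt n = 1 / sqrt \<gamma>" using assms by (simp add: real_sqrt_mult)
  also have "\<dots> \<le> 1" using assms by simp
  finally have e: "1 / sqrt ?x * sqrt n \<le> 1" .
  have "sqrt ?x * sqrt n - 1 / sqrt ?x * sqrt n \<le> sqrt m * sqrt n" using mult_right_mono[OF s, of "sqrt n"] n0 by (simp add: left_diff_distrib)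
  then have 1: "sqrt ?x * sqrt n - 1 \<le> sqrt m * sqrt n" using e by linarith
  have "sqrt ?x * sqrt n = sqrt \<gamma> * n" using assms by (simp add: real_sqrt_mult)
  then have "a_const \<gamma> * n = ?x + n + 2 * (sqrt ?x * sqrt n)" using assms by (simp add: a_const_def power2_sum algebra_simps)
  moreover have "shape m n = m + n + 2 * (sqrt m * sqrt n)" using assms m0 by (simp add: shape_def power2_sum)
  ultimately show ?thesis using 1 assms(3) by linarith
qed

lemma powr_third_cube: "0 \<le> x \<Longrightarrow> (x powr (1/3)) ^ 3 = (x::real)"
  by (cases "x = 0") (simp_all add: powr_power)

lemma powr_third_mono: "0 \<le> x \<Longrightarrow> x \<le> y \<Longrightarrow> x powr (1/3) \<le> (y::real) powr (1/3)"
  by (rule powr_mono2) auto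

lemma le_powr_third: "0 \<le> x \<Longrightarrow> x ^ 3 \<le> y \<Longrightarrow> x \<le> (y::real) powr (1/3)"
proof (cases "x = 0")
  case False
  assume "0 \<le> x" and le: "x ^ 3 \<le> y"
  with False have x: "0 < x" by simp
  have "x = (x powr real 3) powr (1/3)" using x by (subst powr_powr) simp
  also have "x powr real 3 = x ^ 3" using x by (rule powr_realpow)
  also have "(x ^ 3) powr (1/3) \<le> y powr (1/3)" using x le by (intro powr_third_mono) auto
  finally show ?thesis .
qed simp

lemma aspect_cols:
  fixes m n :: real
  assumes "1 \<le> \<gamma>" "1 \<le> n" "n \<le> m" "m \<le> (\<gamma> + 1) * n"
  shows "aspect m n (1 / (4 * (\<gamma> + 2))) (n powr (1/3))"
proof
  let ?\<eta> = "1 / (4 * (\<gamma> + 2))"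
  have s: "0 < sqrt m" "0 < sqrt n" using assms by auto
  have sp: "0 < sqrt m + sqrt n" using s by (rule add_pos_pos)
  have mn: "0 < m" "0 < n" using assms by auto
  show "0 < ?\<eta>" "0 < m" "0 < n" "0 < n powr (1/3)" using assms by auto
  show "(n powr (1/3)) ^ 3 \<le> n" using assms by (simp add: powr_third_cube)
  have "2 * ?\<eta> * (m + n) = (m + n) / (2 * (\<gamma> + 2))" using assms by (simp add: divide_simps) (simp add: algebra_simps)
  also have "\<dots> \<le> n" using assms by (subst pos_divide_le_eq) (auto simp: algebra_simps)
  finally show "2 * ?\<eta> * (m + n) \<le> (n powr (1/3)) ^ 3" using assms by (simp add: powr_third_cube)
  have h: "2 * ?\<eta> \<le> 1 / 2" using assms by simp
  have "?\<eta> \<le> 1 / (2 * (\<gamma> + 2))" using assms by (intro divide_left_mono) auto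
  then have "2 * ?\<eta> \<le> 2 * (1 / (2 * (\<gamma> + 2)))" by (rule mult_left_mono) simp
  moreover have "2 * (1 / (2 * (\<gamma> + 2))) = 1 / (\<gamma> + 2)" using assms by (simp add: divide_simps)
  ultimately have two_eta: "2 * ?\<eta> \<le> 1 / (\<gamma> + 2)" by (simp only:)
  have "sqrt n \<le> sqrt m" using assms by simp
  then have "1 / 2 \<le> crit m n" unfolding crit_def using sp by (subst pos_le_divide_eq) auto
  then show "2 * ?\<eta> \<le> crit m n" using h by linarith
  have "sqrt m \<le> sqrt ((\<gamma> + 1)\<^sup>2 * n)"
  proof (rule real_sqrt_le_mono)
    have "(\<gamma> + 1) * n \<le> (\<gamma> + 1)\<^sup>2 * n" using assms by (intro mult_right_mono) (auto simp: power2_eq_square)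
    then show "m \<le> (\<gamma> + 1)\<^sup>2 * n" using assms by linarith
  qed
  also have "\<dots> = (\<gamma> + 1) * sqrt n" using assms by (simp add: real_sqrt_mult)
  finally have "sqrt m + sqrt n \<le> (\<gamma> + 2) * sqrt n" by (simp add: algebra_simps)
  then have "1 / (\<gamma> + 2) \<le> sqrt n / (sqrt m + sqrt n)" using sp assms by (simp add: divide_simps mult.commute)
  also have "\<dots> = 1 - crit m n" using crit_bounds(3)[OF mn] by simp
  finally show "2 * ?\<eta> \<le> 1 - crit m n" using two_eta by linarith
qed


lemma b_const_pos: "1 \<le> \<gamma> \<Longrightarrow> 0 < b_const \<gamma>"
proof -
  assume "1 \<le> \<gamma>"
  then have "0 < 1 + sqrt \<gamma>" "0 < \<gamma>" by (auto intro: add_pos_nonneg)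
  then show ?thesis unfolding b_const_def by (intro mult_pos_pos) auto
qed

lemma b_const_cube:
  assumes "1 \<le> \<gamma>"
  shows "b_const \<gamma> ^ 3 = (1 + sqrt \<gamma>) ^ 4 / sqrt \<gamma>"
proof -
  have p: "0 < 1 + sqrt \<gamma>" using assms by (simp add: add_pos_nonneg)
  have "(\<gamma> powr (- 1 / 6)) ^ 3 = \<gamma> powr (- (1 / 2))" using assms by (simp add: powr_power)
  also have "\<dots> = 1 / sqrt \<gamma>" using assms by (simp add: powr_minus powr_half_sqrt inverse_eq_divide)
  finally have 1: "(\<gamma> powr (- 1 / 6)) ^ 3 = 1 / sqrt \<gamma>" .
  have "((1 + sqrt \<gamma>) powr (4 / 3)) ^ 3 = (1 + sqrt \<gamma>) powr (real 4)" using p by (simp add: powr_power)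
  also have "\<dots> = (1 + sqrt \<gamma>) ^ 4" using p by (rule powr_realpow)
  finally show ?thesis unfolding b_const_def power_mult_distrib 1 by simp
qed

context prob_space begin

text \<open>
  The box between the end points of sizes \<open>i\<close> and \<open>j\<close>, whose side lengths are differences of
  rounded numbers.
\<close>

lemma segment_typical:
  assumes \<gamma>: "1 \<le> \<gamma>"
  shows "\<exists>C>0. \<exists>N0\<ge>1. \<forall>X i j. exp_array M pos_quadrant X \<longrightarrow> i + N0 \<le> j \<longrightarrow>
    1 / 2 \<le> \<P>(\<omega> in M. a_const \<gamma> * real (j - i) - C * real (j - i) powr (1/3) \<le> bulk (\<lambda>p. X p \<omega>) (cols \<gamma> j - cols \<gamma> i) (j - i))"
proof -
  define \<eta> where "\<eta> = 1 / (4 * (\<gamma> + 2))"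
  have "0 < \<eta>" using \<gamma> by (simp add: \<eta>_def)
  from typical_lower_bound[OF this] obtain C T where C: "0 < C" "0 < T"
    and low: "\<And>X m n t. exp_array M pos_quadrant X \<Longrightarrow> aspect (real m) (real n) \<eta> t \<Longrightarrow> T \<le> t \<Longrightarrow>
     1 / 2 \<le> \<P>(\<omega> in M. shape m n - C * t \<le> bulk (\<lambda>p. X p \<omega>) m n)"
    by blast
  define N0 where "N0 = nat \<lceil>T ^ 3\<rceil> + 1"
  have "0 < C + 3" using C by simp
  moreover have "1 \<le> N0" by (simp add: N0_def)
  moreover have "1 / 2 \<le> \<P>(\<omega> in M. a_const \<gamma> * real (j - i) - (C + 3) * real (j - i) powr (1/3) \<le> bulk (\<lambda>p. X p \<omega>) (cols \<gamma> j - cols \<gamma> i) (j - i))"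
    if X: "exp_array M pos_quadrant X" and ij: "i + N0 \<le> j" for X i j
  proof -
    let ?n = "j - i" and ?m = "cols \<gamma> j - cols \<gamma> i"
    define t where "t = real ?n powr (1/3)"
    have n: "N0 \<le> ?n" "1 \<le> ?n" "i < j" using ij \<open>1 \<le> N0\<close> by auto
    have "T ^ 3 \<le> real N0" unfolding N0_def using real_nat_ceiling_ge[of "T ^ 3"] by simp
    then have Tt: "T \<le> t" unfolding t_def using n C by (intro le_powr_third) auto
    have t1: "1 \<le> t" unfolding t_def using n by (intro le_powr_third) auto
    have m: "?n \<le> ?m" "\<gamma> * real ?n - 1 \<le> real ?m"
    proof -
      have "cols \<gamma> ?n \<le> ?m" using cols_diff(1)[OF \<gamma> n(3)] .
      moreover have "?n \<le> cols \<gamma> ?n" "\<gamma> * real ?n - 1 < real (cols \<gamma> ?n)" using cols_bounds[OF \<gamma>] by blast+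
      ultimately show "?n \<le> ?m" "\<gamma> * real ?n - 1 \<le> real ?m" by linarith+
    qed
    have "aspect (real ?m) (real ?n) \<eta> t" unfolding \<eta>_def t_def
      by (rule aspect_cols[OF \<gamma>]) (use n m cols_diff(2)[OF \<gamma> n(3)] in auto)
    from low[OF X this Tt] have "1 / 2 \<le> \<P>(\<omega> in M. shape ?m ?n - C * t \<le> bulk (\<lambda>p. X p \<omega>) ?m ?n)" .
    also have "\<dots> \<le> \<P>(\<omega> in M. a_const \<gamma> * real ?n - (C + 3) * t \<le> bulk (\<lambda>p. X p \<omega>) ?m ?n)"
    proof (rule finite_measure_mono)
      have "a_const \<gamma> * real ?n - 3 \<le> shape ?m ?n" by (rule shape_ge_linear[OF \<gamma>]) (use n m in auto)
      then have "a_const \<gamma> * real ?n - (C + 3) * t \<le> shape ?m ?n - C * t" using t1 by (simp add: distrib_right)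
      then show "{\<omega> \<in> space M. shape ?m ?n - C * t \<le> bulk (\<lambda>p. X p \<omega>) ?m ?n} \<subseteq> {\<omega> \<in> space M. a_const \<gamma> * real ?n - (C + 3) * t \<le> bulk (\<lambda>p. X p \<omega>) ?m ?n}"
        by auto
      have [measurable]: "(\<lambda>\<omega>. bulk (\<lambda>p. X p \<omega>) ?m ?n) \<in> borel_measurable M" by (rule bulk_measurable[OF X])
      show "{\<omega> \<in> space M. a_const \<gamma> * real ?n - (C + 3) * t \<le> bulk (\<lambda>p. X p \<omega>) ?m ?n} \<in> events" by measurable
    qed
    finally show ?thesis unfolding t_def .
  qed
  ultimately show ?thesis by blast
qed

text \<open>
  A reflection argument: after the first size in the block at which the level is exceeded, the box from there to the
  size \<open>N'\<close> is independent and typical with probability one half, and then the level is still exceeded at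
  \<open>N'\<close> up to $CN'^{1/3}$. So the maximum over a block costs only a factor 2.
\<close>

lemma block_maximal_inequality:
  assumes \<gamma>: "1 \<le> \<gamma>" and C: "0 \<le> C" and X: "exp_array M pos_quadrant X" and N: "1 \<le> N0" "N2 + N0 \<le> N'"
    and seg: "\<And>X i j. exp_array M pos_quadrant X \<Longrightarrow> i + N0 \<le> j \<Longrightarrow>
    1 / 2 \<le> \<P>(\<omega> in M. a_const \<gamma> * real (j - i) - C * real (j - i) powr (1/3) \<le> bulk (\<lambda>p. X p \<omega>) (cols \<gamma> j - cols \<gamma> i) (j - i))"
  shows "\<P>(\<omega> in M. \<exists>N\<in>{N1..N2}. a_const \<gamma> * N + y \<le> bulk (\<lambda>p. X p \<omega>) (cols \<gamma> N) N)
    \<le> 2 * \<P>(\<omega> in M. a_const \<gamma> * N' + y - C * real N' powr (1/3) \<le> bulk (\<lambda>p. X p \<omega>) (cols \<gamma> N') N')"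
proof -
  define J where "J = Suc N2 - N1"
  define A where "A = (\<lambda>j. {1..cols \<gamma> (N1 + j)} \<times> {1..N1 + j})"
  define B where "B = (\<lambda>j. {cols \<gamma> (N1 + j) + 1..cols \<gamma> N'} \<times> {N1 + j + 1..N'})"
  define P where "P = (\<lambda>j x. a_const \<gamma> * real (N1 + j) + y \<le> bulk (shift 0 0 x) (cols \<gamma> (N1 + j)) (N1 + j))"
  define Q where "Q = (\<lambda>j x. a_const \<gamma> * real (N' - (N1 + j)) - C * real (N' - (N1 + j)) powr (1/3)
     \<le> bulk (shift (cols \<gamma> (N1 + j)) (N1 + j) x) (cols \<gamma> N' - cols \<gamma> (N1 + j)) (N' - (N1 + j)))"
  have s00: "shift 0 0 x = x" for x :: "nat \<times> nat \<Rightarrow> real" by (auto simp: shift_def)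
  have j: "N1 + j \<le> N2" "N1 + j + N0 \<le> N'" "N1 + j < N'" if "j < J" for j using that N unfolding J_def by auto
  have c: "cols \<gamma> (N1 + j) + (cols \<gamma> N' - cols \<gamma> (N1 + j)) = cols \<gamma> N'" if "j < J" for j
    by (rule cols_diff(3)[OF \<gamma> j(3)[OF that]])
  have Peq: "P j (\<lambda>p\<in>A j. X p \<omega>) \<longleftrightarrow> a_const \<gamma> * real (N1 + j) + y \<le> bulk (\<lambda>p. X p \<omega>) (cols \<gamma> (N1 + j)) (N1 + j)" for j \<omega>
    unfolding P_def by (subst bulk_shift_restrict) (auto simp: A_def s00)
  have Qeq: "Q j (\<lambda>p\<in>B j. X p \<omega>) \<longleftrightarrow> a_const \<gamma> * real (N' - (N1 + j)) - C * real (N' - (N1 + j)) powr (1/3)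
     \<le> bulk (shift (cols \<gamma> (N1 + j)) (N1 + j) (\<lambda>p. X p \<omega>)) (cols \<gamma> N' - cols \<gamma> (N1 + j)) (N' - (N1 + j))" if "j < J" for j \<omega>
    unfolding Q_def by (subst bulk_shift_restrict) (use c[OF that] j[OF that] in \<open>auto simp: B_def\<close>)
  have "1 / 2 * \<P>(\<omega> in M. \<exists>j<J. P j (\<lambda>p\<in>A j. X p \<omega>)) \<le> \<P>(\<omega> in M. \<exists>j<J. P j (\<lambda>p\<in>A j. X p \<omega>) \<and> Q j (\<lambda>p\<in>B j. X p \<omega>))"
  proof (rule first_success_indep[OF X])
    fix j assume jJ: "j < J"
    show "A j \<inter> B j = {}" "A j \<subseteq> pos_quadrant" "B j \<subseteq> pos_quadrant" by (auto simp: A_def B_def)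
    show "Measurable.pred (PiM (A j) (\<lambda>_. borel)) (P j)" unfolding P_def by (rule bulk_shift_pred) (auto simp: A_def)
    show "Measurable.pred (PiM (B j) (\<lambda>_. borel)) (Q j)" unfolding Q_def
      by (rule bulk_shift_pred) (use c[OF jJ] j[OF jJ] in \<open>auto simp: B_def\<close>)
    show "1 / 2 \<le> \<P>(\<omega> in M. Q j (\<lambda>p\<in>B j. X p \<omega>))"
      unfolding Qeq[OF jJ] shift_apply_fun[symmetric] by (rule seg[OF exp_array_shift[OF X] j(2)[OF jJ]])
  next
    fix i j assume "i \<le> j" "j < J"
    then show "A i \<subseteq> A j" using cols_mono[OF \<gamma>, of "N1 + i" "N1 + j"] by (auto simp: A_def)
  qed
  also have "\<dots> \<le> \<P>(\<omega> in M. a_const \<gamma> * N' + y - C * real N' powr (1/3) \<le> bulk (\<lambda>p. X p \<omega>) (cols \<gamma> N') N')"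
  proof (rule finite_measure_mono)
    show "{\<omega> \<in> space M. \<exists>j<J. P j (\<lambda>p\<in>A j. X p \<omega>) \<and> Q j (\<lambda>p\<in>B j. X p \<omega>)}
       \<subseteq> {\<omega> \<in> space M. a_const \<gamma> * N' + y - C * real N' powr (1/3) \<le> bulk (\<lambda>p. X p \<omega>) (cols \<gamma> N') N'}"
    proof safe
      fix \<omega> j assume jJ: "j < J" and "P j (\<lambda>p\<in>A j. X p \<omega>)" "Q j (\<lambda>p\<in>B j. X p \<omega>)"
      then have 1: "a_const \<gamma> * real (N1 + j) + y \<le> bulk (\<lambda>p. X p \<omega>) (cols \<gamma> (N1 + j)) (N1 + j)"
        and 2: "a_const \<gamma> * real (N' - (N1 + j)) - C * real (N' - (N1 + j)) powr (1/3)
          \<le> bulk (shift (cols \<gamma> (N1 + j)) (N1 + j) (\<lambda>p. X p \<omega>)) (cols \<gamma> N' - cols \<gamma> (N1 + j)) (N' - (N1 + j))"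
        using Peq Qeq[OF jJ] by auto
      have "bulk (\<lambda>p. X p \<omega>) (cols \<gamma> (N1 + j)) (N1 + j) + bulk (shift (cols \<gamma> (N1 + j)) (N1 + j) (\<lambda>p. X p \<omega>)) (cols \<gamma> N' - cols \<gamma> (N1 + j)) (N' - (N1 + j))
         \<le> bulk (\<lambda>p. X p \<omega>) ((cols \<gamma> N' - cols \<gamma> (N1 + j)) + cols \<gamma> (N1 + j)) ((N' - (N1 + j)) + (N1 + j))"
        by (rule bulk_superadditive) (rule exp_arrayD(2)[OF X])
      also have "(cols \<gamma> N' - cols \<gamma> (N1 + j)) + cols \<gamma> (N1 + j) = cols \<gamma> N'" using c[OF jJ] by simp
      also have "(N' - (N1 + j)) + (N1 + j) = N'" using j[OF jJ] by simp
      finally have 3: "bulk (\<lambda>p. X p \<omega>) (cols \<gamma> (N1 + j)) (N1 + j) + bulk (shift (cols \<gamma> (N1 + j)) (N1 + j) (\<lambda>p. X p \<omega>)) (cols \<gamma> N' - cols \<gamma> (N1 + j)) (N' - (N1 + j))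
         \<le> bulk (\<lambda>p. X p \<omega>) (cols \<gamma> N') N'" .
      have "real (N' - (N1 + j)) powr (1/3) \<le> real N' powr (1/3)" by (rule powr_third_mono) auto
      then have 4: "C * real (N' - (N1 + j)) powr (1/3) \<le> C * real N' powr (1/3)" using C by (intro mult_left_mono) auto
      have "a_const \<gamma> * real (N1 + j) + a_const \<gamma> * real (N' - (N1 + j)) = a_const \<gamma> * real N'"
        using j[OF jJ] by (simp add: of_nat_diff algebra_simps)
      then show "a_const \<gamma> * N' + y - C * real N' powr (1/3) \<le> bulk (\<lambda>p. X p \<omega>) (cols \<gamma> N') N'" using 1 2 3 4 by linarith
    qed
    have [measurable]: "(\<lambda>\<omega>. bulk (\<lambda>p. X p \<omega>) (cols \<gamma> N') N') \<in> borel_measurable M" by (rule bulk_measurable[OF X])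
    show "{\<omega> \<in> space M. a_const \<gamma> * N' + y - C * real N' powr (1/3) \<le> bulk (\<lambda>p. X p \<omega>) (cols \<gamma> N') N'} \<in> events" by measurable
  qed
  also have "{\<omega> \<in> space M. \<exists>j<J. P j (\<lambda>p\<in>A j. X p \<omega>)} = {\<omega> \<in> space M. \<exists>N\<in>{N1..N2}. a_const \<gamma> * N + y \<le> bulk (\<lambda>p. X p \<omega>) (cols \<gamma> N) N}"
  proof -
    have "(\<exists>j<J. R (N1 + j)) \<longleftrightarrow> (\<exists>N\<in>{N1..N2}. R N)" for R :: "nat \<Rightarrow> bool"
    proof
      assume "\<exists>N\<in>{N1..N2}. R N"
      then obtain N where "N \<in> {N1..N2}" "R N" by blast
      then show "\<exists>j<J. R (N1 + j)" by (intro exI[of _ "N - N1"]) (auto simp: J_def)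
    qed (auto simp: J_def)
    from this[of "\<lambda>N. a_const \<gamma> * N + y \<le> bulk (\<lambda>p. X p \<omega>) (cols \<gamma> N) N" for \<omega>] show ?thesis unfolding Peq by simp
  qed
  finally show ?thesis by simp
qed

text \<open>
  At the critical density the bound of \<open>bulk_upper_tail\<close> has the exponent $\frac23b^3h^3n-2hbs^2n^{1/3}$
  up to fifth order in \<open>h\<close>, since the linear terms cancel and the cubic coefficient is $b^3n$. The choice
  $h=s/(bn^{1/3})$ minimises this and yields $-\frac43s^3$.
\<close>

lemma sharp_upper_tail:
  assumes \<gamma>: "1 \<le> \<gamma>"
  shows "\<exists>D>0. \<exists>d>0. \<forall>X n s. exp_array M pos_quadrant X \<longrightarrow> 1 \<le> n \<longrightarrow> 0 < s \<longrightarrow> s \<le> d * real n powr (1/3) \<longrightarrow>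
    \<P>(\<omega> in M. a_const \<gamma> * n + b_const \<gamma> * s\<^sup>2 * real n powr (1/3) \<le> bulk (\<lambda>p. X p \<omega>) (cols \<gamma> n) n)
      \<le> exp (- (4 / 3) * s ^ 3 + D * s ^ 5 / real n powr (2/3))"
proof -
  define c where "c = sqrt \<gamma> / (sqrt \<gamma> + 1)"
  let ?b = "b_const \<gamma>" and ?a = "a_const \<gamma>"
  have g1: "1 \<le> sqrt \<gamma>" using \<gamma> by simp
  have g2: "0 < sqrt \<gamma> + 1" using g1 by linarith
  have c1: "1 - c = 1 / (sqrt \<gamma> + 1)" using g2 unfolding c_def by (simp add: diff_divide_eq_iff)
  have c: "0 < c" "c < 1" "1 - c \<le> c"
  proof -
    show "0 < c" unfolding c_def using g1 g2 by (intro divide_pos_pos) linarith+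
    have "0 < 1 - c" unfolding c1 using g2 by (intro divide_pos_pos) simp_all
    then show "c < 1" by simp
    show "1 - c \<le> c" unfolding c1 unfolding c_def using g1 g2 by (intro divide_right_mono) linarith+
  qed
  have b: "0 < ?b" using b_const_pos[OF \<gamma>] .
  define D where "D = (\<gamma> / c ^ 5 + 1 / (1 - c) ^ 5) / ?b ^ 5"
  define d where "d = ?b * (1 - c) / 2"
  have "0 < D" using c b \<gamma> by (simp add: D_def add_pos_pos)
  moreover have "0 < d" using c b by (simp add: d_def)
  moreover have "\<P>(\<omega> in M. ?a * n + ?b * s\<^sup>2 * real n powr (1/3) \<le> bulk (\<lambda>p. X p \<omega>) (cols \<gamma> n) n)
      \<le> exp (- (4 / 3) * s ^ 3 + D * s ^ 5 / real n powr (2/3))"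
    if X: "exp_array M pos_quadrant X" and n: "1 \<le> n" and s: "0 < s" "s \<le> d * real n powr (1/3)" for X n s
  proof -
    define t where "t = real n powr (1/3)"
    have t: "0 < t" "t ^ 3 = real n" "real n powr (2/3) = t\<^sup>2" using n by (auto simp: t_def powr_third_cube powr_power)
    define h where "h = s / (?b * t)"
    have h: "0 < h" "2 * h \<le> 1 - c" "h * ?b * t = s"
    proof -
      show "0 < h" "h * ?b * t = s" using s b t by (auto simp: h_def)
      have "2 * s \<le> ?b * (1 - c) * t" using s unfolding d_def t_def[symmetric] by simp
      then show "2 * h \<le> 1 - c" using b t by (simp add: h_def field_simps)
    qed
    have crit: "crit (\<gamma> * n) n = c"
    proof -
      have "sqrt (\<gamma> * n) + sqrt n = (sqrt \<gamma> + 1) * sqrt n" by (simp add: real_sqrt_mult algebra_simps)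
      then show ?thesis unfolding crit_def c_def using n by (simp add: real_sqrt_mult)
    qed
    have mn: "0 < \<gamma> * n" "0 < real n" using n \<gamma> by auto
    have sh: "shape (\<gamma> * n) n = ?a * n" using n \<gamma> by (simp add: shape_def a_const_def real_sqrt_mult power2_sum algebra_simps)
    have cub: "cubic (\<gamma> * n) n c = ?b ^ 3 * n"
    proof -
      have "cubic (\<gamma> * n) n c = (sqrt (\<gamma> * n) + sqrt n) ^ 4 / (sqrt (\<gamma> * n) * sqrt n)"
        using cubic_crit[OF mn] crit by simp
      also have "\<dots> = (sqrt n * (1 + sqrt \<gamma>)) ^ 4 / (sqrt \<gamma> * (sqrt n * sqrt n))" using \<gamma> by (simp add: real_sqrt_mult algebra_simps)
      also have "\<dots> = (sqrt n) ^ 4 * (1 + sqrt \<gamma>) ^ 4 / (sqrt \<gamma> * n)" by (simp only: power_mult_distrib) simp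
      also have "(sqrt n) ^ 4 = (real n)\<^sup>2" using power_mult[of "sqrt n" 2 2] by simp
      finally show ?thesis unfolding b_const_cube[OF \<gamma>] using n by (simp add: power2_eq_square)
    qed
    have "\<P>(\<omega> in M. ?a * n + ?b * s\<^sup>2 * t \<le> bulk (\<lambda>p. X p \<omega>) (cols \<gamma> n) n)
       \<le> exp (cumulant (cols \<gamma> n) n c h - 2 * h * (?a * n + ?b * s\<^sup>2 * t))"
      by (rule bulk_upper_tail[OF X]) (use h c in auto)
    also have "\<dots> \<le> exp (- (4 / 3) * s ^ 3 + D * s ^ 5 / t\<^sup>2)"
    proof (subst exp_le_cancel_iff)
      have "cumulant (cols \<gamma> n) n c h \<le> cumulant (\<gamma> * n) n c h"
        unfolding cumulant_def using cols_bounds(1)[OF \<gamma>, of n] h c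
        by (intro add_right_mono mult_right_mono ln_ge_zero) (auto simp: divide_simps)
      also have "\<dots> \<le> 2 * h * drift (\<gamma> * n) n c + 2 / 3 * h ^ 3 * cubic (\<gamma> * n) n c + h ^ 5 * (\<gamma> * n / c ^ 5 + n / (1 - c) ^ 5)"
        by (rule cumulant_upper) (use h c mn in auto)
      also have "drift (\<gamma> * n) n c = ?a * n" using drift_crit[OF mn] crit sh by simp
      also have "h ^ 5 * (\<gamma> * n / c ^ 5 + n / (1 - c) ^ 5) = D * s ^ 5 / t\<^sup>2"
      proof -
        have "\<gamma> * n / c ^ 5 + n / (1 - c) ^ 5 = (D * ?b ^ 5) * t ^ 3"
         proof -
           have "D * ?b ^ 5 = \<gamma> / c ^ 5 + 1 / (1 - c) ^ 5" unfolding D_def using b by simp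
           then show ?thesis unfolding t(2) by (simp add: distrib_right)
         qed
        moreover have "h ^ 5 = s ^ 5 / (?b ^ 5 * t ^ 5)" by (simp add: h_def power_divide power_mult_distrib)
        moreover have "t ^ 5 = t ^ 3 * t\<^sup>2" by (simp flip: power_add)
        moreover have "real n \<noteq> 0" using t(1) t(2) by (metis less_irrefl zero_less_power)
        ultimately show ?thesis using b t by simp
      qed
      also have "2 / 3 * h ^ 3 * cubic (\<gamma> * n) n c = 2 / 3 * s ^ 3"
      proof -
        have "h ^ 3 * (?b ^ 3 * t ^ 3) = s ^ 3" unfolding h(3)[symmetric] by (simp add: power_mult_distrib)
        then show ?thesis unfolding cub t(2) by simp
      qed
      finally have "cumulant (cols \<gamma> n) n c h \<le> 2 * h * (?a * n) + 2 / 3 * s ^ 3 + D * s ^ 5 / t\<^sup>2" .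
      moreover have "2 * h * (?a * n + ?b * s\<^sup>2 * t) = 2 * h * (?a * n) + 2 * s ^ 3"
      proof -
        have "h * (?b * s\<^sup>2 * t) = (h * ?b * t) * s\<^sup>2" by (simp only: mult_ac)
        also have "\<dots> = s ^ 3" unfolding h(3) by (simp add: power2_eq_square power3_eq_cube)
        finally show ?thesis by (simp add: distrib_left)
      qed
      ultimately show "cumulant (cols \<gamma> n) n c h - 2 * h * (?a * n + ?b * s\<^sup>2 * t) \<le> - (4 / 3) * s ^ 3 + D * s ^ 5 / t\<^sup>2" by linarith
    qed
    finally show ?thesis unfolding t_def[symmetric] t(3) .
  qed
  ultimately show ?thesis by blast
qed

end

text \<open>
  The asymptotics for the sizes $\exp(wk)$: \<open>s k\<close> is the level on the scale of
  \<open>sharp_upper_tail\<close> at the size $\exp(w(k+2))$, and the condition on $\tau$ says that $\frac43s_k^3$ is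
  asymptotically $(1+\epsilon)\ln k$, so that the tail is summable.
\<close>

lemma lil_rate:
  fixes w C b \<tau> D \<epsilon> d N0 :: real
  assumes w: "0 < w" and "0 < C" "0 < b" "0 < \<tau>" "0 < D" "0 < \<epsilon>" "0 < d"
    and lim: "4 / 3 * (\<tau> powr (3/2) * exp (- w)) = 1 + \<epsilon>"
  defines "s \<equiv> \<lambda>k::nat. sqrt (\<tau> * ((exp (w * real k) - 1) / exp (w * (real k + 2))) powr (1/3) * ln (ln (exp (w * real k) - 1)) powr (2/3) - C / b)"
  shows "\<forall>\<^sub>F k in sequentially. 0 < s k \<and> s k \<le> d * (exp (w * (real k + 2)) - 1) powr (1/3) \<and>
     - (4 / 3) * s k ^ 3 + D * s k ^ 5 / (exp (w * (real k + 2)) - 1) powr (2/3) \<le> 1 - (1 + \<epsilon> / 2) * ln (real k) \<and>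
     1 \<le> ln (exp (w * real k) - 1) \<and> N0 \<le> exp (w * (real k + 2)) - exp (w * (real k + 1)) \<and>
     0 < \<tau> * ((exp (w * real k) - 1) / exp (w * (real k + 2))) powr (1/3) * ln (ln (exp (w * real k) - 1)) powr (2/3) - C / b"
proof -
  have e1: "\<forall>\<^sub>F k in sequentially. 0 < s k" unfolding s_def using assms by real_asymp
  have e2: "\<forall>\<^sub>F k in sequentially. s k \<le> d * (exp (w * (real k + 2)) - 1) powr (1/3)" unfolding s_def using assms(1-7) by real_asymp
  have "(\<lambda>k. s k ^ 3 / ln (real k)) \<longlonglongrightarrow> ((\<tau> * inverse (exp (w * 2)) powr (1 / 3)) powr (1 / 2)) ^ 3"
    unfolding s_def using assms(1-7) by real_asymp
  moreover have "((\<tau> * inverse (exp (w * 2)) powr (1 / 3)) powr (1 / 2)) ^ 3 = \<tau> powr (3/2) * exp (- w)"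
  proof -
    have q: "inverse (exp (w * 2)) powr (1 / 3) = exp (- 2 * w / 3)" by (simp add: powr_def exp_minus[symmetric])
    have "(y powr (1/2)) ^ 3 = y powr (3/2)" if "0 < y" for y :: real
    proof -
      have "(y powr (1/2)) ^ 3 = (y powr (1/2)) powr (real 3)" using that by (subst powr_realpow) auto
      also have "\<dots> = y powr (3/2)" by (subst powr_powr) simp
      finally show ?thesis .
    qed
    then have "((\<tau> * exp (- 2 * w / 3)) powr (1 / 2)) ^ 3 = (\<tau> * exp (- 2 * w / 3)) powr (3/2)" using assms by simp
    also have "\<dots> = \<tau> powr (3/2) * exp (- 2 * w / 3) powr (3/2)" by (rule powr_mult)
    also have "exp (- 2 * w / 3) powr (3/2) = exp (- w)" by (simp add: powr_def)
    finally show ?thesis unfolding q .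
  qed
  ultimately have "(\<lambda>k. 4 / 3 * (s k ^ 3 / ln (real k))) \<longlonglongrightarrow> 4 / 3 * (\<tau> powr (3/2) * exp (- w))"
    by (intro tendsto_mult) auto
  then have "(\<lambda>k. 4 / 3 * (s k ^ 3 / ln (real k))) \<longlonglongrightarrow> 1 + \<epsilon>" by (simp only: lim)
  then have e3: "\<forall>\<^sub>F k in sequentially. 1 + \<epsilon> / 2 < 4 / 3 * (s k ^ 3 / ln (real k))"
    by (rule order_tendstoD) (use assms in simp)
  have e4: "\<forall>\<^sub>F k in sequentially. D * s k ^ 5 / (exp (w * (real k + 2)) - 1) powr (2/3) \<le> 1"
    unfolding s_def using assms(1-7) by real_asymp
  have e5: "\<forall>\<^sub>F k in sequentially. 1 \<le> ln (exp (w * real k) - 1)" using w by real_asymp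
  have e6: "\<forall>\<^sub>F k in sequentially. N0 \<le> exp (w * (real k + 2)) - exp (w * (real k + 1))"
  proof -
    have "\<forall>\<^sub>F k::nat in sequentially. N0 \<le> w * exp (w * real k)" using w by real_asymp
    then show ?thesis
    proof eventually_elim
      case (elim k)
      have "exp (w * (real k + 1)) * w \<le> exp (w * (real k + 1)) * (exp w - 1)"
        by (intro mult_left_mono) ((use exp_ge_add_one_self[of w] in linarith), simp)
      also have "\<dots> = exp (w * (real k + 2)) - exp (w * (real k + 1))" by (simp add: algebra_simps flip: exp_add)
      finally have "exp (w * (real k + 1)) * w \<le> exp (w * (real k + 2)) - exp (w * (real k + 1))" .
      moreover have "w * exp (w * real k) \<le> exp (w * (real k + 1)) * w" using w by (simp add: mult.commute)
      ultimately show ?case using elim by linarith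
    qed
  qed
  have e7: "\<forall>\<^sub>F k::nat in sequentially. 0 < ln (real k)" by real_asymp
  show ?thesis
    using e1 e2 e3 e4 e5 e6 e7
  proof eventually_elim
    case (elim k)
    have "(1 + \<epsilon> / 2) * ln (real k) < 4 / 3 * s k ^ 3" using elim(3,7) by (simp add: field_simps)
    moreover have "0 < \<tau> * ((exp (w * real k) - 1) / exp (w * (real k + 2))) powr (1/3) * ln (ln (exp (w * real k) - 1)) powr (2/3) - C / b"
      using elim(1) unfolding s_def by simp
    ultimately show ?case using elim by auto
  qed
qed

section \<open>The upper half of the law of the iterated logarithm\<close>

context prob_space begin

text \<open>
  On the block $[e^{wk},e^{w(k+1)}]$ an excess over the level of its left end has at most twice the probability of an
  excess at $e^{w(k+2)}$. Using the level of the left end at the larger size loses a factor $e^{-w}$ in the exponent,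
  which the choice $e^{2w}=1+\epsilon$ compensates: $(1+\epsilon)^{3/2}e^{-w}=1+\epsilon$. The probabilities are then
  at most a multiple of $k^{-(1+\epsilon/2)}$.
\<close>

theorem lil_upper:
  assumes \<gamma>: "1 \<le> \<gamma>" and X: "exp_array M pos_quadrant X" and \<epsilon>: "0 < \<epsilon>"
  shows "AE \<omega> in M. \<forall>\<^sub>F N in sequentially. bulk (\<lambda>p. X p \<omega>) (cols \<gamma> N) N
    \<le> a_const \<gamma> * real N + b_const \<gamma> * ((3 / 4) powr (2 / 3) * (1 + \<epsilon>)) * real N powr (1 / 3) * ln (ln (real N)) powr (2 / 3)"
proof -
  define \<tau> where "\<tau> = (3 / 4) powr (2 / 3) * (1 + \<epsilon>)"
  define w where "w = ln (1 + \<epsilon>) / 2"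
  define E where "E = (\<lambda>k::nat. exp (w * real k))"
  define K where "K = (\<lambda>k. nat \<lfloor>E k\<rfloor>)"
  let ?a = "a_const \<gamma>" and ?b = "b_const \<gamma>" and ?H = "\<lambda>\<omega> N. bulk (\<lambda>p. X p \<omega>) (cols \<gamma> N) N"
  have b: "0 < ?b" by (rule b_const_pos[OF \<gamma>])
  have \<tau>0: "0 < \<tau>" using \<epsilon> by (simp add: \<tau>_def)
  have w0: "0 < w" using \<epsilon> by (simp add: w_def)
  have lim: "4 / 3 * (\<tau> powr (3/2) * exp (- w)) = 1 + \<epsilon>"
  proof -
    have 1: "\<tau> powr (3/2) = 3 / 4 * (1 + \<epsilon>) powr (3/2)" unfolding \<tau>_def using \<epsilon> by (simp add: powr_mult powr_powr)
    have 2: "exp (- w) = (1 + \<epsilon>) powr (- 1/2)" using \<epsilon> by (simp add: w_def powr_def)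
    have 3: "(1 + \<epsilon>) powr (3/2) * (1 + \<epsilon>) powr (- 1/2) = (1 + \<epsilon>) powr 1" by (simp flip: powr_add)
    have "4 / 3 * (3 / 4 * u * v) = u * v" for u v :: real by simp
    then show ?thesis unfolding 1 2 using 3 \<epsilon> by simp
  qed
  obtain C N0 where C: "0 < C" and N0: "1 \<le> N0"
    and seg: "\<And>X i j. exp_array M pos_quadrant X \<Longrightarrow> i + N0 \<le> j \<Longrightarrow>
    1 / 2 \<le> \<P>(\<omega> in M. ?a * real (j - i) - C * real (j - i) powr (1/3) \<le> bulk (\<lambda>p. X p \<omega>) (cols \<gamma> j - cols \<gamma> i) (j - i))"
    using segment_typical[OF \<gamma>] by blast
  obtain D d where D: "0 < D" "0 < d"
    and tail: "\<And>X n s. exp_array M pos_quadrant X \<Longrightarrow> 1 \<le> n \<Longrightarrow> 0 < s \<Longrightarrow> s \<le> d * real n powr (1/3) \<Longrightarrow>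
    \<P>(\<omega> in M. ?a * n + ?b * s\<^sup>2 * real n powr (1/3) \<le> bulk (\<lambda>p. X p \<omega>) (cols \<gamma> n) n)
      \<le> exp (- (4 / 3) * s ^ 3 + D * s ^ 5 / real n powr (2/3))"
    using sharp_upper_tail[OF \<gamma>] by blast
  define s where "s = (\<lambda>k::nat. sqrt (\<tau> * ((exp (w * real k) - 1) / exp (w * (real k + 2))) powr (1/3) * ln (ln (exp (w * real k) - 1)) powr (2/3) - C / ?b))"
  define y where "y = (\<lambda>k. ?b * \<tau> * (E k - 1) powr (1/3) * ln (ln (E k - 1)) powr (2/3))"
  define U where "U = (\<lambda>k. {\<omega> \<in> space M. \<exists>N\<in>{K k..K (Suc k)}. ?a * N + y k \<le> ?H \<omega> N})"
  have Kb: "real (K k) \<le> E k" "E k - 1 < real (K k)" for k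
    unfolding K_def E_def by (auto simp: of_nat_nat)
  have E2: "exp (w * (real k + 2)) = E (k + 2)" "exp (w * (real k + 1)) = E (k + 1)" "exp (w * real k) = E k" for k by (simp_all add: E_def add.commute)
  have U_events: "U k \<in> events" for k
  proof -
    have [measurable]: "(\<lambda>\<omega>. ?H \<omega> N) \<in> borel_measurable M" for N by (rule bulk_measurable[OF X])
    show ?thesis unfolding U_def by measurable
  qed
  have rate: "\<forall>\<^sub>F k in sequentially. 0 < s k \<and> s k \<le> d * (E (k + 2) - 1) powr (1/3) \<and>
     - (4 / 3) * s k ^ 3 + D * s k ^ 5 / (E (k + 2) - 1) powr (2/3) \<le> 1 - (1 + \<epsilon> / 2) * ln (real k) \<and>
     1 \<le> ln (E k - 1) \<and> real N0 + 1 \<le> E (k + 2) - E (k + 1) \<and>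
     0 < \<tau> * ((E k - 1) / E (k + 2)) powr (1/3) * ln (ln (E k - 1)) powr (2/3) - C / ?b"
    using lil_rate[OF w0 C b \<tau>0 D(1) \<epsilon> D(2) lim, of "real N0 + 1"] unfolding s_def E2 .
  have "\<forall>\<^sub>F k in sequentially. norm (prob (U k)) \<le> 2 * exp 1 * real k powr (- (1 + \<epsilon> / 2))"
    using rate eventually_ge_at_top[of 1]
  proof eventually_elim
    case (elim k)
    then have s: "0 < s k" "s k \<le> d * (E (k + 2) - 1) powr (1/3)"
      and ex: "- (4 / 3) * s k ^ 3 + D * s k ^ 5 / (E (k + 2) - 1) powr (2/3) \<le> 1 - (1 + \<epsilon> / 2) * ln (real k)"
      and ll: "1 \<le> ln (E k - 1)" and gap: "real N0 + 1 \<le> E (k + 2) - E (k + 1)"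
      and rad: "0 < \<tau> * ((E k - 1) / E (k + 2)) powr (1/3) * ln (ln (E k - 1)) powr (2/3) - C / ?b" and k: "1 \<le> k"
      by auto
    let ?N = "K (k + 2)"
    have Epos: "0 < E j" for j by (simp add: E_def)
    have "real (K (Suc k) + N0) \<le> real ?N" using Kb(1)[of "k + 1"] Kb(2)[of "k + 2"] gap by simp
    then have NN: "K (Suc k) + N0 \<le> ?N" by (simp only: of_nat_le_iff)
    have Ek: "1 \<le> E j" for j unfolding E_def using w0 by simp
    have E21: "0 < E (k + 2) - 1" unfolding E_def using w0 by simp
    have E1: "0 < E k - 1" unfolding E_def using w0 k by simp
    have Eone: "(E (k + 2) - 1) powr q \<le> real ?N powr q" if "0 \<le> q" for q
      using Kb(2)[of "k + 2"] E21 that by (intro powr_mono2) auto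
    have "prob (U k) \<le> 2 * \<P>(\<omega> in M. ?a * ?N + y k - C * real ?N powr (1/3) \<le> ?H \<omega> ?N)"
      unfolding U_def by (rule block_maximal_inequality[OF \<gamma> _ X N0 NN seg]) (use C in auto)
    also have "\<P>(\<omega> in M. ?a * ?N + y k - C * real ?N powr (1/3) \<le> ?H \<omega> ?N)
       \<le> \<P>(\<omega> in M. ?a * ?N + ?b * (s k)\<^sup>2 * real ?N powr (1/3) \<le> ?H \<omega> ?N)"
    proof (rule finite_measure_mono)
      have sq: "(s k)\<^sup>2 = \<tau> * ((E k - 1) / E (k + 2)) powr (1/3) * ln (ln (E k - 1)) powr (2/3) - C / ?b"
        using rad unfolding s_def E2 by simp
      have "((E k - 1) / E (k + 2)) powr (1/3) * real ?N powr (1/3) = ((E k - 1) / E (k + 2) * real ?N) powr (1/3)"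
        by (rule powr_mult[symmetric])
      also have "\<dots> \<le> (E k - 1) powr (1/3)"
      proof (rule powr_third_mono)
        have "(E k - 1) * (real ?N / E (k + 2)) \<le> (E k - 1) * 1"
          using Kb(1)[of "k + 2"] Epos[of "k + 2"] E1 by (intro mult_left_mono) auto
        then show "(E k - 1) / E (k + 2) * real ?N \<le> E k - 1" by simp
        show "0 \<le> (E k - 1) / E (k + 2) * real ?N" using E1 Epos[of "k + 2"] by simp
      qed
      finally have "((E k - 1) / E (k + 2)) powr (1/3) * real ?N powr (1/3) \<le> (E k - 1) powr (1/3)" .
      then have "?b * \<tau> * ln (ln (E k - 1)) powr (2/3) * (((E k - 1) / E (k + 2)) powr (1/3) * real ?N powr (1/3))
         \<le> ?b * \<tau> * ln (ln (E k - 1)) powr (2/3) * (E k - 1) powr (1/3)"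
        using b \<tau>0 by (intro mult_left_mono) auto
      moreover have "?b * (s k)\<^sup>2 * real ?N powr (1/3)
          = ?b * \<tau> * ln (ln (E k - 1)) powr (2/3) * (((E k - 1) / E (k + 2)) powr (1/3) * real ?N powr (1/3)) - C * real ?N powr (1/3)"
        unfolding sq using b by (simp add: right_diff_distrib left_diff_distrib)
      moreover have "y k = ?b * \<tau> * ln (ln (E k - 1)) powr (2/3) * (E k - 1) powr (1/3)" unfolding y_def by simp
      ultimately have le: "?b * (s k)\<^sup>2 * real ?N powr (1/3) \<le> y k - C * real ?N powr (1/3)" by linarith
      show "{\<omega> \<in> space M. ?a * ?N + y k - C * real ?N powr (1/3) \<le> ?H \<omega> ?N}
         \<subseteq> {\<omega> \<in> space M. ?a * ?N + ?b * (s k)\<^sup>2 * real ?N powr (1/3) \<le> ?H \<omega> ?N}"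
      proof safe
        fix \<omega> assume "?a * ?N + y k - C * real ?N powr (1/3) \<le> ?H \<omega> ?N"
        then show "?a * ?N + ?b * (s k)\<^sup>2 * real ?N powr (1/3) \<le> ?H \<omega> ?N" using le by linarith
      qed
      have [measurable]: "(\<lambda>\<omega>. ?H \<omega> N) \<in> borel_measurable M" for N by (rule bulk_measurable[OF X])
      show "{\<omega> \<in> space M. ?a * ?N + ?b * (s k)\<^sup>2 * real ?N powr (1/3) \<le> ?H \<omega> ?N} \<in> events" by measurable
    qed
    also have "\<dots> \<le> exp (- (4 / 3) * s k ^ 3 + D * s k ^ 5 / real ?N powr (2/3))"
    proof (rule tail[OF X])
      show "1 \<le> ?N" using NN N0 by linarith
      show "0 < s k" by (rule s)
      have "d * (E (k + 2) - 1) powr (1/3) \<le> d * real ?N powr (1/3)" using D Eone[of "1/3"] by (intro mult_left_mono) auto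
      then show "s k \<le> d * real ?N powr (1/3)" using s(2) by linarith
    qed
    also have "\<dots> \<le> exp (1 - (1 + \<epsilon> / 2) * ln (real k))"
    proof (subst exp_le_cancel_iff)
      have "D * s k ^ 5 / real ?N powr (2/3) \<le> D * s k ^ 5 / (E (k + 2) - 1) powr (2/3)"
        by (intro divide_left_mono Eone) (use D s E21 NN N0 in auto)
      then show "- (4 / 3) * s k ^ 3 + D * s k ^ 5 / real ?N powr (2/3) \<le> 1 - (1 + \<epsilon> / 2) * ln (real k)"
        using ex by linarith
    qed
    also have "\<dots> = exp 1 * real k powr (- (1 + \<epsilon> / 2))"
      using k by (simp add: powr_def algebra_simps flip: exp_add)
    finally show ?case by simp
  qed
  moreover have "summable (\<lambda>k. 2 * exp 1 * real k powr (- (1 + \<epsilon> / 2)))"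
    using \<epsilon> by (intro summable_mult) (simp add: summable_real_powr_iff)
  ultimately have "summable (\<lambda>k. prob (U k))" by (rule summable_comparison_test_ev)
  then have "AE \<omega> in M. \<forall>\<^sub>F k in sequentially. \<omega> \<in> space M - U k"
    by (intro borel_cantelli_AE1) (auto simp: U_events emeasure_eq_measure)
  then show ?thesis
  proof eventually_elim
    case (elim \<omega>)
    then have "\<forall>\<^sub>F k in sequentially. \<omega> \<in> space M - U k \<and> 1 \<le> ln (E k - 1)"
      using rate by eventually_elim auto
    then obtain k0 where k0: "\<And>k. k0 \<le> k \<Longrightarrow> \<omega> \<in> space M - U k \<and> 1 \<le> ln (E k - 1)"
      unfolding eventually_sequentially by blast
    show ?case
      using eventually_ge_at_top[of "Suc (K (k0 + 1))"]
    proof eventually_elim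
      case (elim N)
      (* The block that contains N. *)
      define k where "k = nat \<lfloor>ln (real N) / w\<rfloor>"
      have "E (k0 + 1) < real (K (k0 + 1)) + 1" using Kb(2)[of "k0 + 1"] by linarith
      also have "\<dots> \<le> real N" using elim by simp
      finally have EN: "E (k0 + 1) < real N" .
      have "1 \<le> E (k0 + 1)" unfolding E_def using w0 by simp
      then have N1: "1 < real N" using EN by linarith
      have "w * real (k0 + 1) \<le> ln (real N)" using EN N1 unfolding E_def by (subst ln_ge_iff) auto
      then have q: "real (k0 + 1) \<le> ln (real N) / w" using w0 by (simp add: pos_le_divide_eq mult.commute)
      have kq: "real k \<le> ln (real N) / w" "ln (real N) / w < real k + 1"
        unfolding k_def using q by (auto simp: of_nat_nat)
      have "k0 \<le> k" using q kq by linarith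
      have "w * real k \<le> ln (real N)" using kq w0 by (simp add: pos_le_divide_eq mult.commute)
      then have lo: "E k \<le> real N" using N1 unfolding E_def by (simp add: ln_ge_iff)
      have "ln (real N) < w * real (Suc k)" using kq w0 by (simp add: pos_divide_less_eq mult.commute add.commute)
      then have "exp (ln (real N)) < E (Suc k)" unfolding E_def by (subst exp_less_cancel_iff)
      then have hi: "real N < E (Suc k)" using N1 by simp
      have "N \<in> {K k..K (Suc k)}"
      proof -
        have "real (K k) \<le> real N" using Kb(1)[of k] lo by linarith
        moreover have "real N < real (K (Suc k)) + 1" using Kb(2)[of "Suc k"] hi by linarith
        ultimately show ?thesis by auto
      qed
      moreover have "\<omega> \<notin> U k" "\<omega> \<in> space M" and ll: "1 \<le> ln (E k - 1)" using k0[OF \<open>k0 \<le> k\<close>] by auto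
      ultimately have "?H \<omega> N < ?a * N + y k" unfolding U_def by force
      also have "y k \<le> ?b * \<tau> * real N powr (1/3) * ln (ln (real N)) powr (2/3)"
      proof -
        have E0: "0 < E k - 1"
        proof (rule ccontr)
          assume "\<not> 0 < E k - 1"
          moreover have "1 \<le> E k" unfolding E_def using w0 by simp
          ultimately have "E k - 1 = 0" by linarith
          then show False using ll by simp
        qed
        have "ln (E k - 1) \<le> ln (real N)" using E0 lo by (rule_tac ln_mono) linarith+
        then have "ln (ln (E k - 1)) \<le> ln (ln (real N))" using ll by (rule_tac ln_mono) linarith+
        then have "ln (ln (E k - 1)) powr (2/3) \<le> ln (ln (real N)) powr (2/3)" using ll by (intro powr_mono2) auto
        moreover have "(E k - 1) powr (1/3) \<le> real N powr (1/3)" using E0 lo by (intro powr_third_mono) auto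
        ultimately have "(E k - 1) powr (1/3) * ln (ln (E k - 1)) powr (2/3) \<le> real N powr (1/3) * ln (ln (real N)) powr (2/3)"
          by (intro mult_mono) auto
        then have "(?b * \<tau>) * ((E k - 1) powr (1/3) * ln (ln (E k - 1)) powr (2/3)) \<le> (?b * \<tau>) * (real N powr (1/3) * ln (ln (real N)) powr (2/3))"
          using b \<tau>0 by (intro mult_left_mono) auto
        then show ?thesis unfolding y_def by (simp only: mult.assoc)
      qed
      finally show ?case unfolding \<tau>_def by simp
    qed
  qed
qed

end

section \<open>Chains of boxes and dyadic windows\<close>

lemma shift_shift: "shift i j (shift k l x) = shift (i + k) (j + l) x"
  by (auto simp: shift_def add.assoc)

context prob_space begin

text \<open>
  Divide the box into $L$ double boxes of $n/L$ rows. Each exceeds its deterministic size by $(n/2L)^{1/3}$ with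
  probability at least $p$ independently, which adds up to a multiple of $L^{2/3}n^{1/3}$; this dominates the loss
  $O(L)$ by rounding when $n/L$ is large.
\<close>

lemma blocks_fluctuation:
  assumes \<gamma>: "1 \<le> \<gamma>"
  shows "\<exists>p R. 0 < p \<and> p < 1 \<and> 0 < R \<and> (\<forall>X n L. exp_array M pos_quadrant X \<longrightarrow> 1 \<le> L \<longrightarrow> R * real L \<le> real n \<longrightarrow>
    p ^ L \<le> \<P>(\<omega> in M. a_const \<gamma> * real n + 1 / 4 * real L powr (2/3) * real n powr (1/3) \<le> bulk (\<lambda>p. X p \<omega>) (cols \<gamma> n) n))"
proof -
  let ?a = "a_const \<gamma>"
  define \<eta> where "\<eta> = 1 / (4 * (\<gamma> + 2))"
  have "0 < \<eta>" using \<gamma> by (simp add: \<eta>_def)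
  from upward_fluctuation[OF this] obtain p' T where p': "0 < p'" and T: "0 < T"
    and up: "\<And>X m n t. exp_array M pos_quadrant X \<Longrightarrow> aspect (real m) (real n) \<eta> t \<Longrightarrow> T \<le> t \<Longrightarrow>
    p' \<le> \<P>(\<omega> in M. 2 * shape m n + t \<le> bulk (\<lambda>p. X p \<omega>) (2 * m) (2 * n))"
    by blast
  define p where "p = min p' (1 / 2)"
  have a0: "0 \<le> ?a" by (simp add: a_const_def)
  (* V bounds the cube root of n / (4 L) from below; it exceeds the threshold T and absorbs the rounding loss per
     box. *)
  define V where "V = 4 * ?a + 12 + T"
  have V: "0 < V" "1 \<le> V" using a0 T by (auto simp: V_def)
  define R where "R = 4 * V ^ 3"
  have "p ^ L \<le> \<P>(\<omega> in M. ?a * real n + 1 / 4 * real L powr (2/3) * real n powr (1/3) \<le> bulk (\<lambda>p. X p \<omega>) (cols \<gamma> n) n)"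
    if X: "exp_array M pos_quadrant X" and L: "1 \<le> L" and n: "R * real L \<le> real n" for X n L
  proof -
    define n0 where "n0 = n div (2 * L)"
    define m0 where "m0 = cols \<gamma> n0"
    define t0 where "t0 = real n0 powr (1/3)"
    define u where "u = (real n / (4 * real L)) powr (1/3)"
    have u3: "u ^ 3 = real n / (4 * real L)" unfolding u_def by (rule powr_third_cube) simp
    have V3: "V ^ 3 \<le> real n / (4 * real L)" using n L by (simp add: R_def pos_le_divide_eq)
    have uV: "V \<le> u" unfolding u_def using V V3 by (intro le_powr_third) auto
    have nn: "2 * L * n0 \<le> n" "n < 2 * L * n0 + 2 * L"
      using div_times_less_eq_dividend[of n "2 * L"] dividend_less_div_times[of "2 * L" n] L unfolding n0_def by (auto simp: mult.commute)
    have nr: "2 * real L * real n0 \<le> real n" "real n < 2 * real L * real n0 + 2 * real L"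
      using nn by (metis of_nat_le_iff of_nat_mult of_nat_numeral, metis of_nat_add of_nat_less_iff of_nat_mult of_nat_numeral)
    have "1 \<le> V ^ 3" using V by simp
    then have "1 \<le> real n / (4 * real L)" using V3 by linarith
    then have n4: "4 * real L \<le> real n" using L by (simp add: pos_le_divide_eq)
    have "real n / (4 * real L) \<le> real n0"
    proof -
      have "real n \<le> 4 * real L * real n0" using nr n4 by linarith
      then show ?thesis using L by (simp add: pos_divide_le_eq mult.commute)
    qed
    then have tu: "u \<le> t0" unfolding u_def t0_def by (intro powr_third_mono) auto
    have "1 \<le> real n / (4 * real L)" using n4 L by simp
    then have n01: "1 \<le> n0" using \<open>real n / (4 * real L) \<le> real n0\<close> by linarith
    have m0: "n0 \<le> m0" "\<gamma> * real n0 - 1 \<le> real m0" "real m0 \<le> \<gamma> * real n0"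
      unfolding m0_def using cols_bounds[OF \<gamma>, of n0] by auto
    have "real m0 \<le> (\<gamma> + 1) * real n0" using m0(3) by (simp add: distrib_right)
    then have "aspect (real m0) (real n0) \<eta> t0" unfolding \<eta>_def t0_def
      using n01 m0 by (intro aspect_cols[OF \<gamma>]) auto
    then have one: "p' \<le> \<P>(\<omega> in M. 2 * shape m0 n0 + t0 \<le> bulk (\<lambda>p. X p \<omega>) (2 * m0) (2 * n0))"
      if "exp_array M pos_quadrant X" for X
      using up[OF that] tu uV a0 T unfolding V_def by force
    have "p ^ L \<le> p' ^ L" unfolding p_def using p' by (intro power_mono) auto
    also have "\<dots> \<le> \<P>(\<omega> in M. real L * (2 * shape m0 n0 + t0) \<le> bulk (\<lambda>p. X p \<omega>) (L * (2 * m0)) (L * (2 * n0)))"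
      by (rule block_chain[OF X _ one]) (use p' in auto)
    also have "\<dots> \<le> \<P>(\<omega> in M. ?a * real n + 1 / 4 * real L powr (2/3) * real n powr (1/3) \<le> bulk (\<lambda>p. X p \<omega>) (cols \<gamma> n) n)"
    proof (rule finite_measure_mono)
      have le: "?a * real n + 1 / 4 * real L powr (2/3) * real n powr (1/3) \<le> real L * (2 * shape m0 n0 + t0)"
      proof -
        define l where "l = real L powr (1/3)"
        define t where "t = real n powr (1/3)"
        have l3: "l ^ 3 = real L" and t3: "t ^ 3 = real n" unfolding l_def t_def by (simp_all add: powr_third_cube)
        have l0: "0 \<le> l" "0 \<le> u" by (simp_all add: l_def u_def)
        have L2: "real L powr (2/3) = l ^ 2" unfolding l_def using L by (simp add: power2_eq_square flip: powr_add)
        have "t ^ 3 \<le> (2 * l * u) ^ 3"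
          unfolding power_mult_distrib l3 u3 t3 using L by simp
        then have "t \<le> 2 * l * u" using l0 by (rule_tac power_le_imp_le_base[of _ 2]) (auto simp: eval_nat_numeral)
        then have "l ^ 2 * t \<le> l ^ 2 * (2 * l * u)" by (rule mult_left_mono) simp
        also have "l ^ 2 * (2 * l * u) = 2 * l ^ 3 * u" by (simp add: power2_eq_square power3_eq_cube)
        finally have 1: "1 / 4 * real L powr (2/3) * real n powr (1/3) \<le> 1 / 2 * (real L * u)"
          unfolding l3 L2 t_def[symmetric] by (simp add: mult_ac)
        have "V * real L \<le> u * real L" by (rule mult_right_mono[OF uV]) simp
        moreover have "(4 * ?a + 12) * real L \<le> V * real L" by (rule mult_right_mono) (use T in \<open>auto simp: V_def\<close>)
        ultimately have 2: "(4 * ?a + 12) * real L \<le> real L * u" by (simp add: mult.commute)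
        have 3: "real L * u \<le> real L * t0" by (rule mult_left_mono[OF tu]) simp
        have "?a * real n0 - 3 \<le> shape m0 n0" by (rule shape_ge_linear[OF \<gamma>]) (use n01 m0 in auto)
        then have 4: "real L * (2 * (?a * real n0 - 3) + t0) \<le> real L * (2 * shape m0 n0 + t0)" by (intro mult_left_mono) auto
        have "?a * real n \<le> ?a * (2 * real L * real n0 + 2 * real L)" by (rule mult_left_mono) (use nr a0 in auto)
        then have 5: "?a * real n \<le> 2 * (?a * (real L * real n0)) + 2 * (?a * real L)" by (simp add: distrib_left)
        have 6: "real L * (2 * (?a * real n0 - 3) + t0) = 2 * (?a * (real L * real n0)) - 6 * real L + real L * t0"
          by (simp add: algebra_simps)
        have 7: "(4 * ?a + 12) * real L = 4 * (?a * real L) + 12 * real L" by (simp add: distrib_right)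
        show ?thesis using 1 2 3 4 5 6 7 by linarith
      qed
      have c: "L * (2 * m0) \<le> cols \<gamma> n"
      proof -
        have "real (L * (2 * m0)) = 2 * real L * real m0" by simp
        also have "\<dots> \<le> 2 * real L * (\<gamma> * real n0)" by (rule mult_left_mono) (use m0 in auto)
        also have "\<dots> = \<gamma> * (2 * real L * real n0)" by simp
        also have "\<dots> \<le> \<gamma> * real n" by (rule mult_left_mono) (use nr \<gamma> in auto)
        finally show ?thesis unfolding cols_def by (simp add: le_nat_floor)
      qed
      have m: "bulk (\<lambda>p. X p \<omega>) (L * (2 * m0)) (L * (2 * n0)) \<le> bulk (\<lambda>p. X p \<omega>) (cols \<gamma> n) n" for \<omega>
        by (rule bulk_mono) (use c nn exp_arrayD(2)[OF X] in \<open>auto simp: mult_ac\<close>)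
      show "{\<omega> \<in> space M. real L * (2 * shape m0 n0 + t0) \<le> bulk (\<lambda>p. X p \<omega>) (L * (2 * m0)) (L * (2 * n0))}
         \<subseteq> {\<omega> \<in> space M. ?a * real n + 1 / 4 * real L powr (2/3) * real n powr (1/3) \<le> bulk (\<lambda>p. X p \<omega>) (cols \<gamma> n) n}"
        by (intro Collect_mono impI conjI) (use le m in \<open>auto intro: order_trans\<close>)
      have [measurable]: "(\<lambda>\<omega>. bulk (\<lambda>p. X p \<omega>) (cols \<gamma> n) n) \<in> borel_measurable M" by (rule bulk_measurable[OF X])
      show "{\<omega> \<in> space M. ?a * real n + 1 / 4 * real L powr (2/3) * real n powr (1/3) \<le> bulk (\<lambda>p. X p \<omega>) (cols \<gamma> n) n} \<in> events" by measurable
    qed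
    finally show ?thesis .
  qed
  moreover have "0 < p" "p < 1" using p' by (auto simp: p_def)
  moreover have "0 < R" using V by (simp add: R_def)
  ultimately show ?thesis by blast
qed

end

text \<open>
  The index runs downwards because the windows are later inspected from the largest scale to the smallest.
\<close>

lemma harmonic_product_small:
  fixes p :: real
  assumes "0 < p" "p \<le> 1"
  shows "\<exists>J. (\<Prod>j<J. 1 - p / real (m + 1 + (J - Suc j))) \<le> 1 / 2"
proof -
  have "\<not> summable (\<lambda>i. p / real (m + 1 + i))"
  proof
    assume "summable (\<lambda>i. p / real (m + 1 + i))"
    then have "summable (\<lambda>i. 1 / p * (p / real (i + (m + 1))))" by (intro summable_mult) (simp add: add_ac)
    then have "summable (\<lambda>i. inverse (real (i + (m + 1))))" using assms by (simp add: inverse_eq_divide)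
    then have "summable (\<lambda>i. inverse (real i))" by (subst (asm) summable_iff_shift)
    then show False using not_summable_harmonic[where 'a = real] by simp
  qed
  then have "\<exists>J. \<not> (\<Sum>i<J. p / real (m + 1 + i)) \<le> ln 2"
    using summableI_nonneg_bounded[of "\<lambda>i. p / real (m + 1 + i)" "ln 2"] assms by auto
  then obtain J where J: "ln 2 < (\<Sum>i<J. p / real (m + 1 + i))" by (auto simp: not_le)
  have "(\<Prod>j<J. 1 - p / real (m + 1 + (J - Suc j))) \<le> (\<Prod>j<J. exp (- (p / real (m + 1 + (J - Suc j)))))"
  proof (rule prod_mono)
    fix j
    have "p / real (m + 1 + (J - Suc j)) \<le> 1" using assms by (simp add: pos_divide_le_eq)
    then show "0 \<le> 1 - p / real (m + 1 + (J - Suc j)) \<and> 1 - p / real (m + 1 + (J - Suc j)) \<le> exp (- (p / real (m + 1 + (J - Suc j))))"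
      using exp_ge_add_one_self[of "- (p / real (m + 1 + (J - Suc j)))"] by simp
  qed
  also have "\<dots> = exp (- (\<Sum>j<J. p / real (m + 1 + (J - Suc j))))" by (simp only: exp_sum[symmetric] finite_lessThan sum_negf)
  also have "(\<Sum>j<J. p / real (m + 1 + (J - Suc j))) = (\<Sum>i<J. p / real (m + 1 + i))"
    by (rule sum.nat_diff_reindex)
  also have "exp (- \<dots>) \<le> exp (- ln 2)" using J by simp
  also have "\<dots> = 1 / 2" by (simp add: exp_minus)
  finally show ?thesis by blast
qed

context prob_space begin

text \<open>
  The segment between $2^{k-1}$ and $2^k$ has an excess \<open>f k\<close> with probability at least $p/k$, so enough
  consecutive segments contain an excess with probability one half. The segments are inspected from the last to the
  first: then the first success \<open>k\<close> depends on weights beyond $2^{k-1}$ only, and the path from $2^{k_0}$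
  to $2^{k-1}$ is independent of it and typical with probability one half.
\<close>

lemma window_fluctuation:
  fixes f :: "nat \<Rightarrow> real"
  assumes \<gamma>: "1 \<le> \<gamma>" and C: "0 \<le> C" and p: "0 < p" "p \<le> 1" and m: "k0 + N0 + 1 \<le> m"
    and seg: "\<And>X i j. exp_array M pos_quadrant X \<Longrightarrow> i + N0 \<le> j \<Longrightarrow>
    1 / 2 \<le> \<P>(\<omega> in M. a_const \<gamma> * real (j - i) - C * real (j - i) powr (1/3) \<le> bulk (\<lambda>p. X p \<omega>) (cols \<gamma> j - cols \<gamma> i) (j - i))"
    and up: "\<And>X k. exp_array M pos_quadrant X \<Longrightarrow> m < k \<Longrightarrow>
    p / real k \<le> \<P>(\<omega> in M. a_const \<gamma> * real (2 ^ k - 2 ^ (k - 1)) + f k \<le> bulk (\<lambda>p. X p \<omega>) (cols \<gamma> (2 ^ k) - cols \<gamma> (2 ^ (k - 1))) (2 ^ k - 2 ^ (k - 1)))"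
  shows "\<exists>K. m \<le> K \<and> (\<forall>X. exp_array M pos_quadrant X \<longrightarrow> 1 / 4 \<le> \<P>(\<omega> in M. \<exists>k\<in>{m<..K}.
     a_const \<gamma> * real (2 ^ k - 2 ^ k0) + f k - C * real (2 ^ k) powr (1/3)
       \<le> bulk (shift (cols \<gamma> (2 ^ k0)) (2 ^ k0) (\<lambda>p. X p \<omega>)) (cols \<gamma> (2 ^ k) - cols \<gamma> (2 ^ k0)) (2 ^ k - 2 ^ k0)))"
proof -
  let ?a = "a_const \<gamma>"
  define c where "c = (\<lambda>k. cols \<gamma> (2 ^ k))"
  obtain J where J: "(\<Prod>j<J. 1 - p / real (m + 1 + (J - Suc j))) \<le> 1 / 2" using harmonic_product_small[OF p] by blast
  define h where "h = (\<lambda>j. m + (J - Suc j))"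
  have h: "m \<le> h j" "h j < m + J" "k0 < h j" if "j < J" for j using that m by (auto simp: h_def)
  have c_mono: "c i \<le> c j" if "i \<le> j" for i j unfolding c_def using that by (intro cols_mono[OF \<gamma>]) simp
  have cd: "c i + (c j - c i) = c j" "(2::nat) ^ i + (2 ^ j - 2 ^ i) = 2 ^ j" if "i \<le> j" for i j
    using c_mono[OF that] that by auto
  (* S j carries one segment, A j this segment and all later ones, and B j the part between 2 ^ k0 and the
     segment. *)
  define S where "S = (\<lambda>j. {c (h j) + 1..c (Suc (h j))} \<times> {(2::nat) ^ h j + 1..2 ^ Suc (h j)})"
  define A where "A = (\<lambda>j. {c (h j) + 1..c (m + J)} \<times> {(2::nat) ^ h j + 1..2 ^ (m + J)})"
  define B where "B = (\<lambda>j. {c k0 + 1..c (h j)} \<times> {(2::nat) ^ k0 + 1..2 ^ h j})"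
  define P where "P = (\<lambda>j x. ?a * real (2 ^ Suc (h j) - 2 ^ h j) + f (Suc (h j)) \<le> bulk (shift (c (h j)) (2 ^ h j) x) (c (Suc (h j)) - c (h j)) (2 ^ Suc (h j) - 2 ^ h j))"
  define Q where "Q = (\<lambda>j x. ?a * real (2 ^ h j - 2 ^ k0) - C * real (2 ^ h j - 2 ^ k0) powr (1/3) \<le> bulk (shift (c k0) (2 ^ k0) x) (c (h j) - c k0) (2 ^ h j - 2 ^ k0))"
  have Sreg: "{c (h j) + 1..c (h j) + (c (Suc (h j)) - c (h j))} \<times> {2 ^ h j + 1..2 ^ h j + (2 ^ Suc (h j) - 2 ^ h j)} \<subseteq> S j" for j
    unfolding S_def using cd[of "h j" "Suc (h j)"] by auto
  have SA: "S j \<subseteq> A j" if "j < J" for j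
  proof -
    have "Suc (h j) \<le> m + J" using h[OF that] by simp
    then have "c (Suc (h j)) \<le> c (m + J)" "(2::nat) ^ Suc (h j) \<le> 2 ^ (m + J)" by (intro c_mono power_increasing; simp)+
    then show ?thesis unfolding S_def A_def by auto
  qed
  have Breg: "{c k0 + 1..c k0 + (c (h j) - c k0)} \<times> {2 ^ k0 + 1..2 ^ k0 + (2 ^ h j - 2 ^ k0)} \<subseteq> B j" if "j < J" for j
    unfolding B_def using cd[of k0 "h j"] h[OF that] by auto
  have "1 / 4 \<le> \<P>(\<omega> in M. \<exists>k\<in>{m<..m + J}.
     ?a * real (2 ^ k - 2 ^ k0) + f k - C * real (2 ^ k) powr (1/3) \<le> bulk (shift (c k0) (2 ^ k0) (\<lambda>p. X p \<omega>)) (c k - c k0) (2 ^ k - 2 ^ k0))"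
    if X: "exp_array M pos_quadrant X" for X
  proof -
    have PA: "P j (\<lambda>p\<in>A j. X p \<omega>) \<longleftrightarrow> P j (\<lambda>p. X p \<omega>)" if "j < J" for j \<omega>
      unfolding P_def by (subst bulk_shift_restrict) (use Sreg SA[OF that] in \<open>auto simp del: power_Suc\<close>)
    have PS: "P j (\<lambda>p\<in>S j. X p \<omega>) \<longleftrightarrow> P j (\<lambda>p. X p \<omega>)" for j \<omega>
      unfolding P_def by (subst bulk_shift_restrict[OF Sreg]) simp
    have QB: "Q j (\<lambda>p\<in>B j. X p \<omega>) \<longleftrightarrow> Q j (\<lambda>p. X p \<omega>)" if "j < J" for j \<omega>
      unfolding Q_def by (subst bulk_shift_restrict[OF Breg[OF that]]) simp
    have Pp: "p / real (m + 1 + (J - Suc j)) \<le> \<P>(\<omega> in M. P j (\<lambda>p. X p \<omega>))" if "j < J" for j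
      using up[OF exp_array_shift[OF X], of "Suc (h j)" "c (h j)" "2 ^ h j"] h[OF that]
      unfolding P_def shift_apply_fun c_def by (simp add: h_def)
    have fail: "\<P>(\<omega> in M. \<forall>j<J. \<not> P j (\<lambda>p\<in>S j. X p \<omega>)) \<le> (\<Prod>j<J. 1 - p / real (m + 1 + (J - Suc j)))"
    proof (rule all_fail_le_prod[OF X])
      fix j assume j: "j < J"
      show "S j \<subseteq> pos_quadrant" by (auto simp: S_def)
      show "Measurable.pred (PiM (S j) (\<lambda>_. borel)) (P j)" unfolding P_def by (rule bulk_shift_pred[OF Sreg])
      show "p / real (m + 1 + (J - Suc j)) \<le> \<P>(\<omega> in M. P j (\<lambda>p\<in>S j. X p \<omega>))" unfolding PS by (rule Pp[OF j])
    next
      fix i j assume "i < j" "j < J"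
      then have "Suc (h j) \<le> h i" by (auto simp: h_def)
      from c_mono[OF this] show "S i \<inter> S j = {}" by (auto simp: S_def)
    qed
    have half: "1 / 2 \<le> \<P>(\<omega> in M. \<exists>j<J. P j (\<lambda>p. X p \<omega>))"
    proof (rule prob_compl_le_imp_ge)
      have "Measurable.pred M (\<lambda>\<omega>. P j (\<lambda>p\<in>S j. X p \<omega>))" for j
        by (rule exp_array_pred[OF X]) (auto simp: S_def P_def intro!: bulk_shift_pred Sreg[unfolded S_def])
      then have [measurable]: "Measurable.pred M (\<lambda>\<omega>. P j (\<lambda>p. X p \<omega>))" for j unfolding PS .
      show "Measurable.pred M (\<lambda>\<omega>. \<exists>j<J. P j (\<lambda>p. X p \<omega>))" by measurable
      show "\<P>(\<omega> in M. \<not> (\<exists>j<J. P j (\<lambda>p. X p \<omega>))) \<le> 1 - 1 / 2" using fail J unfolding PS by simp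
    qed
    have "1 / 2 * \<P>(\<omega> in M. \<exists>j<J. P j (\<lambda>p\<in>A j. X p \<omega>)) \<le> \<P>(\<omega> in M. \<exists>j<J. P j (\<lambda>p\<in>A j. X p \<omega>) \<and> Q j (\<lambda>p\<in>B j. X p \<omega>))"
    proof (rule first_success_indep[OF X])
      fix j assume j: "j < J"
      show "A j \<inter> B j = {}" "A j \<subseteq> pos_quadrant" "B j \<subseteq> pos_quadrant" by (auto simp: A_def B_def)
      show "Measurable.pred (PiM (A j) (\<lambda>_. borel)) (P j)" unfolding P_def
        by (rule bulk_shift_pred) (rule subset_trans[OF Sreg SA[OF j]])
      show "Measurable.pred (PiM (B j) (\<lambda>_. borel)) (Q j)" unfolding Q_def by (rule bulk_shift_pred[OF Breg[OF j]])
      have "(2::nat) ^ k0 + N0 \<le> 2 ^ h j"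
      proof -
        have "Suc N0 \<le> 2 ^ N0" by (rule Suc_leI) simp
        have "(2::nat) ^ k0 + N0 \<le> 2 ^ k0 + 2 ^ k0 * N0" by simp
        also have "\<dots> = 2 ^ k0 * Suc N0" by simp
        also have "\<dots> \<le> 2 ^ k0 * 2 ^ N0" using \<open>Suc N0 \<le> 2 ^ N0\<close> by (rule mult_le_mono2)
        also have "\<dots> \<le> 2 ^ h j" unfolding power_add[symmetric] using h(1)[OF j] m by (intro power_increasing) auto
        finally show ?thesis .
      qed
      from seg[OF exp_array_shift[OF X] this, of "c k0" "2 ^ k0"]
      show "1 / 2 \<le> \<P>(\<omega> in M. Q j (\<lambda>p\<in>B j. X p \<omega>))"
        unfolding QB[OF j] unfolding Q_def shift_apply_fun c_def .
    next
      fix i j assume "i \<le> j" "j < J"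
      then have "h j \<le> h i" by (auto simp: h_def)
      then have "c (h j) \<le> c (h i)" "(2::nat) ^ h j \<le> 2 ^ h i" by (intro c_mono power_increasing; simp)+
      then show "A i \<subseteq> A j" by (auto simp: A_def simp del: power_increasing_iff)
    qed
    also have "{\<omega> \<in> space M. \<exists>j<J. P j (\<lambda>p\<in>A j. X p \<omega>)} = {\<omega> \<in> space M. \<exists>j<J. P j (\<lambda>p. X p \<omega>)}" using PA by auto
    finally have "1 / 4 \<le> \<P>(\<omega> in M. \<exists>j<J. P j (\<lambda>p\<in>A j. X p \<omega>) \<and> Q j (\<lambda>p\<in>B j. X p \<omega>))" using half by linarith
    also have "\<dots> \<le> \<P>(\<omega> in M. \<exists>k\<in>{m<..m + J}.
     ?a * real (2 ^ k - 2 ^ k0) + f k - C * real (2 ^ k) powr (1/3) \<le> bulk (shift (c k0) (2 ^ k0) (\<lambda>p. X p \<omega>)) (c k - c k0) (2 ^ k - 2 ^ k0))"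
    proof (rule finite_measure_mono)
      show "{\<omega> \<in> space M. \<exists>j<J. P j (\<lambda>p\<in>A j. X p \<omega>) \<and> Q j (\<lambda>p\<in>B j. X p \<omega>)}
        \<subseteq> {\<omega> \<in> space M. \<exists>k\<in>{m<..m + J}. ?a * real (2 ^ k - 2 ^ k0) + f k - C * real (2 ^ k) powr (1/3) \<le> bulk (shift (c k0) (2 ^ k0) (\<lambda>p. X p \<omega>)) (c k - c k0) (2 ^ k - 2 ^ k0)}"
      proof (intro Collect_mono impI conjI; elim conjE exE)
        fix \<omega> j assume j: "j < J" and "P j (\<lambda>p\<in>A j. X p \<omega>)" "Q j (\<lambda>p\<in>B j. X p \<omega>)"
        define x where "x = (\<lambda>p. X p \<omega>)"
        define k where "k = h j"
        note hj = h[OF j, folded k_def]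
        have 1: "?a * real (2 ^ Suc k - 2 ^ k) + f (Suc k) \<le> bulk (shift (c k) (2 ^ k) x) (c (Suc k) - c k) (2 ^ Suc k - 2 ^ k)"
          using \<open>P j (\<lambda>p\<in>A j. X p \<omega>)\<close> unfolding PA[OF j] unfolding P_def x_def k_def .
        have 2: "?a * real (2 ^ k - 2 ^ k0) - C * real (2 ^ k - 2 ^ k0) powr (1/3) \<le> bulk (shift (c k0) (2 ^ k0) x) (c k - c k0) (2 ^ k - 2 ^ k0)"
          using \<open>Q j (\<lambda>p\<in>B j. X p \<omega>)\<close> unfolding QB[OF j] unfolding Q_def x_def k_def .
        have kk: "k0 \<le> k" "k \<le> Suc k" using hj by auto
        have ck: "c k0 \<le> c k" "c k \<le> c (Suc k)" using kk by (auto intro: c_mono)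
        have pk: "(2::nat) ^ k0 \<le> 2 ^ k" "(2::nat) ^ k \<le> 2 ^ Suc k" using kk by auto
        have x0: "0 \<le> x p" for p unfolding x_def by (rule exp_arrayD(2)[OF X])
        have "shift (c k - c k0) (2 ^ k - 2 ^ k0) (shift (c k0) (2 ^ k0) x) = shift (c k) (2 ^ k) x"
          unfolding shift_shift using ck pk by simp
        then have "bulk (shift (c k0) (2 ^ k0) x) (c k - c k0) (2 ^ k - 2 ^ k0) + bulk (shift (c k) (2 ^ k) x) (c (Suc k) - c k) (2 ^ Suc k - 2 ^ k)
           \<le> bulk (shift (c k0) (2 ^ k0) x) ((c (Suc k) - c k) + (c k - c k0)) ((2 ^ Suc k - 2 ^ k) + (2 ^ k - 2 ^ k0))"
          using bulk_superadditive[of "shift (c k0) (2 ^ k0) x" "c k - c k0" "2 ^ k - 2 ^ k0" "c (Suc k) - c k" "2 ^ Suc k - 2 ^ k"] x0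
          by (simp add: shift_def split_beta del: power_Suc)
        also have "(c (Suc k) - c k) + (c k - c k0) = c (Suc k) - c k0" using ck by simp
        also have "((2::nat) ^ Suc k - 2 ^ k) + (2 ^ k - 2 ^ k0) = 2 ^ Suc k - 2 ^ k0" using pk by linarith
        finally have 3: "bulk (shift (c k0) (2 ^ k0) x) (c k - c k0) (2 ^ k - 2 ^ k0) + bulk (shift (c k) (2 ^ k) x) (c (Suc k) - c k) (2 ^ Suc k - 2 ^ k)
           \<le> bulk (shift (c k0) (2 ^ k0) x) (c (Suc k) - c k0) (2 ^ Suc k - 2 ^ k0)" .
        have "real (2 ^ k - 2 ^ k0) powr (1/3) \<le> real (2 ^ Suc k) powr (1/3)"
        proof (rule powr_third_mono)
          have "(2::nat) ^ k - 2 ^ k0 \<le> 2 ^ Suc k" by simp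
          then show "real (2 ^ k - 2 ^ k0) \<le> real (2 ^ Suc k)" by (simp only: of_nat_le_iff)
        qed simp
        then have 4: "C * real (2 ^ k - 2 ^ k0) powr (1/3) \<le> C * real (2 ^ Suc k) powr (1/3)" by (rule mult_left_mono[OF _ C])
        have "real (2 ^ Suc k - 2 ^ k) + real (2 ^ k - 2 ^ k0) = real (2 ^ Suc k - 2 ^ k0)" using pk by (simp only: of_nat_diff)
        then have 5: "?a * real (2 ^ Suc k - 2 ^ k0) = ?a * real (2 ^ Suc k - 2 ^ k) + ?a * real (2 ^ k - 2 ^ k0)" by (simp only: distrib_left[symmetric])
        have "?a * real (2 ^ Suc k - 2 ^ k0) + f (Suc k) - C * real (2 ^ Suc k) powr (1/3) \<le> bulk (shift (c k0) (2 ^ k0) x) (c (Suc k) - c k0) (2 ^ Suc k - 2 ^ k0)"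
          using 1 2 3 4 5 by linarith
        moreover have "Suc k \<in> {m<..m + J}" using hj by auto
        ultimately show "\<exists>k\<in>{m<..m + J}. ?a * real (2 ^ k - 2 ^ k0) + f k - C * real (2 ^ k) powr (1/3) \<le> bulk (shift (c k0) (2 ^ k0) (\<lambda>p. X p \<omega>)) (c k - c k0) (2 ^ k - 2 ^ k0)"
          unfolding x_def by blast
      qed
      have [measurable]: "(\<lambda>\<omega>. bulk (shift (c k0) (2 ^ k0) (\<lambda>p. X p \<omega>)) i j) \<in> borel_measurable M" for i j
        using bulk_measurable[OF exp_array_shift[OF X]] unfolding shift_apply_fun .
      show "{\<omega> \<in> space M. \<exists>k\<in>{m<..m + J}. ?a * real (2 ^ k - 2 ^ k0) + f k - C * real (2 ^ k) powr (1/3) \<le> bulk (shift (c k0) (2 ^ k0) (\<lambda>p. X p \<omega>)) (c k - c k0) (2 ^ k - 2 ^ k0)} \<in> events"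
        by measurable
    qed
    finally show ?thesis .
  qed
  then show ?thesis unfolding c_def by (intro exI[of _ "m + J"]) auto
qed

end

section \<open>The lower half of the law of the iterated logarithm\<close>

lemma dyadic_growth:
  fixes \<theta> R c :: real
  assumes "0 < \<theta>" "0 < R"
  shows "\<forall>\<^sub>F k::nat in sequentially. R * (ln (real k) / \<theta> + 1) \<le> 2 ^ k / 2 \<and> c \<le> 1 / 16 * (ln (real k) / \<theta>) powr (2/3) \<and>
     1 \<le> real k * ln 2 \<and> 2 \<le> k"
proof -
  have "\<forall>\<^sub>F k::nat in sequentially. R * (ln (real k) / \<theta> + 1) \<le> 2 ^ k / 2" using assms by real_asymp
  moreover have "\<forall>\<^sub>F k::nat in sequentially. c \<le> 1 / 16 * (ln (real k) / \<theta>) powr (2/3)" using assms by real_asymp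
  moreover have "\<forall>\<^sub>F k::nat in sequentially. 1 \<le> real k * ln 2" by real_asymp
  moreover have "\<forall>\<^sub>F k::nat in sequentially. 2 \<le> k" by (rule eventually_ge_at_top)
  ultimately show ?thesis by eventually_elim auto
qed

context prob_space begin

text \<open>
  Chains of $L_k=\lceil\ln k/\theta\rceil$ boxes with $\theta=-\ln p$ have probability at least $p/k$ and gain a
  multiple of $(\ln k)^{2/3}2^{k/3}$, that is $(\ln\ln N)^{2/3}N^{1/3}$ for $N=2^k$. The windows start at $3k_0$, so
  that discarding the part of the path below $2^{k_0}$ costs $a2^{k_0}\le a2^{k/3}$, which is negligible. Each window
  succeeds with probability one quarter and the windows can be chosen disjoint, hence almost surely infinitely many
  succeed.
\<close>

theorem lil_lower:
  assumes \<gamma>: "1 \<le> \<gamma>"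
  shows "\<exists>\<alpha>>0. \<forall>X. exp_array M pos_quadrant X \<longrightarrow> (AE \<omega> in M. \<exists>\<^sub>F N in sequentially.
    a_const \<gamma> * real N + b_const \<gamma> * \<alpha> * real N powr (1 / 3) * ln (ln (real N)) powr (2 / 3) \<le> bulk (\<lambda>p. X p \<omega>) (cols \<gamma> N) N)"
proof -
  let ?a = "a_const \<gamma>" and ?b = "b_const \<gamma>"
  have b: "0 < ?b" by (rule b_const_pos[OF \<gamma>])
  have a0: "0 \<le> ?a" by (simp add: a_const_def)
  obtain C N0 where C: "0 < C" and N0: "1 \<le> N0"
    and seg: "\<And>X i j. exp_array M pos_quadrant X \<Longrightarrow> i + N0 \<le> j \<Longrightarrow>
    1 / 2 \<le> \<P>(\<omega> in M. ?a * real (j - i) - C * real (j - i) powr (1/3) \<le> bulk (\<lambda>p. X p \<omega>) (cols \<gamma> j - cols \<gamma> i) (j - i))"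
    using segment_typical[OF \<gamma>] by blast
  obtain p R where p: "0 < p" "p < 1" and R: "0 < R"
    and chain: "\<And>X n L. exp_array M pos_quadrant X \<Longrightarrow> 1 \<le> L \<Longrightarrow> R * real L \<le> real n \<Longrightarrow>
    p ^ L \<le> \<P>(\<omega> in M. ?a * real n + 1 / 4 * real L powr (2/3) * real n powr (1/3) \<le> bulk (\<lambda>p. X p \<omega>) (cols \<gamma> n) n)"
    using blocks_fluctuation[OF \<gamma>] by blast
  define \<theta> where "\<theta> = - ln p"
  have \<theta>: "0 < \<theta>" using p by (simp add: \<theta>_def)
  (* Half of the gain 1/8 per unit of (ln k / \<theta>) powr (2/3); the other half pays for C and a. *)
  define \<alpha> where "\<alpha> = 1 / (16 * ?b * \<theta> powr (2/3))"
  have \<alpha>: "0 < \<alpha>" using b \<theta> by (simp add: \<alpha>_def)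
  define L where "L = (\<lambda>k::nat. nat \<lceil>ln (real k) / \<theta>\<rceil>)"
  define f where "f = (\<lambda>k::nat. 1 / 4 * real (L k) powr (2/3) * real (2 ^ k - 2 ^ (k - 1)) powr (1/3))"
  obtain k3 where k3: "\<And>k. k3 \<le> k \<Longrightarrow> R * (ln (real k) / \<theta> + 1) \<le> 2 ^ k / 2 \<and> C + ?a \<le> 1 / 16 * (ln (real k) / \<theta>) powr (2/3) \<and>
     1 \<le> real k * ln 2 \<and> 2 \<le> k"
    using dyadic_growth[OF \<theta> R, of "C + ?a"] unfolding eventually_sequentially by blast
  have half: "real (2 ^ k - 2 ^ (k - 1)) = 2 ^ k / 2" if "1 \<le> k" for k
    using that by (cases k) auto
  have Lb: "ln (real k) / \<theta> \<le> real (L k)" "real (L k) \<le> ln (real k) / \<theta> + 1" "1 \<le> L k" if "2 \<le> k" for k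
  proof -
    have "0 < ln (real k) / \<theta>" using that \<theta> by simp
    then have "0 < \<lceil>ln (real k) / \<theta>\<rceil>" by simp
    then show "ln (real k) / \<theta> \<le> real (L k)" "real (L k) \<le> ln (real k) / \<theta> + 1" "1 \<le> L k"
      unfolding L_def by (auto simp: of_nat_nat) linarith+
  qed
  have up: "p / real k \<le> \<P>(\<omega> in M. ?a * real (2 ^ k - 2 ^ (k - 1)) + f k \<le> bulk (\<lambda>p. X p \<omega>) (cols \<gamma> (2 ^ k) - cols \<gamma> (2 ^ (k - 1))) (2 ^ k - 2 ^ (k - 1)))"
    if X: "exp_array M pos_quadrant X" and k: "k3 \<le> k" for X k
  proof -
    let ?n = "2 ^ k - 2 ^ (k - 1)"
    have k2: "2 \<le> k" "1 \<le> k" using k3[OF k] by auto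
    have "p / real k = exp (- (\<theta> * (ln (real k) / \<theta> + 1)))" using \<theta> p k2 by (simp add: distrib_left exp_diff exp_minus \<theta>_def divide_simps)
    also have "\<dots> \<le> exp (- (\<theta> * real (L k)))" using \<theta> Lb(2)[OF k2(1)] by simp
    also have "\<dots> = p ^ L k" using p by (simp add: \<theta>_def exp_of_nat2_mult)
    also have "\<dots> \<le> \<P>(\<omega> in M. ?a * real ?n + f k \<le> bulk (\<lambda>p. X p \<omega>) (cols \<gamma> ?n) ?n)"
      unfolding f_def
    proof (rule chain[OF X Lb(3)[OF k2(1)]])
      have "R * real (L k) \<le> R * (ln (real k) / \<theta> + 1)" using Lb(2)[OF k2(1)] R by (intro mult_left_mono) auto
      then show "R * real (L k) \<le> real ?n" unfolding half[OF k2(2)] using k3[OF k] by linarith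
    qed
    also have "\<dots> \<le> \<P>(\<omega> in M. ?a * real ?n + f k \<le> bulk (\<lambda>p. X p \<omega>) (cols \<gamma> (2 ^ k) - cols \<gamma> (2 ^ (k - 1))) ?n)"
    proof (rule finite_measure_mono)
      have "cols \<gamma> ?n \<le> cols \<gamma> (2 ^ k) - cols \<gamma> (2 ^ (k - 1))" using k2 by (intro cols_diff(1)[OF \<gamma>]) simp
      then have m: "bulk (\<lambda>p. X p \<omega>) (cols \<gamma> ?n) ?n \<le> bulk (\<lambda>p. X p \<omega>) (cols \<gamma> (2 ^ k) - cols \<gamma> (2 ^ (k - 1))) ?n" for \<omega>
        by (intro bulk_mono exp_arrayD(2)[OF X]) auto
      show "{\<omega> \<in> space M. ?a * real ?n + f k \<le> bulk (\<lambda>p. X p \<omega>) (cols \<gamma> ?n) ?n}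
         \<subseteq> {\<omega> \<in> space M. ?a * real ?n + f k \<le> bulk (\<lambda>p. X p \<omega>) (cols \<gamma> (2 ^ k) - cols \<gamma> (2 ^ (k - 1))) ?n}"
        using order_trans[OF _ m] by blast
      have [measurable]: "(\<lambda>\<omega>. bulk (\<lambda>p. X p \<omega>) (cols \<gamma> (2 ^ k) - cols \<gamma> (2 ^ (k - 1))) ?n) \<in> borel_measurable M" by (rule bulk_measurable[OF X])
      show "{\<omega> \<in> space M. ?a * real ?n + f k \<le> bulk (\<lambda>p. X p \<omega>) (cols \<gamma> (2 ^ k) - cols \<gamma> (2 ^ (k - 1))) ?n} \<in> events" by measurable
    qed
    finally show ?thesis .
  qed
  define m where "m = (\<lambda>k0. 3 * k0 + N0 + k3 + 1)"
  define v where "v = (\<lambda>k0 k. ?a * real (2 ^ k - 2 ^ k0) + f k - C * real (2 ^ k) powr (1/3))"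
  define c where "c = (\<lambda>k. cols \<gamma> (2 ^ k))"
  have "\<exists>K. m k0 \<le> K \<and> (\<forall>X. exp_array M pos_quadrant X \<longrightarrow> 1 / 4 \<le> \<P>(\<omega> in M. \<exists>k\<in>{m k0<..K}.
     v k0 k \<le> bulk (shift (c k0) (2 ^ k0) (\<lambda>p. X p \<omega>)) (c k - c k0) (2 ^ k - 2 ^ k0)))" for k0
    unfolding v_def c_def
  proof (rule window_fluctuation[OF \<gamma> _ p(1) _ _ seg])
    show "p / real k \<le> \<P>(\<omega> in M. ?a * real (2 ^ k - 2 ^ (k - 1)) + f k \<le> bulk (\<lambda>p. X p \<omega>) (cols \<gamma> (2 ^ k) - cols \<gamma> (2 ^ (k - 1))) (2 ^ k - 2 ^ (k - 1)))"
      if "exp_array M pos_quadrant X" "m k0 < k" for X k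
      by (rule up[OF that(1)]) (use that(2) in \<open>simp add: m_def\<close>)
  qed (use C p in \<open>auto simp: m_def\<close>)
  then have "\<exists>W. \<forall>k0. m k0 \<le> W k0 \<and> (\<forall>X. exp_array M pos_quadrant X \<longrightarrow> 1 / 4 \<le> \<P>(\<omega> in M. \<exists>k\<in>{m k0<..W k0}.
     v k0 k \<le> bulk (shift (c k0) (2 ^ k0) (\<lambda>p. X p \<omega>)) (c k - c k0) (2 ^ k - 2 ^ k0)))"
    by (intro choice allI)
  then obtain W where W: "\<And>k0. m k0 \<le> W k0"
    and Wp: "\<And>k0 X. exp_array M pos_quadrant X \<Longrightarrow> 1 / 4 \<le> \<P>(\<omega> in M. \<exists>k\<in>{m k0<..W k0}.
     v k0 k \<le> bulk (shift (c k0) (2 ^ k0) (\<lambda>p. X p \<omega>)) (c k - c k0) (2 ^ k - 2 ^ k0))"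
    by blast
  have Wge: "k0 \<le> W k0" for k0 using W[of k0] unfolding m_def by linarith
  have exceed: "?a * real (2 ^ k) + ?b * \<alpha> * real (2 ^ k) powr (1 / 3) * ln (ln (real (2 ^ k))) powr (2 / 3) \<le> bulk x (c k) (2 ^ k)"
    if x: "\<And>p. 0 \<le> x p" and k: "m k0 < k" and D: "v k0 k \<le> bulk (shift (c k0) (2 ^ k0) x) (c k - c k0) (2 ^ k - 2 ^ k0)" for x k0 k
  proof -
    define t where "t = real (2 ^ k) powr (1/3)"
    define g where "g = (ln (real k) / \<theta>) powr (2/3)"
    have kk: "k3 \<le> k" "3 * k0 \<le> k" "k0 \<le> k" using k by (auto simp: m_def)
    have gr: "C + ?a \<le> 1 / 16 * g" "1 \<le> real k * ln 2" "2 \<le> k" "1 \<le> k" using k3[OF kk(1)] by (auto simp: g_def)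
    have t3: "t ^ 3 = 2 ^ k" unfolding t_def by (simp add: powr_third_cube)
    have t0: "0 < t" by (simp add: t_def)
    have "t / 2 \<le> real (2 ^ k - 2 ^ (k - 1)) powr (1/3)"
      unfolding half[OF gr(4)] using t0 by (intro le_powr_third) (auto simp: power_divide t3)
    moreover have "g \<le> real (L k) powr (2/3)" unfolding g_def using Lb[OF gr(3)] gr \<theta> by (intro powr_mono2) auto
    ultimately have "1 / 4 * g * (t / 2) \<le> f k" unfolding f_def using t0 by (intro mult_mono) (auto simp: g_def)
    then have 1: "g * t / 8 \<le> f k" by simp
    have "((2::real) ^ k0) ^ 3 = 2 ^ (3 * k0)" by (simp add: power_mult[symmetric] mult.commute)
    also have "\<dots> \<le> 2 ^ k" using kk by (intro power_increasing) auto
    finally have "(2::real) ^ k0 \<le> t" unfolding t_def by (intro le_powr_third) auto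
    then have 2: "?a * 2 ^ k0 \<le> ?a * t" using a0 by (rule mult_left_mono)
    have "ln (ln (real (2 ^ k))) \<le> ln (real k)"
    proof -
      have "ln (real (2 ^ k)) = real k * ln 2" by (simp add: ln_realpow)
      moreover have "real k * ln 2 \<le> real k * 1" using ln_2_less_1 by (intro mult_left_mono) auto
      ultimately have "ln (real (2 ^ k)) \<le> real k" "0 < ln (real (2 ^ k))" using gr by auto
      then show ?thesis by (simp only: ln_mono)
    qed
    moreover have "0 \<le> ln (ln (real (2 ^ k)))" using gr by (intro ln_ge_zero) (simp add: ln_realpow)
    ultimately have "ln (ln (real (2 ^ k))) powr (2/3) \<le> ln (real k) powr (2/3)" by (intro powr_mono2) auto
    then have "?b * \<alpha> * t * ln (ln (real (2 ^ k))) powr (2/3) \<le> ?b * \<alpha> * t * ln (real k) powr (2/3)"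
      using b \<alpha> t0 by (intro mult_left_mono) auto
    also have "\<dots> = g * t / 16"
    proof -
      have "g = ln (real k) powr (2/3) / \<theta> powr (2/3)" unfolding g_def by (rule powr_divide)
      then show ?thesis unfolding \<alpha>_def using b \<theta> by (simp add: mult_ac)
    qed
    finally have 3: "?b * \<alpha> * t * ln (ln (real (2 ^ k))) powr (2/3) \<le> g * t / 16" .
    have "(C + ?a) * t \<le> 1 / 16 * g * t" using gr(1) t0 by (intro mult_right_mono) auto
    then have 4: "C * t + ?a * t \<le> g * t / 16" by (simp add: distrib_right)
    have "real (2 ^ k - 2 ^ k0) = 2 ^ k - 2 ^ k0" using kk by (simp add: of_nat_diff)
    then have "?a * real (2 ^ k - 2 ^ k0) = ?a * 2 ^ k - ?a * 2 ^ k0" by (simp only: right_diff_distrib)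
    then have 5: "v k0 k = ?a * 2 ^ k - ?a * 2 ^ k0 + f k - C * t" unfolding v_def t_def by simp
    have ck: "c k0 \<le> c k" unfolding c_def using kk by (intro cols_mono[OF \<gamma>]) simp
    have pk: "(2::nat) ^ k0 \<le> 2 ^ k" using kk by simp
    have "bulk (shift (c k0) (2 ^ k0) x) (c k - c k0) (2 ^ k - 2 ^ k0)
        \<le> bulk x (c k0) (2 ^ k0) + bulk (shift (c k0) (2 ^ k0) x) (c k - c k0) (2 ^ k - 2 ^ k0)" using bulk_nonneg[of x, OF x] by simp
    also have "\<dots> \<le> bulk x ((c k - c k0) + c k0) ((2 ^ k - 2 ^ k0) + 2 ^ k0)" by (rule bulk_superadditive[OF x])
    also have "\<dots> = bulk x (c k) (2 ^ k)" using ck pk by simp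
    finally have 6: "v k0 k \<le> bulk x (c k) (2 ^ k)" using D by linarith
    have "?a * 2 ^ k + ?b * \<alpha> * t * ln (ln (real (2 ^ k))) powr (2 / 3) \<le> bulk x (c k) (2 ^ k)"
      using 1 2 3 4 5 6 by linarith
    then show ?thesis unfolding t_def by simp
  qed
  have "AE \<omega> in M. \<exists>\<^sub>F N in sequentially.
    ?a * real N + ?b * \<alpha> * real N powr (1 / 3) * ln (ln (real N)) powr (2 / 3) \<le> bulk (\<lambda>p. X p \<omega>) (cols \<gamma> N) N"
    if X: "exp_array M pos_quadrant X" for X
  proof -
    define E where "E = (\<lambda>\<omega> k. ?a * real (2 ^ k) + ?b * \<alpha> * real (2 ^ k) powr (1 / 3) * ln (ln (real (2 ^ k))) powr (2 / 3) \<le> bulk (\<lambda>p. X p \<omega>) (c k) (2 ^ k))"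
    define G where "G = (\<lambda>k0 x. \<exists>k\<in>{m k0<..W k0}. v k0 k \<le> bulk (shift (c k0) (2 ^ k0) x) (c k - c k0) (2 ^ k - 2 ^ k0))"
    define S where "S = (\<lambda>k0. {c k0 + 1..c (W k0)} \<times> {(2::nat) ^ k0 + 1..2 ^ W k0})"
    have c_mono: "c i \<le> c j" if "i \<le> j" for i j unfolding c_def using that by (intro cols_mono[OF \<gamma>]) simp
    have reg: "{c k0 + 1..c k0 + (c k - c k0)} \<times> {2 ^ k0 + 1..2 ^ k0 + (2 ^ k - 2 ^ k0)} \<subseteq> S k0" if "k \<in> {m k0<..W k0}" for k k0
    proof -
      have "k0 \<le> k" "k \<le> W k0" using that unfolding m_def by auto
      then have "c k0 \<le> c k" "c k \<le> c (W k0)" "(2::nat) ^ k0 \<le> 2 ^ k" "(2::nat) ^ k \<le> 2 ^ W k0" by (auto intro: c_mono)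
      then show ?thesis unfolding S_def by (auto simp del: power_increasing_iff)
    qed
    have Gpred: "Measurable.pred (PiM (S k0) (\<lambda>_. borel)) (G k0)" for k0
      unfolding G_def by (intro pred_intros_finite bulk_shift_pred reg) auto
    have GS: "G k0 (\<lambda>p\<in>S k0. X p \<omega>) \<longleftrightarrow> G k0 (\<lambda>p. X p \<omega>)" for k0 \<omega>
      unfolding G_def by (intro bex_cong refl, subst bulk_shift_restrict[OF reg]) auto
    have Emeas: "Measurable.pred M (\<lambda>\<omega>. E \<omega> k)" for k
    proof -
      have [measurable]: "(\<lambda>\<omega>. bulk (\<lambda>p. X p \<omega>) (c k) (2 ^ k)) \<in> borel_measurable M" by (rule bulk_measurable[OF X])
      show ?thesis unfolding E_def by measurable
    qed
    have "AE \<omega> in M. \<exists>k\<ge>K. E \<omega> k" for K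
    proof -
      define \<kappa> where "\<kappa> = (\<lambda>i. (W ^^ i) K)"
      have \<kappa>_Suc: "\<kappa> (Suc i) = W (\<kappa> i)" for i by (simp add: \<kappa>_def)
      have \<kappa>_mono: "\<kappa> i \<le> \<kappa> j" if "i \<le> j" for i j
        using that by (induction rule: dec_induct) (auto simp: \<kappa>_Suc intro: order_trans Wge)
      have \<kappa>K: "K \<le> \<kappa> i" for i using \<kappa>_mono[of 0 i] by (simp add: \<kappa>_def)
      have bound: "\<P>(\<omega> in M. \<not> (\<exists>k\<ge>K. E \<omega> k)) \<le> (3 / 4) ^ I" for I
      proof -
        have "\<P>(\<omega> in M. \<not> (\<exists>k\<ge>K. E \<omega> k)) \<le> \<P>(\<omega> in M. \<forall>i<I. \<not> G (\<kappa> i) (\<lambda>p\<in>S (\<kappa> i). X p \<omega>))"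
        proof (rule finite_measure_mono)
          show "{\<omega> \<in> space M. \<not> (\<exists>k\<ge>K. E \<omega> k)} \<subseteq> {\<omega> \<in> space M. \<forall>i<I. \<not> G (\<kappa> i) (\<lambda>p\<in>S (\<kappa> i). X p \<omega>)}"
          proof (intro Collect_mono impI conjI allI notI; elim conjE)
            fix \<omega> i assume no: "\<not> (\<exists>k\<ge>K. E \<omega> k)" and "G (\<kappa> i) (\<lambda>p\<in>S (\<kappa> i). X p \<omega>)"
            then obtain k where k: "m (\<kappa> i) < k" "v (\<kappa> i) k \<le> bulk (shift (c (\<kappa> i)) (2 ^ \<kappa> i) (\<lambda>p. X p \<omega>)) (c k - c (\<kappa> i)) (2 ^ k - 2 ^ \<kappa> i)"
              unfolding GS unfolding G_def by auto
            have "E \<omega> k" unfolding E_def by (rule exceed[OF exp_arrayD(2)[OF X] k])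
            moreover have "K \<le> k" using k(1) \<kappa>K[of i] unfolding m_def by linarith
            ultimately show False using no by blast
          qed auto
          have [measurable]: "Measurable.pred M (\<lambda>\<omega>. G (\<kappa> i) (\<lambda>p\<in>S (\<kappa> i). X p \<omega>))" for i
            by (rule exp_array_pred[OF X _ Gpred]) (auto simp: S_def)
          show "{\<omega> \<in> space M. \<forall>i<I. \<not> G (\<kappa> i) (\<lambda>p\<in>S (\<kappa> i). X p \<omega>)} \<in> events" by measurable
        qed
        also have "\<dots> \<le> (\<Prod>i<I. 1 - 1 / 4)"
        proof (rule all_fail_le_prod[OF X])
          fix i j :: nat assume "i < j"
          then have "W (\<kappa> i) \<le> \<kappa> j" using \<kappa>_mono[of "Suc i" j] by (simp add: \<kappa>_Suc)
          from c_mono[OF this] show "S (\<kappa> i) \<inter> S (\<kappa> j) = {}" by (auto simp: S_def)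
        next
          fix i
          show "S (\<kappa> i) \<subseteq> pos_quadrant" by (auto simp: S_def)
          show "1 / 4 \<le> \<P>(\<omega> in M. G (\<kappa> i) (\<lambda>p\<in>S (\<kappa> i). X p \<omega>))" unfolding GS unfolding G_def by (rule Wp[OF X])
        qed (rule Gpred)
        also have "\<dots> = (3 / 4) ^ I" by simp
        finally show ?thesis .
      qed
      note [measurable] = Emeas
      have meas: "Measurable.pred M (\<lambda>\<omega>. \<exists>k\<ge>K. E \<omega> k)" by measurable
      have "(\<lambda>I. (3 / 4 :: real) ^ I) \<longlonglongrightarrow> 0" by (rule LIMSEQ_realpow_zero) auto
      then have "\<P>(\<omega> in M. \<not> (\<exists>k\<ge>K. E \<omega> k)) \<le> 0" by (rule LIMSEQ_le_const) (use bound in blast)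
      then have "1 \<le> \<P>(\<omega> in M. \<exists>k\<ge>K. E \<omega> k)" by (intro prob_compl_le_imp_ge[OF meas]) simp
      then have "\<P>(\<omega> in M. \<exists>k\<ge>K. E \<omega> k) = 1" using prob_le_1 by (intro antisym) auto
      then show ?thesis using meas by (subst (asm) prob_Collect_eq_1) auto
    qed
    then have "AE \<omega> in M. \<forall>K. \<exists>k\<ge>K. E \<omega> k" by (subst AE_all_countable) auto
    then show ?thesis
    proof eventually_elim
      case (elim \<omega>)
      show ?case unfolding frequently_sequentially
      proof
        fix K
        obtain k where k: "K \<le> k" "E \<omega> k" using elim by blast
        have "K \<le> 2 ^ k" using k(1) less_exp[of k] by linarith
        then show "\<exists>N\<ge>K. ?a * real N + ?b * \<alpha> * real N powr (1 / 3) * ln (ln (real N)) powr (2 / 3) \<le> bulk (\<lambda>p. X p \<omega>) (cols \<gamma> N) N"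
          using k(2) unfolding E_def c_def by blast
      qed
    qed
  qed
  then show ?thesis using \<alpha> by blast
qed

end

section \<open>The law of the iterated logarithm\<close>

text \<open>
  The weights are nonnegative almost surely, and the positive part makes them nonnegative everywhere without changing
  the law.
\<close>

lemma (in prob_space) exp_array_positive_part:
  assumes "indep_vars (\<lambda>_. borel) X I" "\<And>i. i \<in> I \<Longrightarrow> distributed M lborel (X i) (exponential_density 1)"
  shows "exp_array M I (\<lambda>i \<omega>. max 0 (X i \<omega>))" "i \<in> I \<Longrightarrow> AE \<omega> in M. 0 \<le> X i \<omega>"
proof -
  have pos: "AE \<omega> in M. 0 \<le> X i \<omega>" if "i \<in> I" for i
  proof -
    have "AE x in lborel. 0 < ennreal (exponential_density 1 x) \<longrightarrow> (0 \<le> x)" by (rule AE_I2) (auto simp: exponential_density_def)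
    then show ?thesis by (subst distributed_AE2[OF assms(2)[OF that]]) auto
  qed
  then show "i \<in> I \<Longrightarrow> AE \<omega> in M. 0 \<le> X i \<omega>" .
  have "indep_vars (\<lambda>_. borel) (\<lambda>i \<omega>. max 0 (X i \<omega>)) I"
    by (rule indep_vars_compose2[OF assms(1), of "\<lambda>_ x. max 0 x"]) measurable
  moreover have "distributed M lborel (\<lambda>\<omega>. max 0 (X i \<omega>)) (exponential_density 1)" if i: "i \<in> I" for i
  proof -
    have [measurable]: "X i \<in> borel_measurable M" using assms(2)[OF i] by (simp add: distributed_def)
    have "distr M lborel (\<lambda>\<omega>. max 0 (X i \<omega>)) = distr M lborel (X i)"
      using pos[OF i] by (intro distr_cong_AE) (auto simp: max_def)
    then show ?thesis using assms(2)[OF i] by (simp add: distributed_def)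
  qed
  ultimately show "exp_array M I (\<lambda>i \<omega>. max 0 (X i \<omega>))" unfolding exp_array_def by auto
qed

lemma last_passage_cong:
  assumes "\<And>p. p \<in> pos_quadrant \<Longrightarrow> x p = y p"
  shows "last_passage x m n = last_passage y m n"
proof -
  have "(\<Sum>p\<in>set \<pi>. x p) = (\<Sum>p\<in>set \<pi>. y p)" if "\<pi> \<in> up_right_paths (1, 1) (m, n)" for \<pi>
    using that assms by (intro sum.cong) (auto simp: up_right_paths_def)
  then show ?thesis unfolding last_passage_def by (metis (no_types, lifting) image_cong)
qed

lemma frequently_imp_le_limsup:
  fixes u :: "nat \<Rightarrow> ereal"
  assumes "\<exists>\<^sub>F n in sequentially. c \<le> u n"
  shows "c \<le> limsup u"
proof (rule ccontr)
  assume "\<not> c \<le> limsup u"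
  then have "\<forall>\<^sub>F n in sequentially. u n < c" by (intro Limsup_lessD) auto
  then show False using assms by (simp add: frequently_def not_le)
qed

theorem theorem1:
  fixes M :: "'a measure" and X :: "nat \<times> nat \<Rightarrow> 'a \<Rightarrow> real" and \<gamma> :: real
  assumes "prob_space M"
    and "prob_space.indep_vars M (\<lambda>_. borel) X pos_quadrant"
    and "\<And>p. p \<in> pos_quadrant \<Longrightarrow> distributed M lborel (X p) (exponential_density 1)"
    and "\<gamma> \<ge> 1"
  shows "\<exists>\<alpha>\<^sub>s\<^sub>u\<^sub>p::real. \<alpha>\<^sub>s\<^sub>u\<^sub>p > 0 \<and>
    (AE \<omega> in M.
       ereal \<alpha>\<^sub>s\<^sub>u\<^sub>p \<le> limsup (\<lambda>N. ereal (rescaled_last_passage (\<lambda>p. X p \<omega>) \<gamma> N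
                                    / ln (ln (real N)) powr (2 / 3))) \<and>
       limsup (\<lambda>N. ereal (rescaled_last_passage (\<lambda>p. X p \<omega>) \<gamma> N
                       / ln (ln (real N)) powr (2 / 3))) \<le> ereal ((3 / 4) powr (2 / 3)))"
proof -
  interpret prob_space M by fact
  let ?a = "a_const \<gamma>" and ?b = "b_const \<gamma>" and ?\<tau> = "(3 / 4) powr (2 / 3) :: real"
  define Y where "Y = (\<lambda>p \<omega>. max 0 (X p \<omega>))"
  have Y: "exp_array M pos_quadrant Y"
    unfolding Y_def by (rule exp_array_positive_part(1)[OF assms(2,3)])
  have b: "0 < ?b" by (rule b_const_pos[OF assms(4)])
  obtain \<alpha> where \<alpha>: "0 < \<alpha>" and low: "AE \<omega> in M. \<exists>\<^sub>F N in sequentially.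
    ?a * real N + ?b * \<alpha> * real N powr (1 / 3) * ln (ln (real N)) powr (2 / 3) \<le> bulk (\<lambda>p. Y p \<omega>) (cols \<gamma> N) N"
    using lil_lower[OF assms(4)] Y by blast
  have up: "AE \<omega> in M. \<forall>n::nat. \<forall>\<^sub>F N in sequentially. bulk (\<lambda>p. Y p \<omega>) (cols \<gamma> N) N
    \<le> ?a * real N + ?b * (?\<tau> * (1 + 1 / real (Suc n))) * real N powr (1 / 3) * ln (ln (real N)) powr (2 / 3)"
    unfolding AE_all_countable by (intro allI lil_upper[OF assms(4) Y]) simp
  have nn: "AE \<omega> in M. \<forall>p\<in>pos_quadrant. 0 \<le> X p \<omega>"
    by (subst AE_ball_countable) (auto intro: exp_array_positive_part(2)[OF assms(2,3)])
  have "AE \<omega> in M.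
       ereal \<alpha> \<le> limsup (\<lambda>N. ereal (rescaled_last_passage (\<lambda>p. X p \<omega>) \<gamma> N / ln (ln (real N)) powr (2 / 3))) \<and>
       limsup (\<lambda>N. ereal (rescaled_last_passage (\<lambda>p. X p \<omega>) \<gamma> N / ln (ln (real N)) powr (2 / 3))) \<le> ereal ?\<tau>"
    using low up nn
  proof eventually_elim
    case (elim \<omega>)
    define H where "H = (\<lambda>N. bulk (\<lambda>p. Y p \<omega>) (cols \<gamma> N) N)"
    define r where "r = (\<lambda>N. rescaled_last_passage (\<lambda>p. X p \<omega>) \<gamma> N / ln (ln (real N)) powr (2 / 3))"
    have r: "r N = (H N - ?a * real N) / (?b * real N powr (1/3) * ln (ln (real N)) powr (2 / 3))" if "1 \<le> N" for N
    proof -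
      have "last_passage (\<lambda>p. X p \<omega>) (cols \<gamma> N) N = last_passage (\<lambda>p. Y p \<omega>) (cols \<gamma> N) N"
        by (rule last_passage_cong) (use bspec[OF elim(3)] in \<open>simp add: Y_def max_absorb2\<close>)
      also have "\<dots> = H N" unfolding H_def
        by (rule last_passage_eq_bulk) (use that cols_bounds(3)[OF assms(4), of N] in \<open>auto simp: Y_def\<close>)
      finally show ?thesis unfolding r_def rescaled_last_passage_def cols_def[symmetric] by simp
    qed
    have large: "\<forall>\<^sub>F N::nat in sequentially. 1 \<le> N \<and> 0 < ln (ln (real N))"
      by (intro eventually_conj eventually_ge_at_top) real_asymp
    have den: "0 < ?b * real N powr (1/3) * ln (ln (real N)) powr (2 / 3)" if "1 \<le> N \<and> 0 < ln (ln (real N))" for N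
      using that b by (intro mult_pos_pos) auto
    have "\<exists>\<^sub>F N in sequentially. ereal \<alpha> \<le> ereal (r N)"
      using frequently_eventually_conj[OF elim(1) large]
    proof (rule frequently_elim1)
      fix N assume N: "(1 \<le> N \<and> 0 < ln (ln (real N))) \<and> ?a * real N + ?b * \<alpha> * real N powr (1 / 3) * ln (ln (real N)) powr (2 / 3) \<le> bulk (\<lambda>p. Y p \<omega>) (cols \<gamma> N) N"
      then have "\<alpha> \<le> r N" using den[of N] by (simp add: r H_def pos_le_divide_eq mult_ac)
      then show "ereal \<alpha> \<le> ereal (r N)" by simp
    qed
    then have "ereal \<alpha> \<le> limsup (\<lambda>N. ereal (r N))" by (rule frequently_imp_le_limsup)
    moreover have "limsup (\<lambda>N. ereal (r N)) \<le> ereal ?\<tau>"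
    proof (rule LIMSEQ_le_const)
      have "(\<lambda>n. ?\<tau> * (1 + 1 / real (Suc n))) \<longlonglongrightarrow> ?\<tau> * (1 + 0)"
        by (intro tendsto_intros) (rule LIMSEQ_inverse_real_of_nat[unfolded inverse_eq_divide])
      then show "(\<lambda>n. ereal (?\<tau> * (1 + 1 / real (Suc n)))) \<longlonglongrightarrow> ereal ?\<tau>" by simp
      have "limsup (\<lambda>N. ereal (r N)) \<le> ereal (?\<tau> * (1 + 1 / real (Suc n)))" for n
      proof (rule Limsup_bounded)
        show "\<forall>\<^sub>F N in sequentially. ereal (r N) \<le> ereal (?\<tau> * (1 + 1 / real (Suc n)))"
          using spec[OF elim(2), of n] large
        proof eventually_elim
          case (elim N)
          have "r N \<le> ?\<tau> * (1 + 1 / real (Suc n))"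
            using elim(1) den[OF elim(2)] elim(2) by (simp add: r H_def pos_divide_le_eq mult_ac del: of_nat_Suc)
          then show ?case by simp
        qed
      qed
      then show "\<exists>N. \<forall>n\<ge>N. limsup (\<lambda>N. ereal (r N)) \<le> ereal (?\<tau> * (1 + 1 / real (Suc n)))" by blast
    qed
    ultimately show ?case unfolding r_def by blast
  qed
  then show ?thesis using \<alpha> by blast
qed

end
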